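(* Let $M\in\{\mathbb{A},\mathbb{S},\mathbb{D}\}$. The property of being ergodic (with respect to $\mathrm{Leb}$), as a property of elements of $\mathrm{Symp}^0(M)$, is an AbC realizable $C^0$-property.
   Context: Surfaces: $\mathbb{A}=\mathbb{T}\times[-1,1]$ with $\mathbb{T}=\mathbb{R}/\mathbb{Z}$ (cylinder), $\mathbb{S}=\{x\in\mathbb{R}^3:x_1^2+x_2^2+x_3^2=1\}$ (sphere), $\mathbb{D}=\{x\in\mathbb{R}^2:x_1^2+x_2^2\le1\}$ (disk). $\mathbb{T}$ acts on $\mathbb{A}$ by translation of the first coordinate, on $\mathbb{D}$ by rotation about the origin, and on $\mathbb{S}$ by rotation about the $x_3$-axis; $R_\alpha$ denotes the rotation by $\alpha\in\mathbb{T}$. $M$ carries its canonical symplectic form $\Omega$, and $\mathrm{Leb}$ is the associated probability measure. Put $\check{\mathbb{A}}=\mathbb{T}\times(-1,1)$, $\check{\mathbb{D}}=\{x\in\mathbb{D}:0<x_1^2+x_2^2<1\}$, $\check{\mathbb{S}}=\{x\in\mathbb{S}:x\ne(0,0,\pm1)\}$. Let $\pi:\check{\mathbb{A}}\to\check M$ be $\pi(\theta,y)=(\theta,y)$ if $M=\mathbb{A}$; $\pi(\theta,y)=(\sqrt{1-y^2}\cos2\pi\theta,\sqrt{1-y^2}\sin2\pi\theta,y)$ if $M=\mathbb{S}$; $\pi(\theta,y)=\sqrt{(1+y)/2}\,(\cos2\pi\theta,\sin2\pi\theta)$ if $M=\mathbb{D}$. For $\eta\in[0,1)$ let $M_\eta=\pi(\mathbb{T}\times(-1+\eta,1-\eta))$.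 For $1\le r\le\infty$, $\mathrm{Symp}^r(M)$ is the space of $C^r$-symplectomorphisms of $M$ (diffeomorphisms preserving $\Omega$) with the $C^r$-topology; $\mathrm{Symp}^0(M)$ is the closure of $\mathrm{Symp}^1(M)$ for the $C^0$-topology (symplectic homeomorphisms). $\mathrm{Symp}^r_\diamond(M)=\{f\in\mathrm{Symp}^r(M): f|_{M\setminus\check M}=\mathrm{id}\}$. $\mathcal{T}^r$ denotes the topology on $\mathrm{Symp}^r(M)$ obtained as the pull-back by restriction to $\check M$ of the compact-open $C^r$-topology: a basis of neighbourhoods of $f$ is given by the sets $\{g\in\mathrm{Symp}^r(M): d_{C^s}(f|_{M_\eta},g|_{M_\eta})<\epsilon\}$ for $\eta,\epsilon>0$ and finite $s\le r$. A $C^r$-AbC scheme is a map $(h,\alpha)\in\mathrm{Symp}^r_\diamond(M)\times\mathbb{Q}/\mathbb{Z}\mapsto(U(h,\alpha),\nu(h,\alpha))\in\mathcal{T}^r\times(0,\infty)$ such that: (a) each open set $U(h,\alpha)$ contains a map $\hat h\in\mathrm{Symp}^r_\diamond(M)$ with $\hat h\circ R_\alpha\circ\hat h^{-1}=h\circ R_\alpha\circ h^{-1}$; (b) for any sequences $(h_n)_n$ in $\mathrm{Symp}^r_\diamond(M)$ and $(\alpha_n)_n$ in $\mathbb{Q}/\mathbb{Z}$ with $h_0=\mathrm{id}$, $\alpha_0=0$ and, for all $n\ge0$, $h_{n+1}\circ R_{\alpha_n}\circ h_{n+1}^{-1}=h_n\circ R_{\alpha_n}\circ h_n^{-1}$,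 $h_{n+1}\in U(h_n,\alpha_n)$ and $0<|\alpha_{n+1}-\alpha_n|<\nu(h_{n+1},\alpha_n)$, the sequence $f_n=h_n\circ R_{\alpha_n}\circ h_n^{-1}$ converges to a map $f$ in $\mathrm{Symp}^r(M)$. Such a map $f$ is said to be constructed from the scheme $(U,\nu)$. A property $(\mathcal{P})$ on $\mathrm{Symp}^r(M)$ is an AbC realizable $C^r$-property if: (1) it is invariant by $\mathrm{Symp}^r(M)$-conjugacy, i.e. if $f\in\mathrm{Symp}^r(M)$ satisfies $(\mathcal{P})$ then so does $h\circ f\circ h^{-1}$ for every $h\in\mathrm{Symp}^r(M)$; and (2) there exists a $C^r$-AbC scheme such that every map $f\in\mathrm{Symp}^r(M)$ constructed from it satisfies $(\mathcal{P})$. *)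

theory Defs
  imports "HOL-Analysis.Analysis" "HOL-Combinatorics.Permutations"
begin

section \<open>The circle \<open>\<real>/\<int>\<close>\<close>

quotient_type circle = real / "\<lambda>x y :: real. x - y \<in> \<int>"
  morphisms rep_circle angle
proof (rule equivpI)
  show "reflp (\<lambda>x y :: real. x - y \<in> \<int>)"
    by (auto intro: reflpI)
  show "symp (\<lambda>x y :: real. x - y \<in> \<int>)"
    by (metis (mono_tags, lifting) Ints_minus minus_diff_eq sympI)
  show "transp (\<lambda>x y :: real. x - y \<in> \<int>)"
  proof (rule transpI)
    fix x y z :: real
    assume "x - y \<in> \<int>" "y - z \<in> \<int>"
    then have "(x - y) + (y - z) \<in> \<int>" by (rule Ints_add)
    then show "x - z \<in> \<int>" by simp
  qed
qed

instantiation circle :: ab_group_add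
begin

lift_definition zero_circle :: circle is "0 :: real" .

lift_definition plus_circle :: "circle \<Rightarrow> circle \<Rightarrow> circle" is "(+)"
proof -
  fix a b c d :: real
  assume "a - b \<in> \<int>" "c - d \<in> \<int>"
  then have "(a - b) + (c - d) \<in> \<int>" by (rule Ints_add)
  then show "a + c - (b + d) \<in> \<int>" by (simp add: algebra_simps)
qed

lift_definition uminus_circle :: "circle \<Rightarrow> circle" is "uminus"
proof -
  fix a b :: real
  assume "a - b \<in> \<int>"
  then have "- (a - b) \<in> \<int>" by (rule Ints_minus)
  then show "- a - - b \<in> \<int>" by simp
qed

lift_definition minus_circle :: "circle \<Rightarrow> circle \<Rightarrow> circle" is "(-)"
proof -
  fix a b c d :: real
  assume "a - b \<in> \<int>" "c - d \<in> \<int>"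
  then have "(a - b) - (c - d) \<in> \<int>" by (rule Ints_diff)
  then show "a - c - (b - d) \<in> \<int>" by (simp add: algebra_simps)
qed

instance
  by standard (transfer; simp)+

end

text \<open>\<open>circle_abs\<close> is the distance to \<open>0\<close> in \<open>\<real>/\<int>\<close>, i.e. the distance of a representative to the
  nearest integer.\<close>

lift_definition circle_abs :: "circle \<Rightarrow> real" is "\<lambda>t. \<bar>t - of_int (round t)\<bar>"
proof -
  fix a b :: real
  assume "a - b \<in> \<int>"
  then obtain k where "a - b = of_int k" by (auto elim: Ints_cases)
  then have a: "a = b + of_int k" by simp
  have "round a = round b + k"
    unfolding a round_def by linarith
  then show "\<bar>a - of_int (round a)\<bar> = \<bar>b - of_int (round b)\<bar>"
    using a by simp
qed

lift_definition circle_cis :: "circle \<Rightarrow> complex" is "\<lambda>t. cis (2 * pi * t)"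
proof -
  fix a b :: real
  assume "a - b \<in> \<int>"
  then obtain k where "a - b = of_int k" by (auto elim: Ints_cases)
  then have a: "2 * pi * a = 2 * pi * b + 2 * pi * of_int k" by (simp add: algebra_simps)
  show "cis (2 * pi * a) = cis (2 * pi * b)"
    unfolding a by (simp add: cis_multiple_2pi flip: cis_mult)
qed

definition rational_angles :: "circle set" where
  "rational_angles = angle ` \<rat>"


section \<open>Surfaces with a circle action\<close>

text \<open>A surface is a subset of a Euclidean space. \<open>chart\<close> is the map \<open>\<pi>\<close> from
  \<open>\<real>/\<int> \<times> (-1,1)\<close> onto \<open>core\<close> (the surface without its boundary and without the fixed
  points of the action). The symplectic form is given by its values \<open>omega x u v\<close> on vectors
  \<open>u\<close>, \<open>v\<close> of the tangent space \<open>tangent x\<close>. At a boundary point the tangent space is the full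
  two-dimensional one.\<close>

record 'a surface =
  carrier :: "'a set"
  core :: "'a set"
  chart :: "circle \<times> real \<Rightarrow> 'a"
  action :: "circle \<Rightarrow> 'a \<Rightarrow> 'a"
  tangent :: "'a \<Rightarrow> 'a set"
  omega :: "'a \<Rightarrow> 'a \<Rightarrow> 'a \<Rightarrow> real"

text \<open>The first factor of the cylinder is the unit circle of \<open>\<complex>\<close>, identified with \<open>\<real>/\<int>\<close> by
  \<open>\<theta> \<mapsto> e\<^sup>2\<^sup>\<pi>\<^sup>i\<^sup>\<theta>\<close>. Its form is \<open>d\<theta> \<and> dy\<close>, where \<open>d\<theta>\<close> takes the value
  \<open>Im (cnj z * w) / (2 * pi)\<close> on the tangent vector \<open>w\<close> at \<open>z\<close>.\<close>

definition cylinder :: "(complex \<times> real) surface" where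
  "cylinder = \<lparr>
     carrier = sphere 0 1 \<times> {-1..1},
     core = sphere 0 1 \<times> {-1<..<1},
     chart = (\<lambda>(\<theta>, y). (circle_cis \<theta>, y)),
     action = (\<lambda>\<alpha> (z, y). (circle_cis \<alpha> * z, y)),
     tangent = (\<lambda>(z, y). {(w, s). z \<bullet> w = 0}),
     omega = (\<lambda>(z, y) (w, s) (w', s').
       Im (cnj z * w) / (2 * pi) * s' - Im (cnj z * w') / (2 * pi) * s) \<rparr>"

definition sphere2 :: "(real^3) surface" where
  "sphere2 = \<lparr>
     carrier = {x. (x$1)\<^sup>2 + (x$2)\<^sup>2 + (x$3)\<^sup>2 = 1},
     core = {x. (x$1)\<^sup>2 + (x$2)\<^sup>2 + (x$3)\<^sup>2 = 1} - {vector [0, 0, 1], vector [0, 0, -1]},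
     chart = (\<lambda>(\<theta>, y). vector [sqrt (1 - y\<^sup>2) * Re (circle_cis \<theta>),
                               sqrt (1 - y\<^sup>2) * Im (circle_cis \<theta>), y]),
     action = (\<lambda>\<alpha> x. vector [Re (circle_cis \<alpha>) * x$1 - Im (circle_cis \<alpha>) * x$2,
                             Im (circle_cis \<alpha>) * x$1 + Re (circle_cis \<alpha>) * x$2, x$3]),
     tangent = (\<lambda>x. {u. x \<bullet> u = 0}),
     omega = (\<lambda>x u v. x \<bullet> cross3 u v) \<rparr>"

definition disk :: "(real^2) surface" where
  "disk = \<lparr>
     carrier = {x. (x$1)\<^sup>2 + (x$2)\<^sup>2 \<le> 1},
     core = {x. 0 < (x$1)\<^sup>2 + (x$2)\<^sup>2 \<and> (x$1)\<^sup>2 + (x$2)\<^sup>2 < 1},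
     chart = (\<lambda>(\<theta>, y). sqrt ((1 + y) / 2) *\<^sub>R vector [Re (circle_cis \<theta>), Im (circle_cis \<theta>)]),
     action = (\<lambda>\<alpha> x. vector [Re (circle_cis \<alpha>) * x$1 - Im (circle_cis \<alpha>) * x$2,
                             Im (circle_cis \<alpha>) * x$1 + Re (circle_cis \<alpha>) * x$2]),
     tangent = (\<lambda>x. UNIV),
     omega = (\<lambda>x u v. u$1 * v$2 - u$2 * v$1) \<rparr>"

text \<open>Transformations of a surface are functions on the ambient space that fix every point
  outside the surface (as in \<^const>\<open>permutes\<close>). Hence composition, \<^const>\<open>inv\<close> and equality of
  ambient functions are those of transformations of the surface.\<close>

definition rotation :: "'a surface \<Rightarrow> circle \<Rightarrow> 'a \<Rightarrow> 'a" where
  "rotation M \<alpha> x = (if x \<in> carrier M then action M \<alpha> x else x)"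

definition conj_rotation :: "'a surface \<Rightarrow> ('a \<Rightarrow> 'a) \<Rightarrow> circle \<Rightarrow> 'a \<Rightarrow> 'a" where
  "conj_rotation M h \<alpha> = h \<circ> rotation M \<alpha> \<circ> inv h"

definition shrunk :: "'a surface \<Rightarrow> real \<Rightarrow> 'a set" where
  "shrunk M \<eta> = chart M ` (UNIV \<times> {-1 + \<eta> <..< 1 - \<eta>})"

text \<open>The measure of the form \<open>omega\<close>, computed in the coordinates \<open>(\<theta>, y)\<close>: the chart is
  injective on the domain used and misses only a null subset of the surface.\<close>

definition omega_measure :: "'a::euclidean_space surface \<Rightarrow> 'a measure" where
  "omega_measure M =
     distr
       (density (restrict_space lborel ({0..<1} \<times> {-1<..<1}))
          (\<lambda>(t, y). ennreal \<bar>omega M (chart M (angle t, y))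
             (vector_derivative (\<lambda>s. chart M (angle s, y)) (at t))
             (vector_derivative (\<lambda>s. chart M (angle t, s)) (at y))\<bar>))
       borel (\<lambda>(t, y). chart M (angle t, y))"

definition Leb :: "'a::euclidean_space surface \<Rightarrow> 'a measure" where
  "Leb M = uniform_measure (omega_measure M) (carrier M)"


section \<open>Symplectic diffeomorphisms and homeomorphisms\<close>

text \<open>A map on a subset of Euclidean space is of class \<open>C\<^sup>1\<close> if near each point of the subset it
  is the restriction of a \<open>C\<^sup>1\<close> map defined on an open set.\<close>

definition C1_on :: "'a::euclidean_space set \<Rightarrow> ('a \<Rightarrow> 'a) \<Rightarrow> bool" where
  "C1_on S f \<longleftrightarrow>
     (\<forall>x\<in>S. \<exists>W F F'. open W \<and> x \<in> W \<and>
        (\<forall>z\<in>W. (F has_derivative blinfun_apply (F' z)) (at z)) \<and>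
        continuous_on W F' \<and> (\<forall>z\<in>W \<inter> S. F z = f z))"

text \<open>A derivative \<open>D\<close> of \<open>f\<close> at \<open>x\<close> within the surface is only unique on the tangent space at
  \<open>x\<close>, where it is the tangent map.\<close>

definition preserves_omega :: "'a::euclidean_space surface \<Rightarrow> ('a \<Rightarrow> 'a) \<Rightarrow> bool" where
  "preserves_omega M f \<longleftrightarrow>
     (\<forall>x\<in>carrier M. \<exists>D. (f has_derivative D) (at x within carrier M) \<and>
        (\<forall>u\<in>tangent M x. \<forall>v\<in>tangent M x. omega M (f x) (D u) (D v) = omega M x u v))"

definition Symp1 :: "'a::euclidean_space surface \<Rightarrow> ('a \<Rightarrow> 'a) set" where
  "Symp1 M = {f. f permutes carrier M \<and> C1_on (carrier M) f \<and> C1_on (carrier M) (inv f) \<and>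
                 preserves_omega M f}"

definition dC0 :: "'a::metric_space set \<Rightarrow> ('a \<Rightarrow> 'a) \<Rightarrow> ('a \<Rightarrow> 'a) \<Rightarrow> real" where
  "dC0 S f g = (SUP x\<in>S. dist (f x) (g x))"

text \<open>The \<open>C\<^sup>0\<close>-closure of \<^const>\<open>Symp1\<close> is taken in the group of homeomorphisms of the surface.\<close>

definition Symp0 :: "'a::euclidean_space surface \<Rightarrow> ('a \<Rightarrow> 'a) set" where
  "Symp0 M = {f. f permutes carrier M \<and> homeomorphism (carrier M) (carrier M) f (inv f) \<and>
                 (\<forall>\<epsilon>>0. \<exists>g\<in>Symp1 M. dC0 (carrier M) f g < \<epsilon>)}"

definition Symp0_rel :: "'a::euclidean_space surface \<Rightarrow> ('a \<Rightarrow> 'a) set" where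
  "Symp0_rel M = {f \<in> Symp0 M. \<forall>x\<in>carrier M - core M. f x = x}"

text \<open>The sets below are the open balls of the pseudodistances \<open>dC0 (shrunk M \<eta>)\<close>, which increase
  as \<open>\<eta>\<close> decreases. So they form a basis of the topology they generate, and those centred at \<open>f\<close>
  form a basis of neighbourhoods of \<open>f\<close>.\<close>

definition T0_topology :: "'a::euclidean_space surface \<Rightarrow> ('a \<Rightarrow> 'a) topology" where
  "T0_topology M = topology_generated_by
     {{g \<in> Symp0 M. dC0 (shrunk M \<eta>) f g < \<epsilon>} | f \<eta> \<epsilon>. f \<in> Symp0 M \<and> 0 < \<eta> \<and> \<eta> < 1 \<and> 0 < \<epsilon>}"


section \<open>AbC schemes\<close>

type_synonym 'a scheme_nbhd = "('a \<Rightarrow> 'a) \<Rightarrow> circle \<Rightarrow> ('a \<Rightarrow> 'a) set"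
type_synonym 'a scheme_size = "('a \<Rightarrow> 'a) \<Rightarrow> circle \<Rightarrow> real"

definition C0_AbC_sequence ::
  "'a::euclidean_space surface \<Rightarrow> 'a scheme_nbhd \<Rightarrow> 'a scheme_size \<Rightarrow>
     (nat \<Rightarrow> 'a \<Rightarrow> 'a) \<Rightarrow> (nat \<Rightarrow> circle) \<Rightarrow> bool" where
  "C0_AbC_sequence M U \<nu> h \<alpha> \<longleftrightarrow>
     (\<forall>n. h n \<in> Symp0_rel M) \<and> (\<forall>n. \<alpha> n \<in> rational_angles) \<and> h 0 = id \<and> \<alpha> 0 = 0 \<and>
     (\<forall>n. conj_rotation M (h (Suc n)) (\<alpha> n) = conj_rotation M (h n) (\<alpha> n) \<and>
          h (Suc n) \<in> U (h n) (\<alpha> n) \<and>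
          0 < circle_abs (\<alpha> (Suc n) - \<alpha> n) \<and>
          circle_abs (\<alpha> (Suc n) - \<alpha> n) < \<nu> (h (Suc n)) (\<alpha> n))"

definition C0_AbC_converges ::
  "'a::euclidean_space surface \<Rightarrow> (nat \<Rightarrow> 'a \<Rightarrow> 'a) \<Rightarrow> (nat \<Rightarrow> circle) \<Rightarrow> ('a \<Rightarrow> 'a) \<Rightarrow> bool" where
  "C0_AbC_converges M h \<alpha> f \<longleftrightarrow>
     f \<in> Symp0 M \<and>
     uniform_limit (carrier M) (\<lambda>n. conj_rotation M (h n) (\<alpha> n)) f sequentially"

definition C0_AbC_scheme ::
  "'a::euclidean_space surface \<Rightarrow> 'a scheme_nbhd \<Rightarrow> 'a scheme_size \<Rightarrow> bool" where
  "C0_AbC_scheme M U \<nu> \<longleftrightarrow>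
     (\<forall>h\<in>Symp0_rel M. \<forall>\<alpha>\<in>rational_angles.
        openin (T0_topology M) (U h \<alpha>) \<and> 0 < \<nu> h \<alpha> \<and>
        (\<exists>h'\<in>U h \<alpha>. h' \<in> Symp0_rel M \<and> conj_rotation M h' \<alpha> = conj_rotation M h \<alpha>)) \<and>
     (\<forall>h \<alpha>. C0_AbC_sequence M U \<nu> h \<alpha> \<longrightarrow> (\<exists>f. C0_AbC_converges M h \<alpha> f))"

definition C0_constructed ::
  "'a::euclidean_space surface \<Rightarrow> 'a scheme_nbhd \<Rightarrow> 'a scheme_size \<Rightarrow> ('a \<Rightarrow> 'a) \<Rightarrow> bool" where
  "C0_constructed M U \<nu> f \<longleftrightarrow>
     (\<exists>h \<alpha>. C0_AbC_sequence M U \<nu> h \<alpha> \<and> C0_AbC_converges M h \<alpha> f)"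

definition C0_AbC_realizable ::
  "'a::euclidean_space surface \<Rightarrow> (('a \<Rightarrow> 'a) \<Rightarrow> bool) \<Rightarrow> bool" where
  "C0_AbC_realizable M P \<longleftrightarrow>
     (\<forall>f\<in>Symp0 M. P f \<longrightarrow> (\<forall>h\<in>Symp0 M. P (h \<circ> f \<circ> inv h))) \<and>
     (\<exists>U \<nu>. C0_AbC_scheme M U \<nu> \<and> (\<forall>f\<in>Symp0 M. C0_constructed M U \<nu> f \<longrightarrow> P f))"

definition ergodic :: "'a measure \<Rightarrow> ('a \<Rightarrow> 'a) \<Rightarrow> bool" where
  "ergodic \<mu> f \<longleftrightarrow>
     f \<in> measurable \<mu> \<mu> \<and> distr \<mu> \<mu> f = \<mu> \<and>
     (\<forall>E\<in>sets \<mu>. f -` E \<inter> space \<mu> = E \<longrightarrow> measure \<mu> E = 0 \<or> measure \<mu> E = 1)"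

end

theory Submission
  imports Defs "HOL-Probability.Probability_Measure"
begin

text \<open>The three surfaces are treated at once. Each is the image of \<open>\<real>/\<int> \<times> [-1,1]\<close> under a map
\<open>E\<close> that turns the rotations into translations of the first coordinate and under which the symplectic form
becomes a constant multiple of \<open>d\<theta> \<and> dy\<close>. The locale \<open>circle_surface\<close> collects the
properties of such coordinates, and \<open>ergodic_realizable\<close> is proved in it.

Replacing \<open>h\<close> by \<open>h \<circ> g\<close>, where \<open>g\<close> is symplectic and commutes with the rotation by \<open>\<alpha> =
p/q\<close>, does not change \<open>h \<circ> R\<^sub>\<alpha> \<circ> h\<^sup>-\<^sup>1\<close>. So \<open>g\<close> may be chosen to
spread most of the circles \<open>y = const\<close> nearly evenly over the surface. This is measured by the variance,
over the height \<open>y\<close>, of the averages of finitely many test functions over these circles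
(\<open>circle_variance\<close>). The condition that it is less than \<open>1/q\<close> is open for uniform convergence on compact
subsets of the core, because heights near \<open>\<plusminus>1\<close> contribute little, and it defines \<open>U\<close>. If a
rational \<open>\<beta>\<close> is different from \<open>\<alpha>\<close> but very close to it, then its denominator is large and
its orbits nearly fill the circles. Hence, at the time given by this denominator, the Birkhoff averages of
\<open>(h \<circ> g) \<circ> R\<^sub>\<beta> \<circ> (h \<circ> g)\<^sup>-\<^sup>1\<close> are nearly constant away
from a small set. The size \<open>\<nu>\<close> is chosen so small that the following maps of the sequence, and
therefore their limit, are close to this one for that many iterates (\<open>good_size\<close>). So the limit has
Birkhoff averages that tend to the mean in \<open>L\<^sup>1\<close> along a sequence of times, for a dense family of
functions, and this implies ergodicity (\<open>ergodic_criterion\<close>). The denominators of a sequence at least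
double at each step, so errors of the order of the inverse of the denominator are summable.

The map \<open>g\<close> is built from twist maps. Divide \<open>\<real>/\<int> \<times> [-1,1]\<close> into \<open>N\<close> equal cells,
identify each with a square and rotate a concentric disk in it by a quarter turn, with a smooth transition
to the identity near the boundary of the unit disk (\<open>twists\<close>). When \<open>N\<close> is large, the average of
\<open>\<psi> \<circ> g\<close> over the circle at height \<open>v\<close> is obtained from the circle averages of \<open>\<psi>\<close> by
averaging them over the heights that one twisted horizontal segment visits (\<open>twists_average\<close>). A segment
at a height \<open>\<bar>v\<bar> \<le> d\<close> becomes almost vertical and visits almost all heights evenly. So the
variance is multiplied by at most \<open>1 - d\<close>, up to an error of order \<open>d\<^sup>2\<close> (\<open>mixing_estimate\<close>).
Iterating with finer and finer cells makes it of order \<open>d\<close> (\<open>equidistributing_map_rate\<close>).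

Two facts about the symplectic groups are needed. They are groups, and \<open>Symp0\<close> contains the uniform limits
that occur. Their elements preserve \<open>Leb\<close>: for a diffeomorphism this is the change of variables formula in
the coordinates, where the Jacobian is \<open>1\<close> (\<open>Symp1_emeasure_le\<close>), and it passes to uniform limits
(\<open>Symp0_distr\<close>).\<close>

section \<open>Maps of class C1\<close>

text \<open>The extension in the definition of \<open>C1_on\<close>, at one point. Allowing maps between different spaces makes it
possible to compose charts, coordinates and maps of the plane.\<close>

definition C1_at :: "('a::euclidean_space \<Rightarrow> 'b::euclidean_space) \<Rightarrow> 'a \<Rightarrow> bool" where
  "C1_at f x \<longleftrightarrow> (\<exists>W f'. open W \<and> x \<in> W \<and>
     (\<forall>z\<in>W. (f has_derivative blinfun_apply (f' z)) (at z)) \<and> continuous_on W f')"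

text \<open>For maps on a Euclidean space, continuity of the derivative in the operator norm can be tested on vectors.\<close>

lemma C1_atI:
  assumes "open W" "x \<in> W" "\<And>z. z \<in> W \<Longrightarrow> (f has_derivative f' z) (at z)"
    "\<And>u. continuous_on W (\<lambda>z. f' z u)"
  shows "C1_at f x"
proof -
  have bl: "bounded_linear (f' z)" if "z \<in> W" for z
    using assms(3)[OF that] by (rule has_derivative_bounded_linear)
  have "continuous_on W (\<lambda>z. Blinfun (f' z))"
    by (intro continuous_on_blinfun_componentwise)
      (use assms(4) in \<open>auto simp: bounded_linear_Blinfun_apply[OF bl] cong: continuous_on_cong\<close>)
  then show ?thesis
    unfolding C1_at_def using assms(1-3)
    by (intro exI[of _ W] exI[of _ "\<lambda>z. Blinfun (f' z)"])
      (auto simp: bounded_linear_Blinfun_apply[OF bl])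
qed

lemma C1_at_imp_derivative:
  assumes "C1_at f x"
  obtains D where "(f has_derivative D) (at x)"
  using assms unfolding C1_at_def by blast

lemma C1_at_imp_isCont:
  assumes "C1_at f x"
  shows "isCont f x"
  using assms C1_at_imp_derivative has_derivative_continuous by blast

lemma C1_at_compose:
  assumes f: "C1_at f x" and g: "C1_at g (f x)"
  shows "C1_at (\<lambda>y. g (f y)) x"
proof -
  obtain W f' where W: "open W" "x \<in> W" "\<And>z. z \<in> W \<Longrightarrow> (f has_derivative blinfun_apply (f' z)) (at z)"
    "continuous_on W f'" using f unfolding C1_at_def by blast
  obtain V g' where V: "open V" "f x \<in> V" "\<And>z. z \<in> V \<Longrightarrow> (g has_derivative blinfun_apply (g' z)) (at z)"
    "continuous_on V g'" using g unfolding C1_at_def by blast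
  have cf: "continuous_on W f"
    using W(1,3) by (meson continuous_at_imp_continuous_on has_derivative_continuous)
  let ?U = "W \<inter> f -` V"
  have U: "open ?U" using cf W(1) V(1) by (simp add: continuous_open_preimage)
  have cg: "continuous_on ?U (\<lambda>z. g' (f z))"
    by (rule continuous_on_compose2[OF V(4) continuous_on_subset[OF cf]]) auto
  have "continuous_on ?U (\<lambda>z. g' (f z) o\<^sub>L f' z)"
    by (intro bounded_bilinear.continuous_on[OF bounded_bilinear_blinfun_compose] cg
        continuous_on_subset[OF W(4)]) auto
  moreover have "((\<lambda>y. g (f y)) has_derivative blinfun_apply (g' (f z) o\<^sub>L f' z)) (at z)" if "z \<in> ?U" for z
    using diff_chain_at[OF W(3) V(3), of z] that by (simp add: o_def blinfun_compose.rep_eq)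
  ultimately show ?thesis unfolding C1_at_def
    using U W(2) V(2) by (intro exI[of _ ?U] exI[of _ "\<lambda>z. g' (f z) o\<^sub>L f' z"]) auto
qed

lemma C1_at_linear:
  assumes "bounded_linear f"
  shows "C1_at f x"
  by (rule C1_atI[of UNIV _ _ "\<lambda>_. f"]) (auto intro: bounded_linear_imp_has_derivative assms)

lemma C1_at_const: "C1_at (\<lambda>_. c) x"
  by (rule C1_atI[of UNIV _ _ "\<lambda>_ _. 0"]) auto

lemma C1_at_ident: "C1_at (\<lambda>x. x) x"
  by (rule C1_at_linear) (rule bounded_linear_ident)

lemma C1_at_add:
  assumes "C1_at f x" "C1_at g x"
  shows "C1_at (\<lambda>y. f y + g y) x"
proof -
  obtain W f' where W: "open W" "x \<in> W" "\<And>z. z \<in> W \<Longrightarrow> (f has_derivative blinfun_apply (f' z)) (at z)"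
    "continuous_on W f'" using assms(1) unfolding C1_at_def by blast
  obtain V g' where V: "open V" "x \<in> V" "\<And>z. z \<in> V \<Longrightarrow> (g has_derivative blinfun_apply (g' z)) (at z)"
    "continuous_on V g'" using assms(2) unfolding C1_at_def by blast
  show ?thesis unfolding C1_at_def
    by (rule exI[of _ "W \<inter> V"], rule exI[of _ "\<lambda>z. f' z + g' z"])
      (use W V in \<open>auto simp: plus_blinfun.rep_eq intro!: continuous_intros has_derivative_add
        intro: continuous_on_subset\<close>)
qed

lemma C1_at_Pair:
  fixes f :: "'a::euclidean_space \<Rightarrow> 'b::euclidean_space" and g :: "'a \<Rightarrow> 'c::euclidean_space"
  assumes "C1_at f x" "C1_at g x"
  shows "C1_at (\<lambda>y. (f y, g y)) x"
proof -
  have "C1_at (\<lambda>y. (f y, 0 :: 'c) + (0 :: 'b, g y)) x"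
    by (intro C1_at_add C1_at_compose[where g="\<lambda>a. (a, 0)" and f=f]
        C1_at_compose[where g="\<lambda>b. (0, b)" and f=g] C1_at_linear assms bounded_linear_intros)
  then show ?thesis by simp
qed

lemma C1_at_scaleR:
  fixes f :: "'a::euclidean_space \<Rightarrow> real" and g :: "'a \<Rightarrow> 'c::euclidean_space"
  assumes "C1_at f x" "C1_at g x"
  shows "C1_at (\<lambda>y. f y *\<^sub>R g y) x"
proof -
  have "C1_at (\<lambda>p :: real \<times> 'c. fst p *\<^sub>R snd p) q" for q
    by (rule C1_atI[of UNIV _ _ "\<lambda>p u. fst p *\<^sub>R snd u + fst u *\<^sub>R snd p"])
      (auto intro!: derivative_eq_intros continuous_intros)
  from C1_at_compose[OF C1_at_Pair[OF assms] this] show ?thesis by simp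
qed

lemma C1_at_mult:
  fixes f g :: "'a::euclidean_space \<Rightarrow> real"
  assumes "C1_at f x" "C1_at g x"
  shows "C1_at (\<lambda>y. f y * g y) x"
  using C1_at_scaleR[OF assms] by simp

lemma C1_at_diff:
  assumes "C1_at f x" "C1_at g x"
  shows "C1_at (\<lambda>y. f y - g y) x"
proof -
  have "C1_at (\<lambda>y. f y + (-1) *\<^sub>R g y) x"
    by (intro C1_at_add C1_at_scaleR C1_at_const assms)
  then show ?thesis by simp
qed

lemma C1_at_real:
  fixes f :: "real \<Rightarrow> 'b::euclidean_space"
  assumes "open W" "g x \<in> W" "\<And>z. z \<in> W \<Longrightarrow> (f has_vector_derivative f' z) (at z)"
    "continuous_on W f'" "C1_at g x"
  shows "C1_at (\<lambda>y. f (g y)) x"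
proof -
  have "C1_at f (g x)"
    by (rule C1_atI[of W _ _ "\<lambda>z u. u *\<^sub>R f' z"])
      (use assms in \<open>auto simp: has_vector_derivative_def intro!: continuous_intros\<close>)
  from C1_at_compose[OF assms(5) this] show ?thesis .
qed

lemma C1_on_iff:
  "C1_on S f \<longleftrightarrow> (\<forall>x\<in>S. \<exists>F V. C1_at F x \<and> open V \<and> x \<in> V \<and> (\<forall>z\<in>V \<inter> S. F z = f z))"
  (is "_ = ?R")
proof
  assume "C1_on S f"
  then show ?R unfolding C1_on_def C1_at_def by meson
next
  assume r: ?R
  show "C1_on S f" unfolding C1_on_def
  proof
    fix x assume "x \<in> S"
    then obtain F V where F: "C1_at F x" "open V" "x \<in> V" "\<forall>z\<in>V \<inter> S. F z = f z" using r by blast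
    from F(1) obtain W F' where W: "open W" "x \<in> W" "\<And>z. z \<in> W \<Longrightarrow> (F has_derivative blinfun_apply (F' z)) (at z)"
      "continuous_on W F'" unfolding C1_at_def by blast
    show "\<exists>W F F'. open W \<and> x \<in> W \<and> (\<forall>z\<in>W. (F has_derivative blinfun_apply (F' z)) (at z)) \<and>
        continuous_on W F' \<and> (\<forall>z\<in>W \<inter> S. F z = f z)"
      by (intro exI[of _ "W \<inter> V"] exI[of _ F] exI[of _ F'])
        (use W F in \<open>auto intro: continuous_on_subset\<close>)
  qed
qed

lemma has_derivative_within_local:
  assumes "(F has_derivative D) (at x)" "open V" "x \<in> V" "x \<in> S" "\<And>z. z \<in> V \<Longrightarrow> z \<in> S \<Longrightarrow> F z = f z"
  shows "(f has_derivative D) (at x within S)"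
proof -
  obtain d where d: "d > 0" "ball x d \<subseteq> V" using assms(2,3) openE by blast
  show ?thesis
    by (rule has_derivative_transform_within[OF has_derivative_at_withinI[OF assms(1)] d(1) assms(4)])
      (use d(2) assms(5) in \<open>auto simp: dist_commute subset_iff\<close>)
qed

lemma C1_on_imp_derivative:
  assumes "C1_on S f" "x \<in> S"
  obtains D where "(f has_derivative D) (at x within S)"
proof -
  obtain F V where F: "C1_at F x" "open V" "x \<in> V" "\<And>z. z\<in>V \<inter> S \<Longrightarrow> F z = f z"
    using assms unfolding C1_on_iff by blast
  obtain D where "(F has_derivative D) (at x)" using C1_at_imp_derivative[OF F(1)] by blast
  from has_derivative_within_local[OF this F(2,3) assms(2)] F(4) that show ?thesis by auto
qed

lemma C1_on_imp_continuous_on: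
  assumes "C1_on S f"
  shows "continuous_on S f"
  by (meson C1_on_imp_derivative assms continuous_on_eq_continuous_within has_derivative_continuous)

lemma C1_on_compose:
  assumes f: "C1_on S f" and g: "C1_on S g" and S: "f ` S \<subseteq> S"
  shows "C1_on S (g \<circ> f)"
  unfolding C1_on_iff
proof
  fix x assume x: "x \<in> S"
  obtain F V where F: "C1_at F x" "open V" "x \<in> V" "\<And>z. z\<in>V \<inter> S \<Longrightarrow> F z = f z"
    using f x unfolding C1_on_iff by blast
  have fx: "F x = f x" using F x by auto
  have "f x \<in> S" using x S by auto
  then obtain G U where G: "C1_at G (f x)" "open U" "f x \<in> U" "\<And>z. z\<in>U \<inter> S \<Longrightarrow> G z = g z"
    using g unfolding C1_on_iff by blast
  obtain W f' where W: "open W" "x \<in> W" "\<And>z. z \<in> W \<Longrightarrow> (F has_derivative blinfun_apply (f' z)) (at z)"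
    using F(1) unfolding C1_at_def by blast
  have "continuous_on W F"
    using W(1,3) by (meson continuous_at_imp_continuous_on has_derivative_continuous)
  then have "open (W \<inter> F -` U)" using W(1) G(2) by (simp add: continuous_open_preimage)
  then show "\<exists>F V. C1_at F x \<and> open V \<and> x \<in> V \<and> (\<forall>z\<in>V \<inter> S. F z = (g \<circ> f) z)"
    using C1_at_compose[OF F(1), of G] G F W(2) fx S
    by (intro exI[of _ "\<lambda>y. G (F y)"] exI[of _ "V \<inter> (W \<inter> F -` U)"]) (auto simp: image_subset_iff)
qed

section \<open>The circle\<close>

lemma angle_eq_iff: "angle s = angle t \<longleftrightarrow> s - t \<in> \<int>"
   
  by (metis circle.abs_eq_iff)

lemma angle_surj: "\<exists>t. a = angle t"
  by (metis Quotient_circle Quotient_abs_rep)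

lemma angle_add: "angle s + angle t = angle (s + t)"
  by (rule plus_circle.abs_eq)

lemma angle_diff: "angle s - angle t = angle (s - t)"
  by (rule minus_circle.abs_eq)

lemma angle_minus: "- angle t = angle (- t)"
  by (rule uminus_circle.abs_eq)

lemma angle_0: "angle 0 = 0"
  by (simp add: zero_circle_def)

lemma circle_cis_angle: "circle_cis (angle t) = cis (2 * pi * t)"
  by (rule circle_cis.abs_eq)

lemma circle_abs_angle: "circle_abs (angle t) = \<bar>t - of_int (round t)\<bar>"
  by (rule circle_abs.abs_eq)

text \<open>Angles are compared through representatives whose difference realises their distance; then multiples of the
angles can be compared in \<open>\<real>\<close>.\<close>

lemma angle_near:
  obtains b where "\<beta> = angle b" "\<bar>b - a\<bar> = circle_abs (\<beta> - angle a)"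
proof -
  obtain b where b: "\<beta> = angle b" using angle_surj by blast
  have "\<beta> = angle (b - of_int (round (b - a)))" unfolding b angle_eq_iff by simp
  moreover have "\<bar>(b - of_int (round (b - a))) - a\<bar> = circle_abs (\<beta> - angle a)"
    unfolding b angle_diff circle_abs_angle by simp
  ultimately show ?thesis using that by blast
qed

lemma circle_abs_angle_le: "circle_abs (angle t) \<le> \<bar>t\<bar>"
  using round_diff_minimal[of t 0] by (simp add: circle_abs_angle)

lemma circle_cis_add: "circle_cis (a + b) = circle_cis a * circle_cis b"
proof -
  obtain s t where "a = angle s" "b = angle t" using angle_surj by metis
  then show ?thesis by (simp add: angle_add circle_cis_angle cis_mult distrib_left)
qed

lemma circle_cis_0 [simp]: "circle_cis 0 = 1"
  using circle_cis_angle[of 0] by (simp add: angle_0)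

lemma norm_circle_cis [simp]: "cmod (circle_cis a) = 1"
  by (metis angle_surj circle_cis_angle norm_cis)

lemma cis_eq_imp_Ints:
  assumes "cis (2 * pi * s) = cis (2 * pi * t)"
  shows "s - t \<in> \<int>"
proof -
  have "cis (2 * pi * s) / cis (2 * pi * t) = 1" using assms by simp
  then have "cis (2 * pi * (s - t)) = 1" by (simp add: cis_divide right_diff_distrib)
  then have "cos (2 * pi * (s - t)) = 1" by (metis cis.sel(1) one_complex.sel(1))
  then obtain k :: int where "2 * pi * (s - t) = of_int k * 2 * pi"
    using cos_one_2pi_int by blast
  then have "s - t = of_int k" by simp
  then show ?thesis by simp
qed

lemma norm_circle_cis_diff_le: "cmod (circle_cis a - 1) \<le> 2 * pi * circle_abs a"
proof -
  obtain b where b: "a = angle b" "\<bar>b - 0\<bar> = circle_abs (a - angle 0)" using angle_near by blast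
  have "cmod (cis (2 * pi * b) - 1) \<le> \<bar>2 * pi * b\<bar>"
    using dist_exp_i_1[of "2 * pi * b"] abs_sin_x_le_abs_x[of "pi * b"]
    by (simp add: cis_conv_exp)
  then show ?thesis using b by (simp add: circle_cis_angle angle_0 abs_mult)
qed

section \<open>Surfaces with a circle action in coordinates\<close>

text \<open>The standard area form of the plane of coordinates.\<close>

definition det2 :: "real \<times> real \<Rightarrow> real \<times> real \<Rightarrow> real" where
  "det2 u v = fst u * snd v - snd u * fst v"

text \<open>Surfaces with global polar coordinates. \<open>E (\<theta>, y)\<close> is the chart with the circle lifted to
\<open>\<real>\<close>, extended to all of \<open>\<real>\<^sup>2\<close>; on the strip \<open>\<bar>y\<bar> < 1\<close> its derivative is
\<open>E'\<close>. The linear map \<open>Z\<close> and the height \<open>Y\<close> recover the coordinates of a point: the angle is that of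
\<open>Z x\<close> and the second coordinate is \<open>Y x\<close>. The area form becomes \<open>\<kappa>\<close> times \<open>det2\<close>.

A derivative within the surface is determined on tangent vectors only. The projections \<open>proj x\<close> onto the
tangent spaces are derivatives of the identity within the surface, so composing with them makes a derivative
take tangent values; this and \<open>tangent_unique\<close> are all that is needed of the differential geometry at
points of the boundary and at fixed points. The countably many \<open>curves\<close> cover what \<open>E\<close> misses on the
open fundamental domain, namely the seam \<open>\<theta> = 0\<close>, the boundary and the fixed points. It is of
measure zero, and since curves are one-dimensional so is its image under a diffeomorphism.\<close>

locale circle_surface =
  fixes M :: "'a::euclidean_space surface"
    and Z :: "'a \<Rightarrow> complex" and Y :: "'a \<Rightarrow> real"
    and E :: "real \<times> real \<Rightarrow> 'a" and E' :: "real \<times> real \<Rightarrow> real \<times> real \<Rightarrow> 'a"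
    and \<kappa> :: real and proj :: "'a \<Rightarrow> 'a \<Rightarrow> 'a" and curves :: "(real \<Rightarrow> 'a) set"
  assumes E_chart: "E (t, y) = chart M (angle t, y)"
    and compact_carrier: "compact (carrier M)"
    and core_eq: "core M = {x \<in> carrier M. Z x \<noteq> 0 \<and> \<bar>Y x\<bar> < 1}"
    and E_carrier: "\<bar>y\<bar> \<le> 1 \<Longrightarrow> E (t, y) \<in> carrier M"
    and E_cont: "continuous_on UNIV E"
    and E_C1: "\<bar>snd p\<bar> < 1 \<Longrightarrow> C1_at E p"
    and E_deriv: "\<bar>snd p\<bar> < 1 \<Longrightarrow> (E has_derivative E' p) (at p)"
    and Z_linear: "bounded_linear Z"
    and Z_E: "\<bar>y\<bar> < 1 \<Longrightarrow> \<exists>r>0. Z (E (t, y)) = of_real r * cis (2 * pi * t)"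
    and Z_E_1: "\<bar>y\<bar> = 1 \<Longrightarrow> E (t, y) \<notin> core M"
    and Y_C1: "C1_at Y x"
    and Y_E: "\<bar>y\<bar> \<le> 1 \<Longrightarrow> Y (E (t, y)) = y"
    and E_Z_Y: "x \<in> core M \<Longrightarrow> r > 0 \<Longrightarrow> Z x = of_real r * cis (2 * pi * t) \<Longrightarrow> E (t, Y x) = x"
    and tangent_E: "\<bar>snd p\<bar> < 1 \<Longrightarrow> tangent M (E p) = range (E' p)"
    and omega_E: "\<bar>snd p\<bar> < 1 \<Longrightarrow> omega M (E p) (E' p u) (E' p v) = \<kappa> * det2 u v"
    and \<kappa>_nz: "\<kappa> \<noteq> 0"
    and proj_deriv: "x \<in> carrier M \<Longrightarrow> ((\<lambda>y. y) has_derivative proj x) (at x within carrier M)"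
    and proj_tangent: "x \<in> carrier M \<Longrightarrow> proj x w \<in> tangent M x"
    and omega_proj: "x \<in> carrier M \<Longrightarrow> omega M x (proj x w) (proj x w') = omega M x w w'"
    and tangent_unique: "x \<in> carrier M \<Longrightarrow> ((\<lambda>_. 0 :: 'a) has_derivative D) (at x within carrier M) \<Longrightarrow>
      w \<in> tangent M x \<Longrightarrow> D w = 0"
    and action_linear: "bounded_linear (action M \<alpha>)"
    and action_0: "action M 0 x = x"
    and action_add: "action M (\<alpha> + \<beta>) x = action M \<alpha> (action M \<beta> x)"
    and action_carrier: "x \<in> carrier M \<Longrightarrow> action M \<alpha> x \<in> carrier M"
    and action_omega: "omega M (action M \<alpha> x) (action M \<alpha> w) (action M \<alpha> w') = omega M x w w'"
    and action_E: "\<bar>y\<bar> \<le> 1 \<Longrightarrow> action M (angle s) (E (t, y)) = E (s + t, y)"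
    and action_near: "x \<in> carrier M \<Longrightarrow> dist (action M \<alpha> x) x \<le> 2 * pi * circle_abs \<alpha>"
    and curves_countable: "countable curves"
    and curves_differentiable: "b \<in> curves \<Longrightarrow> b differentiable (at s)"
    and curves_carrier: "b \<in> curves \<Longrightarrow> b s \<in> carrier M"
    and curves_cover: "x \<in> carrier M \<Longrightarrow> x \<notin> E ` ({0<..<1} \<times> {-1<..<1}) \<Longrightarrow> \<exists>b\<in>curves. x \<in> range b"
begin

subsection \<open>The group of symplectic diffeomorphisms\<close>

lemma carrier_nonempty: "carrier M \<noteq> {}"
  using E_carrier[of 0 0] by auto

lemma Symp1_permutes: "f \<in> Symp1 M \<Longrightarrow> f permutes carrier M"
  and Symp1_C1: "f \<in> Symp1 M \<Longrightarrow> C1_on (carrier M) f"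
  and Symp1_C1_inv: "f \<in> Symp1 M \<Longrightarrow> C1_on (carrier M) (inv f)"
  and Symp1_omega: "f \<in> Symp1 M \<Longrightarrow> preserves_omega M f"
  by (auto simp: Symp1_def)

text \<open>The chain rule with the identity of the surface, differentiated at the image point.\<close>

lemma derivative_into_tangent:
  assumes "(f has_derivative D) (at x within carrier M)" "x \<in> carrier M" "f ` carrier M \<subseteq> carrier M"
  shows "(f has_derivative (\<lambda>u. proj (f x) (D u))) (at x within carrier M)"
proof -
  have "f x \<in> carrier M" using assms by auto
  from has_derivative_in_compose[OF assms(1) has_derivative_subset[OF proj_deriv[OF this] assms(3)]]
  show ?thesis by simp
qed

lemma derivative_unique_on_tangent:
  fixes f :: "'a \<Rightarrow> 'a"
  assumes "x \<in> carrier M" "(f has_derivative D) (at x within carrier M)"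
    "(f has_derivative D') (at x within carrier M)" "u \<in> tangent M x"
  shows "D u = D' u"
  using tangent_unique[OF assms(1) _ assms(4), of "\<lambda>u. D u - D' u"]
    has_derivative_diff[OF assms(2,3)] by simp

lemma preserves_omegaE:
  assumes "preserves_omega M f" "f ` carrier M \<subseteq> carrier M" "x \<in> carrier M"
  obtains D where "(f has_derivative D) (at x within carrier M)" "\<And>u. D u \<in> tangent M (f x)"
    "\<And>u v. u \<in> tangent M x \<Longrightarrow> v \<in> tangent M x \<Longrightarrow> omega M (f x) (D u) (D v) = omega M x u v"
proof -
  from assms obtain D where D: "(f has_derivative D) (at x within carrier M)"
    "\<And>u v. u \<in> tangent M x \<Longrightarrow> v \<in> tangent M x \<Longrightarrow> omega M (f x) (D u) (D v) = omega M x u v"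
    unfolding preserves_omega_def by blast
  have fx: "f x \<in> carrier M" using assms by auto
  show ?thesis
    by (rule that[OF derivative_into_tangent[OF D(1) assms(3,2)]])
      (use D(2) proj_tangent[OF fx] omega_proj[OF fx] in auto)
qed

lemma Symp1_id: "id \<in> Symp1 M"
proof -
  have "C1_on (carrier M) id" unfolding C1_on_iff using C1_at_ident by (auto simp: id_def)
  moreover have "preserves_omega M id" unfolding preserves_omega_def id_def
    by (intro ballI exI[of _ "\<lambda>u. u"]) (auto intro: derivative_intros)
  ultimately show ?thesis by (auto simp: Symp1_def permutes_id)
qed

lemma Symp1_comp:
  assumes f: "f \<in> Symp1 M" and g: "g \<in> Symp1 M"
  shows "g \<circ> f \<in> Symp1 M"
proof -
  have fi: "f ` carrier M = carrier M" and gi: "g ` carrier M = carrier M"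
    using f g Symp1_permutes permutes_image by blast+
  have bij: "bij f" "bij g" using f g Symp1_permutes permutes_bij by blast+
  have "inv g ` carrier M = carrier M"
    using g Symp1_permutes permutes_inv permutes_image by blast
  then have "C1_on (carrier M) (inv f \<circ> inv g)"
    by (intro C1_on_compose Symp1_C1_inv f g) auto
  moreover have "inv (g \<circ> f) = inv f \<circ> inv g" using bij by (simp add: o_inv_distrib)
  moreover have "preserves_omega M (g \<circ> f)"
    unfolding preserves_omega_def
  proof
    fix x assume x: "x \<in> carrier M"
    obtain D1 where D1: "(f has_derivative D1) (at x within carrier M)" "\<And>u. D1 u \<in> tangent M (f x)"
      "\<And>u v. u \<in> tangent M x \<Longrightarrow> v \<in> tangent M x \<Longrightarrow> omega M (f x) (D1 u) (D1 v) = omega M x u v"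
      by (rule preserves_omegaE[OF Symp1_omega[OF f] equalityD1[OF fi] x]) (rule that, assumption+)
    have fx: "f x \<in> carrier M" using x fi by auto
    obtain D2 where D2: "(g has_derivative D2) (at (f x) within carrier M)"
      "\<And>u v. u \<in> tangent M (f x) \<Longrightarrow> v \<in> tangent M (f x) \<Longrightarrow> omega M (g (f x)) (D2 u) (D2 v) = omega M (f x) u v"
      by (rule preserves_omegaE[OF Symp1_omega[OF g] equalityD1[OF gi] fx]) (rule that, assumption+)
    have "((g \<circ> f) has_derivative D2 \<circ> D1) (at x within carrier M)"
      using diff_chain_within[OF D1(1), of g D2] D2(1) fi by simp
    then show "\<exists>D. ((g \<circ> f) has_derivative D) (at x within carrier M) \<and>
        (\<forall>u\<in>tangent M x. \<forall>v\<in>tangent M x. omega M ((g \<circ> f) x) (D u) (D v) = omega M x u v)"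
      using D1 D2 by (intro exI[of _ "D2 \<circ> D1"]) auto
  qed
  ultimately show ?thesis
    using fi gi f g by (auto simp: Symp1_def intro: permutes_compose C1_on_compose)
qed

text \<open>The derivatives of \<open>f\<close> and of its inverse are inverse to each other on tangent vectors because the
derivative of the identity within the surface is unique there.\<close>

lemma Symp1_inv:
  assumes f: "f \<in> Symp1 M"
  shows "inv f \<in> Symp1 M"
proof -
  have p: "f permutes carrier M" using f Symp1_permutes by blast
  have fi: "f ` carrier M = carrier M" using p permutes_image by blast
  have gi: "inv f ` carrier M = carrier M" using p permutes_inv permutes_image by blast
  have "preserves_omega M (inv f)"
    unfolding preserves_omega_def
  proof
    fix y assume y: "y \<in> carrier M"
    define x where "x = inv f y"
    have x: "x \<in> carrier M" and fx: "f x = y" using y gi p by (auto simp: x_def permutes_inverses)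
    obtain Df where Df: "(f has_derivative Df) (at x within carrier M)"
      "\<And>u v. u \<in> tangent M x \<Longrightarrow> v \<in> tangent M x \<Longrightarrow> omega M y (Df u) (Df v) = omega M x u v"
      by (rule preserves_omegaE[OF Symp1_omega[OF f] equalityD1[OF fi] x]) (rule that, assumption, simp only: fx)
    obtain D0 where "(inv f has_derivative D0) (at y within carrier M)"
      using C1_on_imp_derivative[OF Symp1_C1_inv[OF f] y] by blast
    from derivative_into_tangent[OF this y] gi
    obtain Dg where Dg: "(inv f has_derivative Dg) (at y within carrier M)" "\<And>u. Dg u \<in> tangent M x"
      using proj_tangent[OF x] by (auto simp: x_def)
    have "((f \<circ> inv f) has_derivative Df \<circ> Dg) (at y within carrier M)"
      using diff_chain_within[OF Dg(1), of f Df] Df(1) gi by (simp add: x_def)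
    then have id: "((\<lambda>y. y) has_derivative Df \<circ> Dg) (at y within carrier M)"
      using permutes_inv_o(1)[OF p] by (simp add: id_def)
    have *: "Df (Dg u) = u" if "u \<in> tangent M y" for u
      using derivative_unique_on_tangent[OF y id has_derivative_ident that] by simp
    have "omega M x (Dg u) (Dg v) = omega M y u v" if "u \<in> tangent M y" "v \<in> tangent M y" for u v
      using Df(2)[OF Dg(2)[of u] Dg(2)[of v]] * that by simp
    then show "\<exists>D. (inv f has_derivative D) (at y within carrier M) \<and>
        (\<forall>u\<in>tangent M y. \<forall>v\<in>tangent M y. omega M (inv f y) (D u) (D v) = omega M y u v)"
      using Dg(1) by (auto simp: x_def)
  qed
  then show ?thesis using f p by (auto simp: Symp1_def permutes_inv permutes_inv_inv)
qed

subsection \<open>Rotations\<close>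

lemma rotation_carrier: "x \<in> carrier M \<Longrightarrow> rotation M \<alpha> x \<in> carrier M"
  by (simp add: rotation_def action_carrier)

lemma rotation_0: "rotation M 0 = id"
  by (auto simp: rotation_def action_0)

lemma rotation_add: "rotation M (\<alpha> + \<beta>) = rotation M \<alpha> \<circ> rotation M \<beta>"
  by (auto simp: rotation_def action_add action_carrier fun_eq_iff)

lemma rotation_E: "\<bar>y\<bar> \<le> 1 \<Longrightarrow> rotation M (angle s) (E (t, y)) = E (s + t, y)"
  by (simp add: rotation_def action_E E_carrier)

lemma rotation_permutes: "rotation M \<alpha> permutes carrier M"
proof (rule bij_imp_permutes)
  have *: "rotation M \<alpha> (rotation M (- \<alpha>) x) = x" "rotation M (- \<alpha>) (rotation M \<alpha> x) = x" for x
    using rotation_add[of \<alpha> "- \<alpha>"] rotation_add[of "- \<alpha>" \<alpha>] by (auto simp: rotation_0 fun_eq_iff)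
  show "bij_betw (rotation M \<alpha>) (carrier M) (carrier M)"
    by (rule bij_betwI[where g="rotation M (- \<alpha>)"]) (auto simp: * rotation_carrier)
qed (simp add: rotation_def)

lemma inv_rotation: "inv (rotation M \<alpha>) = rotation M (- \<alpha>)"
  using rotation_add[of \<alpha> "- \<alpha>"] rotation_add[of "- \<alpha>" \<alpha>]
  by (intro inv_equality) (auto simp: rotation_0 fun_eq_iff)

lemma rotation_C1: "C1_on (carrier M) (rotation M \<alpha>)"
  unfolding C1_on_iff
  by (intro ballI exI[of _ "action M \<alpha>"] exI[of _ UNIV]) (auto simp: rotation_def C1_at_linear action_linear)

lemma rotation_Symp1: "rotation M \<alpha> \<in> Symp1 M"
proof -
  have "preserves_omega M (rotation M \<alpha>)" unfolding preserves_omega_def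
    by (intro ballI exI[of _ "action M \<alpha>"] conjI
        has_derivative_within_local[OF bounded_linear_imp_has_derivative[OF action_linear], of UNIV])
      (auto simp: rotation_def action_omega)
  then show ?thesis
    using rotation_permutes rotation_C1 by (auto simp: Symp1_def inv_rotation)
qed

lemma rotation_near:
  assumes "x \<in> carrier M"
  shows "dist (rotation M \<alpha> x) (rotation M \<beta> x) \<le> 2 * pi * circle_abs (\<alpha> - \<beta>)"
proof -
  have "rotation M \<alpha> x = rotation M (\<alpha> - \<beta>) (rotation M \<beta> x)"
    using rotation_add[of "\<alpha> - \<beta>" \<beta>] by (simp add: fun_eq_iff)
  then show ?thesis
    using action_near[OF rotation_carrier[OF assms], of "\<alpha> - \<beta>"] rotation_carrier[OF assms, of \<beta>]
    by (simp add: rotation_def[of M "\<alpha> - \<beta>"])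
qed

subsection \<open>The group of symplectic homeomorphisms\<close>

lemma dist_le_dC0:
  assumes "f permutes carrier M" "g permutes carrier M" "S \<subseteq> carrier M" "x \<in> S"
  shows "dist (f x) (g x) \<le> dC0 S f g"
  unfolding dC0_def
proof (rule cSUP_upper[OF assms(4)])
  obtain B where B: "\<And>x. x \<in> carrier M \<Longrightarrow> norm x \<le> B"
    using compact_imp_bounded[OF compact_carrier] unfolding bounded_iff by blast
  show "bdd_above ((\<lambda>x. dist (f x) (g x)) ` S)"
  proof (rule bdd_aboveI2[of _ _ "B + B"])
    fix x assume "x \<in> S"
    then have "f x \<in> carrier M" "g x \<in> carrier M"
      using assms(1-3) permutes_in_image by fastforce+
    then show "dist (f x) (g x) \<le> B + B"
      using B norm_triangle_ineq4[of "f x" "g x"] by (smt (verit) dist_norm)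
  qed
qed

lemma dC0_le:
  assumes "\<And>x. x \<in> S \<Longrightarrow> dist (f x) (g x) \<le> B" "S \<noteq> {}"
  shows "dC0 S f g \<le> B"
  unfolding dC0_def using assms by (intro cSUP_least) auto

lemma Symp0_permutes: "f \<in> Symp0 M \<Longrightarrow> f permutes carrier M"
  by (simp add: Symp0_def)

lemma Symp0_carrier: "f \<in> Symp0 M \<Longrightarrow> f x \<in> carrier M \<longleftrightarrow> x \<in> carrier M"
  using Symp0_permutes permutes_in_image by metis

lemma Symp0_cont: "f \<in> Symp0 M \<Longrightarrow> continuous_on (carrier M) f"
  by (simp add: Symp0_def homeomorphism_def)

lemma Symp0_approx:
  assumes "f \<in> Symp0 M" "\<epsilon> > 0"
  obtains g where "g \<in> Symp1 M" "\<And>x. x \<in> carrier M \<Longrightarrow> dist (f x) (g x) < \<epsilon>"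
proof -
  obtain g where g: "g \<in> Symp1 M" "dC0 (carrier M) f g < \<epsilon>" using assms unfolding Symp0_def by blast
  show ?thesis
    using dist_le_dC0[OF Symp0_permutes[OF assms(1)] Symp1_permutes[OF g(1)] subset_refl] g
    by (intro that[of g]) (auto intro: le_less_trans)
qed

lemma Symp0I:
  assumes p: "f permutes carrier M" and c: "continuous_on (carrier M) f"
    and a: "\<And>\<epsilon>. \<epsilon> > 0 \<Longrightarrow> \<exists>g\<in>Symp1 M. \<forall>x\<in>carrier M. dist (f x) (g x) < \<epsilon>"
  shows "f \<in> Symp0 M"
proof -
  have i: "f ` carrier M = carrier M" using p permutes_image by blast
  have "continuous_on (f ` carrier M) (inv f)"
    using c compact_carrier p by (intro continuous_on_inv) (auto simp: permutes_inverses)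
  then have "homeomorphism (carrier M) (carrier M) f (inv f)"
    using c p i by (intro homeomorphismI) (auto simp: permutes_inverses permutes_inv permutes_in_image)
  moreover have "\<exists>g\<in>Symp1 M. dC0 (carrier M) f g < \<epsilon>" if "\<epsilon> > 0" for \<epsilon>
  proof -
    obtain g where g: "g \<in> Symp1 M" "\<forall>x\<in>carrier M. dist (f x) (g x) < \<epsilon> / 2"
      using a[OF half_gt_zero[OF \<open>\<epsilon> > 0\<close>]] by blast
    have "dC0 (carrier M) f g \<le> \<epsilon> / 2" using g(2) carrier_nonempty by (intro dC0_le) auto
    then show ?thesis using g(1) that by (intro bexI[of _ g]) auto
  qed
  ultimately show ?thesis using p by (simp add: Symp0_def)
qed

lemma Symp1_imp_Symp0: "f \<in> Symp1 M \<Longrightarrow> f \<in> Symp0 M"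
  by (rule Symp0I) (auto simp: Symp1_permutes C1_on_imp_continuous_on Symp1_C1 intro!: bexI[of _ f])

lemma Symp0_uniformly_cont:
  assumes "f \<in> Symp0 M" "\<epsilon> > 0"
  obtains \<delta> where "\<delta> > 0" "\<And>x y. x \<in> carrier M \<Longrightarrow> y \<in> carrier M \<Longrightarrow> dist x y < \<delta> \<Longrightarrow> dist (f x) (f y) < \<epsilon>"
proof -
  have "uniformly_continuous_on (carrier M) f"
    by (rule compact_uniformly_continuous[OF Symp0_cont[OF assms(1)] compact_carrier])
  from uniformly_continuous_onE[OF this assms(2)] obtain \<delta> where "\<delta> > 0"
    "\<And>x x'. \<lbrakk>x \<in> carrier M; x' \<in> carrier M; dist x' x < \<delta>\<rbrakk> \<Longrightarrow> dist (f x') (f x) < \<epsilon>" by metis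
  then show ?thesis using that by metis
qed

lemma Symp0_comp:
  assumes f: "f \<in> Symp0 M" and g: "g \<in> Symp0 M"
  shows "g \<circ> f \<in> Symp0 M"
proof (rule Symp0I)
  show "g \<circ> f permutes carrier M" using f g Symp0_permutes permutes_compose by blast
  show "continuous_on (carrier M) (g \<circ> f)"
    using f g by (intro continuous_on_compose Symp0_cont)
      (auto intro: continuous_on_subset[OF Symp0_cont] simp: Symp0_carrier)
next
  fix \<epsilon> :: real assume e: "\<epsilon> > 0"
  obtain \<delta> where d: "\<delta> > 0" "\<And>x y. x \<in> carrier M \<Longrightarrow> y \<in> carrier M \<Longrightarrow> dist x y < \<delta> \<Longrightarrow> dist (g x) (g y) < \<epsilon>/2"
    using Symp0_uniformly_cont[OF g, of "\<epsilon>/2"] e by auto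
  obtain f1 where f1: "f1 \<in> Symp1 M" "\<And>x. x \<in> carrier M \<Longrightarrow> dist (f x) (f1 x) < \<delta>"
    using Symp0_approx[OF f d(1)] by blast
  obtain g1 where g1: "g1 \<in> Symp1 M" "\<And>x. x \<in> carrier M \<Longrightarrow> dist (g x) (g1 x) < \<epsilon>/2"
    using Symp0_approx[OF g, of "\<epsilon>/2"] e by auto
  have "dist ((g \<circ> f) x) ((g1 \<circ> f1) x) < \<epsilon>" if x: "x \<in> carrier M" for x
  proof -
    have c: "f x \<in> carrier M" "f1 x \<in> carrier M"
      using x f f1(1) Symp1_imp_Symp0 by (auto simp: Symp0_carrier)
    show ?thesis using d(2)[OF c f1(2)[OF x]] g1(2)[OF c(2)]
        dist_triangle[of "g (f x)" "g1 (f1 x)" "g (f1 x)"] by simp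
  qed
  then show "\<exists>h\<in>Symp1 M. \<forall>x\<in>carrier M. dist ((g \<circ> f) x) (h x) < \<epsilon>"
    using Symp1_comp[OF f1(1) g1(1)] by blast
qed

lemma Symp0_inv:
  assumes f: "f \<in> Symp0 M"
  shows "inv f \<in> Symp0 M"
proof (rule Symp0I)
  have p: "f permutes carrier M" using f Symp0_permutes by blast
  show "inv f permutes carrier M" using p permutes_inv by blast
  show c: "continuous_on (carrier M) (inv f)" using f by (simp add: Symp0_def homeomorphism_def)
  fix \<epsilon> :: real assume e: "\<epsilon> > 0"
  have "uniformly_continuous_on (carrier M) (inv f)"
    by (rule compact_uniformly_continuous[OF c compact_carrier])
  from uniformly_continuous_onE[OF this e] obtain \<delta> where d: "\<delta> > 0"
    "\<And>x x'. \<lbrakk>x \<in> carrier M; x' \<in> carrier M; dist x' x < \<delta>\<rbrakk> \<Longrightarrow> dist (inv f x') (inv f x) < \<epsilon>" by metis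
  obtain g where g: "g \<in> Symp1 M" "\<And>x. x \<in> carrier M \<Longrightarrow> dist (f x) (g x) < \<delta>"
    using Symp0_approx[OF f d(1)] by blast
  have gp: "g permutes carrier M" using g Symp1_permutes by blast
  have "dist (inv f y) (inv g y) < \<epsilon>" if y: "y \<in> carrier M" for y
  proof -
    define z where "z = inv g y"
    have z: "z \<in> carrier M" "g z = y"
      using y gp by (auto simp: z_def permutes_inverses permutes_inv permutes_in_image)
    have "dist (inv f (g z)) (inv f (f z)) < \<epsilon>"
      using d(2)[of "f z" "g z"] g(2)[OF z(1)] z y f by (simp add: Symp0_carrier dist_commute)
    then show ?thesis using z p by (simp add: permutes_inverses z_def)
  qed
  then show "\<exists>h\<in>Symp1 M. \<forall>x\<in>carrier M. dist (inv f x) (h x) < \<epsilon>"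
    using Symp1_inv[OF g(1)] by blast
qed

text \<open>The hypothesis on the inverses makes the limit invertible: its inverse is the limit of the inverses.\<close>

lemma Symp0_limit:
  assumes f: "\<And>n. f n \<in> Symp0 M" and e: "summable e"
    and d: "\<And>n x. x \<in> carrier M \<Longrightarrow> dist (f (Suc n) x) (f n x) \<le> e n"
    and d': "\<And>n x. x \<in> carrier M \<Longrightarrow> dist (inv (f (Suc n)) x) (inv (f n) x) \<le> e n"
  obtains F where "F \<in> Symp0 M" "uniform_limit (carrier M) f F sequentially"
proof -
  have lim: "\<exists>G. uniform_limit (carrier M) g G sequentially \<and> (\<forall>x\<in>carrier M. G x \<in> carrier M) \<and>
      continuous_on (carrier M) G \<and> (\<forall>x. x \<notin> carrier M \<longrightarrow> G x = x)"
    if g: "\<And>n. g n \<in> Symp0 M" "\<And>n x. x \<in> carrier M \<Longrightarrow> dist (g (Suc n) x) (g n x) \<le> e n" for g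
  proof -
    define G0 where "G0 x = g 0 x + (\<Sum>i. g (Suc i) x - g i x)" for x
    define G where "G x = (if x \<in> carrier M then G0 x else x)" for x
    have "uniform_limit (carrier M) (\<lambda>n x. \<Sum>i<n. g (Suc i) x - g i x) (\<lambda>x. \<Sum>i. g (Suc i) x - g i x) sequentially"
      by (rule Weierstrass_m_test[OF _ e]) (use g(2) in \<open>auto simp: dist_norm\<close>)
    then have "uniform_limit (carrier M) (\<lambda>n x. g 0 x + (\<Sum>i<n. g (Suc i) x - g i x)) G0 sequentially"
      unfolding G0_def by (intro uniform_limit_add uniform_limit_const)
    moreover have "g 0 x + (\<Sum>i<n. g (Suc i) x - g i x) = g n x" for n x
      using sum_lessThan_telescope[of "\<lambda>i. g i x" n] by simp
    ultimately have "uniform_limit (carrier M) g G0 sequentially" by simp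
    then have u: "uniform_limit (carrier M) g G sequentially"
      by (rule uniform_limit_cong'[THEN iffD1, rotated -1]) (auto simp: G_def)
    have "G x \<in> carrier M" if "x \<in> carrier M" for x
      using closed_sequentially[OF compact_imp_closed[OF compact_carrier] _ tendsto_uniform_limitI[OF u that]]
        g(1) that by (auto simp: Symp0_carrier)
    moreover have "continuous_on (carrier M) G"
      by (rule uniform_limit_theorem[OF _ u]) (auto simp: Symp0_cont[OF g(1)])
    ultimately show ?thesis using u by (intro exI[of _ G]) (auto simp: G_def)
  qed
  obtain F where F: "uniform_limit (carrier M) f F sequentially" "\<And>x. x \<in> carrier M \<Longrightarrow> F x \<in> carrier M"
    "continuous_on (carrier M) F" "\<And>x. x \<notin> carrier M \<Longrightarrow> F x = x"
    using lim[OF f d] by blast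
  obtain G where G: "uniform_limit (carrier M) (\<lambda>n. inv (f n)) G sequentially"
    "\<And>x. x \<in> carrier M \<Longrightarrow> G x \<in> carrier M" "continuous_on (carrier M) G"
    using lim[of "\<lambda>n. inv (f n)", OF Symp0_inv[OF f] d'] by blast
  have inverse: "G' (F' x) = x"
    if FG: "uniform_limit (carrier M) a F' sequentially" "uniform_limit (carrier M) b G' sequentially"
      "continuous_on (carrier M) G'" "\<And>n x. b n (a n x) = x"
      "\<And>x. x \<in> carrier M \<Longrightarrow> F' x \<in> carrier M" "\<And>n x. x \<in> carrier M \<Longrightarrow> a n x \<in> carrier M"
      and x: "x \<in> carrier M" for a b :: "nat \<Rightarrow> 'a \<Rightarrow> 'a" and F' G' x
  proof -
    have "(\<lambda>n. a n x) \<longlonglongrightarrow> F' x" by (rule tendsto_uniform_limitI[OF FG(1) x])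
    then have 1: "(\<lambda>n. G' (a n x)) \<longlonglongrightarrow> G' (F' x)"
      by (rule continuous_on_tendsto_compose[OF FG(3)]) (use FG x in auto)
    have "(\<lambda>n. G' (a n x)) \<longlonglongrightarrow> x"
    proof (rule metric_LIMSEQ_I)
      fix r :: real assume "r > 0"
      from uniform_limitD[OF FG(2) this] obtain N where N: "\<forall>n\<ge>N. \<forall>x\<in>carrier M. dist (b n x) (G' x) < r"
        unfolding eventually_sequentially by blast
      have "dist (G' (a n x)) x < r" if "n \<ge> N" for n
        using N[rule_format, OF that FG(6)[OF x, of n]] FG(4)[of n x] by (simp add: dist_commute)
      then show "\<exists>no. \<forall>n\<ge>no. dist (G' (a n x)) x < r" by blast
    qed
    from LIMSEQ_unique[OF 1 this] show ?thesis .
  qed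
  have inv: "inv (f n) (f n x) = x" "f n (inv (f n) x) = x" for n x
    using Symp0_permutes[OF f] permutes_inverses by metis+
  have GF: "G (F x) = x" if "x \<in> carrier M" for x
    by (rule inverse[OF F(1) G(1,3) inv(1) F(2) _ that]) (auto simp: Symp0_carrier[OF f])
  have FG: "F (G x) = x" if "x \<in> carrier M" for x
    by (rule inverse[OF G(1) F(1,3) inv(2) G(2) _ that]) (auto simp: Symp0_carrier[OF Symp0_inv[OF f]])
  have "F permutes carrier M"
    by (rule bij_imp_permutes[OF bij_betwI[where g=G]]) (use F G GF FG in auto)
  moreover have "\<exists>g\<in>Symp1 M. \<forall>x\<in>carrier M. dist (F x) (g x) < \<epsilon>" if "\<epsilon> > 0" for \<epsilon>
  proof -
    from uniform_limitD[OF F(1), of "\<epsilon>/2"] that obtain n where n: "\<forall>x\<in>carrier M. dist (f n x) (F x) < \<epsilon>/2"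
      unfolding eventually_sequentially by auto
    obtain g where g: "g \<in> Symp1 M" "\<And>x. x \<in> carrier M \<Longrightarrow> dist (f n x) (g x) < \<epsilon>/2"
      using Symp0_approx[OF f half_gt_zero[OF \<open>\<epsilon> > 0\<close>]] by blast
    have "dist (F x) (g x) < \<epsilon>" if "x \<in> carrier M" for x
      using dist_triangle_half_r[of "f n x" "F x" \<epsilon> "g x"] n g(2) that by (auto simp: dist_commute)
    then show ?thesis using g(1) by blast
  qed
  ultimately have "F \<in> Symp0 M" using F(3) by (intro Symp0I)
  then show ?thesis using F(1) that by blast
qed

end

section \<open>Coordinates and the measure of a surface\<close>

lemma C1_at_Ln:
  assumes "w \<notin> \<real>\<^sub>\<le>\<^sub>0"
  shows "C1_at Ln w"
proof (rule C1_atI[of "- \<real>\<^sub>\<le>\<^sub>0" _ _ "\<lambda>z u. inverse z * u"])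
  show "open (- \<real>\<^sub>\<le>\<^sub>0 :: complex set)" by (intro open_Compl closed_nonpos_Reals_complex)
  show "(Ln has_derivative (*) (inverse z)) (at z)" if "z \<in> - \<real>\<^sub>\<le>\<^sub>0" for z
    using has_field_derivative_Ln[of z] that by (simp add: has_field_derivative_def)
qed (use assms in \<open>auto intro!: continuous_intros\<close>)

text \<open>The open fundamental domain of the coordinates.\<close>

definition Q0 :: "(real \<times> real) set" where
  "Q0 = {0<..<1} \<times> {-1<..<1}"

lemma open_Q0: "open Q0" unfolding Q0_def by (intro open_Times) auto

context circle_surface begin

lemma E_core: "\<bar>y\<bar> < 1 \<Longrightarrow> E (t, y) \<in> core M"
  using Z_E[of y t] E_carrier[of y t] Y_E[of y t] by (auto simp: core_eq)

lemma E_shift: "k \<in> \<int> \<Longrightarrow> E (t + k, y) = E (t, y)"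
  by (simp add: E_chart angle_eq_iff[of "t + k" t, THEN iffD2])

text \<open>A local inverse of \<open>E\<close> with angles in the interval of length \<open>1\<close> centred at \<open>s\<close>. The point is rotated
so that this interval becomes the domain of the principal branch of the logarithm.\<close>

definition coord :: "real \<Rightarrow> 'a \<Rightarrow> real \<times> real" where
  "coord s x = (s + Im (Ln (cis (- (2 * pi * s)) * Z x)) / (2 * pi), Y x)"

text \<open>Rotating by \<open>-s\<close> brings the angle into \<open>(-1/2, 1/2)\<close>, away from the cut of the logarithm.\<close>

lemma coord_E:
  assumes "\<bar>t - s\<bar> < 1 / 2" "\<bar>y\<bar> < 1"
  shows "coord s (E (t, y)) = (t, y)" and "cis (- (2 * pi * s)) * Z (E (t, y)) \<notin> \<real>\<^sub>\<le>\<^sub>0"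
proof -
  obtain r where r: "r > 0" "Z (E (t, y)) = of_real r * cis (2 * pi * t)" using Z_E assms by blast
  have z: "cis (- (2 * pi * s)) * Z (E (t, y)) = of_real r * cis (2 * pi * (t - s))"
    unfolding r(2) by (simp add: cis_mult right_diff_distrib mult.left_commute[of _ "of_real r"])
  have "\<bar>2 * pi * (t - s)\<bar> < pi" using assms(1) by (simp add: abs_mult)
  then have b: "-pi < 2 * pi * (t - s)" "2 * pi * (t - s) < pi" by linarith+
  have "Ln (of_real r * cis (2 * pi * (t - s))) = Complex (ln r) (2 * pi * (t - s))"
    using b r(1) by (intro Ln_unique) (auto simp: exp_eq_polar exp_ln)
  then have ln: "Im (Ln (of_real r * cis (2 * pi * (t - s)))) = 2 * pi * (t - s)" by simp
  then show "coord s (E (t, y)) = (t, y)" using Y_E[of y t] assms(2) by (simp add: coord_def z ln)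
  show "cis (- (2 * pi * s)) * Z (E (t, y)) \<notin> \<real>\<^sub>\<le>\<^sub>0"
  proof
    assume "cis (- (2 * pi * s)) * Z (E (t, y)) \<in> \<real>\<^sub>\<le>\<^sub>0"
    then have "of_real r * cis (2 * pi * (t - s)) \<in> \<real>\<^sub>\<le>\<^sub>0" unfolding z .
    then have "Im (Ln (of_real r * cis (2 * pi * (t - s)))) = pi"
      using Im_Ln_eq_pi[of "of_real r * cis (2 * pi * (t - s))"] r(1)
      by (auto simp: complex_nonpos_Reals_iff less_le complex_eq_iff) (metis cis.sel cis_neq_zero complex_eqI zero_complex.sel)
    then show False using ln b by simp
  qed
qed

lemma coord_C1:
  assumes "cis (- (2 * pi * s)) * Z x \<notin> \<real>\<^sub>\<le>\<^sub>0"
  shows "C1_at (coord s) x"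
proof -
  have "C1_at (\<lambda>x. cis (- (2 * pi * s)) * Z x) x"
    by (rule C1_at_linear) (intro bounded_linear_compose[OF bounded_linear_mult_right Z_linear])
  from C1_at_compose[OF C1_at_compose[OF this C1_at_Ln[OF assms]] C1_at_linear[OF bounded_linear_Im]]
  have "C1_at (\<lambda>x. s + (1 / (2 * pi)) * Im (Ln (cis (- (2 * pi * s)) * Z x))) x"
    by (intro C1_at_add C1_at_const C1_at_mult)
  from C1_at_Pair[OF this Y_C1] show ?thesis by (simp add: coord_def[abs_def])
qed

lemma coord_C1_E:
  assumes "\<bar>t - s\<bar> < 1 / 2" "\<bar>y\<bar> < 1"
  shows "C1_at (coord s) (E (t, y))"
  using assms coord_E(2) coord_C1 by blast

lemma E_coord:
  assumes "x \<in> core M"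
  shows "E (coord s x) = x"
proof -
  let ?w = "cis (- (2 * pi * s)) * Z x"
  have nz: "?w \<noteq> 0" using assms by (simp add: core_eq)
  have "?w = exp (Ln ?w)" using nz by simp
  also have "\<dots> = of_real (cmod ?w) * cis (Im (Ln ?w))" using nz by (simp add: exp_eq_polar)
  finally have "cis (2 * pi * s) * ?w = of_real (cmod ?w) * (cis (2 * pi * s) * cis (Im (Ln ?w)))" by (metis mult.left_commute)
  then have "Z x = of_real (cmod ?w) * cis (2 * pi * (s + Im (Ln ?w) / (2 * pi)))"
    by (simp add: cis_mult mult.assoc[symmetric] distrib_left)
  from E_Z_Y[OF assms _ this] nz show ?thesis by (simp add: coord_def)
qed

lemma snd_coord: "snd (coord s x) = Y x"
  by (simp add: coord_def)

lemma core_imp_E: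
  assumes "x \<in> core M"
  obtains t y where "x = E (t, y)" "\<bar>y\<bar> < 1"
  using E_coord[OF assms, of 0] assms by (metis (no_types, lifting) mem_Collect_eq core_eq snd_coord prod.collapse)

lemma E_eq_iff:
  assumes "\<bar>y\<bar> < 1" "\<bar>y'\<bar> < 1" "E (t, y) = E (t', y')"
  shows "y = y'" "t - t' \<in> \<int>"
proof -
  show "y = y'" using assms Y_E[of y t] Y_E[of y' t'] by simp
  obtain r r' where r: "r > 0" "Z (E (t, y)) = of_real r * cis (2 * pi * t)"
    "r' > 0" "Z (E (t, y)) = of_real r' * cis (2 * pi * t')" using Z_E assms by metis
  then have "cmod (of_real r * cis (2 * pi * t)) = cmod (of_real r' * cis (2 * pi * t'))" by simp
  then have "r = r'" using r(1,3) by (simp add: norm_mult)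
  then have "cis (2 * pi * t) = cis (2 * pi * t')" using r by simp
  then show "t - t' \<in> \<int>" by (rule cis_eq_imp_Ints)
qed

lemma
  assumes p: "p \<in> Q0"
  shows coord_Q0: "coord (1/2) (E p) = p" and coord_C1_Q0: "C1_at (coord (1/2)) (E p)"
proof -
  have 1: "\<bar>fst p - 1/2\<bar> < 1/2" "\<bar>snd p\<bar> < 1" using p by (auto simp: Q0_def abs_real_def)
  show "coord (1/2) (E p) = p" "C1_at (coord (1/2)) (E p)"
    using coord_E(1)[OF 1] coord_C1_E[OF 1] by simp_all
qed

lemma E_Q0_carrier: "p \<in> Q0 \<Longrightarrow> E p \<in> carrier M"
  using E_carrier by (auto simp: Q0_def)

lemma E_Q0_relatively_open: "\<exists>V. open V \<and> E ` Q0 = carrier M \<inter> V"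
proof (intro exI conjI)
  let ?V = "{x. Z x \<notin> \<real>\<^sub>\<ge>\<^sub>0} \<inter> {x. \<bar>Y x\<bar> < 1}"
  have cZ: "continuous_on UNIV Z" using Z_linear by (rule linear_continuous_on)
  have cY: "continuous_on UNIV Y" using C1_at_imp_isCont[OF Y_C1] by (simp add: continuous_at_imp_continuous_on)
  have "open (Z -` (- \<real>\<^sub>\<ge>\<^sub>0))"
    by (rule open_vimage[OF _ cZ]) (intro open_Compl closed_nonneg_Reals_complex)
  moreover have "open {x. \<bar>Y x\<bar> < 1}" by (intro open_Collect_less continuous_intros cY)
  ultimately show "open ?V" by (auto simp: vimage_def)
  show "E ` Q0 = carrier M \<inter> ?V"
  proof (intro equalityI subsetI)
    fix x assume "x \<in> E ` Q0"
    then obtain t y where x: "x = E (t, y)" "0 < t" "t < 1" "\<bar>y\<bar> < 1" by (auto simp: Q0_def)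
    have "\<bar>t - 1/2\<bar> < 1/2" using x by (auto simp: abs_real_def)
    moreover have "cis (- (2 * pi * (1/2))) = -1" by (simp add: complex_eq_iff)
    ultimately have "- Z x \<notin> \<real>\<^sub>\<le>\<^sub>0" using coord_E(2)[of t "1/2" y] x by simp
    then have "Z x \<notin> \<real>\<^sub>\<ge>\<^sub>0" by (simp add: complex_nonpos_Reals_iff complex_nonneg_Reals_iff)
    then show "x \<in> carrier M \<inter> ?V" using x E_carrier[of y t] Y_E[of y t] by simp
  next
    fix x assume x: "x \<in> carrier M \<inter> ?V"
    then have c: "x \<in> core M" by (auto simp: core_eq)
    have "- Z x \<notin> \<real>\<^sub>\<le>\<^sub>0" using x by (simp add: complex_nonpos_Reals_iff complex_nonneg_Reals_iff)
    moreover have n0: "- Z x \<noteq> 0" using x by auto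
    ultimately have "\<bar>Im (Ln (- Z x))\<bar> < pi"
      using Im_Ln_less_pi[of "- Z x"] mpi_less_Im_Ln[of "- Z x"] by (auto simp: abs_less_iff)
    moreover have "cis (- pi) = -1" by (simp add: complex_eq_iff)
    ultimately have "coord (1/2) x \<in> Q0" using x by (auto simp: Q0_def coord_def abs_less_iff field_simps)
    then show "x \<in> E ` Q0" using E_coord[OF c] by (metis image_eqI)
  qed
qed

subsection \<open>The measure\<close>

lemma Symp0_measurable: 
  assumes "f \<in> Symp0 M" shows "f \<in> borel_measurable borel"
proof -
  have "(\<lambda>x. if x \<in> carrier M then f x else x) \<in> borel_measurable borel"
    using assms compact_carrier
    by (intro borel_measurable_continuous_on_if Symp0_cont continuous_on_id) (auto intro: borel_compact)
  moreover have "(\<lambda>x. if x \<in> carrier M then f x else x) = f"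
    using permutes_not_in[OF Symp0_permutes[OF assms]] by auto
  ultimately show ?thesis by simp
qed

lemma E_measurable: "E \<in> borel_measurable borel"
  using E_cont by (rule borel_measurable_continuous_onI)

text \<open>The density of the measure in coordinates is the constant \<open>\<bar>\<kappa>\<bar>\<close>, because the form is
evaluated on the two partial derivatives of \<open>E\<close>.\<close>

lemma emeasure_omega:
  assumes A: "A \<in> sets borel"
  shows "emeasure (omega_measure M) A = ennreal \<bar>\<kappa>\<bar> * emeasure lborel (({0..<1} \<times> {-1<..<1}) \<inter> E -` A)"
proof -
  let ?Q = "{0..<1} \<times> {-1<..<1} :: (real \<times> real) set"
  let ?R = "restrict_space lborel ?Q"
  let ?d = "(\<lambda>(t, y). ennreal \<bar>omega M (chart M (angle t, y))
             (vector_derivative (\<lambda>s. chart M (angle s, y)) (at t))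
             (vector_derivative (\<lambda>s. chart M (angle t, s)) (at y))\<bar>)"
  have Q: "?Q \<in> sets lborel" by (simp add: borel_Times)
  have d: "?d p = ennreal \<bar>\<kappa>\<bar>" if "p \<in> ?Q" for p
  proof -
    obtain t y where p: "p = (t, y)" "\<bar>y\<bar> < 1" using \<open>p \<in> ?Q\<close> by (cases p) auto
    have D: "(E has_derivative E' (t, y)) (at (t, y))" using E_deriv p by simp
    interpret bounded_linear "E' (t, y)" by (rule has_derivative_bounded_linear[OF D])
    have "((\<lambda>s. E (s, y)) has_derivative (\<lambda>h. E' (t, y) (h, 0))) (at t)"
      by (rule has_derivative_compose[where f="\<lambda>s. (s, y)" and f'="\<lambda>h. (h, 0)"])
        (auto intro!: derivative_eq_intros D)
    then have 1: "((\<lambda>s. E (s, y)) has_vector_derivative E' (t, y) (1, 0)) (at t)"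
      by (simp add: has_vector_derivative_def scaleR[symmetric])
    have "((\<lambda>s. E (t, s)) has_derivative (\<lambda>h. E' (t, y) (0, h))) (at y)"
      by (rule has_derivative_compose[where f="\<lambda>s. (t, s)" and f'="\<lambda>h. (0, h)"])
        (auto intro!: derivative_eq_intros D)
    then have 2: "((\<lambda>s. E (t, s)) has_vector_derivative E' (t, y) (0, 1)) (at y)"
      by (simp add: has_vector_derivative_def scaleR[symmetric])
    show ?thesis
      using vector_derivative_at[OF 1] vector_derivative_at[OF 2] omega_E[of "(t, y)" "(1,0)" "(0,1)"] p
      by (simp add: E_chart[symmetric] det2_def)
  qed
  have dm: "?d \<in> borel_measurable ?R"
    by (subst measurable_cong[where g="\<lambda>_. ennreal \<bar>\<kappa>\<bar>"]) (auto simp: d space_restrict_space)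
  have Ec: "(\<lambda>(t, y). chart M (angle t, y)) = E" by (auto simp: E_chart)
  have ER: "E \<in> measurable ?R borel" using E_measurable by (intro measurable_restrict_space1) simp
  have AQ: "?Q \<inter> E -` A \<in> sets borel" using E_measurable A Q by (auto intro!: measurable_sets_borel)
  have EA: "E -` A \<inter> space ?R \<in> sets ?R" using measurable_sets[OF ER A] .
  have "emeasure (omega_measure M) A = emeasure (density ?R ?d) (E -` A \<inter> space ?R)"
    unfolding omega_measure_def Ec using ER A by (subst emeasure_distr) (auto simp: space_density)
  also have "\<dots> = (\<integral>\<^sup>+ p. ?d p * indicator (E -` A \<inter> space ?R) p \<partial>?R)"
    using dm EA by (rule emeasure_density)
  also have "\<dots> = (\<integral>\<^sup>+ p. ennreal \<bar>\<kappa>\<bar> * indicator (E -` A \<inter> space ?R) p \<partial>?R)"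
    by (intro nn_integral_cong) (auto simp: d space_restrict_space split: split_indicator)
  also have "\<dots> = ennreal \<bar>\<kappa>\<bar> * emeasure ?R (E -` A \<inter> space ?R)"
    using EA by (simp add: nn_integral_cmult_indicator)
  also have "emeasure ?R (E -` A \<inter> space ?R) = emeasure lborel (?Q \<inter> E -` A)"
    using Q by (subst emeasure_restrict_space) (auto simp: space_restrict_space Int_commute)
  finally show ?thesis .
qed

lemma emeasure_Leb:
  assumes A: "A \<in> sets borel"
  shows "emeasure (Leb M) A = emeasure lborel (({0..<1} \<times> {-1<..<1}) \<inter> E -` A) / 2"
proof -
  let ?Q = "{0..<1} \<times> {-1<..<1} :: (real \<times> real) set"
  have s: "sets (omega_measure M) = sets borel" by (simp add: omega_measure_def)
  have c: "carrier M \<in> sets borel" using compact_carrier by (rule borel_compact)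
  have QE: "?Q \<inter> E -` carrier M = ?Q" using E_carrier by auto
  have Q2: "emeasure lborel ?Q = 2"
    using lborel.emeasure_pair_measure_Times[of "{0..<1::real}" lborel "{-1<..<1::real}"]
    by (simp add: lborel_prod)
  have QA: "?Q \<inter> E -` (carrier M \<inter> A) = ?Q \<inter> E -` A" using QE by blast
  have "emeasure (Leb M) A = emeasure (omega_measure M) (carrier M \<inter> A) / emeasure (omega_measure M) (carrier M)"
    unfolding Leb_def using A c s by (intro emeasure_uniform_measure) auto
  also have "\<dots> = (ennreal \<bar>\<kappa>\<bar> * emeasure lborel (?Q \<inter> E -` A)) / (ennreal \<bar>\<kappa>\<bar> * 2)"
    unfolding emeasure_omega[OF c] emeasure_omega[OF sets.Int[OF c A]] QE Q2 QA ..
  also have "\<dots> = emeasure lborel (?Q \<inter> E -` A) / 2"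
    using \<kappa>_nz by (simp add: divide_mult_eq mult.commute[of "ennreal \<bar>\<kappa>\<bar>"])
  finally show ?thesis .
qed

end

section \<open>Invariance of the measure\<close>

text \<open>Coordinates are pairs, while determinants and the change of variables formula refer to \<open>real ^ 2\<close>;
\<open>vec2\<close> identifies the two planes.\<close>

definition vec2 :: "real \<times> real \<Rightarrow> real ^ 2" where
  "vec2 p = (\<chi> i. if i = 1 then fst p else snd p)"

lemma vec2_nth [simp]: "vec2 p $ 1 = fst p" "vec2 p $ 2 = snd p"
  by (auto simp: vec2_def)

definition unvec2 :: "real ^ 2 \<Rightarrow> real \<times> real" where
  "unvec2 v = (v $ 1, v $ 2)"

lemma vec2_inverse [simp]: "unvec2 (vec2 p) = p" "vec2 (unvec2 v) = v"
  by (auto simp: unvec2_def vec_eq_iff forall_2)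

lemma linear_vec2: "bounded_linear vec2"
  by (intro linear_conv_bounded_linear[THEN iffD1] linearI) (auto simp: vec_eq_iff forall_2)

lemma linear_unvec2: "bounded_linear unvec2"
  by (intro linear_conv_bounded_linear[THEN iffD1] linearI) (auto simp: unvec2_def)

lemma vec2_measurable [measurable]: "vec2 \<in> borel_measurable borel"
  and unvec2_measurable [measurable]: "unvec2 \<in> borel_measurable borel"
  by (intro borel_measurable_continuous_onI linear_continuous_on linear_vec2 linear_unvec2)+

lemma lborel_vec2: "lborel = distr lborel borel vec2"
proof (rule lborel_eqI)
  fix l u :: "real ^ 2" assume lu: "\<And>b. b \<in> Basis \<Longrightarrow> l \<bullet> b \<le> u \<bullet> b"
  have B: "(Basis :: (real ^ 2) set) = {axis 1 1, axis 2 1}" by (auto simp: Basis_vec_def UNIV_2)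
  have "vec2 -` box l u = box (unvec2 l) (unvec2 u)"
    by (auto simp: box_def B inner_axis Basis_prod_def unvec2_def)
  moreover have "emeasure lborel (box (unvec2 l) (unvec2 u)) = (\<Prod>b\<in>Basis. (unvec2 u - unvec2 l) \<bullet> b)"
    using lu[of "axis 1 1"] lu[of "axis 2 1"] by (intro emeasure_lborel_box) (auto simp: B inner_axis Basis_prod_def unvec2_def)
  moreover have "(\<Prod>b\<in>Basis. (unvec2 u - unvec2 l) \<bullet> b) = (\<Prod>b\<in>Basis. (u - l) \<bullet> b)"
    by (simp add: B Basis_prod_def unvec2_def inner_axis axis_eq_axis)
  ultimately show "emeasure (distr lborel borel vec2) (box l u) = (\<Prod>b\<in>Basis. (u - l) \<bullet> b)"
    by (subst emeasure_distr) auto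
qed simp

lemma emeasure_vec2_image:
  assumes "A \<in> sets borel"
  shows "vec2 ` A \<in> sets borel" "emeasure lborel (vec2 ` A) = emeasure lborel A"
proof -
  have e: "vec2 ` A = unvec2 -` A" by (auto simp: image_iff) (metis vec2_inverse(2))
  then show s: "vec2 ` A \<in> sets borel" using measurable_sets_borel[OF unvec2_measurable assms] by simp
  have "vec2 -` (vec2 ` A) = A" unfolding e by auto
  then show "emeasure lborel (vec2 ` A) = emeasure lborel A"
    using s by (subst lborel_vec2, subst emeasure_distr) auto
qed

text \<open>An injective differentiable map with Jacobian \<open>1\<close> preserves area; the image may be smaller than \<open>B\<close>.\<close>

lemma emeasure_image_det2:
  fixes F :: "real \<times> real \<Rightarrow> real \<times> real"
  assumes A: "A \<in> sets borel" and fin: "bounded A"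
    and D: "\<And>p. p \<in> A \<Longrightarrow> (F has_derivative F' p) (at p)"
    and det: "\<And>p. p \<in> A \<Longrightarrow> det2 (F' p (1, 0)) (F' p (0, 1)) = 1"
    and inj: "inj_on F A" and B: "B \<in> sets borel" "F ` A \<subseteq> B"
  shows "emeasure lborel A \<le> emeasure lborel B"
proof -
  define f where "f = vec2 \<circ> F \<circ> unvec2"
  let ?A = "vec2 ` A"
  define f' where "f' v = vec2 \<circ> F' (unvec2 v) \<circ> unvec2" for v
  have bA: "bounded ?A" using fin linear_vec2 by (simp add: bounded_linear_image)
  have A': "?A \<in> sets borel" using emeasure_vec2_image[OF A] by blast
  have mA: "?A \<in> lmeasurable" using bA A' by (simp add: bounded_set_imp_lmeasurable)
  have fv: "(f has_derivative f' v) (at v within ?A)" if "v \<in> ?A" for v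
  proof -
    have "unvec2 v \<in> A" using that by auto
    from D[OF this] have "((vec2 \<circ> F \<circ> unvec2) has_derivative (vec2 \<circ> F' (unvec2 v) \<circ> unvec2)) (at v)"
      by (intro diff_chain_at) (auto intro: bounded_linear_imp_has_derivative linear_vec2 linear_unvec2)
    then show ?thesis unfolding f_def f'_def by (rule has_derivative_at_withinI)
  qed
  have d1: "\<bar>det (matrix (f' v))\<bar> = 1" if "v \<in> ?A" for v
  proof -
    have "unvec2 v \<in> A" using that by auto
    from det[OF this] show ?thesis
      by (simp add: det_2 matrix_def f'_def det2_def unvec2_def axis_def mult.commute)
  qed
  have injf: "inj_on f ?A"
  proof (rule inj_onI)
    fix v w assume vw: "v \<in> ?A" "w \<in> ?A" "f v = f w"
    then obtain p q where p: "p \<in> A" "v = vec2 p" "q \<in> A" "w = vec2 q" by blast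
    have "unvec2 (f v) = unvec2 (f w)" using vw(3) by simp
    then have "F p = F q" unfolding f_def p by simp
    then show "v = w" using inj_onD[OF inj _ p(1,3)] p by simp
  qed
  have "((\<lambda>v. 1 :: real) has_integral measure lebesgue ?A) ?A"
    using mA unfolding lmeasure_integral[OF mA] by (intro integrable_integral) (simp add: lmeasurable_iff_integrable_on)
  then have "((\<lambda>v. \<bar>det (matrix (f' v))\<bar>) has_integral measure lebesgue ?A) ?A"
    by (rule has_integral_eq[rotated]) (simp add: d1)
  then have m: "f ` ?A \<in> lmeasurable" "measure lebesgue (f ` ?A) = measure lebesgue ?A"
    using has_measure_differentiable_image[OF _ fv injf] A' by auto
  have "emeasure lborel A = emeasure lebesgue ?A"
    using emeasure_vec2_image[OF A] by simp
  also have "\<dots> = emeasure lebesgue (f ` ?A)"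
    unfolding emeasure_eq_measure2[OF mA] emeasure_eq_measure2[OF m(1)] m(2) ..
  also have "\<dots> \<le> emeasure lebesgue (vec2 ` B)"
    using B emeasure_vec2_image(1)[OF B(1)] by (intro emeasure_mono) (auto simp: f_def)
  also have "\<dots> = emeasure lborel B" using emeasure_vec2_image[OF B(1)] by simp
  finally show ?thesis .
qed

context circle_surface begin

lemma emeasure_Leb_Q0:
  assumes A: "A \<in> sets borel"
  shows "emeasure (Leb M) A = emeasure lborel (Q0 \<inter> E -` A) / 2"
proof -
  have Q: "Q0 \<inter> E -` A \<in> sets borel" "{0} \<times> UNIV \<in> sets (borel :: (real \<times> real) measure)"
    using open_Q0 A E_measurable by (auto intro!: measurable_sets_borel sets.Int borel_Times)
  have "{0} \<times> UNIV \<in> null_sets (lborel :: (real \<times> real) measure)"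
    using lborel.emeasure_pair_measure_Times[of "{0::real}" lborel "UNIV :: real set"]
    by (auto simp: lborel_prod null_sets_def Q)
  then have "emeasure lborel (Q0 \<inter> E -` A) = emeasure lborel ((Q0 \<inter> E -` A) \<union> ({0} \<times> UNIV) \<inter> ({0..<1} \<times> {-1<..<1} \<inter> E -` A))"
    using Q E_measurable A
    by (intro emeasure_Un_null_set[symmetric] null_set_Int2) (auto intro!: measurable_sets_borel sets.Int borel_Times)
  also have "(Q0 \<inter> E -` A) \<union> ({0} \<times> UNIV) \<inter> ({0..<1} \<times> {-1<..<1} \<inter> E -` A) = ({0..<1} \<times> {-1<..<1}) \<inter> E -` A"
    by (auto simp: Q0_def less_le)
  finally show ?thesis using emeasure_Leb[OF A] by simp
qed

lemma sets_Leb [simp, measurable_cong]: "sets (Leb M) = sets borel"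
  by (simp add: Leb_def omega_measure_def)

lemma space_Leb [simp]: "space (Leb M) = UNIV"
  using sets_eq_imp_space_eq[OF sets_Leb] by simp

lemma prob_Leb: "prob_space (Leb M)"
proof
  have "emeasure lborel Q0 = 2" unfolding Q0_def
    using lborel.emeasure_pair_measure_Times[of "{0<..<1::real}" lborel "{-1<..<1::real}"]
    by (simp add: lborel_prod)
  then show "emeasure (Leb M) (space (Leb M)) = 1"
    using emeasure_Leb_Q0[of UNIV] by simp
qed

text \<open>Points whose image leaves the fundamental domain come, under the inverse map, from countably many
differentiable curves, and a curve is negligible in the plane.\<close>

lemma Symp1_null:
  assumes f: "f \<in> Symp1 M"
  shows "negligible {p \<in> Q0. f (E p) \<notin> E ` Q0}"
proof -
  have p: "f permutes carrier M" using f Symp1_permutes by blast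
  define S where "S b = {s. inv f (b s) \<in> E ` Q0}" for b :: "real \<Rightarrow> 'a"
  have "{p \<in> Q0. f (E p) \<notin> E ` Q0} \<subseteq> (\<Union>b\<in>curves. (\<lambda>s. coord (1/2) (inv f (b s))) ` S b)"
  proof
    fix q assume "q \<in> {p \<in> Q0. f (E p) \<notin> E ` Q0}"
    then have q: "q \<in> Q0" "f (E q) \<notin> E ` Q0" by auto
    have "f (E q) \<in> carrier M" using E_Q0_carrier[OF q(1)] p by (simp add: permutes_in_image)
    then obtain b s where b: "b \<in> curves" "f (E q) = b s" using curves_cover q(2) unfolding Q0_def by blast
    then have e: "inv f (b s) = E q" using p by (metis permutes_inverses(2))
    then have "q = coord (1/2) (inv f (b s))" "s \<in> S b" using q(1) coord_Q0 by (auto simp: S_def)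
    then show "q \<in> (\<Union>b\<in>curves. (\<lambda>s. coord (1/2) (inv f (b s))) ` S b)" using b(1) by blast
  qed
  moreover have "negligible ((\<lambda>s. coord (1/2) (inv f (b s))) ` S b)" if b: "b \<in> curves" for b
  proof (rule negligible_differentiable_image_lowdim)
    show "(\<lambda>s. coord (1/2) (inv f (b s))) differentiable_on S b"
      unfolding differentiable_on_def
    proof
      fix s assume "s \<in> S b"
      then obtain q where q: "q \<in> Q0" "inv f (b s) = E q" by (auto simp: S_def)
      obtain D1 where D1: "(b has_derivative D1) (at s within S b)"
        using curves_differentiable[OF b, of s] by (meson differentiable_def has_derivative_at_withinI)
      obtain D2 where D2: "(inv f has_derivative D2) (at (b s) within carrier M)"
        using C1_on_imp_derivative[OF Symp1_C1_inv[OF f] curves_carrier[OF b]] by blast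
      obtain D3 where D3: "(coord (1/2) has_derivative D3) (at (inv f (b s)))"
        using C1_at_imp_derivative[OF coord_C1_Q0[OF q(1)]] q(2) by metis
      have "b ` S b \<subseteq> carrier M" using curves_carrier[OF b] by auto
      from has_derivative_in_compose[OF D1 has_derivative_subset[OF D2 this]]
      have "((\<lambda>s. inv f (b s)) has_derivative (\<lambda>h. D2 (D1 h))) (at s within S b)" .
      from has_derivative_compose[OF this D3]
      show "(\<lambda>s. coord (1/2) (inv f (b s))) differentiable at s within S b"
        by (rule differentiableI)
    qed
  qed simp
  then have "negligible (\<Union> ((\<lambda>b. (\<lambda>s. coord (1/2) (inv f (b s))) ` S b) ` curves))"
    by (intro negligible_countable_Union countable_image curves_countable) blast
  ultimately show ?thesis using negligible_subset by blast
qed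

text \<open>Read in coordinates, \<open>f\<close> is a map \<open>F\<close> with \<open>E \<circ> F = f \<circ> E\<close>. Differentiating this equation
and using that \<open>f\<close> preserves the form gives \<open>\<kappa> * det2 (F' u) (F' v) = \<kappa> * det2 u v\<close>.\<close>

lemma Symp1_coordinate_map:
  assumes f: "f \<in> Symp1 M"
  defines "S \<equiv> {p \<in> Q0. f (E p) \<in> E ` Q0}"
  defines "F \<equiv> \<lambda>p. coord (1/2) (f (E p))"
  shows "open S" and "\<And>p. p \<in> S \<Longrightarrow> F p \<in> Q0 \<and> E (F p) = f (E p)"
    and "\<And>p. p \<in> S \<Longrightarrow> \<exists>F'. (F has_derivative F') (at p) \<and> det2 (F' (1, 0)) (F' (0, 1)) = 1"
proof -
  have perm: "f permutes carrier M" using f Symp1_permutes by blast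
  have EQ: "E ` Q0 \<subseteq> carrier M" using E_Q0_carrier by blast
  have fc: "continuous_on (carrier M) f" using f Symp1_C1 C1_on_imp_continuous_on by blast
  obtain V where V: "open V" "E ` Q0 = carrier M \<inter> V" using E_Q0_relatively_open by blast
  have "continuous_on Q0 (f \<circ> E)"
    by (intro continuous_on_compose continuous_on_subset[OF E_cont] continuous_on_subset[OF fc] EQ) auto
  then have "open (Q0 \<inter> (f \<circ> E) -` V)" using open_Q0 V(1) by (simp add: continuous_open_preimage)
  moreover have "S = Q0 \<inter> (f \<circ> E) -` V"
    using V(2) perm E_Q0_carrier by (auto simp: S_def permutes_in_image)
  ultimately show oS: "open S" by simp
  show FE: "F p \<in> Q0 \<and> E (F p) = f (E p)" if "p \<in> S" for p
    using that coord_Q0 by (auto simp: S_def F_def)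
  fix p assume p: "p \<in> S"
  then have pQ: "p \<in> Q0" by (simp add: S_def)
  have sp: "\<bar>snd p\<bar> < 1" "\<bar>snd (F p)\<bar> < 1" using pQ FE[OF p] by (auto simp: Q0_def)
  obtain D where D: "(f has_derivative D) (at (E p) within carrier M)"
    "\<And>u v. u \<in> tangent M (E p) \<Longrightarrow> v \<in> tangent M (E p) \<Longrightarrow> omega M (f (E p)) (D u) (D v) = omega M (E p) u v"
    using Symp1_omega[OF f] E_Q0_carrier[OF pQ] unfolding preserves_omega_def by blast
  have "((\<lambda>q. f (E q)) has_derivative (\<lambda>u. D (E' p u))) (at p within Q0)"
    by (rule has_derivative_in_compose[OF has_derivative_at_withinI[OF E_deriv[OF sp(1)]] has_derivative_subset[OF D(1) EQ]])
  then have fE: "((\<lambda>q. f (E q)) has_derivative (\<lambda>u. D (E' p u))) (at p)"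
    using at_within_open[OF pQ open_Q0] by simp
  obtain C' where C': "(coord (1/2) has_derivative C') (at (f (E p)))"
    using C1_at_imp_derivative[OF coord_C1_Q0, of "F p"] FE[OF p] by metis
  have F': "(F has_derivative (\<lambda>u. C' (D (E' p u)))) (at p)"
    unfolding F_def by (rule has_derivative_compose[OF fE C'])
  let ?F' = "\<lambda>u. C' (D (E' p u))"
  have "((\<lambda>q. E (F q)) has_derivative (\<lambda>u. E' (F p) (?F' u))) (at p)"
    by (rule has_derivative_compose[OF F' E_deriv[OF sp(2)]])
  then have "((\<lambda>q. f (E q)) has_derivative (\<lambda>u. E' (F p) (?F' u))) (at p)"
    by (rule has_derivative_transform_within_open[OF _ oS p]) (use FE in auto)
  from has_derivative_unique[OF this fE] have eq: "E' (F p) (?F' u) = D (E' p u)" for u by metis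
  have "\<kappa> * det2 (?F' u) (?F' v) = \<kappa> * det2 u v" for u v
  proof -
    have "\<kappa> * det2 (?F' u) (?F' v) = omega M (E (F p)) (E' (F p) (?F' u)) (E' (F p) (?F' v))"
      by (rule omega_E[OF sp(2), symmetric])
    also have "\<dots> = omega M (f (E p)) (D (E' p u)) (D (E' p v))"
      using FE[OF p] by (simp only: eq)
    also have "\<dots> = omega M (E p) (E' p u) (E' p v)"
      by (rule D(2)) (simp_all add: tangent_E[OF sp(1)])
    finally show ?thesis by (simp only: omega_E[OF sp(1)])
  qed
  moreover have "det2 (1, 0) (0, 1) = 1" by (simp add: det2_def)
  ultimately have "\<kappa> * det2 (?F' (1, 0)) (?F' (0, 1)) = \<kappa> * 1" by metis
  then have "det2 (?F' (1, 0)) (?F' (0, 1)) = 1" using \<kappa>_nz by (simp only: mult_cancel_left simp_thms)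
  then show "\<exists>F'. (F has_derivative F') (at p) \<and> det2 (F' (1, 0)) (F' (0, 1)) = 1"
    using F' by blast
qed

text \<open>Injectivity of \<open>f\<close> in coordinates gives only an inequality, but it holds for all sets, hence also for
complements; \<open>Symp1_distr\<close> draws the conclusion.\<close>

lemma Symp1_emeasure_le:
  assumes f: "f \<in> Symp1 M" and A: "A \<in> sets borel"
  shows "emeasure (Leb M) (f -` A) \<le> emeasure (Leb M) A"
proof -
  define S where "S = {p \<in> Q0. f (E p) \<in> E ` Q0}"
  define F where "F = (\<lambda>p. coord (1/2) (f (E p)))"
  have FS: "open S" "\<And>p. p \<in> S \<Longrightarrow> F p \<in> Q0 \<and> E (F p) = f (E p)"
    "\<And>p. p \<in> S \<Longrightarrow> \<exists>F'. (F has_derivative F') (at p) \<and> det2 (F' (1, 0)) (F' (0, 1)) = 1"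
    unfolding S_def F_def by (fact Symp1_coordinate_map[OF f])+
  have fm: "f \<in> borel_measurable borel" using f Symp1_imp_Symp0 Symp0_measurable by blast
  have fA: "f -` A \<in> sets borel" using fm A by (rule measurable_sets_borel)
  have m: "Q0 \<inter> E -` (f -` A) \<in> sets borel" "Q0 \<inter> E -` A \<in> sets borel"
    using open_Q0 A fA E_measurable by (auto intro!: measurable_sets_borel sets.Int)
  have bQ: "bounded Q0" unfolding Q0_def by (intro bounded_Times) auto
  from FS(3) obtain F' where F': "\<And>p. p \<in> S \<Longrightarrow> (F has_derivative F' p) (at p)"
    "\<And>p. p \<in> S \<Longrightarrow> det2 (F' p (1, 0)) (F' p (0, 1)) = 1" by metis
  have inj: "inj_on F S"
  proof (rule inj_onI)
    fix p q assume pq: "p \<in> S" "q \<in> S" "F p = F q"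
    have "f (E p) = f (E q)" using FS(2)[OF pq(1)] FS(2)[OF pq(2)] pq(3) by simp
    then have "E p = E q" by (rule injD[OF permutes_inj[OF Symp1_permutes[OF f]]])
    moreover have "p \<in> Q0" "q \<in> Q0" using pq(1,2) unfolding S_def by blast+
    ultimately show "p = q" using coord_Q0[of p] coord_Q0[of q] by metis
  qed
  let ?S = "S \<inter> E -` (f -` A)"
  have Ss: "?S \<in> sets borel" "S \<in> sets borel"
    using FS(1) fA E_measurable by (auto intro!: measurable_sets_borel sets.Int)
  have "emeasure lborel ?S \<le> emeasure lborel (Q0 \<inter> E -` A)"
    by (rule emeasure_image_det2[where F=F and F'=F'])
      (use Ss m F' FS(2) inj in \<open>auto intro: inj_on_subset bounded_subset[OF bQ] simp: S_def\<close>)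
  moreover have "Q0 - S \<in> null_sets lborel"
  proof -
    have "Q0 - S = {p \<in> Q0. f (E p) \<notin> E ` Q0}" by (auto simp: S_def)
    then have "negligible (Q0 - S)" using Symp1_null[OF f] by simp
    moreover have "Q0 - S \<in> sets borel" using Ss open_Q0 by auto
    ultimately show ?thesis by (simp add: negligible_iff_null_sets null_sets_def)
  qed
  then have "emeasure lborel (Q0 \<inter> E -` (f -` A)) \<le> emeasure lborel ?S"
  proof -
    assume n: "Q0 - S \<in> null_sets lborel"
    have "emeasure lborel (Q0 \<inter> E -` (f -` A)) \<le> emeasure lborel (?S \<union> (Q0 - S))"
      using Ss open_Q0 by (intro emeasure_mono) (auto simp: S_def)
    also have "\<dots> = emeasure lborel ?S" using Ss n by (intro emeasure_Un_null_set) auto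
    finally show ?thesis .
  qed
  ultimately show ?thesis
    unfolding emeasure_Leb_Q0[OF A] emeasure_Leb_Q0[OF fA] by (intro divide_right_mono_ennreal) (rule order_trans)
qed

lemma Symp1_distr:
  assumes f: "f \<in> Symp1 M"
  shows "distr (Leb M) (Leb M) f = Leb M"
proof (rule measure_eqI)
  interpret prob_space "Leb M" by (rule prob_Leb)
  have fm: "f \<in> borel_measurable borel" using f Symp1_imp_Symp0 Symp0_measurable by blast
  fix A assume "A \<in> sets (distr (Leb M) (Leb M) f)"
  then have A: "A \<in> sets borel" by simp
  then have fA: "f -` A \<in> sets borel" using fm by (intro measurable_sets_borel)
  have le: "prob (f -` B) \<le> prob B" if "B \<in> sets borel" for B
    using Symp1_emeasure_le[OF f that] by (simp add: emeasure_eq_measure)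
  have "prob (f -` A) = prob A"
    using le[OF A] le[of "- A"] prob_compl[of A] prob_compl[of "f -` A"] A fA
    by (auto simp: Compl_eq_Diff_UNIV vimage_Diff)
  then show "emeasure (distr (Leb M) (Leb M) f) A = emeasure (Leb M) A"
    using A fm by (subst emeasure_distr) (auto simp: emeasure_eq_measure)
qed simp

text \<open>A uniform limit of maps preserving the measure preserves integrals of bounded continuous functions, by
dominated convergence. Indicators of closed sets are decreasing limits of such functions.\<close>

lemma Symp0_distr:
  assumes f: "f \<in> Symp0 M"
  shows "distr (Leb M) (Leb M) f = Leb M"
proof -
  interpret prob_space "Leb M" by (rule prob_Leb)
  have fm: "f \<in> borel_measurable borel" using f Symp0_measurable by blast
  have "\<exists>g. g \<in> Symp1 M \<and> (\<forall>x\<in>carrier M. dist (f x) (g x) < 1 / Suc n)" for n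
    using Symp0_approx[OF f, of "1 / Suc n"] by (metis of_nat_0_less_iff zero_less_Suc zero_less_divide_1_iff)
  then obtain g where g: "\<And>n. g n \<in> Symp1 M" "\<And>n x. x \<in> carrier M \<Longrightarrow> dist (f x) (g n x) < 1 / Suc n"
    by metis
  have gm: "g n \<in> borel_measurable borel" for n
    using g(1) Symp1_imp_Symp0 Symp0_measurable by blast
  have lim: "(\<lambda>n. g n x) \<longlonglongrightarrow> f x" for x
  proof (cases "x \<in> carrier M")
    case True
    have "(\<lambda>n. dist (g n x) (f x)) \<longlonglongrightarrow> 0"
      by (rule tendsto_sandwich[OF _ _ tendsto_const LIMSEQ_Suc[OF lim_1_over_n]])
        (use g(2)[OF True] in \<open>auto simp: dist_commute less_imp_le intro!: always_eventually\<close>)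
    then show ?thesis by (rule tendsto_dist_iff[THEN iffD2])
  next
    case False
    then show ?thesis
      using permutes_not_in[OF Symp0_permutes[OF f]] permutes_not_in[OF Symp1_permutes[OF g(1)]] by simp
  qed
  have int: "(\<integral>x. \<phi> (f x) \<partial>Leb M) = (\<integral>x. \<phi> x \<partial>Leb M)"
    if c: "continuous_on UNIV \<phi>" and b: "\<And>x. \<bar>\<phi> x\<bar> \<le> 1" for \<phi> :: "'a \<Rightarrow> real"
  proof -
    have pm: "\<phi> \<in> borel_measurable borel" using c by (rule borel_measurable_continuous_onI)
    have "(\<lambda>n. \<integral>x. \<phi> (g n x) \<partial>Leb M) \<longlonglongrightarrow> (\<integral>x. \<phi> (f x) \<partial>Leb M)"
    proof (rule integral_dominated_convergence[where w="\<lambda>_. 1"])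
      show "AE x in Leb M. (\<lambda>n. \<phi> (g n x)) \<longlonglongrightarrow> \<phi> (f x)"
        using c lim by (intro AE_I2) (auto intro: continuous_on_tendsto_compose)
    qed (use pm fm gm b in \<open>auto intro: measurable_compose\<close>)
    moreover have "(\<integral>x. \<phi> (g n x) \<partial>Leb M) = (\<integral>x. \<phi> x \<partial>Leb M)" for n
      using integral_distr[of "g n" "Leb M" "Leb M" \<phi>] Symp1_distr[OF g(1)] gm pm by simp
    ultimately have "(\<lambda>n. \<integral>x. \<phi> x \<partial>Leb M) \<longlonglongrightarrow> (\<integral>x. \<phi> (f x) \<partial>Leb M)" by (simp only:)
    then show ?thesis by (simp only: LIMSEQ_const_iff)
  qed
  have closed: "prob (f -` C) = prob C" if C: "closed C" "C \<noteq> {}" for C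
  proof -
    define \<phi> where "\<phi> n x = max 0 (1 - real n * infdist x C)" for n x
    have c: "continuous_on UNIV (\<phi> n)" for n unfolding \<phi>_def by (intro continuous_intros)
    have b: "\<bar>\<phi> n x\<bar> \<le> 1" for n x by (auto simp: \<phi>_def infdist_nonneg)
    have pm: "\<phi> n \<in> borel_measurable borel" for n using c by (rule borel_measurable_continuous_onI)
    have l: "(\<lambda>n. \<phi> n x) \<longlonglongrightarrow> indicator C x" for x
    proof (cases "x \<in> C")
      case True then show ?thesis by (simp add: \<phi>_def)
    next
      case False
      then have i: "infdist x C > 0"
        using C by (metis in_closed_iff_infdist_zero infdist_nonneg less_le)
      obtain N where N: "real N > 1 / infdist x C" using reals_Archimedean2 by blast
      have "\<phi> n x = 0" if "n \<ge> N" for n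
      proof -
        have "real n > 1 / infdist x C" using N that by linarith
        then have "1 < real n * infdist x C" using i by (simp add: field_simps)
        then show ?thesis by (simp add: \<phi>_def)
      qed
      then have "eventually (\<lambda>n. \<phi> n x = 0) sequentially" by (auto simp: eventually_sequentially)
      then show ?thesis using False by (simp add: tendsto_eventually)
    qed
    have Cm: "C \<in> sets borel" using C by simp
    have 1: "(\<lambda>n. \<integral>x. \<phi> n x \<partial>Leb M) \<longlonglongrightarrow> (\<integral>x. indicator C x \<partial>Leb M)"
      by (rule integral_dominated_convergence[where w="\<lambda>_. 1"]) (use pm l b Cm in auto)
    have 2: "(\<lambda>n. \<integral>x. \<phi> n (f x) \<partial>Leb M) \<longlonglongrightarrow> (\<integral>x. indicator C (f x) \<partial>Leb M)"
      by (rule integral_dominated_convergence[where w="\<lambda>_. 1"]) (use pm l b fm Cm in \<open>auto intro: measurable_compose\<close>)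
    have "(\<integral>x. indicator C (f x) \<partial>Leb M) = (\<integral>x. indicator C x \<partial>Leb M :: real)"
      using LIMSEQ_unique[OF 1] 2 int[OF c b] by simp
    moreover have "(\<lambda>x. indicator C (f x)) = (indicator (f -` C) :: 'a \<Rightarrow> real)" by (auto simp: indicator_def)
    ultimately show ?thesis by simp
  qed
  have fin: "emeasure (distr (Leb M) (Leb M) f) UNIV \<noteq> \<infinity>"
    using fm by (subst emeasure_distr) (auto simp: emeasure_eq_measure)
  show ?thesis
  proof (rule measure_eqI_generator_eq[where E="Collect closed" and \<Omega>=UNIV and A="\<lambda>_. UNIV"])
    fix X :: "'a set" assume "X \<in> Collect closed"
    then have X: "closed X" by simp
    show "emeasure (distr (Leb M) (Leb M) f) X = emeasure (Leb M) X"
      using X closed[OF X] fm by (subst emeasure_distr) (cases "X = {}"; auto simp: emeasure_eq_measure)+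
  qed (use fin in \<open>auto simp: Int_stable_def borel_eq_closed\<close>)
qed

end

section \<open>Averages over circles\<close>

text \<open>The normalised measures on a period of the angle and on the heights. The end points are those of the
coordinates used for \<open>Leb\<close>.\<close>

definition circ :: "real measure" where "circ = uniform_measure lborel {0..<1}"
definition seg :: "real measure" where "seg = uniform_measure lborel {-1<..<1}"

lemma sets_circ [simp, measurable_cong]: "sets circ = sets borel"
  and sets_seg [simp, measurable_cong]: "sets seg = sets borel"
  by (simp_all add: circ_def seg_def)

lemma space_circ [simp]: "space circ = UNIV" and space_seg [simp]: "space seg = UNIV"
  by (simp_all add: circ_def seg_def)

interpretation circ: prob_space circ
  unfolding circ_def by (rule prob_space_uniform_measure) auto

interpretation seg: prob_space seg
  unfolding seg_def by (rule prob_space_uniform_measure) auto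

interpretation cs: pair_prob_space circ seg ..

lemma AE_circ: "AE t in circ. 0 \<le> t \<and> t < 1"
  unfolding circ_def by (rule AE_uniform_measureI) auto

lemma AE_seg: "AE y in seg. \<bar>y\<bar> < 1"
  unfolding seg_def by (rule AE_uniform_measureI) auto

lemma circ_density: "circ = density lborel (\<lambda>t. ennreal (indicator {0..<1} t))"
  unfolding circ_def uniform_measure_def by (intro density_cong) (auto split: split_indicator)

lemma seg_density: "seg = density lborel (\<lambda>t. ennreal (indicator {-1<..<1} t / 2))"
  unfolding seg_def uniform_measure_def
  by (intro density_cong) (auto split: split_indicator simp: divide_ennreal[symmetric])

lemma integral_circ:
  fixes f :: "real \<Rightarrow> real" assumes [measurable]: "f \<in> borel_measurable borel"
  shows "(\<integral>t. f t \<partial>circ) = (\<integral>t. indicator {0..<1} t * f t \<partial>lborel)"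
  unfolding circ_density
  using integral_density[of f lborel "\<lambda>t. indicator {0..<1} t"] by simp

lemma integral_seg:
  fixes f :: "real \<Rightarrow> real" assumes [measurable]: "f \<in> borel_measurable borel"
  shows "(\<integral>t. f t \<partial>seg) = (\<integral>t. indicator {-1<..<1} t / 2 * f t \<partial>lborel)"
  unfolding seg_density
  using integral_density[of f lborel "\<lambda>t. indicator {-1<..<1} t / 2"] by simp

lemma integral_circ_seg:
  fixes f :: "real \<Rightarrow> real" assumes [measurable]: "f \<in> borel_measurable borel"
  shows "(\<integral>t. f (2 * t - 1) \<partial>circ) = (\<integral>y. f y \<partial>seg)"
proof -
  have "(\<integral>y. f y \<partial>seg) = (\<integral>y. indicator {-1..<1} y / 2 * f y \<partial>lborel)"
    unfolding integral_seg[OF assms]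
  proof (rule integral_cong_AE)
    show "AE y in lborel. indicator {-1<..<1} y / 2 * f y = indicator {-1..<1} y / 2 * f y"
      using AE_lborel_singleton[of "-1::real"] by eventually_elim (auto split: split_indicator)
  qed simp_all
  also have "\<dots> = \<bar>2\<bar> *\<^sub>R (\<integral>x. indicator {-1..<1} (-1 + 2 * x) / 2 * f (-1 + 2 * x) \<partial>lborel)"
    by (rule lborel_integral_real_affine) simp
  also have "\<dots> = (\<integral>x. 2 * (indicator {-1..<1} (-1 + 2 * x) / 2 * f (-1 + 2 * x)) \<partial>lborel)" by simp
  also have "\<dots> = (\<integral>t. indicator {0..<1} t * f (2 * t - 1) \<partial>lborel)"
    by (intro Bochner_Integration.integral_cong) (auto split: split_indicator simp: field_simps)
  also have "\<dots> = (\<integral>t. f (2 * t - 1) \<partial>circ)" by (rule integral_circ[symmetric]) simp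
  finally show ?thesis ..
qed

lemma circ_bounded_integrable:
  fixes f :: "real \<Rightarrow> real"
  assumes "f \<in> borel_measurable borel" "\<And>t. 0 \<le> t \<Longrightarrow> t < 1 \<Longrightarrow> \<bar>f t\<bar> \<le> B"
  shows "integrable circ f"
proof (rule circ.integrable_const_bound[of _ B])
  show "AE t in circ. norm (f t) \<le> B" using AE_circ by eventually_elim (use assms(2) in simp)
qed (use assms in simp)

lemma seg_bounded_integrable:
  fixes f :: "real \<Rightarrow> real"
  assumes "f \<in> borel_measurable borel" "\<And>y. \<bar>y\<bar> < 1 \<Longrightarrow> \<bar>f y\<bar> \<le> B"
  shows "integrable seg f"
proof (rule seg.integrable_const_bound[of _ B])
  show "AE t in seg. norm (f t) \<le> B" using AE_seg by eventually_elim (use assms(2) in simp)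
qed (use assms in simp)

lemma circ_abs_integral_le:
  fixes f :: "real \<Rightarrow> real"
  assumes "f \<in> borel_measurable borel" "\<And>t. 0 \<le> t \<Longrightarrow> t < 1 \<Longrightarrow> \<bar>f t\<bar> \<le> B"
  shows "\<bar>\<integral>t. f t \<partial>circ\<bar> \<le> B"
proof -
  have i: "integrable circ f" using circ_bounded_integrable assms by blast
  have "\<bar>\<integral>t. f t \<partial>circ\<bar> \<le> (\<integral>t. \<bar>f t\<bar> \<partial>circ)" by (rule integral_abs_bound)
  also have "\<dots> \<le> (\<integral>t. B \<partial>circ)"
  proof (rule integral_mono_AE)
    show "AE t in circ. \<bar>f t\<bar> \<le> B" using AE_circ by eventually_elim (use assms(2) in simp)
  qed (use i in simp_all)
  finally show ?thesis by (simp add: circ.prob_space[simplified])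
qed

lemma integral_cs:
  fixes f :: "real \<times> real \<Rightarrow> real"
  assumes [measurable]: "f \<in> borel_measurable borel"
    and b: "\<And>t y. 0 \<le> t \<Longrightarrow> t < 1 \<Longrightarrow> \<bar>y\<bar> < 1 \<Longrightarrow> \<bar>f (t, y)\<bar> \<le> B"
  shows "integrable (circ \<Otimes>\<^sub>M seg) f"
    "(\<integral>p. f p \<partial>(circ \<Otimes>\<^sub>M seg)) = (\<integral>y. (\<integral>t. f (t, y) \<partial>circ) \<partial>seg)"
proof -
  have [measurable]: "f \<in> borel_measurable (circ \<Otimes>\<^sub>M seg)"
    using assms(1) by (simp add: borel_prod[symmetric] cong: measurable_cong_sets sets_pair_measure_cong)
  have m: "{p \<in> space (circ \<Otimes>\<^sub>M seg). \<bar>f p\<bar> \<le> B} \<in> sets (circ \<Otimes>\<^sub>M seg)" by measurable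
  have "AE t in circ. AE y in seg. \<bar>f (t, y)\<bar> \<le> B"
    using AE_circ by eventually_elim (use AE_seg b in \<open>auto elim!: eventually_mono\<close>)
  then have "AE p in circ \<Otimes>\<^sub>M seg. \<bar>f p\<bar> \<le> B"
    by (rule cs.AE_pair_measure[OF m])
  then show i: "integrable (circ \<Otimes>\<^sub>M seg) f"
    by (intro cs.integrable_const_bound[of _ B]) auto
  show "(\<integral>p. f p \<partial>(circ \<Otimes>\<^sub>M seg)) = (\<integral>y. (\<integral>t. f (t, y) \<partial>circ) \<partial>seg)"
    using cs.integral_snd[of "\<lambda>t y. f (t, y)"] i by simp
qed

lemma circ_average_measurable:
  fixes f :: "real \<times> real \<Rightarrow> real"
  assumes [measurable]: "f \<in> borel_measurable borel"
  shows "(\<lambda>y. \<integral>t. f (t, y) \<partial>circ) \<in> borel_measurable borel"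
proof -
  have "f \<in> borel_measurable (circ \<Otimes>\<^sub>M seg)"
    using assms(1) by (simp add: borel_prod[symmetric] cong: measurable_cong_sets sets_pair_measure_cong)
  then have "(\<lambda>(y, t). f (t, y)) \<in> borel_measurable (seg \<Otimes>\<^sub>M circ)"
    by (subst measurable_pair_swap_iff) (simp add: case_prod_beta')
  from circ.borel_measurable_lebesgue_integral[OF this] show ?thesis
    by (simp cong: measurable_cong_sets)
qed

text \<open>The average over a period equals the average over one cell of the sums over corresponding points of all
\<open>N\<close> cells.\<close>

lemma circ_average_cells:
  fixes f :: "real \<Rightarrow> real"
  assumes [measurable]: "f \<in> borel_measurable borel"
    and b: "\<And>t. 0 \<le> t \<Longrightarrow> t < 1 \<Longrightarrow> \<bar>f t\<bar> \<le> B" and N: "N > 0"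
  shows "(\<integral>t. f t \<partial>circ) = (\<integral>s. (1 / real N) * (\<Sum>j<N. f ((real j + s) / real N)) \<partial>circ)"
proof -
  let ?I = "\<lambda>j. {real j / N..<(real j + 1) / N}"
  have ind: "(indicator {0..<1} t :: real) = (\<Sum>j<N. indicator (?I j) t)" for t :: real
  proof (cases "0 \<le> t \<and> t < 1")
    case True
    define k where "k = nat \<lfloor>t * N\<rfloor>"
    have k: "real k \<le> t * N" "t * N < real k + 1" using True N by (auto simp: k_def)
    have kN: "k < N"
    proof -
      have "t * N < N" using True N by simp
      then show ?thesis using k(1) by linarith
    qed
    have "(\<Sum>j<N. indicator (?I j) t :: real) = (\<Sum>j<N. if j = k then 1 else 0)"
    proof (intro sum.cong refl)
      fix j
      have "t \<in> ?I j \<longleftrightarrow> real j \<le> t * N \<and> t * N < real j + 1" using N by (auto simp: field_simps)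
      also have "\<dots> \<longleftrightarrow> j = k" using k by linarith
      finally show "(indicator (?I j) t :: real) = (if j = k then 1 else 0)" by (simp add: indicator_def)
    qed
    then show ?thesis using True kN by simp
  next
    case False
    have "t \<notin> ?I j" if "j < N" for j
    proof
      assume a: "t \<in> ?I j"
      have "0 \<le> real j / N" by simp
      then have "0 \<le> t" using a by (meson atLeastLessThan_iff order_trans)
      moreover have "(real j + 1) / N \<le> 1" using that N by simp
      then have "t < 1" using a by (meson atLeastLessThan_iff less_le_trans)
      ultimately show False using False by simp
    qed
    then have "(\<Sum>j<N. indicator (?I j) t :: real) = 0" by (intro sum.neutral) auto
    then show ?thesis using False by simp
  qed
  have cell: "(\<integral>t. indicator (?I j) t * f t \<partial>lborel) = (1 / N) * (\<integral>s. f ((real j + s) / N) \<partial>circ)" for j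
  proof -
    have "(\<integral>t. indicator (?I j) t * f t \<partial>lborel) = \<bar>1 / N\<bar> *\<^sub>R (\<integral>s. indicator (?I j) (j / N + (1 / N) * s) * f (j / N + (1 / N) * s) \<partial>lborel)"
      using N by (intro lborel_integral_real_affine) simp
    also have "(\<integral>s. indicator (?I j) (j / N + (1 / N) * s) * f (j / N + (1 / N) * s) \<partial>lborel) = (\<integral>s. indicator {0..<1} s * f ((real j + s) / N) \<partial>lborel)"
      using N by (intro Bochner_Integration.integral_cong) (auto split: split_indicator simp: field_simps)
    also have "\<dots> = (\<integral>s. f ((real j + s) / N) \<partial>circ)" by (rule integral_circ[symmetric]) simp
    finally show ?thesis by simp
  qed
  have sub: "\<bar>f ((real j + s) / N)\<bar> \<le> B" if "j < N" "0 \<le> s" "s < 1" for j s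
  proof (rule b)
    have "real j + s < N" using that by linarith
    then show "(real j + s) / N < 1" using N by simp
  qed (use that in simp)
  have int: "integrable lborel (\<lambda>t. indicator (?I j) t * f t)" if "j < N" for j
  proof (rule integrableI_bounded_set_indicator[where B=B, of "?I j" lborel f, simplified])
    have "AE x in lborel. x \<in> ?I j \<longrightarrow> norm (f x) \<le> B"
    proof (intro AE_I2 impI)
      fix x assume x: "x \<in> ?I j"
      then have "x = (real j + (x * N - j)) / N" using N by simp
      moreover have "0 \<le> x * N - j" "x * N - j < 1" using x N by (auto simp: field_simps)
      ultimately show "norm (f x) \<le> B" using sub[OF that, of "x * N - j"] by simp
    qed
    then show "AE x in lborel. real j / N \<le> x \<and> x < (real j + 1) / N \<longrightarrow> \<bar>f x\<bar> \<le> B" by simp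
    show "emeasure lborel (?I j) < top" using N by (simp add: divide_right_mono)
  qed
  have "(\<integral>t. f t \<partial>circ) = (\<integral>t. (\<Sum>j<N. indicator (?I j) t * f t) \<partial>lborel)"
    unfolding integral_circ[OF assms(1)] ind sum_distrib_right ..
  also have "\<dots> = (\<Sum>j<N. \<integral>t. indicator (?I j) t * f t \<partial>lborel)"
    by (rule Bochner_Integration.integral_sum) (use int in auto)
  also have "\<dots> = (\<Sum>j<N. \<integral>s. (1 / N) * f ((real j + s) / N) \<partial>circ)"
    unfolding cell by simp
  also have "\<dots> = (\<integral>s. (\<Sum>j<N. (1 / N) * f ((real j + s) / N)) \<partial>circ)"
    by (rule Bochner_Integration.integral_sum[symmetric])
      (use sub N in \<open>auto intro!: integrable_mult_right circ_bounded_integrable[where B="B / N"] divide_right_mono\<close>)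
  finally show ?thesis by (simp add: sum_distrib_left)
qed

text \<open>By \<open>circ_average_cells\<close> the integral is an average of Riemann sums, and two Riemann sums for the same
partition differ by at most the oscillation on a cell.\<close>

lemma circ_average_riemann:
  fixes f :: "real \<Rightarrow> real"
  assumes [measurable]: "f \<in> borel_measurable borel"
    and b: "\<And>t. 0 \<le> t \<Longrightarrow> t < 1 \<Longrightarrow> \<bar>f t\<bar> \<le> B" and N: "N > 0"
    and mod: "\<And>t t'. t \<in> {0..1} \<Longrightarrow> t' \<in> {0..1} \<Longrightarrow> \<bar>t - t'\<bar> \<le> 1 / real N \<Longrightarrow> \<bar>f t - f t'\<bar> \<le> \<epsilon>"
    and r: "\<And>j. j < N \<Longrightarrow> r j \<in> {real j / real N..(real j + 1) / real N}"
  shows "\<bar>(1 / real N) * (\<Sum>j<N. f (r j)) - (\<integral>t. f t \<partial>circ)\<bar> \<le> \<epsilon>"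
proof -
  let ?g = "\<lambda>s. (1 / real N) * (\<Sum>j<N. f (r j)) - (1 / real N) * (\<Sum>j<N. f ((real j + s) / real N))"
  have le1: "(real j + 1) / N \<le> 1" if "j < N" for j using that N by simp
  have rb: "\<bar>f (r j) - f ((real j + s) / N)\<bar> \<le> \<epsilon>" if "j < N" "0 \<le> s" "s < 1" for j s
  proof (rule mod)
    have j0: "0 \<le> real j / N" by simp
    show "r j \<in> {0..1}" using r[OF that(1)] le1[OF that(1)] j0 by (meson atLeastAtMost_iff order_trans)
    have c: "real j / N \<le> (real j + s) / N" "(real j + s) / N \<le> (real j + 1) / N"
      using that N by (simp_all add: divide_right_mono)
    then show "(real j + s) / N \<in> {0..1}" using le1[OF that(1)] j0 by (meson atLeastAtMost_iff order_trans)
    have "(real j + 1) / N = real j / N + 1 / N" by (simp add: add_divide_distrib)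
    then show "\<bar>r j - (real j + s) / N\<bar> \<le> 1 / N" using c r[OF that(1)] by (simp add: abs_le_iff)
  qed
  have gb: "\<bar>?g s\<bar> \<le> \<epsilon>" if "0 \<le> s" "s < 1" for s
  proof -
    have "\<bar>?g s\<bar> = (1 / N) * \<bar>\<Sum>j<N. f (r j) - f ((real j + s) / N)\<bar>"
      by (simp add: sum_subtractf diff_divide_distrib[symmetric])
    also have "\<dots> \<le> (1 / N) * (\<Sum>j<N. \<epsilon>)"
      using rb[OF _ that] by (intro mult_left_mono order_trans[OF sum_abs] sum_mono) auto
    finally show ?thesis using N by simp
  qed
  have "\<bar>(1 / N) * (\<Sum>j<N. f ((real j + s) / N))\<bar> \<le> \<epsilon> + \<bar>(1 / real N) * (\<Sum>j<N. f (r j))\<bar>" if "0 \<le> s" "s < 1" for s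
    using gb[OF that] by linarith
  then have "integrable circ (\<lambda>s. (1 / N) * (\<Sum>j<N. f ((real j + s) / N)))"
    by (intro circ_bounded_integrable) auto
  then have "(\<integral>s. ?g s \<partial>circ) = (1 / real N) * (\<Sum>j<N. f (r j)) - (\<integral>t. f t \<partial>circ)"
    using circ_average_cells[OF assms(1-3)]
    by (subst Bochner_Integration.integral_diff) (auto simp: circ.prob_space[simplified])
  moreover have "\<bar>\<integral>s. ?g s \<partial>circ\<bar> \<le> \<epsilon>" by (rule circ_abs_integral_le) (use gb in auto)
  ultimately show ?thesis by simp
qed

context circle_surface begin

text \<open>So integrals for \<open>Leb\<close> are iterated integrals: averages over heights of averages over circles.\<close>

lemma Leb_eq: "Leb M = distr (circ \<Otimes>\<^sub>M seg) borel E"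
proof (rule measure_eqI)
  fix A assume "A \<in> sets (Leb M)"
  then have A: "A \<in> sets borel" by simp
  let ?Q = "{0..<1} \<times> {-1<..<1} :: (real \<times> real) set"
  have EA [measurable]: "E -` A \<in> sets borel" using measurable_sets_borel[OF E_measurable A] .
  have Em: "E \<in> measurable (circ \<Otimes>\<^sub>M seg) borel"
    using E_measurable by (simp add: borel_prod[symmetric] cong: measurable_cong_sets sets_pair_measure_cong)
  have Qm [measurable]: "?Q \<in> sets borel" by (simp add: borel_Times)
  have "sigma_finite_measure (density lborel (\<lambda>t::real. ennreal (indicator {-1<..<1} t / 2)))"
    using seg.sigma_finite_measure_axioms unfolding seg_density .
  then have "circ \<Otimes>\<^sub>M seg = density (lborel \<Otimes>\<^sub>M lborel) (\<lambda>(x, y). ennreal (indicator {0..<1} x) * ennreal (indicator {-1<..<1} y / 2))"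
    unfolding circ_density seg_density
    by (intro pair_measure_density sigma_finite_lborel) auto
  also have "\<dots> = density lborel (\<lambda>p. indicator ?Q p / 2)"
    unfolding lborel_prod
    by (intro arg_cong[where f="density lborel"])
      (auto simp: fun_eq_iff divide_ennreal[symmetric] split: split_indicator)
  finally have "emeasure (distr (circ \<Otimes>\<^sub>M seg) borel E) A = emeasure (density lborel (\<lambda>p. indicator ?Q p / 2)) (E -` A)"
    using A Em by (subst emeasure_distr) (auto simp: space_pair_measure)
  also have "\<dots> = (\<integral>\<^sup>+p. indicator (?Q \<inter> E -` A) p / 2 \<partial>lborel)"
    by (subst emeasure_density) (auto intro!: nn_integral_cong split: split_indicator)
  also have "\<dots> = emeasure lborel (?Q \<inter> E -` A) / 2"
    by (subst nn_integral_divide) auto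
  finally show "emeasure (Leb M) A = emeasure (distr (circ \<Otimes>\<^sub>M seg) borel E) A"
    using emeasure_Leb[OF A] by simp
qed simp

lemma integral_Leb:
  fixes \<phi> :: "'a \<Rightarrow> real"
  assumes [measurable]: "\<phi> \<in> borel_measurable borel" and b: "\<And>x. x \<in> carrier M \<Longrightarrow> \<bar>\<phi> x\<bar> \<le> B"
  shows "integrable (Leb M) \<phi>" "(\<integral>x. \<phi> x \<partial>Leb M) = (\<integral>y. (\<integral>t. \<phi> (E (t, y)) \<partial>circ) \<partial>seg)"
proof -
  have Em: "E \<in> measurable (circ \<Otimes>\<^sub>M seg) borel"
    using E_measurable by (simp add: borel_prod[symmetric] cong: measurable_cong_sets sets_pair_measure_cong)
  have m: "(\<lambda>p. \<phi> (E p)) \<in> borel_measurable borel" using E_measurable by measurable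
  have b': "\<bar>\<phi> (E (t, y))\<bar> \<le> B" if "0 \<le> t" "t < 1" "\<bar>y\<bar> < 1" for t y
    using b E_carrier[of y t] that by simp
  note i = integral_cs[OF m b']
  show "integrable (Leb M) \<phi>" using i(1) Em by (simp add: Leb_eq integrable_distr_eq)
  show "(\<integral>x. \<phi> x \<partial>Leb M) = (\<integral>y. (\<integral>t. \<phi> (E (t, y)) \<partial>circ) \<partial>seg)"
    using i(2) Em by (simp add: Leb_eq integral_distr)
qed

end

section \<open>Twist maps\<close>

text \<open>A \<open>C\<^sup>1\<close> function that vanishes on the negative half-line; combinations of its translates give an
elementary \<open>C\<^sup>1\<close> step.\<close>

definition bend :: "real \<Rightarrow> real" where "bend x = x * max 0 x"

lemma bend_deriv: "(bend has_real_derivative 2 * max 0 x) (at x)"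
proof (cases x "0 :: real" rule: linorder_cases)
  case less
  have "((\<lambda>_. 0 :: real) has_real_derivative 2 * max 0 x) (at x)" using less by simp
  then show ?thesis
    by (rule has_field_derivative_transform_within_open[of _ _ _ "{..<0}"]) (use less in \<open>auto simp: bend_def\<close>)
next
  case equal
  have "((\<lambda>h. bend (0 + h) / h) \<longlongrightarrow> 0) (at 0)"
  proof (rule Lim_null_comparison[where g="\<lambda>h. \<bar>h\<bar>"])
    show "\<forall>\<^sub>F h in at 0. norm (bend (0 + h) / h) \<le> \<bar>h :: real\<bar>"
    proof (rule always_eventually, rule allI)
      fix h :: real show "norm (bend (0 + h) / h) \<le> \<bar>h\<bar>" by (cases "h = 0") (auto simp: bend_def)
    qed
    show "((\<lambda>h::real. \<bar>h\<bar>) \<longlongrightarrow> 0) (at 0)" using tendsto_rabs_zero[OF tendsto_ident_at] by blast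
  qed
  then show ?thesis using equal by (simp add: DERIV_def bend_def)
next
  case greater
  have "((\<lambda>y. y * y) has_real_derivative 2 * max 0 x) (at x)"
    using greater by (auto intro!: derivative_eq_intros)
  then show ?thesis
    by (rule has_field_derivative_transform_within_open[of _ _ _ "{0<..}"]) (use greater in \<open>auto simp: bend_def\<close>)
qed

definition step :: "real \<Rightarrow> real" where
  "step x = 2 * bend x - 4 * bend (x - 1/2) + 2 * bend (x - 1)"

lemma step_0: "x \<le> 0 \<Longrightarrow> step x = 0" and step_1: "x \<ge> 1 \<Longrightarrow> step x = 1"
  by (auto simp: step_def bend_def algebra_simps)

definition step' :: "real \<Rightarrow> real" where
  "step' x = 4 * max 0 x - 8 * max 0 (x - 1/2) + 4 * max 0 (x - 1)"

lemma step_deriv: "(step has_real_derivative step' x) (at x)"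
  unfolding step_def[abs_def] step'_def
  by (rule derivative_eq_intros DERIV_chain2[OF bend_deriv] refl)+ simp

text \<open>The angle of rotation as a function of the squared radius: a quarter turn up to \<open>1 - d\<close>, and none from \<open>1
- d/2\<close> on.\<close>

definition quarter :: "real \<Rightarrow> real \<Rightarrow> real" where
  "quarter d s = pi / 2 * step ((1 - d / 2 - s) / (d / 2))"

definition quarter' :: "real \<Rightarrow> real \<Rightarrow> real" where
  "quarter' d s = - (pi / 2) * (step' ((1 - d / 2 - s) / (d / 2)) / (d / 2))"

lemma quarter_deriv: "d > 0 \<Longrightarrow> (quarter d has_real_derivative quarter' d s) (at s)"
  unfolding quarter_def[abs_def] quarter'_def
  by (rule derivative_eq_intros DERIV_chain2[OF step_deriv] refl | simp)+

lemma quarter'_cont: "continuous_on UNIV (quarter' d)"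
proof (cases "d = 0")
  case True then show ?thesis by (simp add: quarter'_def[abs_def])
next
  case False
  then show ?thesis unfolding quarter'_def[abs_def] step'_def by (intro continuous_intros) auto
qed

lemma quarter_outside: "d > 0 \<Longrightarrow> s \<ge> 1 - d / 2 \<Longrightarrow> quarter d s = 0"
  unfolding quarter_def by (subst step_0) (auto simp: divide_nonpos_pos)

lemma quarter_inside: "d > 0 \<Longrightarrow> s \<le> 1 - d \<Longrightarrow> quarter d s = pi / 2"
  unfolding quarter_def by (subst step_1) (auto simp: field_simps)

text \<open>Rotation of each circle centred at the origin by an angle depending on its squared radius.\<close>

definition twist :: "(real \<Rightarrow> real) \<Rightarrow> real \<times> real \<Rightarrow> real \<times> real" where
  "twist a p = (let s = a ((fst p)\<^sup>2 + (snd p)\<^sup>2) in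
     (cos s * fst p - sin s * snd p, sin s * fst p + cos s * snd p))"

lemma twist_norm: "(fst (twist a p))\<^sup>2 + (snd (twist a p))\<^sup>2 = (fst p)\<^sup>2 + (snd p)\<^sup>2"
proof -
  have "(c * x - s * y)\<^sup>2 + (s * x + c * y)\<^sup>2 = (c\<^sup>2 + s\<^sup>2) * (x\<^sup>2 + y\<^sup>2)" for c s x y :: real
    by (simp add: power2_eq_square algebra_simps)
  then show ?thesis by (simp add: twist_def Let_def)
qed

lemma twist_inverse: "twist (\<lambda>s. - a s) (twist a p) = p"
proof -
  let ?s = "a ((fst p)\<^sup>2 + (snd p)\<^sup>2)"
  have "a ((fst (twist a p))\<^sup>2 + (snd (twist a p))\<^sup>2) = ?s" by (simp only: twist_norm)
  then have "twist (\<lambda>s. - a s) (twist a p) = (cos ?s * fst (twist a p) + sin ?s * snd (twist a p),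
      - sin ?s * fst (twist a p) + cos ?s * snd (twist a p))"
    unfolding twist_def[of "\<lambda>s. - a s"] by (simp add: Let_def)
  also have "\<dots> = (((cos ?s)\<^sup>2 + (sin ?s)\<^sup>2) * fst p, ((cos ?s)\<^sup>2 + (sin ?s)\<^sup>2) * snd p)"
    unfolding twist_def Let_def by (simp add: power2_eq_square algebra_simps del: sin_cos_squared_add sin_cos_squared_add2 sin_cos_squared_add3)
  finally show ?thesis by simp
qed

lemma twist_id: "a ((fst p)\<^sup>2 + (snd p)\<^sup>2) = 0 \<Longrightarrow> twist a p = p"
  by (simp add: twist_def)

lemma C1_at_fst: "C1_at (\<lambda>p :: real \<times> real. fst p) p"
  and C1_at_snd: "C1_at (\<lambda>p :: real \<times> real. snd p) p"
  by (rule C1_at_linear, rule bounded_linear_fst, rule C1_at_linear, rule bounded_linear_snd)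

lemma C1_at_twist:
  assumes "\<And>s. (a has_real_derivative a' s) (at s)" "continuous_on UNIV a'"
  shows "C1_at (twist a) p"
proof -
  have a: "C1_at (\<lambda>q :: real \<times> real. a ((fst q)\<^sup>2 + (snd q)\<^sup>2)) p"
    unfolding power2_eq_square
    by (rule C1_at_real[OF open_UNIV UNIV_I has_real_derivative_iff_has_vector_derivative[THEN iffD1, OF assms(1)] assms(2)])
      (intro C1_at_add C1_at_mult C1_at_fst C1_at_snd)
  have c: "C1_at (\<lambda>q :: real \<times> real. cos (a ((fst q)\<^sup>2 + (snd q)\<^sup>2))) p"
    by (rule C1_at_real[OF _ _ _ _ a, of UNIV _ "\<lambda>s. - sin s"])
      (auto simp: has_real_derivative_iff_has_vector_derivative[symmetric] intro!: derivative_eq_intros continuous_intros)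
  have s: "C1_at (\<lambda>q :: real \<times> real. sin (a ((fst q)\<^sup>2 + (snd q)\<^sup>2))) p"
    by (rule C1_at_real[OF _ _ _ _ a, of UNIV _ cos])
      (auto simp: has_real_derivative_iff_has_vector_derivative[symmetric] intro!: derivative_eq_intros continuous_intros)
  show ?thesis unfolding twist_def[abs_def] Let_def
    by (intro C1_at_Pair C1_at_add C1_at_diff C1_at_mult c s C1_at_fst C1_at_snd)
qed

text \<open>The derivative is a rotation composed with a shear along the circle, so it preserves area.\<close>

lemma twist_deriv:
  assumes a: "\<And>s. (a has_real_derivative a' s) (at s)"
  shows "\<exists>D. (twist a has_derivative D) (at p) \<and> (\<forall>u v. det2 (D u) (D v) = det2 u v)"
proof -
  obtain x y where p: "p = (x, y)" by (cases p)
  let ?s = "x\<^sup>2 + y\<^sup>2"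
  define c where "c = cos (a ?s)"
  define s where "s = sin (a ?s)"
  define w where "w u = a' ?s * (2 * x * fst u + 2 * y * snd u)" for u :: "real \<times> real"
  define D where "D u = (c * fst u - s * snd u - w u * (s * x + c * y), s * fst u + c * snd u + w u * (c * x - s * y))" for u
  have A: "((\<lambda>q. a ((fst q)\<^sup>2 + (snd q)\<^sup>2)) has_derivative w) (at p)"
    by (rule has_derivative_eq_rhs, rule DERIV_compose_FDERIV[OF a])
      (auto simp: p w_def intro!: derivative_eq_intros)
  have C: "((\<lambda>q. cos (a ((fst q)\<^sup>2 + (snd q)\<^sup>2))) has_derivative (\<lambda>u. - s * w u)) (at p)"
    by (rule has_derivative_eq_rhs, rule has_derivative_cos[OF A]) (auto simp: p s_def)
  have S: "((\<lambda>q. sin (a ((fst q)\<^sup>2 + (snd q)\<^sup>2))) has_derivative (\<lambda>u. c * w u)) (at p)"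
    by (rule has_derivative_eq_rhs, rule has_derivative_sin[OF A]) (auto simp: p c_def)
  have "(twist a has_derivative D) (at p)"
    unfolding twist_def[abs_def] Let_def
  proof (rule has_derivative_eq_rhs)
    have f: "(fst has_derivative fst) (at p)" "(snd has_derivative snd) (at p)"
      by (auto intro: derivative_intros has_derivative_fst has_derivative_snd)
    show "((\<lambda>q. (cos (a ((fst q)\<^sup>2 + (snd q)\<^sup>2)) * fst q - sin (a ((fst q)\<^sup>2 + (snd q)\<^sup>2)) * snd q,
        sin (a ((fst q)\<^sup>2 + (snd q)\<^sup>2)) * fst q + cos (a ((fst q)\<^sup>2 + (snd q)\<^sup>2)) * snd q)) has_derivative
      (\<lambda>u. (c * fst u + - s * w u * x - (s * snd u + c * w u * y), s * fst u + c * w u * x + (c * snd u + - s * w u * y)))) (at p)"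
      using has_derivative_Pair[OF has_derivative_diff[OF has_derivative_mult[OF C f(1)] has_derivative_mult[OF S f(2)]]
          has_derivative_add[OF has_derivative_mult[OF S f(1)] has_derivative_mult[OF C f(2)]]]
      by (simp add: p c_def s_def)
    show "(\<lambda>u. (c * fst u + - s * w u * x - (s * snd u + c * w u * y), s * fst u + c * w u * x + (c * snd u + - s * w u * y))) = D"
      by (simp add: D_def fun_eq_iff algebra_simps)
  qed
  moreover have "det2 (D u) (D v) = det2 u v" for u v
  proof -
    have cs: "c\<^sup>2 + s\<^sup>2 = 1" by (simp add: c_def s_def)
    obtain u1 u2 v1 v2 where uv: "u = (u1, u2)" "v = (v1, v2)" by (cases u, cases v)
    define k where "k = a' ?s"
    have "det2 (D u) (D v) = (c\<^sup>2 + s\<^sup>2) * (u1 * v2 - u2 * v1)"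
      by (simp add: det2_def D_def w_def uv k_def[symmetric] algebra_simps power2_eq_square)
    then show ?thesis by (simp add: cs uv det2_def)
  qed
  ultimately show ?thesis by blast
qed

text \<open>Affine maps between the cell \<open>j/N \<le> t \<le> (j+1)/N\<close> and the square \<open>[-1,1]\<^sup>2\<close>, which leave
the second coordinate unchanged.\<close>

definition cell_in :: "nat \<Rightarrow> int \<Rightarrow> real \<times> real \<Rightarrow> real \<times> real" where
  "cell_in N j p = (2 * (real N * fst p - of_int j) - 1, snd p)"

definition cell_out :: "nat \<Rightarrow> int \<Rightarrow> real \<times> real \<Rightarrow> real \<times> real" where
  "cell_out N j p = ((of_int j + (fst p + 1) / 2) / real N, snd p)"

definition cell_twist :: "nat \<Rightarrow> (real \<Rightarrow> real) \<Rightarrow> int \<Rightarrow> real \<times> real \<Rightarrow> real \<times> real" where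
  "cell_twist N a j p = cell_out N j (twist a (cell_in N j p))"

text \<open>The twist is applied in each of the cells of width \<open>1/N\<close>.\<close>

definition twists :: "nat \<Rightarrow> (real \<Rightarrow> real) \<Rightarrow> real \<times> real \<Rightarrow> real \<times> real" where
  "twists N a p = cell_twist N a \<lfloor>real N * fst p\<rfloor> p"

lemma cell_in_out: "N > 0 \<Longrightarrow> cell_in N j (cell_out N j p) = p"
  and cell_out_in: "N > 0 \<Longrightarrow> cell_out N j (cell_in N j p) = p"
  by (auto simp: cell_in_def cell_out_def prod_eq_iff field_simps)

lemma cell_in_floor: "\<bar>fst (cell_in N \<lfloor>real N * fst p\<rfloor> p)\<bar> \<le> 1"
proof -
  have "\<bar>2 * (x - k) - 1\<bar> \<le> 1" if "k \<le> x" "x < k + 1" for k x :: real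
    using that by (simp add: abs_le_iff)
  then show ?thesis unfolding cell_in_def fst_conv by simp
qed

lemma C1_at_cell_twist:
  assumes "\<And>s. (a has_real_derivative a' s) (at s)" "continuous_on UNIV a'"
  shows "C1_at (cell_twist N a j) p"
proof -
  have i: "C1_at (cell_in N j) p" for p
    unfolding cell_in_def[abs_def]
    by (intro C1_at_Pair C1_at_diff C1_at_mult C1_at_const C1_at_fst C1_at_snd)
  have o: "C1_at (cell_out N j) p" for p
    unfolding cell_out_def[abs_def] divide_inverse
    by (intro C1_at_Pair C1_at_diff C1_at_add C1_at_mult C1_at_const C1_at_fst C1_at_snd)
  show ?thesis unfolding cell_twist_def[abs_def]
    by (rule C1_at_compose[OF C1_at_compose[OF i C1_at_twist[OF assms]] o])
qed

lemma cell_twist_deriv: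
  assumes a: "\<And>s. (a has_real_derivative a' s) (at s)" and N: "N > 0"
  shows "\<exists>D. (cell_twist N a j has_derivative D) (at p) \<and> (\<forall>u v. det2 (D u) (D v) = det2 u v)"
proof -
  obtain D where D: "(twist a has_derivative D) (at (cell_in N j p))" "\<And>u v. det2 (D u) (D v) = det2 u v"
    using twist_deriv[OF a] by blast
  have i: "(cell_in N j has_derivative (\<lambda>u. (2 * real N * fst u, snd u))) (at p)"
    unfolding cell_in_def[abs_def] by (auto intro!: derivative_eq_intros)
  have o: "(cell_out N j has_derivative (\<lambda>u. (fst u / (2 * real N), snd u))) (at q)" for q
    unfolding cell_out_def[abs_def] using N by (auto intro!: derivative_eq_intros simp: field_simps)
  let ?D = "\<lambda>u. (fst (D (2 * real N * fst u, snd u)) / (2 * real N), snd (D (2 * real N * fst u, snd u)))"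
  have "(cell_twist N a j has_derivative ?D) (at p)"
    unfolding cell_twist_def[abs_def]
    by (rule has_derivative_compose[OF has_derivative_compose[OF i D(1)] o])
  moreover have "det2 (?D u) (?D v) = det2 u v" for u v
  proof -
    have "det2 (?D u) (?D v) = det2 (D (2 * real N * fst u, snd u)) (D (2 * real N * fst v, snd v)) / (2 * real N)"
      by (simp add: det2_def diff_divide_distrib)
    also have "\<dots> = det2 u v" unfolding D(2) using N by (simp add: det2_def field_simps)
    finally show ?thesis .
  qed
  ultimately show ?thesis by blast
qed

text \<open>Since the angle vanishes for squared radius at least \<open>r < 1\<close>, the twist is the identity near the boundary
of the unit disk. Hence the maps of neighbouring cells fit together smoothly.\<close>

locale twist_profile =
  fixes a a' :: "real \<Rightarrow> real" and r :: real
  assumes a_deriv: "\<And>s. (a has_real_derivative a' s) (at s)" and a'_cont: "continuous_on UNIV a'"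
    and r: "0 < r" "r < 1" and a_0: "\<And>s. s \<ge> r \<Longrightarrow> a s = 0"
begin

lemma cell_twist_id:
  assumes "N > 0" "(fst (cell_in N j p))\<^sup>2 + (snd p)\<^sup>2 \<ge> r"
  shows "cell_twist N a j p = p"
  unfolding cell_twist_def using assms a_0
  by (subst twist_id) (auto simp: cell_out_in, simp add: cell_in_def)

lemma twists_id:
  assumes "N > 0" "(snd p)\<^sup>2 \<ge> r"
  shows "twists N a p = p"
  unfolding twists_def using assms zero_le_power2[of "fst (cell_in N \<lfloor>real N * fst p\<rfloor> p)"]
  by (intro cell_twist_id) linarith+

text \<open>The formula of the cell \<open>j\<close> is valid slightly beyond this cell: there both it and the formula of the
neighbouring cell give the identity.\<close>

lemma twists_local:
  assumes N: "N > 0"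
  defines "e \<equiv> (1 - r) / 2"
  assumes "\<bar>fst (cell_in N j p)\<bar> \<le> 1 + e"
  shows "twists N a p = cell_twist N a j p"
proof (cases "\<lfloor>real N * fst p\<rfloor> = j")
  case True then show ?thesis by (simp add: twists_def)
next
  case False
  define k where "k = \<lfloor>real N * fst p\<rfloor>"
  define x where "x = real N * fst p"
  have e: "0 < e" "e < 1/2" "(1 - e)\<^sup>2 \<ge> r" using r zero_le_power2[of "1 - r"] by (auto simp: e_def power2_eq_square algebra_simps)
  have x: "of_int k \<le> x" "x < of_int k + 1" by (auto simp: k_def x_def)
  have xj: "\<bar>2 * (x - of_int j) - 1\<bar> \<le> 1 + e" using assms(3) by (simp add: cell_in_def x_def)
  have kj: "k = j - 1 \<or> k = j + 1" 
  proof -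
    have "x > of_int j - 1" "x < of_int j + 2" using xj e by (auto simp: abs_le_iff)
    then have "k \<ge> j - 1" "k \<le> j + 1" unfolding k_def x_def by linarith+
    then show ?thesis using False unfolding k_def by linarith
  qed
  then have far: "\<bar>2 * (x - of_int k) - 1\<bar> \<ge> 1 - e \<and> \<bar>2 * (x - of_int j) - 1\<bar> \<ge> 1"
    using x xj e by (auto simp: abs_le_iff)
  have sq: "u\<^sup>2 \<ge> r" if "\<bar>u\<bar> \<ge> 1 - e" for u :: real
  proof -
    have "(1 - e)\<^sup>2 \<le> \<bar>u\<bar>\<^sup>2" using that e by (intro power_mono) auto
    then show ?thesis using e by simp
  qed
  have "(2 * (x - of_int k) - 1)\<^sup>2 \<ge> r" "(2 * (x - of_int j) - 1)\<^sup>2 \<ge> r" using far e by (auto intro!: sq)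
  then have "cell_twist N a k p = p" "cell_twist N a j p = p"
    using zero_le_power2[of "snd p"]
    by (intro cell_twist_id[OF N]; simp add: cell_in_def x_def[symmetric]; linarith)+
  then show ?thesis by (simp add: twists_def k_def)
qed

lemma twists_locally_cell:
  assumes N: "N > 0"
  shows "\<exists>V j. open V \<and> p \<in> V \<and> (\<forall>q\<in>V. twists N a q = cell_twist N a j q)"
proof (intro exI conjI ballI)
  let ?j = "\<lfloor>real N * fst p\<rfloor>"
  let ?V = "{q. \<bar>fst (cell_in N ?j q)\<bar> < 1 + (1 - r) / 2}"
  show "open ?V" unfolding cell_in_def fst_conv by (intro open_Collect_less continuous_intros)
  have "\<bar>fst (cell_in N ?j p)\<bar> \<le> 1" by (rule cell_in_floor)
  moreover have "1 < 1 + (1 - r) / 2" using r by simp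
  ultimately show "p \<in> ?V" by (simp only: mem_Collect_eq)
  show "twists N a q = cell_twist N a ?j q" if "q \<in> ?V" for q using twists_local[OF N] that by simp
qed

lemma twists_shift:
  assumes N: "N > 0" and k: "real N * k \<in> \<int>"
  shows "twists N a (t + k, y) = (fst (twists N a (t, y)) + k, snd (twists N a (t, y)))"
proof -
  obtain m where m: "real N * k = of_int m" using k by (auto elim: Ints_cases)
  have "real N * (t + k) = real N * t + of_int m" using m by (simp add: distrib_left)
  then have f: "\<lfloor>real N * fst (t + k, y)\<rfloor> = \<lfloor>real N * t\<rfloor> + m" by simp
  have 1: "cell_in N (\<lfloor>real N * t\<rfloor> + m) (t + k, y) = cell_in N \<lfloor>real N * t\<rfloor> (t, y)"
    using m by (simp add: cell_in_def distrib_left)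
  have 2: "cell_out N (\<lfloor>real N * t\<rfloor> + m) q = (fst (cell_out N \<lfloor>real N * t\<rfloor> q) + k, snd (cell_out N \<lfloor>real N * t\<rfloor> q))" for q
    using N m by (simp add: cell_out_def field_simps)
  show ?thesis unfolding twists_def cell_twist_def f 1 2 by simp
qed

lemma twist_square:
  assumes "\<bar>fst p\<bar> \<le> 1" "\<bar>snd p\<bar> \<le> 1"
  shows "\<bar>fst (twist a p)\<bar> \<le> 1 \<and> \<bar>snd (twist a p)\<bar> \<le> 1"
proof (cases "(fst p)\<^sup>2 + (snd p)\<^sup>2 \<ge> r")
  case True then show ?thesis using a_0 twist_id assms by simp
next
  case False
  then have "(fst (twist a p))\<^sup>2 + (snd (twist a p))\<^sup>2 \<le> 1" using r twist_norm[of a p] by simp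
  then have "(fst (twist a p))\<^sup>2 \<le> 1" "(snd (twist a p))\<^sup>2 \<le> 1"
    using zero_le_power2[of "fst (twist a p)"] zero_le_power2[of "snd (twist a p)"] by linarith+
  then show ?thesis by (simp add: abs_square_le_1)
qed

lemma twist_strip:
  assumes "\<bar>snd p\<bar> < 1"
  shows "\<bar>snd (twist a p)\<bar> < 1"
proof (cases "(fst p)\<^sup>2 + (snd p)\<^sup>2 \<ge> r")
  case True then show ?thesis using a_0 twist_id assms by simp
next
  case False
  then have "(snd (twist a p))\<^sup>2 < 1" using r twist_norm[of a p] zero_le_power2[of "fst (twist a p)"] by linarith
  then show ?thesis by (simp add: abs_square_less_1)
qed

lemma twists_strip:
  assumes "\<bar>snd p\<bar> < 1"
  shows "\<bar>snd (twists N a p)\<bar> < 1"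
  unfolding twists_def cell_twist_def cell_out_def using twist_strip assms by (simp add: cell_in_def)

lemma twists_inverse:
  assumes N: "N > 0"
  shows "twists N (\<lambda>s. - a s) (twists N a p) = p"
proof -
  interpret m: twist_profile "\<lambda>s. - a s" "\<lambda>s. - a' s" r
    using r a_0 a'_cont by unfold_locales (auto intro!: derivative_eq_intros a_deriv continuous_intros)
  let ?j = "\<lfloor>real N * fst p\<rfloor>"
  have u: "\<bar>fst (cell_in N ?j p)\<bar> \<le> 1" by (rule cell_in_floor)
  define q where "q = twists N a p"
  have q: "cell_in N ?j q = twist a (cell_in N ?j p)"
    unfolding q_def twists_def cell_twist_def by (rule cell_in_out[OF N])
  have "\<bar>fst (cell_in N ?j q)\<bar> \<le> 1"
  proof (cases "(fst (cell_in N ?j p))\<^sup>2 + (snd (cell_in N ?j p))\<^sup>2 \<ge> r")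
    case True then show ?thesis using u a_0 twist_id q by simp
  next
    case False
    then have "(fst (twist a (cell_in N ?j p)))\<^sup>2 \<le> 1"
      using r twist_norm[of a "cell_in N ?j p"] zero_le_power2[of "snd (twist a (cell_in N ?j p))"] by linarith
    then show ?thesis unfolding q by (simp add: abs_square_le_1)
  qed
  then have "twists N (\<lambda>s. - a s) q = cell_twist N (\<lambda>s. - a s) ?j q"
  proof (intro m.twists_local[OF N])
    assume "\<bar>fst (cell_in N ?j q)\<bar> \<le> 1"
    also have "1 \<le> 1 + (1 - r) / 2" using r by simp
    finally show "\<bar>fst (cell_in N ?j q)\<bar> \<le> 1 + (1 - r) / 2" .
  qed
  also have "\<dots> = p" unfolding cell_twist_def q twist_inverse by (rule cell_out_in[OF N])
  finally show ?thesis by (simp add: q_def)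
qed

end

section \<open>Averages of twisted circles\<close>

lemma borel_measurable_fst_snd [measurable]:
  "fst \<in> borel_measurable (borel :: (real \<times> real) measure)" "snd \<in> borel_measurable (borel :: (real \<times> real) measure)"
  by (rule borel_measurable_continuous_onI, intro continuous_intros)+

lemma pair_borel_measurable:
  fixes f g :: "'x \<Rightarrow> real"
  assumes "f \<in> borel_measurable X" "g \<in> borel_measurable X"
  shows "(\<lambda>x. (f x, g x)) \<in> borel_measurable X"
  using measurable_Pair[OF assms] by (simp add: borel_prod)

lemma twist_measurable:
  assumes [measurable]: "a \<in> borel_measurable borel"
  shows "twist a \<in> borel_measurable borel"
  unfolding twist_def[abs_def] Let_def by (rule pair_borel_measurable) measurable

lemma twists_measurable:
  assumes [measurable]: "a \<in> borel_measurable borel"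
  shows "twists N a \<in> borel_measurable borel"
  unfolding twists_def[abs_def] cell_twist_def cell_out_def cell_in_def twist_def Let_def
  by (rule pair_borel_measurable) (simp_all, measurable)

context twist_profile begin

lemma a_measurable [measurable]: "a \<in> borel_measurable borel"
  by (rule borel_measurable_continuous_onI)
    (meson DERIV_isCont a_deriv continuous_at_imp_continuous_on)

text \<open>At a fixed relative position \<open>s\<close> in the cells, the images under the twists of the points in the \<open>N\<close>
cells have the same height and one angle in each cell. So their average is a Riemann sum of a circle
average.\<close>

lemma twists_average:
  fixes F :: "real \<times> real \<Rightarrow> real"
  assumes F [measurable]: "F \<in> borel_measurable borel" and N: "N > 0" and v: "\<bar>v\<bar> \<le> 1"
    and b: "\<And>t y. t \<in> {0..1} \<Longrightarrow> \<bar>y\<bar> \<le> 1 \<Longrightarrow> \<bar>F (t, y)\<bar> \<le> B"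
    and mod: "\<And>t t' y. t \<in> {0..1} \<Longrightarrow> t' \<in> {0..1} \<Longrightarrow> \<bar>y\<bar> \<le> 1 \<Longrightarrow> \<bar>t - t'\<bar> \<le> 1 / real N \<Longrightarrow>
      \<bar>F (t, y) - F (t', y)\<bar> \<le> \<epsilon>"
  shows "\<bar>(\<integral>t. F (twists N a (t, v)) \<partial>circ) - (\<integral>s. (\<integral>t. F (t, snd (twist a (2 * s - 1, v))) \<partial>circ) \<partial>circ)\<bar> \<le> \<epsilon>"
proof -
  have tm [measurable]: "twists N a \<in> borel_measurable borel" "twist a \<in> borel_measurable borel"
    by (intro twists_measurable twist_measurable a_measurable)+
  have pm [measurable]: "(\<lambda>s. (g s, v)) \<in> borel_measurable borel" if "g \<in> borel_measurable borel" for g :: "real \<Rightarrow> real"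
    using that by (intro pair_borel_measurable) auto
  have Fm: "(\<lambda>t. F (twists N a (t, v))) \<in> borel_measurable borel"
    by (rule measurable_compose[OF measurable_compose[OF pm tm(1)] F]) measurable
  define w where "w s = twist a (2 * s - 1, v)" for s
  have w: "\<bar>fst (w s)\<bar> \<le> 1" "\<bar>snd (w s)\<bar> \<le> 1" if "0 \<le> s" "s < 1" for s
    using twist_square[of "(2 * s - 1, v)"] that v by (auto simp: w_def abs_le_iff)
  have cell: "twists N a ((real j + s) / N, v) = ((real j + (fst (w s) + 1) / 2) / N, snd (w s))"
    if "0 \<le> s" "s < 1" for j s
  proof -
    have *: "real N * ((real j + s) / N) = real j + s" using N by simp
    have fl: "\<lfloor>real j + s\<rfloor> = int j" using that by linarith
    have "cell_in N (int j) ((real j + s) / N, v) = (2 * s - 1, v)"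
      unfolding cell_in_def fst_conv snd_conv * by simp
    then show ?thesis unfolding twists_def fst_conv * fl cell_twist_def cell_out_def w_def by simp
  qed
  define A where "A y = (\<integral>t. F (t, y) \<partial>circ)" for y
  have Am [measurable]: "A \<in> borel_measurable borel" unfolding A_def by (rule circ_average_measurable[OF F])
  have wm [measurable]: "w \<in> borel_measurable borel"
    unfolding w_def by (rule measurable_compose[OF pm tm(2)]) measurable
  have le1: "(real j + 1) / N \<le> 1" if "j < N" for j using that N by simp
  have rj: "(real j + (fst (w s) + 1) / 2) / N \<in> {real j / N..(real j + 1) / N}" if "0 \<le> s" "s < 1" for s j
    using w(1)[OF that] N by (auto intro!: divide_right_mono simp: abs_le_iff)
  have rj01: "(real j + (fst (w s) + 1) / 2) / N \<in> {0..1}" if "0 \<le> s" "s < 1" "j < N" for s j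
    using rj[OF that(1,2), of j] le1[OF that(3)]
    by (auto intro: order_trans[of _ "(real j + 1) / real N"] order_trans[of _ "real j / real N"] simp del: divide_le_eq_1)
  have Fb: "\<bar>F (twists N a (t, v))\<bar> \<le> B" if "0 \<le> t" "t < 1" for t
  proof -
    define j where "j = nat \<lfloor>t * N\<rfloor>"
    have j: "real j \<le> t * N" "t * N < real j + 1" using that N by (auto simp: j_def)
    have "t * N < N" using that N by simp
    then have jN: "j < N" using j by linarith
    have s: "0 \<le> t * N - j" "t * N - j < 1" using j by auto
    have t: "t = (real j + (t * N - j)) / N" using N by simp
    show ?thesis by (subst t, subst cell[OF s]) (intro b rj01 w s jN)
  qed
  let ?S = "\<lambda>s. (1 / real N) * (\<Sum>j<N. F (twists N a ((real j + s) / N, v)))"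
  have close: "\<bar>?S s - A (snd (w s))\<bar> \<le> \<epsilon>" if s: "0 \<le> s" "s < 1" for s
  proof -
    have *: "(\<lambda>t. F (t, snd (w s))) \<in> borel_measurable borel"
      by (intro measurable_compose[OF _ F] pair_borel_measurable) auto
    show ?thesis unfolding cell[OF s] A_def
      by (rule circ_average_riemann[where B=B]) (use * b mod w[OF s] N rj[OF s] in auto)
  qed
  have Ab: "\<bar>A y\<bar> \<le> B" if "\<bar>y\<bar> \<le> 1" for y
    unfolding A_def
    by (rule circ_abs_integral_le) (use b that in \<open>auto intro!: measurable_compose[OF _ F] pair_borel_measurable\<close>)
  have i1: "integrable circ (\<lambda>s. A (snd (w s)))"
    by (rule circ_bounded_integrable[of _ B]) (use Ab w in auto)
  have Sm: "?S \<in> borel_measurable borel"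
    by (intro borel_measurable_times borel_measurable_const borel_measurable_sum measurable_compose[OF _ Fm]) measurable
  have i2: "integrable circ ?S"
  proof (rule circ_bounded_integrable[OF Sm])
    fix s :: real assume s: "0 \<le> s" "s < 1"
    show "\<bar>?S s\<bar> \<le> B + \<epsilon>" using close[OF s] Ab[OF w(2)[OF s]] by linarith
  qed
  have "\<bar>\<integral>s. ?S s - A (snd (w s)) \<partial>circ\<bar> \<le> \<epsilon>"
    by (rule circ_abs_integral_le) (use close Sm in auto)
  moreover have "(\<integral>s. ?S s - A (snd (w s)) \<partial>circ) = (\<integral>s. ?S s \<partial>circ) - (\<integral>s. A (snd (w s)) \<partial>circ)"
    by (rule Bochner_Integration.integral_diff[OF i2 i1])
  moreover have "(\<integral>s. ?S s \<partial>circ) = (\<integral>t. F (twists N a (t, v)) \<partial>circ)"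
    by (rule circ_average_cells[OF Fm Fb N, symmetric]) auto
  ultimately show ?thesis by (simp add: A_def w_def)
qed

end

lemma seg_interval:
  fixes d :: real assumes d: "0 \<le> d" "d \<le> 1"
  shows "(\<integral>y. indicator {-d..d} y \<partial>seg) = d"
proof -
  have "(\<integral>y. indicator {-d..d} y \<partial>seg) = (\<integral>y. indicator {-1<..<1} y / 2 * indicator {-d..d} y \<partial>lborel :: real)"
    by (rule integral_seg) simp
  also have "\<dots> = (\<integral>y. (1/2) * indicator {-d..d} y \<partial>lborel)"
  proof (rule integral_cong_AE)
    show "AE y in lborel. indicator {-1<..<1} y / 2 * indicator {-d..d} y = (1/2) * (indicator {-d..d} y :: real)"
      using AE_lborel_singleton[of "-1::real"] AE_lborel_singleton[of "1::real"]
      by eventually_elim (use d in \<open>auto split: split_indicator\<close>)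
  qed simp_all
  also have "\<dots> = d" using d by simp
  finally show ?thesis .
qed

text \<open>Here \<open>\<Phi>\<close> is a function of the height with mean zero and \<open>\<gamma>\<close> is the height after the twist.
Write \<open>K v\<close> for the new average at height \<open>v\<close>. If \<open>\<bar>v\<bar> \<le> d\<close>, then \<open>\<gamma> (u, v) =
u\<close> for \<open>\<bar>u\<bar> \<le> 1 - d\<close>, so that \<open>K v\<close> is the integral of \<open>\<Phi>\<close> up to a set of measure
\<open>d\<close> and \<open>\<bar>K v\<bar> \<le> 4 * d\<close>. At the other heights Jensen's inequality bounds \<open>(K v)\<^sup>2\<close>
by the average \<open>L v\<close> of \<open>\<Phi>\<^sup>2\<close>. As \<open>L\<close> has the same total integral as \<open>\<Phi>\<^sup>2\<close>, by
preservation of area, what is gained is the integral of \<open>L\<close> over \<open>\<bar>v\<bar> \<le> d\<close>, about \<open>d\<close>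
times the integral of \<open>\<Phi>\<^sup>2\<close>.\<close>

lemma mixing_estimate:
  fixes \<Phi> :: "real \<Rightarrow> real" and \<gamma> :: "real \<times> real \<Rightarrow> real"
  assumes \<Phi> [measurable]: "\<Phi> \<in> borel_measurable borel" and \<gamma>: "\<gamma> \<in> borel_measurable borel"
    and b: "\<And>y. \<bar>y\<bar> \<le> 1 \<Longrightarrow> \<bar>\<Phi> y\<bar> \<le> 2" and mean: "(\<integral>y. \<Phi> y \<partial>seg) = 0"
    and d: "0 < d" "d \<le> 1 / 2"
    and square: "\<And>u v. \<bar>u\<bar> \<le> 1 \<Longrightarrow> \<bar>v\<bar> < 1 \<Longrightarrow> \<bar>\<gamma> (u, v)\<bar> \<le> 1"
    and turn: "\<And>u v. u\<^sup>2 + v\<^sup>2 \<le> 1 - d \<Longrightarrow> \<gamma> (u, v) = u"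
    and area: "(\<integral>v. (\<integral>s. (\<Phi> (\<gamma> (2 * s - 1, v)))\<^sup>2 \<partial>circ) \<partial>seg) = (\<integral>y. (\<Phi> y)\<^sup>2 \<partial>seg)"
  shows "(\<integral>v. (\<integral>s. \<Phi> (\<gamma> (2 * s - 1, v)) \<partial>circ)\<^sup>2 \<partial>seg) \<le> (1 - d) * (\<integral>y. (\<Phi> y)\<^sup>2 \<partial>seg) + 12 * d\<^sup>2"
proof -
  define W where "W = (\<integral>y. (\<Phi> y)\<^sup>2 \<partial>seg)"
  define K where "K v = (\<integral>s. \<Phi> (\<gamma> (2 * s - 1, v)) \<partial>circ)" for v
  define L where "L v = (\<integral>s. (\<Phi> (\<gamma> (2 * s - 1, v)))\<^sup>2 \<partial>circ)" for v
  let ?I = "{-(1-d)..1-d}"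
  have b4: "(\<Phi> y)\<^sup>2 \<le> 4" if "\<bar>y\<bar> \<le> 1" for y
    using power_mono[OF b[OF that], of 2] by simp
  have gm [measurable]: "(\<lambda>s. \<gamma> (2 * s - 1, v)) \<in> borel_measurable borel" for v
    by (intro measurable_compose[OF _ \<gamma>] pair_borel_measurable) auto
  have gm2: "(\<lambda>p. \<Phi> (\<gamma> (2 * fst p - 1, snd p))) \<in> borel_measurable borel"
    by (intro measurable_compose[OF _ \<Phi>] measurable_compose[OF _ \<gamma>] pair_borel_measurable) measurable
  have Km [measurable]: "K \<in> borel_measurable borel"
    using circ_average_measurable[OF gm2] by (simp add: K_def[abs_def])
  have Lm [measurable]: "L \<in> borel_measurable borel"
    using circ_average_measurable[of "\<lambda>p. (\<Phi> (\<gamma> (2 * fst p - 1, snd p)))\<^sup>2"] gm2 by (simp add: L_def[abs_def])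
  have gb: "\<bar>\<gamma> (2 * s - 1, v)\<bar> \<le> 1" if "0 \<le> s" "s < 1" "\<bar>v\<bar> < 1" for s v
    using that by (intro square) auto
  have Li: "integrable seg L"
  proof (rule seg_bounded_integrable[of _ 4])
    fix v :: real assume v: "\<bar>v\<bar> < 1"
    show "\<bar>L v\<bar> \<le> 4" unfolding L_def
      by (rule circ_abs_integral_le) (use gb[OF _ _ v] b4 in auto)
  qed simp
  have Wi: "integrable seg (\<lambda>y. (\<Phi> y)\<^sup>2)" by (rule seg_bounded_integrable[of _ 4]) (use b4 in auto)
  have Pi: "integrable seg \<Phi>" by (rule seg_bounded_integrable[of _ 2]) (use b in auto)
  have iI: "integrable seg (indicator ?I :: real \<Rightarrow> real)"
    by (rule seg_bounded_integrable[of _ 1]) auto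
  have out: "\<bar>\<integral>y. (1 - indicator ?I y) * g y \<partial>seg\<bar> \<le> c * d"
    if [measurable]: "g \<in> borel_measurable borel" and g: "\<And>y. \<bar>y\<bar> \<le> 1 \<Longrightarrow> \<bar>g y\<bar> \<le> c" for g and c :: real
  proof -
    have c0: "0 \<le> c" using g[of 0] by simp
    have "\<bar>\<integral>y. (1 - indicator ?I y) * g y \<partial>seg\<bar> \<le> (\<integral>y. \<bar>(1 - indicator ?I y) * g y\<bar> \<partial>seg)"
      by (rule integral_abs_bound)
    also have "\<dots> \<le> (\<integral>y. c * (1 - indicator ?I y) \<partial>seg)"
    proof (rule integral_mono_AE)
      show "integrable seg (\<lambda>y. \<bar>(1 - indicator ?I y) * g y\<bar>)"
        by (rule seg_bounded_integrable[of _ c]) (use g c0 in \<open>auto split: split_indicator\<close>)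
      show "AE y in seg. \<bar>(1 - indicator ?I y) * g y\<bar> \<le> c * (1 - indicator ?I y)"
        using AE_seg by eventually_elim (use g c0 in \<open>auto split: split_indicator\<close>)
    qed (rule seg_bounded_integrable[of _ "\<bar>c\<bar>"], auto split: split_indicator)
    also have "\<dots> = c * d"
      using seg_interval[of "1 - d"] d iI
      by (subst integral_mult_right_zero, subst Bochner_Integration.integral_diff) (auto simp: seg.prob_space[simplified])
    finally show ?thesis .
  qed
  have split: "(\<integral>y. indicator ?I y * g y \<partial>seg) = (\<integral>y. g y \<partial>seg) - (\<integral>y. (1 - indicator ?I y) * g y \<partial>seg)"
    if [measurable]: "g \<in> borel_measurable borel" and g: "\<And>y. \<bar>y\<bar> \<le> 1 \<Longrightarrow> \<bar>g y\<bar> \<le> c" for g and c :: real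
  proof -
    have c0: "0 \<le> c" using g[of 0] by simp
    have "integrable seg g" by (rule seg_bounded_integrable[of _ c]) (use g in auto)
    moreover have "integrable seg (\<lambda>y. (1 - indicator ?I y) * g y)"
      by (rule seg_bounded_integrable[of _ c]) (use g c0 in \<open>auto split: split_indicator\<close>)
    ultimately have "(\<integral>y. g y \<partial>seg) - (\<integral>y. (1 - indicator ?I y) * g y \<partial>seg) = (\<integral>y. g y - (1 - indicator ?I y) * g y \<partial>seg)"
      by simp
    then show ?thesis by (simp add: algebra_simps)
  qed
  have inner1: "\<bar>\<integral>y. indicator ?I y * \<Phi> y \<partial>seg\<bar> \<le> 2 * d"
    using split[OF \<Phi> b] out[OF \<Phi> b] mean by simp
  have inner2: "(\<integral>y. indicator ?I y * (\<Phi> y)\<^sup>2 \<partial>seg) \<ge> W - 4 * d"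
    using split[of "\<lambda>y. (\<Phi> y)\<^sup>2" 4] out[of "\<lambda>y. (\<Phi> y)\<^sup>2" 4] b4 by (simp add: W_def)
  have turn': "\<gamma> (2 * s - 1, v) = 2 * s - 1" if "\<bar>v\<bar> \<le> d" "2 * s - 1 \<in> ?I" for s v
  proof (rule turn)
    have "(2 * s - 1)\<^sup>2 \<le> (1 - d)\<^sup>2" using that d by (intro abs_le_square_iff[THEN iffD1]) (auto simp: abs_le_iff)
    moreover have "v\<^sup>2 \<le> d\<^sup>2" using that d by (intro abs_le_square_iff[THEN iffD1]) auto
    moreover have "(1 - d)\<^sup>2 + d\<^sup>2 \<le> 1 - d"
      using mult_left_mono[OF d(2), of d] d by (simp add: power2_eq_square algebra_simps)
    ultimately show "(2 * s - 1)\<^sup>2 + v\<^sup>2 \<le> 1 - d" by linarith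
  qed
  have jm [measurable]: "(\<lambda>s. indicator ?I (2 * s - 1) :: real) \<in> borel_measurable borel"
    by (rule measurable_compose[of _ borel borel]) auto
  have inner_circ: "(\<integral>s. indicator ?I (2 * s - 1) * g (\<gamma> (2 * s - 1, v)) \<partial>circ) = (\<integral>y. indicator ?I y * g y \<partial>seg)"
    if "\<bar>v\<bar> \<le> d" and [measurable]: "g \<in> borel_measurable borel" for v and g :: "real \<Rightarrow> real"
  proof -
    have "(\<integral>s. indicator ?I (2 * s - 1) * g (\<gamma> (2 * s - 1, v)) \<partial>circ) = (\<integral>s. indicator ?I (2 * s - 1) * g (2 * s - 1) \<partial>circ)"
      by (intro Bochner_Integration.integral_cong) (use turn'[OF that(1)] in \<open>auto split: split_indicator\<close>)
    also have "\<dots> = (\<integral>y. indicator ?I y * g y \<partial>seg)"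
      by (rule integral_circ_seg[where f="\<lambda>y. indicator ?I y * g y"]) simp
    finally show ?thesis .
  qed
  have K4: "\<bar>K v\<bar> \<le> 4 * d" if v: "\<bar>v\<bar> \<le> d" for v
  proof -
    have v1: "\<bar>v\<bar> < 1" using v d by simp
    have gs: "\<bar>\<Phi> (\<gamma> (2 * s - 1, v))\<bar> \<le> 2" if "0 \<le> s" "s < 1" for s using b gb[OF that v1] by simp
    have ia: "integrable circ (\<lambda>s. indicator ?I (2 * s - 1) * \<Phi> (\<gamma> (2 * s - 1, v)))"
      by (rule circ_bounded_integrable[of _ 2]) (use gs in \<open>auto split: split_indicator\<close>)
    have ib: "integrable circ (\<lambda>s. (1 - indicator ?I (2 * s - 1)) * \<Phi> (\<gamma> (2 * s - 1, v)))"
      by (rule circ_bounded_integrable[of _ 2]) (use gs in \<open>auto split: split_indicator\<close>)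
    have "K v = (\<integral>s. indicator ?I (2 * s - 1) * \<Phi> (\<gamma> (2 * s - 1, v)) + (1 - indicator ?I (2 * s - 1)) * \<Phi> (\<gamma> (2 * s - 1, v)) \<partial>circ)"
      unfolding K_def by (simp add: algebra_simps)
    also have "\<dots> = (\<integral>s. indicator ?I (2 * s - 1) * \<Phi> (\<gamma> (2 * s - 1, v)) \<partial>circ) + (\<integral>s. (1 - indicator ?I (2 * s - 1)) * \<Phi> (\<gamma> (2 * s - 1, v)) \<partial>circ)"
      by (rule Bochner_Integration.integral_add[OF ia ib])
    finally have K: "K v = (\<integral>y. indicator ?I y * \<Phi> y \<partial>seg) + (\<integral>s. (1 - indicator ?I (2 * s - 1)) * \<Phi> (\<gamma> (2 * s - 1, v)) \<partial>circ)"
      unfolding inner_circ[OF v \<Phi>] .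
    have "\<bar>\<integral>s. (1 - indicator ?I (2 * s - 1)) * \<Phi> (\<gamma> (2 * s - 1, v)) \<partial>circ\<bar> \<le> (\<integral>s. \<bar>(1 - indicator ?I (2 * s - 1)) * \<Phi> (\<gamma> (2 * s - 1, v))\<bar> \<partial>circ)"
      by (rule integral_abs_bound)
    also have "\<dots> \<le> (\<integral>s. 2 * (1 - indicator ?I (2 * s - 1)) \<partial>circ)"
    proof (rule integral_mono_AE)
      show "AE s in circ. \<bar>(1 - indicator ?I (2 * s - 1)) * \<Phi> (\<gamma> (2 * s - 1, v))\<bar> \<le> 2 * (1 - indicator ?I (2 * s - 1))"
        using AE_circ by eventually_elim (use gs in \<open>auto split: split_indicator\<close>)
      show "integrable circ (\<lambda>s. 2 * (1 - indicator ?I (2 * s - 1)) :: real)"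
        by (rule circ_bounded_integrable[of _ 2]) (auto split: split_indicator)
    qed (use ib in simp)
    also have "\<dots> = (\<integral>y. 2 * (1 - indicator ?I y) \<partial>seg)"
      by (rule integral_circ_seg[where f="\<lambda>y. 2 * (1 - indicator ?I y)"]) simp
    also have "\<dots> = 2 * d"
      using seg_interval[of "1 - d"] d iI
      by (subst integral_mult_right_zero, subst Bochner_Integration.integral_diff) (auto simp: seg.prob_space[simplified])
    finally show ?thesis using K inner1 by linarith
  qed
  \<comment> \<open>Near height \<open>0\<close> the bound \<open>L v \<ge> W - 4 * d\<close> is traded against \<open>(K v)\<^sup>2 \<le> 16 *
d\<^sup>2\<close>.\<close>
  have pt: "(K v)\<^sup>2 \<le> L v + indicator {-d..d} v * (16 * d\<^sup>2 - (W - 4 * d))" if v1: "\<bar>v\<bar> < 1" for v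
  proof -
    have gs: "\<bar>\<Phi> (\<gamma> (2 * s - 1, v))\<bar> \<le> 2" "(\<Phi> (\<gamma> (2 * s - 1, v)))\<^sup>2 \<le> 4" if "0 \<le> s" "s < 1" for s
      using b b4 gb[OF that v1] by simp_all
    have i: "integrable circ (\<lambda>s. \<Phi> (\<gamma> (2 * s - 1, v)))" "integrable circ (\<lambda>s. (\<Phi> (\<gamma> (2 * s - 1, v)))\<^sup>2)"
      by (rule circ_bounded_integrable[of _ 2] circ_bounded_integrable[of _ 4]; use gs in auto)+
    show ?thesis
    proof (cases "\<bar>v\<bar> \<le> d")
      case False
      have "0 \<le> (\<integral>s. (\<Phi> (\<gamma> (2 * s - 1, v)) - K v)\<^sup>2 \<partial>circ)" by (rule Bochner_Integration.integral_nonneg) simp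
      also have "\<dots> = (\<integral>s. (\<Phi> (\<gamma> (2 * s - 1, v)))\<^sup>2 - 2 * K v * \<Phi> (\<gamma> (2 * s - 1, v)) + (K v)\<^sup>2 \<partial>circ)"
        by (intro Bochner_Integration.integral_cong) (auto simp: power2_eq_square algebra_simps)
      also have "\<dots> = L v - 2 * K v * K v + (K v)\<^sup>2"
        using i by (simp add: L_def K_def circ.prob_space[simplified])
      finally have "(K v)\<^sup>2 \<le> L v" by (simp add: power2_eq_square)
      then show ?thesis using False by (auto simp: indicator_def abs_le_iff)
    next
      case True
      have "(K v)\<^sup>2 \<le> (4 * d)\<^sup>2" using K4[OF True] d by (intro abs_le_square_iff[THEN iffD1]) auto
      moreover have "W - 4 * d \<le> L v"
      proof -
        have "W - 4 * d \<le> (\<integral>s. indicator ?I (2 * s - 1) * (\<Phi> (\<gamma> (2 * s - 1, v)))\<^sup>2 \<partial>circ)"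
          using inner2 inner_circ[OF True, of "\<lambda>y. (\<Phi> y)\<^sup>2"] by simp
        also have "\<dots> \<le> L v" unfolding L_def
          by (intro integral_mono[OF _ i(2)] circ_bounded_integrable[of _ 4]) (use gs in \<open>auto split: split_indicator\<close>)
        finally show ?thesis .
      qed
      moreover have "v \<in> {-d..d}" using True by (auto simp: abs_le_iff)
      ultimately show ?thesis by (simp add: power_mult_distrib)
    qed
  qed
  have W4: "W = (\<integral>v. L v \<partial>seg)" using area by (simp add: W_def L_def)
  have "(\<integral>v. (K v)\<^sup>2 \<partial>seg) \<le> (\<integral>v. L v + indicator {-d..d} v * (16 * d\<^sup>2 - (W - 4 * d)) \<partial>seg)"
  proof (rule integral_mono_AE)
    show "AE v in seg. (K v)\<^sup>2 \<le> L v + indicator {-d..d} v * (16 * d\<^sup>2 - (W - 4 * d))"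
      using AE_seg by eventually_elim (rule pt)
    show i: "integrable seg (\<lambda>v. L v + indicator {-d..d} v * (16 * d\<^sup>2 - (W - 4 * d)))"
    proof (rule Bochner_Integration.integrable_add[OF Li])
      show "integrable seg (\<lambda>v. indicator {-d..d} v * (16 * d\<^sup>2 - (W - 4 * d)))"
        by (rule seg_bounded_integrable[of _ "\<bar>16 * d\<^sup>2 - (W - 4 * d)\<bar>"]) (auto split: split_indicator)
    qed
    show "integrable seg (\<lambda>v. (K v)\<^sup>2)"
    proof (rule Bochner_Integration.integrable_bound[OF i])
      show "AE v in seg. norm ((K v)\<^sup>2) \<le> norm (L v + indicator {-d..d} v * (16 * d\<^sup>2 - (W - 4 * d)))"
        using AE_seg by eventually_elim (use pt in fastforce)
    qed simp
  qed
  also have "\<dots> = W + d * (16 * d\<^sup>2 - (W - 4 * d))"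
  proof -
    have "integrable seg (\<lambda>v. indicator {-d..d} v :: real)"
      by (rule seg_bounded_integrable[of _ 1]) auto
    then show ?thesis using Li seg_interval[of d] d by (simp add: W4)
  qed
  also have "\<dots> \<le> (1 - d) * W + 12 * d\<^sup>2"
    using mult_left_mono[OF d(2), of "16 * d\<^sup>2"] by (simp add: power2_eq_square algebra_simps)
  finally show ?thesis by (simp add: K_def W_def)
qed

section \<open>Twist maps on a surface\<close>

lemma twist_profile_uminus: "twist_profile a a' r \<Longrightarrow> twist_profile (\<lambda>s. - a s) (\<lambda>s. - a' s) r"
  unfolding twist_profile_def by (auto intro!: derivative_eq_intros continuous_intros)

lemma twist_profile_quarter: "0 < d \<Longrightarrow> d < 1 \<Longrightarrow> twist_profile (quarter d) (quarter' d) (1 - d / 2)"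
  by (intro twist_profile.intro) (auto simp: quarter_deriv quarter'_cont quarter_outside)

context circle_surface begin

text \<open>The lift \<open>twists N a\<close> commutes with integer translations of the angle, so any branch of the coordinates
may be used.\<close>

definition twist_map :: "nat \<Rightarrow> (real \<Rightarrow> real) \<Rightarrow> 'a \<Rightarrow> 'a" where
  "twist_map N a x = (if x \<in> core M then E (twists N a (coord 0 x)) else x)"

lemma twist_map_E:
  assumes "twist_profile a a' r" "N > 0" "\<bar>y\<bar> \<le> 1"
  shows "twist_map N a (E (t, y)) = E (twists N a (t, y))"
proof -
  interpret twist_profile a a' r by fact
  show ?thesis
  proof (cases "\<bar>y\<bar> < 1")
    case True
    obtain t' where t': "coord 0 (E (t, y)) = (t', y)"
      using snd_coord[of 0 "E (t, y)"] Y_E[of y t] assms(3) by (metis prod.collapse)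
    have "E (t', y) = E (t, y)" using E_coord[OF E_core[OF True], of 0 t] t' by simp
    then have k: "t' - t \<in> \<int>" using E_eq_iff(2)[OF True True] by blast
    then have "real N * (t' - t) \<in> \<int>" by simp
    from twists_shift[OF assms(2) this, of t y]
    have "twists N a (t', y) = (fst (twists N a (t, y)) + (t' - t), snd (twists N a (t, y)))" by simp
    then have "E (twists N a (t', y)) = E (twists N a (t, y))"
      using E_shift[OF k, of "fst (twists N a (t, y))" "snd (twists N a (t, y))"] by simp
    then show ?thesis using E_core[OF True, of t] t' by (simp add: twist_map_def)
  next
    case False
    then have y: "\<bar>y\<bar> = 1" using assms(3) by simp
    then have "y\<^sup>2 = 1" by (metis power2_abs one_power2)
    then have "twists N a (t, y) = (t, y)" using r by (intro twists_id assms) simp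
    then show ?thesis using Z_E_1[OF y] by (simp add: twist_map_def)
  qed
qed

lemma twist_map_core:
  assumes "twist_profile a a' r" "N > 0" "x \<in> core M"
  shows "twist_map N a x \<in> core M"
proof -
  interpret twist_profile a a' r by fact
  obtain t y where x: "x = E (t, y)" "\<bar>y\<bar> < 1" using core_imp_E[OF assms(3)] .
  show ?thesis
    using twist_map_E[OF assms(1,2), of y t] x twists_strip[of "(t, y)" N] E_core[of "snd (twists N a (t, y))" "fst (twists N a (t, y))"]
    by simp
qed

lemma twist_map_inverse:
  assumes "twist_profile a a' r" "N > 0"
  shows "twist_map N (\<lambda>s. - a s) (twist_map N a x) = x"
proof (cases "x \<in> core M")
  case True
  interpret twist_profile a a' r by fact
  obtain t y where x: "x = E (t, y)" "\<bar>y\<bar> < 1" using core_imp_E[OF True] .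
  have "\<bar>snd (twists N a (t, y))\<bar> < 1" using twists_strip[of "(t, y)" N] x by simp
  then have "twist_map N (\<lambda>s. - a s) (E (twists N a (t, y))) = E (twists N (\<lambda>s. - a s) (twists N a (t, y)))"
    using twist_map_E[OF twist_profile_uminus[OF assms(1)] assms(2), of "snd (twists N a (t, y))" "fst (twists N a (t, y))"] by simp
  then show ?thesis
    using twist_map_E[OF assms, of y t] x twists_inverse[OF assms(2), of "(t, y)"] by simp
qed (simp add: twist_map_def)

lemma twist_map_permutes:
  assumes "twist_profile a a' r" "N > 0"
  shows "twist_map N a permutes carrier M" "inv (twist_map N a) = twist_map N (\<lambda>s. - a s)"
proof -
  have i: "twist_map N (\<lambda>s. - a s) (twist_map N a x) = x" "twist_map N a (twist_map N (\<lambda>s. - a s) x) = x" for x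
    using twist_map_inverse[OF assms] twist_map_inverse[OF twist_profile_uminus[OF assms(1)] assms(2)] by simp_all
  have c: "twist_map N b x \<in> carrier M" if "x \<in> carrier M" "twist_profile b b' r" for b b' x
    using twist_map_core[OF that(2) assms(2), of x] that(1) by (cases "x \<in> core M") (auto simp: core_eq twist_map_def[of N b x])
  have o: "twist_map N a x = x" if "x \<notin> carrier M" for x
    using that by (simp add: twist_map_def core_eq)
  show "twist_map N a permutes carrier M"
    by (rule bij_imp_permutes[OF bij_betwI[where g="twist_map N (\<lambda>s. - a s)"]])
      (use i c assms(1) twist_profile_uminus[OF assms(1)] o in auto)
  show "inv (twist_map N a) = twist_map N (\<lambda>s. - a s)" by (intro inv_equality i)
qed

lemma core_carrier: "x \<in> core M \<Longrightarrow> x \<in> carrier M"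
  by (simp add: core_eq)

lemma core_locally_open:
  assumes "x \<in> core M"
  obtains U where "open U" "x \<in> U" "U \<inter> carrier M \<subseteq> core M"
proof -
  have cZ: "continuous_on UNIV Z" using Z_linear by (rule linear_continuous_on)
  have cY: "continuous_on UNIV Y" using C1_at_imp_isCont[OF Y_C1] by (simp add: continuous_at_imp_continuous_on)
  have "open {x. Z x \<noteq> 0}" "open {x. \<bar>Y x\<bar> < 1}"
    by (intro open_Collect_neq open_Collect_less continuous_intros cZ cY)+
  then show ?thesis
    using assms by (intro that[of "{x. Z x \<noteq> 0} \<inter> {x. \<bar>Y x\<bar> < 1}"]) (auto simp: core_eq)
qed

text \<open>At a point of the core, \<open>F\<close> is the twist of one cell read through a local branch of the coordinates, and
\<open>D\<close> preserves the form because the twist has Jacobian \<open>1\<close>. Elsewhere the map is the identity nearby: it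
moves only points of a compact subset of the core.\<close>

lemma twist_map_local:
  assumes tp: "twist_profile a a' r" and N: "N > 0" and x: "x \<in> carrier M"
  shows "\<exists>F U D. C1_at F x \<and> open U \<and> x \<in> U \<and> (\<forall>z\<in>U \<inter> carrier M. F z = twist_map N a z) \<and>
    (F has_derivative D) (at x) \<and>
    (\<forall>u\<in>tangent M x. \<forall>v\<in>tangent M x. omega M (twist_map N a x) (D u) (D v) = omega M x u v)"
proof (cases "x \<in> core M")
  case True
  interpret twist_profile a a' r by fact
  obtain t y where xE: "x = E (t, y)" "\<bar>y\<bar> < 1" using core_imp_E[OF True] .
  obtain V j where V: "open V" "(t, y) \<in> V" "\<And>q. q \<in> V \<Longrightarrow> twists N a q = cell_twist N a j q"
    using twists_locally_cell[OF N, of "(t, y)"] by blast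
  let ?c = "coord t"
  have cx: "?c x = (t, y)" using coord_E(1)[of t t y] xE by simp
  have cC: "C1_at ?c x" using coord_C1_E[of t t y] xE by simp
  define p' where "p' = cell_twist N a j (t, y)"
  have p': "p' = twists N a (t, y)" using V by (simp add: p'_def)
  have sp': "\<bar>snd p'\<bar> < 1" unfolding p' using twists_strip[of "(t, y)"] xE by simp
  have gC: "C1_at (cell_twist N a j) (t, y)" by (rule C1_at_cell_twist[OF a_deriv a'_cont])
  obtain Dg where Dg: "(cell_twist N a j has_derivative Dg) (at (t, y))" "\<And>u v. det2 (Dg u) (Dg v) = det2 u v"
    using cell_twist_deriv[OF a_deriv N] by blast
  obtain Dc where Dc: "(?c has_derivative Dc) (at x)" using C1_at_imp_derivative[OF cC] .
  define F where "F z = E (cell_twist N a j (?c z))" for z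
  have F: "C1_at F x" unfolding F_def
    by (rule C1_at_compose[OF C1_at_compose[OF cC]]) (use gC E_C1[OF sp'] cx p'_def in auto)
  have FD: "(F has_derivative (\<lambda>u. E' p' (Dg (Dc u)))) (at x)" unfolding F_def
    by (rule has_derivative_compose[OF has_derivative_compose[OF Dc]]) (use Dg E_deriv[OF sp'] cx p'_def in auto)
  obtain U1 where U1: "open U1" "x \<in> U1" "U1 \<inter> carrier M \<subseteq> core M" using core_locally_open[OF True] .
  have "?c \<midarrow>x\<rightarrow> ?c x" using C1_at_imp_isCont[OF cC] by (simp add: isCont_def)
  then have "\<forall>\<^sub>F z in nhds x. ?c z \<in> V"
    using C1_at_imp_isCont[OF cC] V(1,2) cx by (metis isCont_def tendsto_at_iff_tendsto_nhds topological_tendstoD)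
  then obtain U2 where U2: "open U2" "x \<in> U2" "\<And>z. z \<in> U2 \<Longrightarrow> ?c z \<in> V" unfolding eventually_nhds by blast
  have FU: "F z = twist_map N a z" if "z \<in> (U1 \<inter> U2) \<inter> carrier M" for z
  proof -
    have zc: "z \<in> core M" using that U1 by blast
    have z: "E (?c z) = z" by (rule E_coord[OF zc])
    have "\<bar>snd (?c z)\<bar> < 1" using zc by (simp add: snd_coord core_eq)
    then have "twist_map N a (E (?c z)) = E (twists N a (?c z))"
      using twist_map_E[OF tp N, of "snd (?c z)" "fst (?c z)"] by simp
    then show ?thesis using z V(3)[OF U2(3)] that by (simp add: F_def)
  qed
  have Fx: "twist_map N a x = E p'" using twist_map_E[OF tp N, of y t] xE p' by simp
  have "((\<lambda>q. ?c (E q)) has_derivative (\<lambda>u. Dc (E' (t, y) u))) (at (t, y))"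
    by (rule has_derivative_compose[OF E_deriv]) (use Dc xE in auto)
  moreover have "((\<lambda>q. ?c (E q)) has_derivative (\<lambda>u. u)) (at (t, y))"
  proof (rule has_derivative_transform_within_open[where s="{q. \<bar>fst q - t\<bar> < 1/2 \<and> \<bar>snd q\<bar> < 1}"])
    show "open {q::real \<times> real. \<bar>fst q - t\<bar> < 1/2 \<and> \<bar>snd q\<bar> < 1}"
      by (intro open_Collect_conj open_Collect_less continuous_intros)
    show "q = ?c (E q)" if "q \<in> {q. \<bar>fst q - t\<bar> < 1/2 \<and> \<bar>snd q\<bar> < 1}" for q
      using coord_E(1)[of "fst q" t "snd q"] that by simp
  qed (use xE in auto)
  ultimately have "(\<lambda>u. Dc (E' (t, y) u)) = (\<lambda>u. u)" by (rule has_derivative_unique)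
  then have DcE: "Dc (E' (t, y) u) = u" for u by metis
  have "omega M (twist_map N a x) (E' p' (Dg (Dc u))) (E' p' (Dg (Dc v))) = omega M x u v"
    if uv: "u \<in> tangent M x" "v \<in> tangent M x" for u v
  proof -
    have sy: "\<bar>snd (t, y)\<bar> < 1" using xE by simp
    obtain u0 v0 where u0: "u = E' (t, y) u0" "v = E' (t, y) v0"
      using uv tangent_E[OF sy] xE(1) by auto
    show ?thesis unfolding u0 DcE Fx omega_E[OF sp'] Dg(2) unfolding xE(1) omega_E[OF sy] ..
  qed
  then show ?thesis using F FD FU U1 U2
    by (intro exI[of _ F] exI[of _ "U1 \<inter> U2"] exI[of _ "\<lambda>u. E' p' (Dg (Dc u))"]) auto
next
  case False
  interpret twist_profile a a' r by fact
  define K where "K = E ` ({0..1} \<times> {-sqrt r..sqrt r})"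
  have K: "K \<subseteq> core M"
  proof
    fix z assume "z \<in> K"
    then obtain t y where z: "z = E (t, y)" "-sqrt r \<le> y" "y \<le> sqrt r" by (auto simp: K_def)
    have "sqrt r < 1" using r by simp
    then have "\<bar>y\<bar> < 1" using z by linarith
    then show "z \<in> core M" using z E_core by simp
  qed
  have "compact K" unfolding K_def
    by (intro compact_continuous_image continuous_on_subset[OF E_cont] compact_Times) auto
  then have oU: "open (- K)" by (simp add: compact_imp_closed open_Compl)
  have id: "twist_map N a z = z" if "z \<notin> K" "z \<in> carrier M" for z
  proof (cases "z \<in> core M")
    case True
    obtain t y where z: "z = E (t, y)" "\<bar>y\<bar> < 1" using core_imp_E[OF True] .
    have zf: "z = E (frac t, y)" using E_shift[of "- of_int \<lfloor>t\<rfloor>" t y] z by (simp add: frac_def)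
    have "y\<^sup>2 \<ge> r"
    proof (rule ccontr)
      assume "\<not> y\<^sup>2 \<ge> r"
      then have "\<bar>y\<bar> < sqrt r" by (intro real_less_rsqrt) simp
      then have "z \<in> K" unfolding K_def zf by (intro imageI) (auto simp: frac_lt_1 less_imp_le abs_le_iff)
      then show False using that by simp
    qed
    then show ?thesis using twist_map_E[OF tp N, of y t] twists_id[OF N, of "(t, y)"] z by simp
  qed (simp add: twist_map_def)
  then show ?thesis using False K oU x
    by (intro exI[of _ "\<lambda>z. z"] exI[of _ "- K"] exI[of _ "\<lambda>u. u"]) (auto simp: C1_at_ident twist_map_def[of N a x])
qed

lemma twist_map_Symp1:
  assumes tp: "twist_profile a a' r" and N: "N > 0"
  shows "twist_map N a \<in> Symp1 M"
proof -
  have C1: "C1_on (carrier M) (twist_map N b)" if "twist_profile b b' r" for b b'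
    unfolding C1_on_iff using twist_map_local[OF that N] by meson
  have "preserves_omega M (twist_map N a)"
    unfolding preserves_omega_def
  proof
    fix x assume x: "x \<in> carrier M"
    obtain F U D where F: "open U" "x \<in> U" "\<forall>z\<in>U \<inter> carrier M. F z = twist_map N a z"
      "(F has_derivative D) (at x)"
      "\<forall>u\<in>tangent M x. \<forall>v\<in>tangent M x. omega M (twist_map N a x) (D u) (D v) = omega M x u v"
      using twist_map_local[OF tp N x] by blast
    have "(twist_map N a has_derivative D) (at x within carrier M)"
      by (rule has_derivative_within_local[OF F(4,1,2) x]) (use F(3) in auto)
    then show "\<exists>D. (twist_map N a has_derivative D) (at x within carrier M) \<and>
        (\<forall>u\<in>tangent M x. \<forall>v\<in>tangent M x. omega M (twist_map N a x) (D u) (D v) = omega M x u v)"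
      using F(5) by blast
  qed
  then show ?thesis
    using C1[OF tp] C1[OF twist_profile_uminus[OF tp]] twist_map_permutes[OF tp N] by (simp add: Symp1_def)
qed

lemma rotation_core_iff: "x \<in> carrier M \<Longrightarrow> rotation M \<alpha> x \<in> core M \<longleftrightarrow> x \<in> core M"
proof -
  have *: "rotation M \<alpha> x \<in> core M" if "x \<in> core M" for \<alpha> x
  proof -
    obtain t y where x: "x = E (t, y)" "\<bar>y\<bar> < 1" using core_imp_E[OF \<open>x \<in> core M\<close>] .
    obtain s where "\<alpha> = angle s" using angle_surj by blast
    then show ?thesis using rotation_E[of y s t] x E_core by simp
  qed
  have "rotation M (- \<alpha>) (rotation M \<alpha> x) = x"
    using rotation_add[of "- \<alpha>" \<alpha>] by (simp add: rotation_0 fun_eq_iff)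
  then show ?thesis using *[of x \<alpha>] *[of "rotation M \<alpha> x" "- \<alpha>"] by metis
qed

lemma twist_map_rotation:
  assumes tp: "twist_profile a a' r" and N: "N > 0" and k: "real N * k \<in> \<int>"
  shows "twist_map N a \<circ> rotation M (angle k) = rotation M (angle k) \<circ> twist_map N a"
proof
  interpret twist_profile a a' r by fact
  fix x
  consider "x \<in> core M" | "x \<in> carrier M" "x \<notin> core M" | "x \<notin> carrier M" using core_carrier by blast
  then show "(twist_map N a \<circ> rotation M (angle k)) x = (rotation M (angle k) \<circ> twist_map N a) x"
  proof cases
    case 1
    obtain t y where x: "x = E (t, y)" "\<bar>y\<bar> < 1" using core_imp_E[OF 1] .
    have s: "\<bar>snd (twists N a (t, y))\<bar> < 1" using twists_strip[of "(t, y)" N] x by simp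
    have "twist_map N a (rotation M (angle k) x) = E (twists N a (t + k, y))"
      using x rotation_E[of y k t] twist_map_E[OF tp N, of y "t + k"] by (simp add: add.commute)
    also have "\<dots> = E (fst (twists N a (t, y)) + k, snd (twists N a (t, y)))"
      using twists_shift[OF N k] by simp
    also have "\<dots> = rotation M (angle k) (E (twists N a (t, y)))"
      using rotation_E[of "snd (twists N a (t, y))" k "fst (twists N a (t, y))"] s by (simp add: add.commute)
    also have "\<dots> = rotation M (angle k) (twist_map N a x)"
      using x twist_map_E[OF tp N, of y t] by simp
    finally show ?thesis by simp
  next
    case 2
    then show ?thesis using rotation_core_iff[of x "angle k"] by (simp add: twist_map_def)
  next
    case 3
    then show ?thesis using core_carrier by (auto simp: twist_map_def rotation_def)
  qed
qed

end

section \<open>Equidistribution of circles\<close>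

context circle_surface begin

definition circle_average :: "('a \<Rightarrow> real) \<Rightarrow> real \<Rightarrow> real" where
  "circle_average \<psi> y = (\<integral>t. \<psi> (E (t, y)) \<partial>circ)"

text \<open>It vanishes when \<open>\<psi>\<close> has the same average on almost every circle.\<close>

definition circle_variance :: "('a \<Rightarrow> real) \<Rightarrow> real" where
  "circle_variance \<psi> = (\<integral>y. (circle_average \<psi> y - (\<integral>x. \<psi> x \<partial>Leb M))\<^sup>2 \<partial>seg)"

definition test_function :: "('a \<Rightarrow> real) \<Rightarrow> bool" where
  "test_function \<psi> \<longleftrightarrow> \<psi> \<in> borel_measurable borel \<and> continuous_on (carrier M) \<psi> \<and> (\<forall>x\<in>carrier M. \<bar>\<psi> x\<bar> \<le> 1)"

lemma test_function_compose:
  assumes "test_function \<psi>" "g \<in> Symp0 M"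
  shows "test_function (\<lambda>x. \<psi> (g x))"
  unfolding test_function_def
proof (intro conjI)
  show "(\<lambda>x. \<psi> (g x)) \<in> borel_measurable borel"
    using assms Symp0_measurable[OF assms(2)] unfolding test_function_def by (auto intro: measurable_compose)
  show "continuous_on (carrier M) (\<lambda>x. \<psi> (g x))"
    using assms unfolding test_function_def
    by (intro continuous_on_compose2[of "carrier M" \<psi> _ g] Symp0_cont) (auto simp: Symp0_carrier)
  show "\<forall>x\<in>carrier M. \<bar>\<psi> (g x)\<bar> \<le> 1" using assms by (auto simp: test_function_def Symp0_carrier)
qed

lemma integral_Symp0:
  assumes g: "g \<in> Symp0 M" and \<psi>: "\<psi> \<in> borel_measurable borel"
  shows "(\<integral>x. \<psi> (g x) \<partial>Leb M) = (\<integral>x. (\<psi> x :: real) \<partial>Leb M)"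
proof -
  have "g \<in> measurable (Leb M) (Leb M)" using Symp0_measurable[OF g] by (simp cong: measurable_cong_sets)
  then show ?thesis using integral_distr[of g "Leb M" "Leb M" \<psi>] Symp0_distr[OF g] \<psi> by simp
qed

lemma test_function_E:
  assumes "test_function \<psi>"
  shows "(\<lambda>p. \<psi> (E p)) \<in> borel_measurable borel" "(\<lambda>t. \<psi> (E (t, y))) \<in> borel_measurable borel"
    "\<bar>y\<bar> \<le> 1 \<Longrightarrow> \<bar>\<psi> (E (t, y))\<bar> \<le> 1"
proof -
  show m: "(\<lambda>p. \<psi> (E p)) \<in> borel_measurable borel"
    using assms E_measurable unfolding test_function_def by (auto intro: measurable_compose)
  show "(\<lambda>t. \<psi> (E (t, y))) \<in> borel_measurable borel"
    by (intro measurable_compose[OF _ m] pair_borel_measurable) auto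
  show "\<bar>y\<bar> \<le> 1 \<Longrightarrow> \<bar>\<psi> (E (t, y))\<bar> \<le> 1"
    using assms E_carrier[of y t] unfolding test_function_def by blast
qed

lemma circle_average_measurable:
  assumes "test_function \<psi>"
  shows "circle_average \<psi> \<in> borel_measurable borel"
  using circ_average_measurable[OF test_function_E(1)[OF assms]] by (simp add: circle_average_def[abs_def])

lemma circle_average_bound:
  assumes "test_function \<psi>" "\<bar>y\<bar> \<le> 1"
  shows "\<bar>circle_average \<psi> y\<bar> \<le> 1"
  unfolding circle_average_def using test_function_E[OF assms(1)] assms(2) by (intro circ_abs_integral_le) auto

lemma integral_circle_average:
  assumes "test_function \<psi>"
  shows "(\<integral>x. \<psi> x \<partial>Leb M) = (\<integral>y. circle_average \<psi> y \<partial>seg)" "\<bar>\<integral>x. \<psi> x \<partial>Leb M\<bar> \<le> 1"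
    "integrable (Leb M) \<psi>"
proof -
  have b: "\<psi> \<in> borel_measurable borel" "\<And>x. x \<in> carrier M \<Longrightarrow> \<bar>\<psi> x\<bar> \<le> 1"
    using assms by (auto simp: test_function_def)
  show i: "(\<integral>x. \<psi> x \<partial>Leb M) = (\<integral>y. circle_average \<psi> y \<partial>seg)"
    unfolding circle_average_def by (rule integral_Leb(2)[OF b])
  show "integrable (Leb M) \<psi>" by (rule integral_Leb(1)[OF b])
  have "\<bar>\<integral>y. circle_average \<psi> y \<partial>seg\<bar> \<le> (\<integral>y. \<bar>circle_average \<psi> y\<bar> \<partial>seg)" by (rule integral_abs_bound)
  also have "\<dots> \<le> (\<integral>y. 1 \<partial>seg)"
  proof (rule integral_mono_AE)
    show "integrable seg (\<lambda>y. \<bar>circle_average \<psi> y\<bar>)"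
      by (rule seg_bounded_integrable[of _ 1])
        (use circle_average_bound[OF assms] circle_average_measurable[OF assms] in auto)
    show "AE y in seg. \<bar>circle_average \<psi> y\<bar> \<le> 1"
      using AE_seg by eventually_elim (use circle_average_bound[OF assms] in auto)
  qed simp
  finally show "\<bar>\<integral>x. \<psi> x \<partial>Leb M\<bar> \<le> 1" using i by (simp add: seg.prob_space[simplified])
qed

lemma circle_variance_le_4:
  assumes "test_function \<psi>"
  shows "circle_variance \<psi> \<le> 4"
proof -
  let ?m = "\<integral>x. \<psi> x \<partial>Leb M"
  have b: "(circle_average \<psi> y - ?m)\<^sup>2 \<le> 4" if "\<bar>y\<bar> < 1" for y
  proof -
    have "\<bar>circle_average \<psi> y - ?m\<bar> \<le> 2"
      using circle_average_bound[OF assms less_imp_le[OF that]] integral_circle_average(2)[OF assms] by (simp add: abs_le_iff)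
    then have "\<bar>circle_average \<psi> y - ?m\<bar>\<^sup>2 \<le> 2\<^sup>2" by (intro power_mono) auto
    then show ?thesis by simp
  qed
  have "circle_variance \<psi> \<le> (\<integral>y. 4 \<partial>seg)" unfolding circle_variance_def
  proof (rule integral_mono_AE)
    show "integrable seg (\<lambda>y. (circle_average \<psi> y - ?m)\<^sup>2)"
      by (rule seg_bounded_integrable[of _ 4]) (use b circle_average_measurable[OF assms] in auto)
    show "AE y in seg. (circle_average \<psi> y - ?m)\<^sup>2 \<le> 4" using AE_seg by eventually_elim (rule b)
  qed simp
  then show ?thesis by (simp add: seg.prob_space[simplified])
qed

text \<open>For \<open>N\<close> large, \<open>twists_average\<close> reduces the new circle averages to the situation of \<open>mixing_estimate\<close>;
the error \<open>e\<close> is chosen to contribute at most \<open>d\<^sup>2\<close>.\<close>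

lemma twist_map_variance:
  assumes \<psi>: "test_function \<psi>" and d: "0 < d" "d \<le> 1 / 2"
  shows "\<exists>N0. \<forall>N\<ge>N0. N > 0 \<longrightarrow>
    circle_variance (\<lambda>x. \<psi> (twist_map N (quarter d) x)) \<le> (1 - d) * circle_variance \<psi> + 13 * d\<^sup>2"
proof -
  let ?a = "quarter d"
  have tp: "twist_profile ?a (quarter' d) (1 - d / 2)" using d by (intro twist_profile_quarter) auto
  interpret twist_profile ?a "quarter' d" "1 - d / 2" by (rule tp)
  define m where "m = (\<integral>x. \<psi> x \<partial>Leb M)"
  define \<Phi> where "\<Phi> y = circle_average \<psi> y - m" for y
  define \<gamma> where "\<gamma> p = snd (twist ?a p)" for p
  define e where "e = d\<^sup>2 / 5"
  have e: "0 < e" "e \<le> 1" using d power_mono[of d 1 2] by (auto simp: e_def)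
  have m1: "\<bar>m\<bar> \<le> 1" unfolding m_def by (rule integral_circle_average(2)[OF \<psi>])
  have \<Phi>m [measurable]: "\<Phi> \<in> borel_measurable borel"
    unfolding \<Phi>_def using circle_average_measurable[OF \<psi>] by simp
  have \<Phi>b: "\<bar>\<Phi> y\<bar> \<le> 2" if "\<bar>y\<bar> \<le> 1" for y
    using circle_average_bound[OF \<psi> that] m1 by (simp add: \<Phi>_def abs_le_iff)
  have tm: "twist ?a \<in> borel_measurable borel" by (rule twist_measurable) simp
  have \<gamma>m: "\<gamma> \<in> borel_measurable borel" unfolding \<gamma>_def by (rule measurable_compose[OF tm]) simp
  have \<gamma>sm: "(\<lambda>s. \<gamma> (2 * s - 1, v)) \<in> borel_measurable borel" for v
    by (intro measurable_compose[OF _ \<gamma>m] pair_borel_measurable) auto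
  have \<gamma>1: "\<bar>\<gamma> (u, v)\<bar> \<le> 1" if "\<bar>u\<bar> \<le> 1" "\<bar>v\<bar> \<le> 1" for u v
    using twist_square[of "(u, v)"] that by (simp add: \<gamma>_def)
  have turn: "\<gamma> (u, v) = u" if "u\<^sup>2 + v\<^sup>2 \<le> 1 - d" for u v
    unfolding \<gamma>_def twist_def Let_def fst_conv snd_conv quarter_inside[OF d(1) that] by simp
  have ci: "integrable seg (circle_average \<psi>)"
    by (rule seg_bounded_integrable[of _ 1]) (use circle_average_bound[OF \<psi>] circle_average_measurable[OF \<psi>] in auto)
  have mean: "(\<integral>y. \<Phi> y \<partial>seg) = 0"
    unfolding \<Phi>_def using ci integral_circle_average(1)[OF \<psi>] by (simp add: m_def seg.prob_space[simplified])
  have area: "(\<integral>v. (\<integral>s. (\<Phi> (\<gamma> (2 * s - 1, v)))\<^sup>2 \<partial>circ) \<partial>seg) = (\<integral>y. (\<Phi> y)\<^sup>2 \<partial>seg)"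
  proof -
    \<comment> \<open>Preservation of area is obtained from the invariance of \<open>Leb\<close> under the twist map with one cell.\<close>
    let ?sq = "\<lambda>x. (\<Phi> (Y x))\<^sup>2"
    let ?g = "twist_map 1 ?a"
    have g: "?g \<in> Symp0 M" by (intro Symp1_imp_Symp0 twist_map_Symp1[OF tp]) simp
    have "continuous_on UNIV Y" using C1_at_imp_isCont[OF Y_C1] by (simp add: continuous_at_imp_continuous_on)
    then have Ym [measurable]: "Y \<in> borel_measurable borel" by (rule borel_measurable_continuous_onI)
    have cm: "?sq \<in> borel_measurable borel" by measurable
    define sq where "sq x = (if \<bar>Y x\<bar> \<le> 1 then ?sq x else 0)" for x
    have sqm: "sq \<in> borel_measurable borel" unfolding sq_def by measurable
    have sqb: "\<bar>sq x\<bar> \<le> 4" for x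
      using power_mono[OF \<Phi>b[of "Y x"], of 2] by (auto simp: sq_def)
    have sqgm: "(\<lambda>x. sq (?g x)) \<in> borel_measurable borel"
      using measurable_compose[OF Symp0_measurable[OF g] sqm] .
    have "(\<integral>x. sq x \<partial>Leb M) = (\<integral>y. (\<integral>t. sq (E (t, y)) \<partial>circ) \<partial>seg)"
      by (rule integral_Leb(2)[OF sqm sqb])
    also have "\<dots> = (\<integral>y. (\<Phi> y)\<^sup>2 \<partial>seg)"
    proof (rule integral_cong_AE)
      show "AE y in seg. (\<integral>t. sq (E (t, y)) \<partial>circ) = (\<Phi> y)\<^sup>2"
        using AE_seg by eventually_elim (simp add: sq_def Y_E circ.prob_space[simplified])
      show "(\<lambda>y. \<integral>t. sq (E (t, y)) \<partial>circ) \<in> borel_measurable seg"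
        using circ_average_measurable[OF measurable_compose[OF E_measurable sqm]] by simp
    qed simp
    finally have 1: "(\<integral>x. sq x \<partial>Leb M) = (\<integral>y. (\<Phi> y)\<^sup>2 \<partial>seg)" .
    have pt: "sq (?g (E (t, y))) = (\<Phi> (\<gamma> (2 * t - 1, y)))\<^sup>2" if "0 \<le> t" "t < 1" "\<bar>y\<bar> < 1" for t y
    proof -
      have f: "\<lfloor>real 1 * t\<rfloor> = 0" using that by (simp add: floor_eq_iff)
      have s: "snd (twists 1 ?a (t, y)) = \<gamma> (2 * t - 1, y)"
        unfolding twists_def fst_conv f by (simp add: cell_twist_def cell_out_def cell_in_def \<gamma>_def)
      have "\<bar>\<gamma> (2 * t - 1, y)\<bar> \<le> 1" using that by (intro \<gamma>1) auto
      then have "Y (?g (E (t, y))) = \<gamma> (2 * t - 1, y)"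
        using twist_map_E[OF tp, of 1 y t] that s Y_E[of "snd (twists 1 ?a (t, y))" "fst (twists 1 ?a (t, y))", unfolded prod.collapse] by simp
      then show ?thesis using \<open>\<bar>\<gamma> (2 * t - 1, y)\<bar> \<le> 1\<close> by (simp add: sq_def)
    qed
    have "(\<integral>x. sq (?g x) \<partial>Leb M) = (\<integral>y. (\<integral>t. sq (?g (E (t, y))) \<partial>circ) \<partial>seg)"
      by (rule integral_Leb(2)[OF sqgm sqb])
    also have "\<dots> = (\<integral>v. (\<integral>s. (\<Phi> (\<gamma> (2 * s - 1, v)))\<^sup>2 \<partial>circ) \<partial>seg)"
    proof (rule integral_cong_AE)
      show "AE y in seg. (\<integral>t. sq (?g (E (t, y))) \<partial>circ) = (\<integral>s. (\<Phi> (\<gamma> (2 * s - 1, y)))\<^sup>2 \<partial>circ)"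
        using AE_seg
      proof eventually_elim
        fix y :: real assume y: "\<bar>y\<bar> < 1"
        show "(\<integral>t. sq (?g (E (t, y))) \<partial>circ) = (\<integral>s. (\<Phi> (\<gamma> (2 * s - 1, y)))\<^sup>2 \<partial>circ)"
        proof (rule integral_cong_AE)
          show "AE t in circ. sq (?g (E (t, y))) = (\<Phi> (\<gamma> (2 * t - 1, y)))\<^sup>2"
            using AE_circ by eventually_elim (use pt y in auto)
          show "(\<lambda>t. sq (?g (E (t, y)))) \<in> borel_measurable circ"
            using measurable_compose[OF pair_borel_measurable[of "\<lambda>t. t" borel "\<lambda>_. y"] measurable_compose[OF E_measurable sqgm]] by simp
          show "(\<lambda>s. (\<Phi> (\<gamma> (2 * s - 1, y)))\<^sup>2) \<in> borel_measurable circ"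
            using measurable_compose[OF \<gamma>sm \<Phi>m] by simp
        qed
      qed
      show "(\<lambda>y. \<integral>t. sq (?g (E (t, y))) \<partial>circ) \<in> borel_measurable seg"
        using circ_average_measurable[OF measurable_compose[OF E_measurable sqgm]] by simp
      have "(\<lambda>p. (\<Phi> (\<gamma> (2 * fst p - 1, snd p)))\<^sup>2) \<in> borel_measurable borel"
        by (intro borel_measurable_power measurable_compose[OF _ \<Phi>m] measurable_compose[OF _ \<gamma>m] pair_borel_measurable) measurable
      from circ_average_measurable[OF this]
      show "(\<lambda>y. \<integral>s. (\<Phi> (\<gamma> (2 * s - 1, y)))\<^sup>2 \<partial>circ) \<in> borel_measurable seg" by simp
    qed
    finally show ?thesis using integral_Symp0[OF g sqm] 1 by simp
  qed
  define K where "K v = (\<integral>s. \<Phi> (\<gamma> (2 * s - 1, v)) \<partial>circ)" for v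
  have mix: "(\<integral>v. (K v)\<^sup>2 \<partial>seg) \<le> (1 - d) * circle_variance \<psi> + 12 * d\<^sup>2"
    unfolding K_def circle_variance_def m_def[symmetric] \<Phi>_def[symmetric]
    by (rule mixing_estimate[OF \<Phi>m \<gamma>m \<Phi>b mean d _ turn area]) (use \<gamma>1 in auto)
  have Km: "K \<in> borel_measurable borel"
  proof -
    have "(\<lambda>p. \<Phi> (\<gamma> (2 * fst p - 1, snd p))) \<in> borel_measurable borel"
      by (intro measurable_compose[OF _ \<Phi>m] measurable_compose[OF _ \<gamma>m] pair_borel_measurable) measurable
    from circ_average_measurable[OF this] show ?thesis by (simp add: K_def[abs_def])
  qed
  have Kb: "\<bar>K v\<bar> \<le> 2" if "\<bar>v\<bar> < 1" for v unfolding K_def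
    by (rule circ_abs_integral_le[OF measurable_compose[OF \<gamma>sm \<Phi>m]]) (use \<Phi>b \<gamma>1 that in auto)
  have "compact ({0..1::real} \<times> {-1..1::real})" by (intro compact_Times) auto
  moreover have "continuous_on ({0..1} \<times> {-1..1}) (\<lambda>p. \<psi> (E p))"
    using \<psi> E_carrier unfolding test_function_def
    by (intro continuous_on_compose2[of "carrier M" \<psi> _ E] continuous_on_subset[OF E_cont]) auto
  ultimately have "uniformly_continuous_on ({0..1} \<times> {-1..1}) (\<lambda>p. \<psi> (E p))"
    by (rule compact_uniformly_continuous[rotated])
  from uniformly_continuous_onE[OF this e(1)] obtain \<delta> where \<delta>: "\<delta> > 0"
    "\<And>p q. \<lbrakk>p \<in> {0..1} \<times> {-1..1}; q \<in> {0..1} \<times> {-1..1}; dist q p < \<delta>\<rbrakk> \<Longrightarrow> dist (\<psi> (E q)) (\<psi> (E p)) < e" by metis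
  obtain N0 where N0: "real N0 > 1 / \<delta>" using reals_Archimedean2 by blast
  show ?thesis
  proof (intro exI[of _ N0] allI impI)
    fix N assume N: "N0 \<le> N" "0 < N"
    let ?g = "twist_map N ?a"
    have gS: "?g \<in> Symp0 M" by (intro Symp1_imp_Symp0 twist_map_Symp1[OF tp] N)
    define \<psi>g where "\<psi>g x = \<psi> (?g x)" for x
    have \<psi>g: "test_function \<psi>g" unfolding \<psi>g_def[abs_def] by (rule test_function_compose[OF \<psi> gS])
    have "1 / real N < \<delta>"
    proof -
      have "real N > 1 / \<delta>" using N0 N(1) by linarith
      then show ?thesis using \<delta>(1) N(2) by (simp add: field_simps)
    qed
    then have mod: "\<bar>\<psi> (E (t, y)) - \<psi> (E (t', y))\<bar> \<le> e"
      if "t \<in> {0..1}" "t' \<in> {0..1}" "\<bar>y\<bar> \<le> 1" "\<bar>t - t'\<bar> \<le> 1 / real N" for t t' y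
      using \<delta>(2)[of "(t', y)" "(t, y)"] that by (auto simp: dist_Pair_Pair dist_real_def abs_le_iff)
    have close: "\<bar>circle_average \<psi>g v - m - K v\<bar> \<le> e" if v: "\<bar>v\<bar> < 1" for v
    proof -
      have *: "circle_average \<psi>g v = (\<integral>t. \<psi> (E (twists N ?a (t, v))) \<partial>circ)"
        unfolding circle_average_def \<psi>g_def using v twist_map_E[OF tp N(2)] by simp
      have "\<bar>circle_average \<psi>g v - (\<integral>s. circle_average \<psi> (\<gamma> (2 * s - 1, v)) \<partial>circ)\<bar> \<le> e"
        unfolding * unfolding circle_average_def \<gamma>_def
        by (rule twists_average[where B=1]) (use test_function_E[OF \<psi>] N v mod in auto)
      moreover have "(\<integral>s. circle_average \<psi> (\<gamma> (2 * s - 1, v)) \<partial>circ) = K v + m"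
      proof -
        have "integrable circ (\<lambda>s. \<Phi> (\<gamma> (2 * s - 1, v)))"
          by (rule circ_bounded_integrable[OF measurable_compose[OF \<gamma>sm \<Phi>m], of v 2]) (use \<Phi>b \<gamma>1 v in auto)
        then have "(\<integral>s. \<Phi> (\<gamma> (2 * s - 1, v)) + m \<partial>circ) = K v + m"
          by (simp add: K_def circ.prob_space[simplified])
        then show ?thesis by (simp add: \<Phi>_def)
      qed
      ultimately show ?thesis by simp
    qed
    have mg: "(\<integral>x. \<psi>g x \<partial>Leb M) = m"
      unfolding \<psi>g_def m_def using \<psi> by (intro integral_Symp0[OF gS]) (simp add: test_function_def)
    have pt: "(circle_average \<psi>g v - m)\<^sup>2 \<le> (K v)\<^sup>2 + d\<^sup>2" if v: "\<bar>v\<bar> < 1" for v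
    proof -
      have "\<bar>circle_average \<psi>g v - m\<bar> \<le> \<bar>K v\<bar> + e" using close[OF v] by linarith
      then have "\<bar>circle_average \<psi>g v - m\<bar>\<^sup>2 \<le> (\<bar>K v\<bar> + e)\<^sup>2" by (intro power_mono) auto
      also have "\<dots> = (K v)\<^sup>2 + (2 * \<bar>K v\<bar> + e) * e" by (simp add: power2_eq_square algebra_simps)
      also have "\<dots> \<le> (K v)\<^sup>2 + 5 * e" using Kb[OF v] e by (intro add_left_mono mult_right_mono) auto
      finally show ?thesis by (simp add: e_def)
    qed
    have Ki: "integrable seg (\<lambda>v. (K v)\<^sup>2)"
    proof (rule seg_bounded_integrable[of _ 4])
      fix v :: real assume v: "\<bar>v\<bar> < 1"
      show "\<bar>(K v)\<^sup>2\<bar> \<le> 4" using power_mono[OF Kb[OF v], of 2] by simp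
    qed (use Km in simp)
    have "circle_variance \<psi>g \<le> (\<integral>v. (K v)\<^sup>2 + d\<^sup>2 \<partial>seg)"
      unfolding circle_variance_def mg
    proof (rule integral_mono_AE)
      show i: "integrable seg (\<lambda>v. (K v)\<^sup>2 + d\<^sup>2)" using Ki by simp
      show "AE v in seg. (circle_average \<psi>g v - m)\<^sup>2 \<le> (K v)\<^sup>2 + d\<^sup>2"
        using AE_seg by eventually_elim (rule pt)
      show "integrable seg (\<lambda>v. (circle_average \<psi>g v - m)\<^sup>2)"
      proof (rule seg_bounded_integrable[of _ "5"])
        fix v :: real assume v: "\<bar>v\<bar> < 1"
        have "(K v)\<^sup>2 \<le> 4" using power_mono[OF Kb[OF v], of 2] by simp
        moreover have "d\<^sup>2 \<le> 1" using d power_mono[of d 1 2] by simp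
        ultimately show "\<bar>(circle_average \<psi>g v - m)\<^sup>2\<bar> \<le> 5" using pt[OF v] by simp
      qed (use circle_average_measurable[OF \<psi>g] in simp)
    qed
    also have "\<dots> = (\<integral>v. (K v)\<^sup>2 \<partial>seg) + d\<^sup>2" using Ki by (simp add: seg.prob_space[simplified])
    finally show "circle_variance (\<lambda>x. \<psi> (?g x)) \<le> (1 - d) * circle_variance \<psi> + 13 * d\<^sup>2"
      using mix by (simp add: \<psi>g_def[abs_def])
  qed
qed

text \<open>Twist maps with finer cells are composed on the right, so that each step acts on the functions \<open>\<psi>
\<circ> g\<close> already obtained. The number of cells is a multiple of \<open>q\<close>, which makes the maps commute with
the rotations of order \<open>q\<close>. The bound is stable under \<open>W \<mapsto> (1 - d) * W + 13 * d\<^sup>2\<close>.\<close>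

lemma equidistributing_map_rate:
  assumes \<Psi>: "finite \<Psi>" "\<And>\<psi>. \<psi> \<in> \<Psi> \<Longrightarrow> test_function \<psi>" and q: "q > (0 :: nat)" and d: "0 < d" "d \<le> 1 / 2"
  shows "\<exists>g\<in>Symp1 M. (\<forall>x. x \<notin> core M \<longrightarrow> g x = x) \<and>
    (\<forall>k. real q * k \<in> \<int> \<longrightarrow> g \<circ> rotation M (angle k) = rotation M (angle k) \<circ> g) \<and>
    (\<forall>\<psi>\<in>\<Psi>. circle_variance (\<lambda>x. \<psi> (g x)) \<le> 4 * (1 - d) ^ n + 13 * d)"
proof (induction n)
  case 0
  have "circle_variance \<psi> \<le> 4 * (1 - d) ^ 0 + 13 * d" if "\<psi> \<in> \<Psi>" for \<psi>
    using circle_variance_le_4[OF \<Psi>(2)[OF that]] d by simp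
  then show ?case using Symp1_id by (intro bexI[of _ id]) auto
next
  case (Suc n)
  then obtain g where g: "g \<in> Symp1 M" "\<And>x. x \<notin> core M \<Longrightarrow> g x = x"
    "\<And>k. real q * k \<in> \<int> \<Longrightarrow> g \<circ> rotation M (angle k) = rotation M (angle k) \<circ> g"
    "\<And>\<psi>. \<psi> \<in> \<Psi> \<Longrightarrow> circle_variance (\<lambda>x. \<psi> (g x)) \<le> 4 * (1 - d) ^ n + 13 * d" by blast
  have tp: "twist_profile (quarter d) (quarter' d) (1 - d / 2)" using d by (intro twist_profile_quarter) auto
  have "\<exists>N0. \<forall>N\<ge>N0. N > 0 \<longrightarrow> circle_variance (\<lambda>x. \<psi> (g (twist_map N (quarter d) x))) \<le>
      (1 - d) * circle_variance (\<lambda>x. \<psi> (g x)) + 13 * d\<^sup>2" if "\<psi> \<in> \<Psi>" for \<psi>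
    using twist_map_variance[OF test_function_compose[OF \<Psi>(2)[OF that] Symp1_imp_Symp0[OF g(1)]] d] .
  then obtain N0 where N0: "\<And>\<psi> N. \<psi> \<in> \<Psi> \<Longrightarrow> N \<ge> N0 \<psi> \<Longrightarrow> N > 0 \<Longrightarrow>
      circle_variance (\<lambda>x. \<psi> (g (twist_map N (quarter d) x))) \<le> (1 - d) * circle_variance (\<lambda>x. \<psi> (g x)) + 13 * d\<^sup>2"
    by metis
  \<comment> \<open>A positive multiple of \<open>q\<close> above all the thresholds.\<close>
  define N where "N = q * (Suc (\<Sum>\<psi>\<in>\<Psi>. N0 \<psi>))"
  have N: "N > 0" using q by (simp add: N_def)
  have NN0: "N0 \<psi> \<le> N" if "\<psi> \<in> \<Psi>" for \<psi>
  proof -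
    have "N0 \<psi> \<le> (\<Sum>\<psi>\<in>\<Psi>. N0 \<psi>)" by (rule member_le_sum[OF that]) (use \<Psi> in auto)
    also have "\<dots> \<le> 1 * Suc (\<Sum>\<psi>\<in>\<Psi>. N0 \<psi>)" by simp
    also have "\<dots> \<le> N" unfolding N_def using q by (intro mult_right_mono) auto
    finally show ?thesis .
  qed
  let ?t = "twist_map N (quarter d)"
  show ?case
  proof (intro bexI[of _ "g \<circ> ?t"] conjI allI impI ballI)
    show "g \<circ> ?t \<in> Symp1 M" by (intro Symp1_comp g twist_map_Symp1[OF tp N])
    show "(g \<circ> ?t) x = x" if "x \<notin> core M" for x using g(2)[OF that] that by (simp add: twist_map_def)
    show "(g \<circ> ?t) \<circ> rotation M (angle k) = rotation M (angle k) \<circ> (g \<circ> ?t)" if k: "real q * k \<in> \<int>" for k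
    proof -
      have "real N * k = real (Suc (\<Sum>\<psi>\<in>\<Psi>. N0 \<psi>)) * (real q * k)" by (simp add: N_def algebra_simps)
      then have "real N * k \<in> \<int>" using k by (metis Ints_mult Ints_of_nat)
      from twist_map_rotation[OF tp N this] g(3)[OF k]
      show ?thesis by (metis comp_assoc)
    qed
    fix \<psi> assume \<psi>: "\<psi> \<in> \<Psi>"
    have "circle_variance (\<lambda>x. \<psi> (g (?t x))) \<le> (1 - d) * circle_variance (\<lambda>x. \<psi> (g x)) + 13 * d\<^sup>2"
      by (rule N0[OF \<psi> NN0[OF \<psi>] N])
    also have "\<dots> \<le> (1 - d) * (4 * (1 - d) ^ n + 13 * d) + 13 * d\<^sup>2"
      using g(4)[OF \<psi>] d by (intro add_right_mono mult_left_mono) auto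
    also have "\<dots> = 4 * (1 - d) ^ Suc n + 13 * d" by (simp add: power2_eq_square algebra_simps)
    finally show "circle_variance (\<lambda>x. \<psi> ((g \<circ> ?t) x)) \<le> 4 * (1 - d) ^ Suc n + 13 * d" by simp
  qed
qed

lemma equidistributing_map:
  assumes \<Psi>: "finite \<Psi>" "\<And>\<psi>. \<psi> \<in> \<Psi> \<Longrightarrow> test_function \<psi>" and q: "q > (0 :: nat)" and \<epsilon>: "\<epsilon> > 0"
  obtains g where "g \<in> Symp1 M" "\<And>x. x \<notin> core M \<Longrightarrow> g x = x"
    "\<And>k. real q * k \<in> \<int> \<Longrightarrow> g \<circ> rotation M (angle k) = rotation M (angle k) \<circ> g"
    "\<And>\<psi>. \<psi> \<in> \<Psi> \<Longrightarrow> circle_variance (\<lambda>x. \<psi> (g x)) < \<epsilon>"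
proof -
  define d where "d = min (1/2) (\<epsilon> / 26)"
  have d: "0 < d" "d \<le> 1/2" "13 * d \<le> \<epsilon> / 2" using \<epsilon> by (auto simp: d_def)
  have "(\<lambda>n. 4 * (1 - d) ^ n) \<longlonglongrightarrow> 4 * 0" using d by (intro tendsto_mult tendsto_const LIMSEQ_power_zero) auto
  from order_tendstoD(2)[OF this, of "\<epsilon> / 2"]
  have "\<forall>\<^sub>F n in sequentially. 4 * (1 - d) ^ n < \<epsilon> / 2" using \<epsilon> by simp
  then obtain n where n: "4 * (1 - d) ^ n < \<epsilon> / 2" by (auto simp: eventually_sequentially)
  obtain g where g: "g \<in> Symp1 M" "\<And>x. x \<notin> core M \<Longrightarrow> g x = x"
    "\<And>k. real q * k \<in> \<int> \<Longrightarrow> g \<circ> rotation M (angle k) = rotation M (angle k) \<circ> g"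
    "\<And>\<psi>. \<psi> \<in> \<Psi> \<Longrightarrow> circle_variance (\<lambda>x. \<psi> (g x)) \<le> 4 * (1 - d) ^ n + 13 * d"
    using equidistributing_map_rate[OF \<Psi> q d(1,2), of n] by blast
  have "circle_variance (\<lambda>x. \<psi> (g x)) < \<epsilon>" if "\<psi> \<in> \<Psi>" for \<psi>
    using g(4)[OF that] n d(3) by linarith
  then show ?thesis using that g(1-3) by blast
qed

end

section \<open>A countable family of test functions\<close>

text \<open>The functions are continuous approximations from below of indicators of finite unions of basic open sets.
They do not depend on the measure; outer regularity shows that they approximate indicators of Borel sets in
\<open>L\<^sup>1\<close> for every probability measure.\<close>

lemma dense_test_functions:
  obtains \<phi> :: "nat \<Rightarrow> 'a::euclidean_space \<Rightarrow> real" where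
    "\<And>j. continuous_on UNIV (\<phi> j)" "\<And>j x. 0 \<le> \<phi> j x" "\<And>j x. \<phi> j x \<le> 1"
    "\<And>\<mu> S \<epsilon>. prob_space \<mu> \<Longrightarrow> sets \<mu> = sets borel \<Longrightarrow> S \<in> sets borel \<Longrightarrow> \<epsilon> > 0 \<Longrightarrow>
      \<exists>j. (\<integral>x. \<bar>indicator S x - \<phi> j x\<bar> \<partial>\<mu>) < \<epsilon>"
proof -
  obtain B :: "'a set set" where B: "countable B" "topological_basis B" using ex_countable_basis by blast
  define \<U> where "\<U> = Union ` {F. finite F \<and> F \<subseteq> insert {} B}"
  have cU: "countable \<U>" unfolding \<U>_def using B(1) by (intro countable_image countable_Collect_finite_subset) simp
  have oU: "open U" if "U \<in> \<U>" for U
    using that topological_basis_open[OF B(2)] by (auto simp: \<U>_def intro!: open_Union)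
  define bump :: "'a set \<times> nat \<Rightarrow> 'a \<Rightarrow> real" where
    "bump = (\<lambda>(U, k) x. if U = UNIV then 1 else min 1 (real k * infdist x (- U)))"
  define G where "G = bump ` (\<U> \<times> UNIV)"
  have "{} \<in> \<U>" unfolding \<U>_def by (rule image_eqI[of _ _ "{}"]) auto
  then have G: "G \<noteq> {}" "countable G" using cU by (auto simp: G_def)
  define \<phi> where "\<phi> = from_nat_into G"
  have \<phi>: "range \<phi> = G" unfolding \<phi>_def by (rule range_from_nat_into[OF G])
  have bump: "continuous_on UNIV (bump p)" "0 \<le> bump p x" "bump p x \<le> 1" for p x
  proof -
    obtain U k where p: "p = (U, k)" by (cases p)
    have "bump p = (if U = UNIV then (\<lambda>_. 1) else (\<lambda>x. min 1 (real k * infdist x (- U))))"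
      by (auto simp: bump_def p)
    then show "continuous_on UNIV (bump p)" "0 \<le> bump p x" "bump p x \<le> 1"
      by (auto simp: infdist_nonneg intro!: continuous_intros)
  qed
  have \<phi>b: "\<exists>p. \<phi> j = bump p" for j using \<phi> unfolding G_def by blast
  have dense: "\<exists>j. (\<integral>x. \<bar>indicator S x - \<phi> j x\<bar> \<partial>\<mu>) < \<epsilon>"
    if \<mu>: "prob_space \<mu>" "sets \<mu> = sets borel" and S: "S \<in> sets borel" and \<epsilon>: "\<epsilon> > 0" for \<mu> S \<epsilon>
  proof -
    interpret prob_space \<mu> by (rule \<mu>(1))
    note [measurable_cong] = \<mu>(2)
    have [simp]: "space \<mu> = UNIV" using sets_eq_imp_space_eq[OF \<mu>(2)] by simp
    have "emeasure \<mu> S = (INF U \<in> {U. S \<subseteq> U \<and> open U}. emeasure \<mu> U)"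
      using \<mu>(2) S by (intro outer_regular) auto
    moreover have "emeasure \<mu> S < ennreal (prob S + \<epsilon> / 3)"
      using \<epsilon> by (auto simp: emeasure_eq_measure ennreal_less_iff)
    ultimately obtain V where V: "S \<subseteq> V" "open V" "emeasure \<mu> V < ennreal (prob S + \<epsilon> / 3)"
      by (auto simp: INF_less_iff)
    then have V3: "prob V < prob S + \<epsilon> / 3" by (simp add: emeasure_eq_measure ennreal_less_iff)
    obtain B' where B': "B' \<subseteq> B" "V = \<Union>B'" using B(2) V(2) unfolding topological_basis_def by metis
    have "countable (insert {} B')" "insert {} B' \<noteq> {}" using B(1) B'(1) countable_subset by auto
    then have b: "range (from_nat_into (insert {} B')) = insert {} B'" by (intro range_from_nat_into)
    define b where "b = from_nat_into (insert {} B')"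
    note b = b[folded b_def]
    define U where "U n = (\<Union>i\<le>n. b i)" for n :: nat
    have UU: "U n \<in> \<U>" for n unfolding \<U>_def U_def
      using b B'(1) by (intro image_eqI[of _ _ "b ` {..n}"]) auto
    have "b i \<subseteq> U i" for i by (auto simp: U_def)
    then have "(\<Union>n. U n) = \<Union> (range b)" unfolding U_def by blast
    then have UV: "(\<Union>n. U n) = V" using b B'(2) by simp
    have "(\<lambda>n. prob (U n)) \<longlonglongrightarrow> prob (\<Union>n. U n)"
    proof (rule finite_Lim_measure_incseq)
      show "incseq U" unfolding incseq_def U_def by (intro allI impI UN_mono) auto
      show "range U \<subseteq> events" using oU[OF UU] \<mu>(2) by auto
    qed
    from order_tendstoD(1)[OF this, of "prob V - \<epsilon> / 3"] UV \<epsilon>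
    obtain n where n: "prob V - \<epsilon> / 3 < prob (U n)" by (auto simp: eventually_sequentially)
    have UnV: "U n \<subseteq> V" using UV by blast
    have Um [measurable]: "U n \<in> sets borel" "V \<in> sets borel" "S \<in> sets borel" using oU[OF UU] V(2) S by auto
    have bm [measurable]: "bump p \<in> borel_measurable borel" for p
      using bump(1) by (rule borel_measurable_continuous_onI)
    have lim: "(\<lambda>k. bump (U n, k) x) \<longlonglongrightarrow> indicator (U n) x" for x
    proof (cases "U n = UNIV \<or> x \<notin> U n")
      case True then show ?thesis by (cases "U n = UNIV") (auto simp: bump_def)
    next
      case False
      then have "infdist x (- U n) > 0"
        using oU[OF UU[of n]] by (metis ComplI Compl_empty_eq closed_Compl double_compl in_closed_iff_infdist_zero infdist_nonneg less_le ComplD)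
      then obtain N where N: "real N > 1 / infdist x (- U n)" and i: "infdist x (- U n) > 0"
        using reals_Archimedean2 by blast
      have "bump (U n, k) x = 1" if "k \<ge> N" for k
      proof -
        have "real k > 1 / infdist x (- U n)" using N that by linarith
        then have "1 < real k * infdist x (- U n)" using i by (simp add: field_simps)
        then show ?thesis using False by (simp add: bump_def)
      qed
      then have "eventually (\<lambda>k. bump (U n, k) x = 1) sequentially" by (auto simp: eventually_sequentially)
      then show ?thesis using False by (simp add: tendsto_eventually)
    qed
    have "(\<lambda>k. \<integral>x. \<bar>indicator (U n) x - bump (U n, k) x\<bar> \<partial>\<mu>) \<longlonglongrightarrow> (\<integral>x. 0 \<partial>\<mu>)"
    proof (rule integral_dominated_convergence[where w="\<lambda>_. 1"])
      show "AE x in \<mu>. (\<lambda>k. \<bar>indicator (U n) x - bump (U n, k) x\<bar>) \<longlonglongrightarrow> 0"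
        by (intro AE_I2) (rule tendsto_rabs_zero, rule tendsto_eq_rhs[OF tendsto_diff[OF tendsto_const lim]], simp)
      show "AE x in \<mu>. norm \<bar>indicator (U n) x - bump (U n, k) x\<bar> \<le> 1" for k
      proof (intro AE_I2)
        fix x show "norm \<bar>indicator (U n) x - bump (U n, k) x\<bar> \<le> 1"
          using bump(2,3)[of "(U n, k)" x] by (auto split: split_indicator simp: abs_le_iff)
      qed
    qed auto
    then have "(\<lambda>k. \<integral>x. \<bar>indicator (U n) x - bump (U n, k) x\<bar> \<partial>\<mu>) \<longlonglongrightarrow> 0" by simp
    from order_tendstoD(2)[OF this, of "\<epsilon> / 3"] \<epsilon>
    obtain k where k: "(\<integral>x. \<bar>indicator (U n) x - bump (U n, k) x\<bar> \<partial>\<mu>) < \<epsilon> / 3"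
      by (auto simp: eventually_sequentially)
    have "bump (U n, k) \<in> range \<phi>" using UU by (auto simp: \<phi> G_def)
    then obtain j where j: "\<phi> j = bump (U n, k)" by (metis imageE)
    have i: "integrable \<mu> (indicator V :: 'a \<Rightarrow> real)" "integrable \<mu> (indicator S :: 'a \<Rightarrow> real)"
      "integrable \<mu> (indicator (U n) :: 'a \<Rightarrow> real)" "integrable \<mu> (bump (U n, k))"
      using bump by (auto intro!: integrable_const_bound[of _ 1])
    have "(\<integral>x. \<bar>indicator S x - \<phi> j x\<bar> \<partial>\<mu>) \<le>
      (\<integral>x. ((indicator V x - indicator S x) + (indicator V x - indicator (U n) x)) + \<bar>indicator (U n) x - bump (U n, k) x\<bar> \<partial>\<mu>)"
    proof (rule integral_mono)
      fix x
      show "\<bar>indicator S x - \<phi> j x\<bar> \<le> ((indicator V x - indicator S x) + (indicator V x - indicator (U n) x)) + \<bar>indicator (U n) x - bump (U n, k) x\<bar>"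
        using V(1) UnV unfolding j by (auto split: split_indicator)
    qed (use i in \<open>auto simp: j\<close>)
    also have "\<dots> = (prob V - prob S) + (prob V - prob (U n)) + (\<integral>x. \<bar>indicator (U n) x - bump (U n, k) x\<bar> \<partial>\<mu>)"
      using i by simp
    also have "\<dots> < \<epsilon>" using V3 n k by linarith
    finally show ?thesis by blast
  qed
  show ?thesis
    by (rule that[of \<phi>]) (use \<phi>b bump dense in \<open>metis+\<close>)
qed

section \<open>A criterion for ergodicity\<close>

text \<open>If \<open>S\<close> is invariant, then \<open>1\<^sub>S\<close> equals its Birkhoff averages. Replacing \<open>1\<^sub>S\<close> by a close
test function changes these averages little in \<open>L\<^sup>1\<close> at all times, and at a suitable time the
averages of the test function are nearly constant. So \<open>1\<^sub>S\<close> is constant almost everywhere. One good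
time for each accuracy is enough.\<close>

lemma ergodic_criterion:
  fixes \<mu> :: "'a::euclidean_space measure" and \<phi> :: "nat \<Rightarrow> 'a \<Rightarrow> real"
  assumes "prob_space \<mu>" and sets: "sets \<mu> = sets borel"
    and f: "f \<in> borel_measurable borel" and inv: "distr \<mu> \<mu> f = \<mu>"
    and \<phi>: "\<And>j. \<phi> j \<in> borel_measurable borel" "\<And>j x. 0 \<le> \<phi> j x" "\<And>j x. \<phi> j x \<le> 1"
    and dense: "\<And>S \<epsilon>. S \<in> sets borel \<Longrightarrow> \<epsilon> > 0 \<Longrightarrow> \<exists>j. (\<integral>x. \<bar>indicator S x - \<phi> j x\<bar> \<partial>\<mu>) < \<epsilon>"
    and birkhoff: "\<And>j \<epsilon>. \<epsilon> > 0 \<Longrightarrow>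
      \<exists>N>0. (\<integral>x. \<bar>(1 / real N) * (\<Sum>k<N. \<phi> j ((f ^^ k) x)) - (\<integral>x. \<phi> j x \<partial>\<mu>)\<bar> \<partial>\<mu>) < \<epsilon>"
  shows "ergodic \<mu> f"
proof -
  interpret prob_space \<mu> by fact
  note [measurable_cong] = sets
  have sp [simp]: "space \<mu> = UNIV" using sets_eq_imp_space_eq[OF sets] by simp
  have fm: "f \<in> measurable \<mu> \<mu>" using f by (simp cong: measurable_cong_sets)
  have fk [measurable]: "(f ^^ k) \<in> borel_measurable borel" for k
  proof (induction k)
    case 0 then show ?case by (simp add: id_def)
  next
    case (Suc k) show ?case unfolding funpow.simps by (rule measurable_comp[OF Suc f])
  qed
  have ik: "(\<integral>x. g ((f ^^ k) x) \<partial>\<mu>) = (\<integral>x. g x \<partial>\<mu>)" if [measurable]: "g \<in> borel_measurable borel" for g :: "'a \<Rightarrow> real" and k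
  proof (induction k)
    case (Suc k)
    have "(\<lambda>x. g ((f ^^ k) x)) \<in> borel_measurable \<mu>" by measurable
    then have "(\<integral>x. g ((f ^^ k) (f x)) \<partial>\<mu>) = (\<integral>x. g ((f ^^ k) x) \<partial>\<mu>)"
      using integral_distr[OF fm, of "\<lambda>x. g ((f ^^ k) x)"] inv by simp
    then show ?case using Suc by (simp add: funpow_swap1)
  qed simp
  have "measure \<mu> S = 0 \<or> measure \<mu> S = 1" if S: "S \<in> sets \<mu>" and iS: "f -` S \<inter> space \<mu> = S" for S
  proof -
    have Sm [measurable]: "S \<in> sets borel" using S sets by simp
    have ifx: "(indicator S (f x) :: real) = indicator S x" for x
      using iS by (auto simp: indicator_def)
    have ifk: "(indicator S ((f ^^ k) x) :: real) = indicator S x" for k x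
      by (induction k) (auto simp: ifx)
    let ?p = "measure \<mu> S"
    have Si: "integrable \<mu> (indicator S :: 'a \<Rightarrow> real)" by (rule integrable_const_bound[of _ 1]) auto
    have small: "(\<integral>x. \<bar>indicator S x - ?p\<bar> \<partial>\<mu>) < 3 * \<epsilon>" if \<epsilon>: "\<epsilon> > 0" for \<epsilon>
    proof -
      obtain j where j: "(\<integral>x. \<bar>indicator S x - \<phi> j x\<bar> \<partial>\<mu>) < \<epsilon>" using dense[OF Sm \<epsilon>] by blast
      define m where "m = (\<integral>x. \<phi> j x \<partial>\<mu>)"
      obtain N where N: "N > 0" "(\<integral>x. \<bar>(1 / real N) * (\<Sum>k<N. \<phi> j ((f ^^ k) x)) - m\<bar> \<partial>\<mu>) < \<epsilon>"
        using birkhoff[OF \<epsilon>, of j] unfolding m_def by blast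
      define g where "g x = \<bar>indicator S x - \<phi> j x\<bar>" for x
      have [measurable]: "\<phi> j \<in> borel_measurable borel" by (rule \<phi>)
      have gm [measurable]: "g \<in> borel_measurable borel" unfolding g_def by measurable
      have gb: "\<bar>g x\<bar> \<le> 1" for x using \<phi>(2,3)[of j x] by (auto simp: g_def split: split_indicator)
      define A where "A x = (1 / real N) * (\<Sum>k<N. \<phi> j ((f ^^ k) x))" for x
      have Am [measurable]: "A \<in> borel_measurable borel" unfolding A_def by measurable
      have Ab: "0 \<le> A x" "A x \<le> 1" for x
      proof -
        show "0 \<le> A x" unfolding A_def using \<phi>(2) by (intro mult_nonneg_nonneg sum_nonneg) auto
        have "(\<Sum>k<N. \<phi> j ((f ^^ k) x)) \<le> (\<Sum>k<N. 1)" by (intro sum_mono \<phi>(3))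
        then show "A x \<le> 1" using N(1) by (simp add: A_def)
      qed
      have m01: "0 \<le> m" "m \<le> 1" unfolding m_def using \<phi>
        by (auto intro!: integral_nonneg_AE integral_le_const integrable_const_bound[of _ 1])
      have \<phi>i: "integrable \<mu> (\<phi> j)" using \<phi>(2,3) by (intro integrable_const_bound[of _ 1]) auto
      have gi: "integrable \<mu> (\<lambda>x. g ((f ^^ k) x))" for k
        using gb by (intro integrable_const_bound[of _ 1]) auto
      have "norm \<bar>A x - m\<bar> \<le> 1" for x using Ab[of x] m01 by (simp add: abs_le_iff)
      then have Ai: "integrable \<mu> (\<lambda>x. \<bar>A x - m\<bar>)"
        by (intro integrable_const_bound[of _ 1] AE_I2) auto
      have mp: "\<bar>m - ?p\<bar> < \<epsilon>"
      proof -
        have "\<bar>?p - m\<bar> = \<bar>\<integral>x. indicator S x - \<phi> j x \<partial>\<mu>\<bar>" using Si \<phi>i by (simp add: m_def)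
        also have "\<dots> \<le> (\<integral>x. \<bar>indicator S x - \<phi> j x\<bar> \<partial>\<mu>)" by (rule integral_abs_bound)
        finally show ?thesis using j by simp
      qed
      have pt: "\<bar>indicator S x - ?p\<bar> \<le> (1 / real N) * (\<Sum>k<N. g ((f ^^ k) x)) + \<bar>A x - m\<bar> + \<bar>m - ?p\<bar>" for x
      proof -
        have "(\<Sum>k<N. indicator S ((f ^^ k) x) :: real) = real N * indicator S x" by (simp add: ifk)
        then have "indicator S x - A x = (1 / real N) * (\<Sum>k<N. indicator S ((f ^^ k) x) - \<phi> j ((f ^^ k) x))"
          using N(1) by (simp add: A_def sum_subtractf diff_divide_distrib)
        then have "\<bar>indicator S x - A x\<bar> = (1 / real N) * \<bar>\<Sum>k<N. indicator S ((f ^^ k) x) - \<phi> j ((f ^^ k) x)\<bar>"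
          by (simp add: abs_mult)
        also have "\<dots> \<le> (1 / real N) * (\<Sum>k<N. g ((f ^^ k) x))"
          unfolding g_def by (intro mult_left_mono sum_abs) auto
        finally show ?thesis by linarith
      qed
      have "(\<integral>x. \<bar>indicator S x - ?p\<bar> \<partial>\<mu>) \<le> (\<integral>x. (1 / real N) * (\<Sum>k<N. g ((f ^^ k) x)) + \<bar>A x - m\<bar> + \<bar>m - ?p\<bar> \<partial>\<mu>)"
        by (rule integral_mono[OF _ _ pt]) (use Si gi Ai in auto)
      also have "\<dots> = (1 / real N) * (\<Sum>k<N. \<integral>x. g ((f ^^ k) x) \<partial>\<mu>) + (\<integral>x. \<bar>A x - m\<bar> \<partial>\<mu>) + \<bar>m - ?p\<bar>"
        using gi Ai by (simp add: prob_space[simplified])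
      also have "(\<Sum>k<N. \<integral>x. g ((f ^^ k) x) \<partial>\<mu>) = real N * (\<integral>x. g x \<partial>\<mu>)" by (simp add: ik[OF gm])
      also have "(1 / real N) * (real N * (\<integral>x. g x \<partial>\<mu>)) = (\<integral>x. \<bar>indicator S x - \<phi> j x\<bar> \<partial>\<mu>)"
        using N(1) by (simp add: g_def)
      finally show ?thesis using j N(2) mp by (simp add: A_def)
    qed
    have "(\<integral>x. \<bar>indicator S x - ?p\<bar> \<partial>\<mu>) \<le> 0"
    proof (rule field_le_epsilon)
      fix e :: real assume "0 < e"
      then show "(\<integral>x. \<bar>indicator S x - ?p\<bar> \<partial>\<mu>) \<le> 0 + e" using small[of "e / 3"] by simp
    qed
    moreover have "(\<integral>x. \<bar>indicator S x - ?p\<bar> \<partial>\<mu>) = 2 * ?p * (1 - ?p)"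
    proof -
      have "\<bar>indicator S x - ?p\<bar> = ?p + indicator S x * (1 - 2 * ?p)" for x
        using prob_le_1[of S] by (auto split: split_indicator)
      then have "(\<integral>x. \<bar>indicator S x - ?p\<bar> \<partial>\<mu>) = (\<integral>x. ?p + indicator S x * (1 - 2 * ?p) \<partial>\<mu>)" by (simp only:)
      also have "\<dots> = ?p + ?p * (1 - 2 * ?p)" using Si by (simp add: prob_space[simplified])
      finally show ?thesis by (simp add: algebra_simps)
    qed
    ultimately have "?p * (1 - ?p) \<le> 0" by simp
    moreover have "0 \<le> ?p * (1 - ?p)" using prob_le_1[of S] by simp
    ultimately have "?p * (1 - ?p) = 0" by linarith
    then show ?thesis by simp
  qed
  then show ?thesis using fm inv unfolding ergodic_def by blast
qed

section \<open>Rational rotations\<close>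

text \<open>The order of \<open>\<alpha>\<close> in the circle group, i.e. the denominator of a reduced representative.\<close>

definition den :: "circle \<Rightarrow> nat" where
  "den \<alpha> = (LEAST q. 0 < q \<and> (\<exists>a. \<alpha> = angle a \<and> real q * a \<in> \<int>))"

lemma den:
  assumes "\<alpha> \<in> rational_angles"
  shows "den \<alpha> > 0" "\<alpha> = angle a \<Longrightarrow> real (den \<alpha>) * a \<in> \<int>"
    "\<alpha> = angle a \<Longrightarrow> 0 < k \<Longrightarrow> real k * a \<in> \<int> \<Longrightarrow> den \<alpha> \<le> k"
proof -
  obtain x where x: "\<alpha> = angle x" "x \<in> \<rat>" using assms by (auto simp: rational_angles_def)
  obtain m b where mb: "b > 0" "x = of_int m / of_int b" using x(2) by (elim Rats_cases')
  define n where "n = nat b"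
  have mn: "n > 0" "x = of_int m / real n" using mb by (auto simp: n_def)
  then have "real n * x \<in> \<int>" by simp
  then have ex: "\<exists>q. 0 < q \<and> (\<exists>a. \<alpha> = angle a \<and> real q * a \<in> \<int>)" using mn(1) x(1) by blast
  from LeastI_ex[OF this] have *: "0 < den \<alpha> \<and> (\<exists>a. \<alpha> = angle a \<and> real (den \<alpha>) * a \<in> \<int>)"
    unfolding den_def .
  then show "den \<alpha> > 0" by blast
  show "den \<alpha> \<le> k" if "\<alpha> = angle a" "0 < k" "real k * a \<in> \<int>"
    unfolding den_def by (rule Least_le) (use that in blast)
  assume a: "\<alpha> = angle a"
  obtain b where b: "\<alpha> = angle b" "real (den \<alpha>) * b \<in> \<int>" using * by blast
  have "a - b \<in> \<int>" using a b(1) angle_eq_iff by metis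
  then have "real (den \<alpha>) * b + real (den \<alpha>) * (a - b) \<in> \<int>" by (intro Ints_add b(2) Ints_mult) auto
  then show "real (den \<alpha>) * a \<in> \<int>" by (simp add: algebra_simps)
qed

text \<open>Distinct fractions with denominators \<open>q\<close> and \<open>q'\<close> are at distance at least \<open>1/(q * q')\<close>.\<close>

lemma den_separation:
  assumes "\<alpha> \<in> rational_angles" "\<beta> \<in> rational_angles" "0 < circle_abs (\<beta> - \<alpha>)"
  shows "1 \<le> real (den \<alpha>) * real (den \<beta>) * circle_abs (\<beta> - \<alpha>)"
proof -
  obtain a where a: "\<alpha> = angle a" using angle_surj by blast
  obtain b where b: "\<beta> = angle b" "\<bar>b - a\<bar> = circle_abs (\<beta> - angle a)" using angle_near by blast
  let ?z = "real (den \<alpha>) * real (den \<beta>) * (b - a)"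
  have "real (den \<alpha>) * (real (den \<beta>) * b) - real (den \<beta>) * (real (den \<alpha>) * a) \<in> \<int>"
    by (intro Ints_diff Ints_mult[of "of_nat _"] den(2)[OF assms(2) b(1)] den(2)[OF assms(1) a]) auto
  then have "?z \<in> \<int>" by (simp add: algebra_simps)
  moreover have "?z \<noteq> 0" using den(1)[OF assms(1)] den(1)[OF assms(2)] assms(3) b(2) a by auto
  ultimately have "1 \<le> \<bar>?z\<bar>" using Ints_nonzero_abs_ge1 by blast
  then show ?thesis using b(2) a by (simp add: abs_mult)
qed

text \<open>The multiples of \<open>\<alpha>\<close> are all the \<open>q\<close>-th division points of the circle, so an orbit is a translate
of the group of these points and has one point in each interval \<open>[i/q, (i+1)/q)\<close>.\<close>

lemma orbit_sum:
  fixes f :: "circle \<Rightarrow> real"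
  assumes \<alpha>: "\<alpha> \<in> rational_angles" "\<alpha> = angle a"
  defines "q \<equiv> den \<alpha>"
  obtains s where "0 \<le> s" "s < 1 / real q"
    "(\<Sum>k<q. f (angle (t + real k * a))) = (\<Sum>i<q. f (angle (s + real i / real q)))"
proof -
  have q: "q > 0" unfolding q_def by (rule den(1)[OF \<alpha>(1)])
  define H where "H = {angle x | x. real q * x \<in> \<int>}"
  have H1: "H = (\<lambda>i. angle (real i / real q)) ` {..<q}"
  proof (intro equalityI subsetI)
    fix c assume "c \<in> H"
    then obtain x z where x: "c = angle x" "real q * x = of_int z" by (auto simp: H_def elim: Ints_cases)
    define i where "i = nat (z mod int q)"
    have i: "int i = z mod int q" "i < q" using q by (auto simp: i_def nat_less_iff)
    have "z = (z div int q) * int q + int i" using i(1) by simp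
    then have "real_of_int z = of_int (z div int q) * real q + real i" by (metis of_int_add of_int_mult of_int_of_nat_eq)
    then have "x - real i / real q = of_int (z div int q)" using x(2) q by (simp add: field_simps)
    then have "c = angle (real i / real q)" using x(1) angle_eq_iff by (metis Ints_of_int)
    then show "c \<in> (\<lambda>i. angle (real i / real q)) ` {..<q}" using i(2) by blast
  next
    fix c assume "c \<in> (\<lambda>i. angle (real i / real q)) ` {..<q}"
    then obtain i where i: "c = angle (real i / real q)" by blast
    have "real q * (real i / real q) \<in> \<int>" using q by simp
    then show "c \<in> H" using i by (auto simp: H_def)
  qed
  have inj1: "inj_on (\<lambda>i. angle (real i / real q)) {..<q}"
  proof (rule inj_onI)
    fix i j assume ij: "i \<in> {..<q}" "j \<in> {..<q}" "angle (real i / real q) = angle (real j / real q)"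
    then have z: "real i / real q - real j / real q \<in> \<int>" by (simp add: angle_eq_iff)
    have "\<bar>real i / real q - real j / real q\<bar> < 1"
      using ij(1,2) q by (auto simp: diff_divide_distrib[symmetric] abs_less_iff divide_less_eq)
    then have "real i / real q - real j / real q = 0" using z Ints_nonzero_abs_ge1 by fastforce
    then show "i = j" using q by simp
  qed
  have finH: "finite H" "card H = q" unfolding H1 using inj1 by (auto simp: card_image)
  have inj2: "inj_on (\<lambda>k. angle (real k * a)) {..<q}"
  proof (rule linorder_inj_onI')
    fix i j assume ij: "i \<in> {..<q}" "j \<in> {..<q}" "i < j"
    show "angle (real i * a) \<noteq> angle (real j * a)"
    proof
      assume "angle (real i * a) = angle (real j * a)"
      then have "real j * a - real i * a \<in> \<int>" by (metis angle_eq_iff)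
      then have "real (j - i) * a \<in> \<int>" using ij(3) by (simp add: of_nat_diff left_diff_distrib)
      then have "q \<le> j - i" unfolding q_def using den(3)[OF \<alpha>] ij(3) by simp
      then show False using ij by simp
    qed
  qed
  have "(\<lambda>k. angle (real k * a)) ` {..<q} \<subseteq> H"
  proof
    fix c assume "c \<in> (\<lambda>k. angle (real k * a)) ` {..<q}"
    then obtain k where k: "c = angle (real k * a)" by blast
    have "real k * (real q * a) \<in> \<int>"
      unfolding q_def by (rule Ints_mult[OF Ints_of_nat den(2)[OF \<alpha>]])
    then show "c \<in> H" using k by (auto simp: H_def algebra_simps)
  qed
  then have H2: "(\<lambda>k. angle (real k * a)) ` {..<q} = H"
    using finH inj2 by (intro card_subset_eq) (auto simp: card_image)
  define z where "z = \<lfloor>real q * t\<rfloor>"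
  define s where "s = t - of_int z / real q"
  have s: "0 \<le> s" "s < 1 / real q"
  proof -
    have "of_int z \<le> real q * t" "real q * t < of_int z + 1" by (auto simp: z_def)
    moreover have "s = (real q * t - of_int z) / real q" using q by (simp add: s_def field_simps)
    ultimately show "0 \<le> s" "s < 1 / real q" using q by (simp_all add: divide_strict_right_mono)
  qed
  \<comment> \<open>Subtracting a multiple of \<open>1/q\<close> moves the base point into \<open>[0, 1/q)\<close>; it permutes the group \<open>H\<close>.\<close>
  define e where "e = angle (of_int z / real q)"
  have eH: "e \<in> H" "- e \<in> H"
    using q by (auto simp: e_def H_def angle_minus intro: exI[of _ "of_int z / real q"] exI[of _ "- (of_int z / real q)"])
  have Hadd: "c + c' \<in> H" if cc: "c \<in> H" "c' \<in> H" for c c'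
  proof -
    obtain x x' where x: "c = angle x" "real q * x \<in> \<int>" "c' = angle x'" "real q * x' \<in> \<int>" using cc by (auto simp: H_def)
    have "real q * (x + x') \<in> \<int>" using x by (simp add: distrib_left)
    then show ?thesis using x by (auto simp: H_def angle_add)
  qed
  have "(\<Sum>k<q. f (angle (t + real k * a))) = (\<Sum>k<q. f (angle t + angle (real k * a)))" by (simp add: angle_add)
  also have "\<dots> = (\<Sum>c\<in>H. f (angle t + c))" unfolding H2[symmetric] by (simp add: sum.reindex[OF inj2])
  also have "\<dots> = (\<Sum>c\<in>H. f (angle s + c))"
  proof (rule sum.reindex_bij_witness[of _ "\<lambda>c. - e + c" "\<lambda>c. e + c"])
    have "angle t = angle s + e" by (simp add: s_def e_def angle_add)
    then show "f (angle s + (e + c)) = f (angle t + c)" for c by (simp add: add.assoc)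
    show "- e + c \<in> H" "e + c \<in> H" if "c \<in> H" for c using Hadd eH that by blast+
  qed auto
  also have "\<dots> = (\<Sum>i<q. f (angle s + angle (real i / real q)))"
    unfolding H1 by (simp add: sum.reindex[OF inj1])
  also have "\<dots> = (\<Sum>i<q. f (angle (s + real i / real q)))" by (simp add: angle_add)
  finally show ?thesis using that s by blast
qed

section \<open>A scheme whose limits are ergodic\<close>

context circle_surface begin

lemma Symp0_inverse:
  assumes "g \<in> Symp0 M"
  shows "inv g (g x) = x" "g (inv g x) = x"
  using permutes_inverses[OF Symp0_permutes[OF assms]] by auto

lemma rotation_Symp0: "rotation M \<alpha> \<in> Symp0 M"
  by (intro Symp1_imp_Symp0 rotation_Symp1)

lemma conj_rotation_Symp0: "g \<in> Symp0 M \<Longrightarrow> conj_rotation M g \<alpha> \<in> Symp0 M"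
  unfolding conj_rotation_def by (intro Symp0_comp Symp0_inv rotation_Symp0)

lemma conj_rotation_add:
  assumes "g \<in> Symp0 M"
  shows "conj_rotation M g (\<alpha> + \<beta>) x = conj_rotation M g \<alpha> (conj_rotation M g \<beta> x)"
  by (simp add: conj_rotation_def rotation_add Symp0_inverse[OF assms])

lemma conj_rotation_0: "g \<in> Symp0 M \<Longrightarrow> conj_rotation M g 0 x = x"
  by (simp add: conj_rotation_def rotation_0 Symp0_inverse)

lemma conj_rotation_funpow:
  assumes "g \<in> Symp0 M"
  shows "(conj_rotation M g (angle a) ^^ k) x = conj_rotation M g (angle (real k * a)) x"
proof (induction k)
  case 0 then show ?case using conj_rotation_0[OF assms] by (simp add: angle_0)
next
  case (Suc k)
  have "angle (real (Suc k) * a) = angle a + angle (real k * a)" by (simp add: angle_add distrib_right)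
  then show ?case using Suc conj_rotation_add[OF assms] by simp
qed

lemma inv_conj_rotation:
  assumes "g \<in> Symp0 M"
  shows "inv (conj_rotation M g \<alpha>) = conj_rotation M g (- \<alpha>)"
  using conj_rotation_add[OF assms, of \<alpha> "- \<alpha>"] conj_rotation_add[OF assms, of "- \<alpha>" \<alpha>] conj_rotation_0[OF assms]
  by (intro inv_equality) simp_all

text \<open>A neighbourhood controls the maps on the circles of height \<open>\<bar>y\<bar> \<le> 1 - 2 * \<eta>\<close> only; the
remaining heights have measure \<open>2 * \<eta>\<close> and contribute a bounded amount each.\<close>

lemma circle_variance_openin:
  assumes \<phi>: "test_function \<phi>" and c: "continuous_on UNIV \<phi>"
  shows "openin (T0_topology M) {g \<in> Symp0 M. circle_variance (\<lambda>x. \<phi> (g x)) < e}"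
proof (subst openin_subopen, intro ballI)
  fix g assume "g \<in> {g \<in> Symp0 M. circle_variance (\<lambda>x. \<phi> (g x)) < e}"
  then have g: "g \<in> Symp0 M" "circle_variance (\<lambda>x. \<phi> (g x)) < e" by auto
  define gap where "gap = e - circle_variance (\<lambda>x. \<phi> (g x))"
  have gap: "gap > 0" using g by (simp add: gap_def)
  define \<eta> where "\<eta> = min (1/4) (gap / 32)"
  have \<eta>: "0 < \<eta>" "\<eta> \<le> 1/4" "8 * \<eta> \<le> gap / 4" using gap by (auto simp: \<eta>_def)
  define b where "b = gap / 16"
  have b: "b > 0" using gap by (simp add: b_def)
  have "uniformly_continuous_on (carrier M) \<phi>"
    by (intro compact_uniformly_continuous compact_carrier continuous_on_subset[OF c]) auto
  from uniformly_continuous_onE[OF this b] obtain \<delta> where \<delta>: "\<delta> > 0"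
    "\<And>x x'. \<lbrakk>x \<in> carrier M; x' \<in> carrier M; dist x' x < \<delta>\<rbrakk> \<Longrightarrow> dist (\<phi> x') (\<phi> x) < b" by metis
  let ?T = "{g' \<in> Symp0 M. dC0 (shrunk M \<eta>) g g' < \<delta>}"
  have sub: "shrunk M \<eta> \<subseteq> carrier M"
  proof
    fix x assume "x \<in> shrunk M \<eta>"
    then obtain c y where x: "x = chart M (c, y)" "-1 + \<eta> < y" "y < 1 - \<eta>" by (auto simp: shrunk_def)
    obtain t where "c = angle t" using angle_surj by blast
    then show "x \<in> carrier M" using x \<eta> E_chart[of t y] E_carrier[of y t] by (simp add: abs_le_iff)
  qed
  have ne: "shrunk M \<eta> \<noteq> {}" using \<eta> by (auto simp: shrunk_def)
  have "openin (T0_topology M) ?T"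
    unfolding T0_topology_def by (rule topology_generated_by_Basis, rule CollectI, rule exI[of _ g], rule exI[of _ \<eta>], rule exI[of _ \<delta>])
      (use g(1) \<eta> \<delta> in auto)
  moreover have "g \<in> ?T"
  proof -
    have "dC0 (shrunk M \<eta>) g g \<le> 0" by (rule dC0_le) (use ne in auto)
    then show ?thesis using g(1) \<delta>(1) by simp
  qed
  moreover have "?T \<subseteq> {g \<in> Symp0 M. circle_variance (\<lambda>x. \<phi> (g x)) < e}"
  proof
    fix g' assume "g' \<in> ?T"
    then have g': "g' \<in> Symp0 M" "dC0 (shrunk M \<eta>) g g' < \<delta>" by auto
    let ?A = "circle_average (\<lambda>x. \<phi> (g x))" and ?A' = "circle_average (\<lambda>x. \<phi> (g' x))"
    define m where "m = (\<integral>x. \<phi> x \<partial>Leb M)"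
    have \<phi>m: "\<phi> \<in> borel_measurable borel" using \<phi> by (simp add: test_function_def)
    have mg: "(\<integral>x. \<phi> (g x) \<partial>Leb M) = m" "(\<integral>x. \<phi> (g' x) \<partial>Leb M) = m"
      unfolding m_def using integral_Symp0[OF g(1) \<phi>m] integral_Symp0[OF g'(1) \<phi>m] by auto
    have m1: "\<bar>m\<bar> \<le> 1" unfolding m_def by (rule integral_circle_average(2)[OF \<phi>])
    have tg: "test_function (\<lambda>x. \<phi> (g x))" "test_function (\<lambda>x. \<phi> (g' x))"
      using test_function_compose[OF \<phi>] g(1) g'(1) by auto
    have close: "\<bar>?A y - ?A' y\<bar> \<le> b" if y: "\<bar>y\<bar> \<le> 1 - 2 * \<eta>" for y
    proof -
      have y1: "\<bar>y\<bar> \<le> 1" using y \<eta> by linarith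
      have "\<bar>\<phi> (g (E (t, y))) - \<phi> (g' (E (t, y)))\<bar> \<le> b" for t
      proof -
        have "-1 + \<eta> < y" "y < 1 - \<eta>" using y \<eta> by (auto simp: abs_le_iff)
        then have Es: "E (t, y) \<in> shrunk M \<eta>" by (auto simp: shrunk_def E_chart)
        then have "dist (g (E (t, y))) (g' (E (t, y))) < \<delta>"
          using dist_le_dC0[OF Symp0_permutes[OF g(1)] Symp0_permutes[OF g'(1)] sub Es] g'(2) by linarith
        then have "dist (\<phi> (g (E (t, y)))) (\<phi> (g' (E (t, y)))) < b"
          using Es sub g(1) g'(1) by (intro \<delta>(2)) (auto simp: Symp0_carrier)
        then show ?thesis by (simp add: dist_real_def)
      qed
      then have "\<bar>\<integral>t. \<phi> (g (E (t, y))) - \<phi> (g' (E (t, y))) \<partial>circ\<bar> \<le> b"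
        using test_function_E(2)[OF tg(1)] test_function_E(2)[OF tg(2)] by (intro circ_abs_integral_le) auto
      moreover have "(\<integral>t. \<phi> (g (E (t, y))) - \<phi> (g' (E (t, y))) \<partial>circ) = ?A y - ?A' y"
        unfolding circle_average_def
        by (intro Bochner_Integration.integral_diff circ_bounded_integrable[of _ 1])
          (use test_function_E[OF tg(1)] test_function_E[OF tg(2)] y1 in auto)
      ultimately show ?thesis by simp
    qed
    let ?I = "{-(1 - 2 * \<eta>)..1 - 2 * \<eta>}"
    have pt: "(?A' y - m)\<^sup>2 \<le> (?A y - m)\<^sup>2 + 4 * b + 4 * (1 - indicator ?I y)" if y: "\<bar>y\<bar> < 1" for y
    proof -
      have ab: "\<bar>?A y\<bar> \<le> 1" "\<bar>?A' y\<bar> \<le> 1"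
        using circle_average_bound[OF tg(1)] circle_average_bound[OF tg(2)] y by auto
      show ?thesis
      proof (cases "y \<in> ?I")
        case True
        then have "\<bar>y\<bar> \<le> 1 - 2 * \<eta>" by (auto simp: abs_le_iff)
        then have d: "\<bar>?A' y - ?A y\<bar> \<le> b" using close by (simp add: abs_minus_commute)
        have "(?A' y - m)\<^sup>2 - (?A y - m)\<^sup>2 = (?A' y - ?A y) * (?A' y + ?A y - 2 * m)"
          by (simp add: power2_eq_square algebra_simps)
        also have "\<dots> \<le> \<bar>?A' y - ?A y\<bar> * \<bar>?A' y + ?A y - 2 * m\<bar>"
          by (metis abs_ge_self abs_mult)
        also have "\<dots> \<le> b * 4"
          using d ab m1 b by (intro mult_mono) auto
        finally show ?thesis using True by simp
      next
        case False
        have "\<bar>?A' y - m\<bar> \<le> 2" using ab m1 by linarith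
        then have 4: "(?A' y - m)\<^sup>2 \<le> 4" using power_mono[of "\<bar>?A' y - m\<bar>" 2 2] by simp
        have "0 \<le> (?A y - m)\<^sup>2 + 4 * b" using b by (intro add_nonneg_nonneg) auto
        then show ?thesis unfolding indicator_simps(2)[OF False] by (intro order_trans[OF 4]) simp
      qed
    qed
    have Am: "?A \<in> borel_measurable borel" "?A' \<in> borel_measurable borel"
      using circle_average_measurable tg by auto
    have sq: "\<bar>(B y - m)\<^sup>2\<bar> \<le> 4" if "\<bar>B y\<bar> \<le> 1" for B :: "real \<Rightarrow> real" and y
    proof -
      have "\<bar>B y - m\<bar> \<le> 2" using that m1 by linarith
      then show ?thesis using power_mono[of "\<bar>B y - m\<bar>" 2 2] by simp
    qed
    have i: "integrable seg (\<lambda>y. (?A y - m)\<^sup>2)" "integrable seg (\<lambda>y. (?A' y - m)\<^sup>2)"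
      by (rule seg_bounded_integrable[of _ 4], use Am in simp, rule sq, use circle_average_bound tg in simp)+
    have iI: "integrable seg (indicator ?I :: real \<Rightarrow> real)"
      by (rule seg_bounded_integrable[of _ 1]) auto
    have "circle_variance (\<lambda>x. \<phi> (g' x)) \<le> (\<integral>y. (?A y - m)\<^sup>2 + 4 * b + 4 * (1 - indicator ?I y) \<partial>seg)"
      unfolding circle_variance_def mg
    proof (rule integral_mono_AE)
      show "AE y in seg. (?A' y - m)\<^sup>2 \<le> (?A y - m)\<^sup>2 + 4 * b + 4 * (1 - indicator ?I y)"
        using AE_seg by eventually_elim (rule pt)
    qed (use i iI in auto)
    also have "\<dots> = circle_variance (\<lambda>x. \<phi> (g x)) + 4 * b + 8 * \<eta>"
      using i iI seg_interval[of "1 - 2 * \<eta>"] \<eta> by (simp add: circle_variance_def mg seg.prob_space[simplified])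
    also have "\<dots> < e"
    proof -
      have "circle_variance (\<lambda>x. \<phi> (g x)) + gap = e" "4 * b = gap / 4" by (simp_all add: gap_def b_def)
      then show ?thesis using \<eta>(3) gap by linarith
    qed
    finally show "g' \<in> {g \<in> Symp0 M. circle_variance (\<lambda>x. \<phi> (g x)) < e}" using g'(1) by simp
  qed
  ultimately show "\<exists>T. openin (T0_topology M) T \<and> g \<in> T \<and> T \<subseteq> {g \<in> Symp0 M. circle_variance (\<lambda>x. \<phi> (g x)) < e}"
    by blast
qed

end

locale circle_surface_tests = circle_surface M Z Y E E' \<kappa> proj curves
  for M :: "'a::euclidean_space surface" and Z Y E E' \<kappa> proj curves +
  fixes \<phi> :: "nat \<Rightarrow> 'a \<Rightarrow> real"
  assumes \<phi>_cont: "continuous_on UNIV (\<phi> j)" and \<phi>_nonneg: "0 \<le> \<phi> j x" and \<phi>_le_1: "\<phi> j x \<le> 1"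
    and \<phi>_dense: "S \<in> sets borel \<Longrightarrow> \<epsilon> > 0 \<Longrightarrow> \<exists>j. (\<integral>x. \<bar>indicator S x - \<phi> j x\<bar> \<partial>Leb M) < \<epsilon>"
begin

lemma \<phi>_measurable: "\<phi> j \<in> borel_measurable borel"
  using \<phi>_cont by (rule borel_measurable_continuous_onI)

lemma \<phi>_test: "test_function (\<phi> j)"
  using \<phi>_measurable \<phi>_nonneg \<phi>_le_1 continuous_on_subset[OF \<phi>_cont]
  by (auto simp: test_function_def abs_le_iff intro: order_trans[of _ 0])

text \<open>The number of test functions grows and the tolerance shrinks with the denominator. It tends to infinity
along a sequence, so all test functions are eventually controlled with any accuracy.\<close>

definition scheme_U :: "'a scheme_nbhd" where
  "scheme_U h \<alpha> = (\<Inter>j\<le>den \<alpha>. {g \<in> Symp0 M. circle_variance (\<lambda>x. \<phi> j (g x)) < 1 / real (den \<alpha>)})"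

lemma scheme_U_open: "openin (T0_topology M) (scheme_U h \<alpha>)"
  unfolding scheme_U_def
  by (rule openin_INT2) (auto intro: circle_variance_openin \<phi>_test \<phi>_cont)

lemma scheme_U_nonempty:
  assumes h: "h \<in> Symp0_rel M" and \<alpha>: "\<alpha> \<in> rational_angles"
  shows "\<exists>h'\<in>scheme_U h \<alpha>. h' \<in> Symp0_rel M \<and> conj_rotation M h' \<alpha> = conj_rotation M h \<alpha>"
proof -
  let ?q = "den \<alpha>"
  have q: "?q > 0" by (rule den(1)[OF \<alpha>])
  have hS: "h \<in> Symp0 M" "\<And>x. x \<in> carrier M - core M \<Longrightarrow> h x = x" using h by (auto simp: Symp0_rel_def)
  let ?\<Psi> = "(\<lambda>j x. \<phi> j (h x)) ` {..?q}"
  obtain g where g: "g \<in> Symp1 M" "\<And>x. x \<notin> core M \<Longrightarrow> g x = x"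
    "\<And>k. real ?q * k \<in> \<int> \<Longrightarrow> g \<circ> rotation M (angle k) = rotation M (angle k) \<circ> g"
    "\<And>\<psi>. \<psi> \<in> ?\<Psi> \<Longrightarrow> circle_variance (\<lambda>x. \<psi> (g x)) < 1 / real ?q"
    using equidistributing_map[of ?\<Psi> ?q "1 / real ?q"] q test_function_compose[OF \<phi>_test hS(1)] by auto
  have gS: "g \<in> Symp0 M" using g(1) by (rule Symp1_imp_Symp0)
  have hg: "h \<circ> g \<in> Symp0 M" by (rule Symp0_comp[OF gS hS(1)])
  have "h \<circ> g \<in> scheme_U h \<alpha>" unfolding scheme_U_def using hg g(4) by auto
  moreover have "h \<circ> g \<in> Symp0_rel M" using hg g(2) hS(2) by (auto simp: Symp0_rel_def)
  moreover have "conj_rotation M (h \<circ> g) \<alpha> = conj_rotation M h \<alpha>"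
  proof -
    obtain a where a: "\<alpha> = angle a" using angle_surj by blast
    have c: "g \<circ> rotation M \<alpha> = rotation M \<alpha> \<circ> g" unfolding a by (rule g(3)[OF den(2)[OF \<alpha> a]])
    have b: "bij h" "bij g" using permutes_bij Symp0_permutes hS(1) gS by blast+
    have "conj_rotation M (h \<circ> g) \<alpha> = h \<circ> (g \<circ> rotation M \<alpha>) \<circ> (inv g \<circ> inv h)"
      unfolding conj_rotation_def using b by (simp add: o_inv_distrib comp_assoc)
    also have "\<dots> = h \<circ> rotation M \<alpha> \<circ> (g \<circ> inv g) \<circ> inv h" unfolding c by (simp add: comp_assoc)
    also have "g \<circ> inv g = id" using Symp0_inverse(2)[OF gS] by (simp add: fun_eq_iff)
    finally show ?thesis by (simp only: conj_rotation_def comp_id)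
  qed
  ultimately show ?thesis by blast
qed

text \<open>Three requirements on \<open>\<nu>\<close>: the denominator doubles; the orbits of \<open>\<beta>\<close> are dense enough to
compute the averages of the first test functions over all circles; and conjugated rotations stay close for
\<open>den \<alpha>\<close> iterates. The integer \<open>k\<close> may be negative because the inverses have to converge as well.\<close>

definition good_size :: "real \<Rightarrow> ('a \<Rightarrow> 'a) \<Rightarrow> circle \<Rightarrow> bool" where
  "good_size \<nu> g \<alpha> \<longleftrightarrow> \<nu> > 0 \<and>
    (\<forall>\<beta>\<in>rational_angles. 0 < circle_abs (\<beta> - \<alpha>) \<and> circle_abs (\<beta> - \<alpha>) < \<nu> \<longrightarrow> 2 * den \<alpha> \<le> den \<beta> \<and>
      (\<forall>j\<le>den \<alpha>. \<forall>b t y. \<beta> = angle b \<and> \<bar>y\<bar> \<le> 1 \<longrightarrow>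
        \<bar>(1 / real (den \<beta>)) * (\<Sum>k<den \<beta>. \<phi> j (g (E (t + real k * b, y)))) - circle_average (\<lambda>x. \<phi> j (g x)) y\<bar>
          \<le> 1 / real (den \<alpha>))) \<and>
    (\<forall>a b. \<forall>k::int. \<alpha> = angle a \<and> \<bar>b - a\<bar> < \<nu> \<and> \<bar>k\<bar> \<le> int (den \<alpha>) \<longrightarrow>
      (\<forall>x\<in>carrier M. dist (g (rotation M (angle (of_int k * b)) x)) (g (rotation M (angle (of_int k * a)) x)) \<le> 1 / real (den \<alpha>)))"

lemma good_size_exists:
  assumes g: "g \<in> Symp0 M" and \<alpha>: "\<alpha> \<in> rational_angles"
  shows "\<exists>\<nu>. good_size \<nu> g \<alpha>"
proof -
  let ?q = "den \<alpha>"
  have q: "?q > 0" by (rule den(1)[OF \<alpha>])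
  have "\<exists>N1. \<forall>N\<ge>N1. N > 0 \<longrightarrow> (\<forall>y r. \<bar>y\<bar> \<le> 1 \<longrightarrow> (\<forall>i<N. r i \<in> {real i / real N..(real i + 1) / real N}) \<longrightarrow>
      \<bar>(1 / real N) * (\<Sum>i<N. \<phi> j (g (E (r i, y)))) - circle_average (\<lambda>x. \<phi> j (g x)) y\<bar> \<le> 1 / real ?q)" for j
  proof -
    have t: "test_function (\<lambda>x. \<phi> j (g x))" by (rule test_function_compose[OF \<phi>_test g])
    have "compact ({0..1::real} \<times> {-1..1::real})" by (intro compact_Times) auto
    moreover have "continuous_on ({0..1} \<times> {-1..1}) (\<lambda>p. \<phi> j (g (E p)))"
      using t E_carrier unfolding test_function_def
      by (intro continuous_on_compose2[of "carrier M" "\<lambda>x. \<phi> j (g x)" _ E] continuous_on_subset[OF E_cont]) auto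
    ultimately have "uniformly_continuous_on ({0..1} \<times> {-1..1}) (\<lambda>p. \<phi> j (g (E p)))"
      by (rule compact_uniformly_continuous[rotated])
    from uniformly_continuous_onE[OF this, of "1 / real ?q"] q obtain \<delta> where \<delta>: "\<delta> > 0"
      "\<And>p p'. \<lbrakk>p \<in> {0..1} \<times> {-1..1}; p' \<in> {0..1} \<times> {-1..1}; dist p' p < \<delta>\<rbrakk> \<Longrightarrow>
        dist (\<phi> j (g (E p'))) (\<phi> j (g (E p))) < 1 / real ?q" by (metis of_nat_0_less_iff zero_less_divide_1_iff)
    obtain N1 where N1: "real N1 > 1 / \<delta>" using reals_Archimedean2 by blast
    show ?thesis
    proof (intro exI[of _ N1] allI impI)
      fix N y r assume N: "N1 \<le> N" "0 < N" and y: "\<bar>y\<bar> \<le> (1::real)"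
        and r: "\<forall>i<N. r i \<in> {real i / real N..(real i + 1) / real N}"
      have "real N > 1 / \<delta>" using N1 N(1) by linarith
      then have "1 / real N < \<delta>" using \<delta>(1) N(2) by (simp add: field_simps)
      then have mod: "\<bar>\<phi> j (g (E (s, y))) - \<phi> j (g (E (s', y)))\<bar> \<le> 1 / real ?q"
        if "s \<in> {0..1}" "s' \<in> {0..1}" "\<bar>s - s'\<bar> \<le> 1 / real N" for s s'
        using \<delta>(2)[of "(s', y)" "(s, y)"] that y by (auto simp: dist_Pair_Pair dist_real_def abs_le_iff)
      show "\<bar>(1 / real N) * (\<Sum>i<N. \<phi> j (g (E (r i, y)))) - circle_average (\<lambda>x. \<phi> j (g x)) y\<bar> \<le> 1 / real ?q"
        unfolding circle_average_def
        by (rule circ_average_riemann[where B=1]) (use test_function_E[OF t] y N mod r in auto)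
    qed
  qed
  then obtain N1 where N1: "\<And>j N y r. N1 j \<le> N \<Longrightarrow> N > 0 \<Longrightarrow> \<bar>y\<bar> \<le> 1 \<Longrightarrow>
      (\<And>i. i < N \<Longrightarrow> r i \<in> {real i / real N..(real i + 1) / real N}) \<Longrightarrow>
      \<bar>(1 / real N) * (\<Sum>i<N. \<phi> j (g (E (r i, y)))) - circle_average (\<lambda>x. \<phi> j (g x)) y\<bar> \<le> 1 / real ?q"
    by metis
  define N0 where "N0 = 2 * ?q + (\<Sum>j\<le>?q. N1 j)"
  have N0: "N0 > 0" "2 * ?q \<le> N0" using q by (auto simp: N0_def)
  have N01: "N1 j \<le> N0" if "j \<le> ?q" for j
  proof -
    have "N1 j \<le> (\<Sum>j\<le>?q. N1 j)" by (rule member_le_sum) (use that in auto)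
    then show ?thesis by (simp add: N0_def)
  qed
  obtain \<delta> where \<delta>: "\<delta> > 0"
    "\<And>x y. x \<in> carrier M \<Longrightarrow> y \<in> carrier M \<Longrightarrow> dist x y < \<delta> \<Longrightarrow> dist (g x) (g y) < 1 / real ?q"
    using Symp0_uniformly_cont[OF g, of "1 / real ?q"] q by auto
  define \<nu> where "\<nu> = min (1 / (real ?q * real N0)) (\<delta> / (2 * pi * real ?q))"
  have \<nu>: "\<nu> > 0" using \<delta>(1) q N0 by (simp add: \<nu>_def)
  have "good_size \<nu> g \<alpha>"
    unfolding good_size_def
  proof (intro conjI ballI allI impI \<nu>)
    fix \<beta> assume \<beta>: "\<beta> \<in> rational_angles" "0 < circle_abs (\<beta> - \<alpha>) \<and> circle_abs (\<beta> - \<alpha>) < \<nu>"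
    let ?p = "den \<beta>"
    have p: "?p > 0" by (rule den(1)[OF \<beta>(1)])
    have "1 \<le> real ?q * real ?p * circle_abs (\<beta> - \<alpha>)" using den_separation[OF \<alpha> \<beta>(1)] \<beta>(2) by simp
    also have "\<dots> \<le> real ?q * real ?p * (1 / (real ?q * real N0))"
      using \<beta>(2) by (intro mult_left_mono) (auto simp: \<nu>_def)
    also have "\<dots> = real ?p / real N0" using q by simp
    finally have pN0: "N0 \<le> ?p" using N0 by (simp add: divide_simps)
    then show "2 * ?q \<le> ?p" using N0 by simp
    fix j b t y assume j: "j \<le> ?q" and by': "\<beta> = angle b \<and> \<bar>y\<bar> \<le> (1::real)"
    obtain s where s: "0 \<le> s" "s < 1 / real ?p"
      "(\<Sum>k<?p. \<phi> j (g (chart M (angle (t + real k * b), y)))) = (\<Sum>i<?p. \<phi> j (g (chart M (angle (s + real i / real ?p), y))))"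
      using orbit_sum[OF \<beta>(1), of b "\<lambda>c. \<phi> j (g (chart M (c, y)))" t] by' by blast
    have "s + real i / real ?p \<in> {real i / real ?p..(real i + 1) / real ?p}" for i
      using s by (simp add: add_divide_distrib)
    then show "\<bar>(1 / real ?p) * (\<Sum>k<?p. \<phi> j (g (E (t + real k * b, y)))) - circle_average (\<lambda>x. \<phi> j (g x)) y\<bar> \<le> 1 / real ?q"
      using N1[of j ?p y "\<lambda>i. s + real i / real ?p"] N01[OF j] pN0 p by' s(3) by (simp add: E_chart)
  next
    fix a b and k :: int and x
    assume h: "\<alpha> = angle a \<and> \<bar>b - a\<bar> < \<nu> \<and> \<bar>k\<bar> \<le> int ?q" and x: "x \<in> carrier M"
    have k: "real_of_int \<bar>k\<bar> \<le> real ?q" using h by (metis of_int_le_iff of_int_of_nat_eq)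
    have "dist (rotation M (angle (of_int k * b)) x) (rotation M (angle (of_int k * a)) x)
        \<le> 2 * pi * circle_abs (angle (of_int k * b) - angle (of_int k * a))" by (rule rotation_near[OF x])
    also have "\<dots> \<le> 2 * pi * \<bar>of_int k * b - of_int k * a\<bar>"
      unfolding angle_diff by (intro mult_left_mono circle_abs_angle_le) auto
    also have "\<dots> = 2 * pi * (real_of_int \<bar>k\<bar> * \<bar>b - a\<bar>)" by (simp add: abs_mult right_diff_distrib[symmetric])
    also have "\<dots> \<le> 2 * pi * (real ?q * \<bar>b - a\<bar>)" using k by (intro mult_left_mono mult_right_mono) auto
    also have "\<dots> < 2 * pi * (real ?q * \<nu>)" using h q by simp
    also have "\<dots> \<le> 2 * pi * (real ?q * (\<delta> / (2 * pi * real ?q)))"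
      by (intro mult_left_mono) (auto simp: \<nu>_def)
    also have "\<dots> = \<delta>" using q by simp
    finally show "dist (g (rotation M (angle (of_int k * b)) x)) (g (rotation M (angle (of_int k * a)) x)) \<le> 1 / real ?q"
      using \<delta>(2) x by (intro less_imp_le) (simp add: rotation_carrier)
  qed
  then show ?thesis by blast
qed

definition scheme_\<nu> :: "'a scheme_size" where
  "scheme_\<nu> g \<alpha> = (SOME \<nu>. good_size \<nu> g \<alpha>)"

lemma scheme_\<nu>: "g \<in> Symp0 M \<Longrightarrow> \<alpha> \<in> rational_angles \<Longrightarrow> good_size (scheme_\<nu> g \<alpha>) g \<alpha>"
  unfolding scheme_\<nu>_def by (rule someI_ex[OF good_size_exists])

context
  fixes h :: "nat \<Rightarrow> 'a \<Rightarrow> 'a" and \<alpha> :: "nat \<Rightarrow> circle"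
  assumes seq: "C0_AbC_sequence M scheme_U scheme_\<nu> h \<alpha>"
begin

lemma h_Symp0: "h n \<in> Symp0 M" and \<alpha>_rational: "\<alpha> n \<in> rational_angles"
  using seq by (auto simp: C0_AbC_sequence_def Symp0_rel_def)

abbreviation q :: "nat \<Rightarrow> nat" where "q n \<equiv> den (\<alpha> n)"
abbreviation f :: "nat \<Rightarrow> 'a \<Rightarrow> 'a" where "f n \<equiv> conj_rotation M (h n) (\<alpha> n)"

lemma seq_step:
  "f n = conj_rotation M (h (Suc n)) (\<alpha> n)" "h (Suc n) \<in> scheme_U (h n) (\<alpha> n)"
  "0 < circle_abs (\<alpha> (Suc n) - \<alpha> n)" "circle_abs (\<alpha> (Suc n) - \<alpha> n) < scheme_\<nu> (h (Suc n)) (\<alpha> n)"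
  using seq by (auto simp: C0_AbC_sequence_def)

lemma good: "good_size (scheme_\<nu> (h (Suc n)) (\<alpha> n)) (h (Suc n)) (\<alpha> n)"
  by (rule scheme_\<nu>[OF h_Symp0 \<alpha>_rational])

lemma q_pos: "q n > 0" by (rule den(1)[OF \<alpha>_rational])

lemma q_double: "2 * q n \<le> q (Suc n)"
  using good[of n] seq_step(3,4)[of n] \<alpha>_rational[of "Suc n"] unfolding good_size_def by blast

lemma q_ge: "2 ^ n \<le> q n"
proof (induction n)
  case 0 then show ?case using q_pos[of 0] by simp
next
  case (Suc n) then show ?case using q_double[of n] by simp
qed

lemma f_Symp0: "f n \<in> Symp0 M"
  by (intro conj_rotation_Symp0 h_Symp0)

text \<open>Both maps are conjugates of rotations by the same \<open>h (Suc n)\<close>, since passing from \<open>h n\<close> to \<open>h (Suc n)\<close>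
does not change the map at stage \<open>n\<close>.\<close>

lemma iterates_close:
  assumes x: "x \<in> carrier M"
  shows "k \<le> q n \<Longrightarrow> dist ((f (Suc n) ^^ k) x) ((f n ^^ k) x) \<le> 1 / real (q n)"
    and "dist (inv (f (Suc n)) x) (inv (f n) x) \<le> 1 / real (q n)"
proof -
  let ?g = "h (Suc n)"
  obtain a where a: "\<alpha> n = angle a" using angle_surj by blast
  obtain b where b: "\<alpha> (Suc n) = angle b" "\<bar>b - a\<bar> = circle_abs (\<alpha> (Suc n) - angle a)" using angle_near by blast
  have bn: "\<bar>b - a\<bar> < scheme_\<nu> ?g (\<alpha> n)" using b(2) seq_step(4)[of n] a by simp
  have x': "inv ?g x \<in> carrier M" using Symp0_carrier[OF Symp0_inv[OF h_Symp0]] x by blast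
  have *: "dist (conj_rotation M ?g (angle (of_int k * b)) x) (conj_rotation M ?g (angle (of_int k * a)) x) \<le> 1 / real (q n)"
    if "\<bar>k\<bar> \<le> int (q n)" for k :: int
    using good[of n] a bn that x' unfolding good_size_def conj_rotation_def by simp
  show "dist ((f (Suc n) ^^ k) x) ((f n ^^ k) x) \<le> 1 / real (q n)" if "k \<le> q n"
    using *[of "int k"] that unfolding seq_step(1)[of n] unfolding a b(1) conj_rotation_funpow[OF h_Symp0] by simp
  show "dist (inv (f (Suc n)) x) (inv (f n) x) \<le> 1 / real (q n)"
    using *[of "-1"] q_pos[of n] unfolding seq_step(1)[of n] unfolding a b(1) inv_conj_rotation[OF h_Symp0] angle_minus by simp
qed

lemma sequence_converges: "\<exists>F. C0_AbC_converges M h \<alpha> F"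
proof -
  have "summable (\<lambda>n. 1 / real (q n))"
  proof (rule summable_comparison_test')
    show "summable (\<lambda>n. (1 / 2) ^ n :: real)" by (rule summable_geometric) simp
    fix n
    have "1 / real (q n) \<le> 1 / 2 ^ n"
      using q_ge[of n] q_pos[of n] by (intro divide_left_mono) (auto simp: of_nat_le_iff[of "2 ^ n" "q n", where 'a=real, simplified])
    then show "norm (1 / real (q n)) \<le> (1 / 2) ^ n" by (simp add: power_one_over)
  qed
  moreover have "dist (f (Suc n) x) (f n x) \<le> 1 / real (q n)" if "x \<in> carrier M" for n x
    using iterates_close(1)[OF that, of 1 n] q_pos[of n] by simp
  ultimately obtain F where "F \<in> Symp0 M" "uniform_limit (carrier M) f F sequentially"
    using Symp0_limit[of f "\<lambda>n. 1 / real (q n)", OF f_Symp0] iterates_close(2) by blast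
  then show ?thesis unfolding C0_AbC_converges_def by blast
qed

text \<open>Integrate over the circles \<open>h n (E (s, y))\<close>. On each of them the Birkhoff average over the period \<open>q n\<close>
is the circle average up to \<open>1 / q m\<close>, and the circle averages are close to the mean in \<open>L\<^sup>2\<close> by
the choice of \<open>h n\<close>.\<close>

lemma average_close:
  assumes n: "n = Suc m" and j: "j \<le> q m"
  shows "(\<integral>x. \<bar>(1 / real (q n)) * (\<Sum>k<q n. \<phi> j ((f n ^^ k) x)) - (\<integral>x. \<phi> j x \<partial>Leb M)\<bar> \<partial>Leb M)
    \<le> 1 / real (q m) + sqrt (1 / real (q m))"
proof -
  define c where "c = (\<integral>x. \<phi> j x \<partial>Leb M)"
  define \<psi> where "\<psi> x = \<bar>(1 / real (q n)) * (\<Sum>k<q n. \<phi> j ((f n ^^ k) x)) - c\<bar>" for x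
  obtain b where b: "\<alpha> n = angle b" using angle_surj by blast
  have c1: "\<bar>c\<bar> \<le> 1" unfolding c_def by (rule integral_circle_average(2)[OF \<phi>_test])
  have fk: "(f n ^^ k) \<in> borel_measurable borel" for k
  proof -
    have "(f n ^^ k) = conj_rotation M (h n) (angle (real k * b))"
      unfolding b by (rule ext) (rule conj_rotation_funpow[OF h_Symp0])
    then show ?thesis using Symp0_measurable[OF conj_rotation_Symp0[OF h_Symp0]] by simp
  qed
  have \<psi>m: "\<psi> \<in> borel_measurable borel"
    unfolding \<psi>_def
    by (intro borel_measurable_abs borel_measurable_diff borel_measurable_times borel_measurable_const borel_measurable_sum)
      (use measurable_compose[OF fk \<phi>_measurable] in auto)
  have \<psi>b: "\<bar>\<psi> x\<bar> \<le> 2" for x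
  proof -
    have "(\<Sum>k<q n. \<phi> j ((f n ^^ k) x)) \<le> (\<Sum>k<q n. 1)" by (intro sum_mono \<phi>_le_1)
    then have "(1 / real (q n)) * (\<Sum>k<q n. \<phi> j ((f n ^^ k) x)) \<le> 1" using q_pos[of n] by simp
    moreover have "0 \<le> (1 / real (q n)) * (\<Sum>k<q n. \<phi> j ((f n ^^ k) x))"
      by (intro mult_nonneg_nonneg sum_nonneg \<phi>_nonneg) auto
    ultimately show ?thesis using c1 unfolding \<psi>_def by linarith
  qed
  let ?A = "circle_average (\<lambda>x. \<phi> j (h n x))"
  have t: "test_function (\<lambda>x. \<phi> j (h n x))" by (rule test_function_compose[OF \<phi>_test h_Symp0])
  have mg: "(\<integral>x. \<phi> j (h n x) \<partial>Leb M) = c" unfolding c_def by (rule integral_Symp0[OF h_Symp0 \<phi>_measurable])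
  have var: "(\<integral>y. (?A y - c)\<^sup>2 \<partial>seg) < 1 / real (q m)"
    using seq_step(2)[of m] j n unfolding scheme_U_def circle_variance_def mg[symmetric] by auto
  have pt: "\<psi> (h n (E (s, y))) \<le> 1 / real (q m) + \<bar>?A y - c\<bar>" if y: "\<bar>y\<bar> \<le> 1" for s y
  proof -
    have "(f n ^^ k) (h n (E (s, y))) = h n (E (s + real k * b, y))" for k
    proof -
      have "(f n ^^ k) (h n (E (s, y))) = conj_rotation M (h n) (angle (real k * b)) (h n (E (s, y)))"
        unfolding b by (rule conj_rotation_funpow[OF h_Symp0])
      then show ?thesis
        using rotation_E[OF y, of "real k * b" s] Symp0_inverse(1)[OF h_Symp0]
        by (simp add: conj_rotation_def add.commute)
    qed
    then have "\<psi> (h n (E (s, y))) = \<bar>(1 / real (q n)) * (\<Sum>k<q n. \<phi> j (h n (E (s + real k * b, y)))) - c\<bar>"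
      by (simp add: \<psi>_def)
    moreover have "\<bar>(1 / real (q n)) * (\<Sum>k<q n. \<phi> j (h n (E (s + real k * b, y)))) - ?A y\<bar> \<le> 1 / real (q m)"
      using good[of m] seq_step(3,4)[of m] \<alpha>_rational[of n] b j y unfolding good_size_def n by blast
    ultimately show ?thesis by linarith
  qed
  define s where "s = sqrt (1 / real (q m))"
  have s: "s > 0" "s\<^sup>2 = 1 / real (q m)" using q_pos[of m] by (auto simp: s_def)
  have Am: "?A \<in> borel_measurable borel" by (rule circle_average_measurable[OF t])
  have Ab: "\<bar>?A y - c\<bar> \<le> 2" if "\<bar>y\<bar> < 1" for y using circle_average_bound[OF t less_imp_le[OF that]] c1 by linarith
  have i1: "integrable seg (\<lambda>y. (?A y - c)\<^sup>2)"
  proof (rule seg_bounded_integrable[of _ 4])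
    fix y :: real assume "\<bar>y\<bar> < 1"
    then show "\<bar>(?A y - c)\<^sup>2\<bar> \<le> 4" using power_mono[OF Ab, of y 2] by simp
  qed (use Am in simp)
  have \<psi>hm: "(\<lambda>x. \<psi> (h n x)) \<in> borel_measurable borel"
    by (rule measurable_compose[OF Symp0_measurable[OF h_Symp0] \<psi>m])
  have "(\<integral>x. \<psi> x \<partial>Leb M) = (\<integral>x. \<psi> (h n x) \<partial>Leb M)" by (rule integral_Symp0[OF h_Symp0 \<psi>m, symmetric])
  also have "\<dots> = (\<integral>y. (\<integral>t. \<psi> (h n (E (t, y))) \<partial>circ) \<partial>seg)" by (rule integral_Leb(2)[OF \<psi>hm \<psi>b])
  also have "\<dots> \<le> (\<integral>y. 1 / real (q m) + ((?A y - c)\<^sup>2 / (2 * s) + s / 2) \<partial>seg)"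
  proof (rule integral_mono_AE)
    have m1: "(\<lambda>y. \<integral>t. \<psi> (h n (E (t, y))) \<partial>circ) \<in> borel_measurable borel"
      by (rule circ_average_measurable[OF measurable_compose[OF E_measurable \<psi>hm]])
    have m2: "(\<lambda>t. \<psi> (h n (E (t, y)))) \<in> borel_measurable borel" for y
      by (intro measurable_compose[OF _ measurable_compose[OF E_measurable \<psi>hm]] pair_borel_measurable) auto
    show "integrable seg (\<lambda>y. \<integral>t. \<psi> (h n (E (t, y))) \<partial>circ)"
      by (rule seg_bounded_integrable[OF m1, of 2]) (rule circ_abs_integral_le[OF m2 \<psi>b])
    show "integrable seg (\<lambda>y. 1 / real (q m) + ((?A y - c)\<^sup>2 / (2 * s) + s / 2))" using i1 by simp
    show "AE y in seg. (\<integral>t. \<psi> (h n (E (t, y))) \<partial>circ) \<le> 1 / real (q m) + ((?A y - c)\<^sup>2 / (2 * s) + s / 2)"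
      using AE_seg
    proof eventually_elim
      fix y :: real assume y: "\<bar>y\<bar> < 1"
      have "\<bar>\<integral>t. \<psi> (h n (E (t, y))) \<partial>circ\<bar> \<le> 1 / real (q m) + \<bar>?A y - c\<bar>"
        by (rule circ_abs_integral_le[OF m2]) (use pt y in \<open>auto simp: \<psi>_def\<close>)
      moreover have "\<bar>?A y - c\<bar> \<le> (?A y - c)\<^sup>2 / (2 * s) + s / 2"
      proof -
        \<comment> \<open>The weight \<open>s\<close> balances the two terms: \<open>s\<^sup>2\<close> bounds the variance.\<close>
        have "0 \<le> (\<bar>?A y - c\<bar> - s)\<^sup>2" by simp
        then have "2 * s * \<bar>?A y - c\<bar> \<le> (?A y - c)\<^sup>2 + s\<^sup>2" by (simp add: power2_eq_square algebra_simps)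
        then show ?thesis using s(1) by (simp add: field_simps power2_eq_square)
      qed
      ultimately show "(\<integral>t. \<psi> (h n (E (t, y))) \<partial>circ) \<le> 1 / real (q m) + ((?A y - c)\<^sup>2 / (2 * s) + s / 2)"
        by linarith
    qed
  qed
  also have "\<dots> = 1 / real (q m) + ((\<integral>y. (?A y - c)\<^sup>2 \<partial>seg) / (2 * s) + s / 2)"
    using i1 by (simp add: seg.prob_space[simplified])
  also have "\<dots> \<le> 1 / real (q m) + (s\<^sup>2 / (2 * s) + s / 2)"
    using var s by (intro add_left_mono add_right_mono divide_right_mono) auto
  also have "\<dots> = 1 / real (q m) + s" using s(1) by (simp add: power2_eq_square)
  finally show ?thesis by (simp add: \<psi>_def c_def s_def)
qed

text \<open>For \<open>k \<le> q n\<close> the iterates of the limit differ from those of the map at stage \<open>n\<close> by at most \<open>2 / q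
n\<close>, the sum of the later errors. So the estimate of \<open>average_close\<close> carries over.\<close>

lemma limit_ergodic:
  assumes F: "C0_AbC_converges M h \<alpha> F"
  shows "ergodic (Leb M) F"
proof (rule ergodic_criterion[OF prob_Leb sets_Leb, where \<phi>=\<phi>])
  have FS: "F \<in> Symp0 M" and ul: "uniform_limit (carrier M) f F sequentially"
    using F by (auto simp: C0_AbC_converges_def)
  show "F \<in> borel_measurable borel" by (rule Symp0_measurable[OF FS])
  show "distr (Leb M) (Leb M) F = Leb M" by (rule Symp0_distr[OF FS])
  show "\<phi> j \<in> borel_measurable borel" "0 \<le> \<phi> j x" "\<phi> j x \<le> 1" for j x by (rule \<phi>_measurable \<phi>_nonneg \<phi>_le_1)+
  show "\<exists>j. (\<integral>x. \<bar>indicator S x - \<phi> j x\<bar> \<partial>Leb M) < \<epsilon>" if "S \<in> sets borel" "\<epsilon> > 0" for S \<epsilon>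
    using that by (rule \<phi>_dense)
  have Fk: "(F ^^ k) x \<in> carrier M" "(f n ^^ k) x \<in> carrier M" if "x \<in> carrier M" for k x n
    using that by (induction k) (auto simp: Symp0_carrier[OF FS] Symp0_carrier[OF f_Symp0])
  have lim: "(\<lambda>n. (f n ^^ k) x) \<longlonglongrightarrow> (F ^^ k) x" if x: "x \<in> carrier M" for k x
  proof (induction k)
    case 0 then show ?case by simp
  next
    case (Suc k)
    have 1: "(\<lambda>n. F ((f n ^^ k) x)) \<longlonglongrightarrow> F ((F ^^ k) x)"
      by (rule continuous_on_tendsto_compose[OF Symp0_cont[OF FS] Suc]) (use Fk x in auto)
    have 2: "(\<lambda>n. f n ((f n ^^ k) x) - F ((f n ^^ k) x)) \<longlonglongrightarrow> 0"
    proof (rule metric_LIMSEQ_I)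
      fix r :: real assume "r > 0"
      from uniform_limitD[OF ul this] obtain N where N: "\<forall>n\<ge>N. \<forall>x\<in>carrier M. dist (f n x) (F x) < r"
        unfolding eventually_sequentially by blast
      then show "\<exists>no. \<forall>n\<ge>no. dist (f n ((f n ^^ k) x) - F ((f n ^^ k) x)) 0 < r"
        using Fk(2)[OF x] by (intro exI[of _ N]) (simp add: dist_norm)
    qed
    from tendsto_add[OF 2 1] show ?case by simp
  qed
  have close: "dist ((F ^^ k) x) ((f n ^^ k) x) \<le> 2 / real (q n)" if x: "x \<in> carrier M" and k: "k \<le> q n" for x k n
  proof -
    \<comment> \<open>The bound telescopes because \<open>2 / q (Suc m) \<le> 1 / q m\<close>.\<close>
    have *: "dist ((f (n + i) ^^ k) x) ((f n ^^ k) x) \<le> 2 / real (q n) - 2 / real (q (n + i)) \<and> q n \<le> q (n + i)" for i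
    proof (induction i)
      case (Suc i)
      have ki: "k \<le> q (n + i)" using k Suc by linarith
      have "2 / real (q (Suc (n + i))) \<le> 2 / (2 * real (q (n + i)))"
        using q_double[of "n + i"] q_pos[of "n + i"] by (intro divide_left_mono) (auto simp flip: of_nat_mult)
      moreover have "dist ((f (Suc (n + i)) ^^ k) x) ((f (n + i) ^^ k) x) \<le> 1 / real (q (n + i))"
        by (rule iterates_close(1)[OF x ki])
      ultimately show ?case
        using Suc q_double[of "n + i"] dist_triangle[of "(f (Suc (n + i)) ^^ k) x" "(f n ^^ k) x" "(f (n + i) ^^ k) x"]
        by simp
    qed simp
    have "(\<lambda>i. (f (i + n) ^^ k) x) \<longlonglongrightarrow> (F ^^ k) x"
      by (rule LIMSEQ_ignore_initial_segment[OF lim[OF x]])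
    then have "(\<lambda>i. dist ((f (i + n) ^^ k) x) ((f n ^^ k) x)) \<longlonglongrightarrow> dist ((F ^^ k) x) ((f n ^^ k) x)"
      by (intro tendsto_dist tendsto_const)
    moreover have "dist ((f (i + n) ^^ k) x) ((f n ^^ k) x) \<le> 2 / real (q n)" for i
    proof -
      have "0 \<le> 2 / real (q (n + i))" by simp
      then show ?thesis using *[of i] by (simp only: add.commute[of i n]) linarith
    qed
    ultimately show ?thesis by (intro LIMSEQ_le_const2) auto
  qed
  fix j and \<epsilon> :: real assume \<epsilon>: "\<epsilon> > 0"
  define c where "c = (\<integral>x. \<phi> j x \<partial>Leb M)"
  have "uniformly_continuous_on (carrier M) (\<phi> j)"
    by (intro compact_uniformly_continuous compact_carrier continuous_on_subset[OF \<phi>_cont]) auto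
  from uniformly_continuous_onE[OF this, of "\<epsilon> / 4"] \<epsilon> obtain \<delta> where \<delta>: "\<delta> > 0"
    "\<And>x x'. \<lbrakk>x \<in> carrier M; x' \<in> carrier M; dist x' x < \<delta>\<rbrakk> \<Longrightarrow> dist (\<phi> j x') (\<phi> j x) < \<epsilon> / 4"
    by (metis divide_pos_pos zero_less_numeral)
  have inf: "\<exists>m. \<forall>n\<ge>m. 1 / real (q n) < e" if e: "e > 0" for e :: real
  proof -
    obtain m where m: "real m > 1 / e" using reals_Archimedean2 by blast
    have "1 / real (q n) < e" if "n \<ge> m" for n
    proof -
      have "n < 2 ^ n" by (rule less_exp)
      then have "n < q n" using q_ge[of n] by linarith
      then have "1 / e < real (q n)" using m that by linarith
      then show ?thesis using e q_pos[of n] by (simp add: field_simps)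
    qed
    then show ?thesis by blast
  qed
  obtain m1 where m1: "\<And>n. n \<ge> m1 \<Longrightarrow> 1 / real (q n) < \<delta> / 2" using inf[of "\<delta> / 2"] \<delta>(1) by auto
  obtain m2 where m2: "\<And>n. n \<ge> m2 \<Longrightarrow> 1 / real (q n) < \<epsilon> / 4" using inf[of "\<epsilon> / 4"] \<epsilon> by auto
  obtain m3 where m3: "\<And>n. n \<ge> m3 \<Longrightarrow> 1 / real (q n) < (\<epsilon> / 4)\<^sup>2" using inf[of "(\<epsilon> / 4)\<^sup>2"] \<epsilon> by auto
  define m where "m = m1 + m2 + m3 + j"
  define n where "n = Suc m"
  have jq: "j \<le> q m"
  proof -
    have "j \<le> m" by (simp add: m_def)
    also have "m \<le> 2 ^ m" by (rule less_imp_le[OF less_exp])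
    also have "\<dots> \<le> q m" by (rule q_ge)
    finally show ?thesis .
  qed
  let ?B = "\<lambda>g x. (1 / real (q n)) * (\<Sum>k<q n. \<phi> j ((g ^^ k) x))"
  have Bdiff: "\<bar>?B F x - ?B (f n) x\<bar> \<le> \<epsilon> / 4" if x: "x \<in> carrier M" for x
  proof -
    have "\<bar>\<phi> j ((F ^^ k) x) - \<phi> j ((f n ^^ k) x)\<bar> \<le> \<epsilon> / 4" if "k < q n" for k
    proof -
      have "dist ((F ^^ k) x) ((f n ^^ k) x) < \<delta>"
        using close[OF x, of k n] that m1[of n] by (simp add: n_def m_def)
      then show ?thesis using \<delta>(2)[OF Fk(2)[OF x] Fk(1)[OF x]] by (auto simp: dist_real_def intro: less_imp_le)
    qed
    then have "\<bar>\<Sum>k<q n. \<phi> j ((F ^^ k) x) - \<phi> j ((f n ^^ k) x)\<bar> \<le> (\<Sum>k<q n. \<epsilon> / 4)"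
      by (intro order_trans[OF sum_abs] sum_mono) auto
    then have "\<bar>(\<Sum>k<q n. \<phi> j ((F ^^ k) x)) - (\<Sum>k<q n. \<phi> j ((f n ^^ k) x))\<bar> \<le> real (q n) * (\<epsilon> / 4)"
      by (simp add: sum_subtractf)
    moreover have "?B F x - ?B (f n) x = ((\<Sum>k<q n. \<phi> j ((F ^^ k) x)) - (\<Sum>k<q n. \<phi> j ((f n ^^ k) x))) / real (q n)"
      by (simp add: diff_divide_distrib)
    ultimately show ?thesis using q_pos[of n] by (simp add: pos_divide_le_eq mult.commute)
  qed
  have B01: "0 \<le> ?B g x" "?B g x \<le> 1" for g x
  proof -
    show "0 \<le> ?B g x" by (intro mult_nonneg_nonneg sum_nonneg \<phi>_nonneg) auto
    have "(\<Sum>k<q n. \<phi> j ((g ^^ k) x)) \<le> (\<Sum>k<q n. 1)" by (intro sum_mono \<phi>_le_1)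
    then show "?B g x \<le> 1" using q_pos[of n] by simp
  qed
  have c1: "\<bar>c\<bar> \<le> 1" unfolding c_def by (rule integral_circle_average(2)[OF \<phi>_test])
  have gk: "(g ^^ k) \<in> borel_measurable borel" if "g \<in> Symp0 M" for g k
  proof (induction k)
    case 0 then show ?case by (simp add: id_def)
  next
    case (Suc k) show ?case unfolding funpow.simps by (rule measurable_comp[OF Suc Symp0_measurable[OF that]])
  qed
  have Bm: "?B g \<in> borel_measurable borel" if "g \<in> Symp0 M" for g
    by (intro borel_measurable_times borel_measurable_const borel_measurable_sum measurable_compose[OF gk[OF that] \<phi>_measurable])
  have Bi: "integrable (Leb M) (\<lambda>x. \<bar>?B g x - c\<bar>)" if "g \<in> Symp0 M" for g
  proof (rule integral_Leb(1)[of _ 2])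
    show "(\<lambda>x. \<bar>?B g x - c\<bar>) \<in> borel_measurable borel" using Bm[OF that] by simp
    show "\<bar>\<bar>?B g x - c\<bar>\<bar> \<le> 2" for x using B01[of g x] c1 by linarith
  qed
  interpret L: prob_space "Leb M" by (rule prob_Leb)
  have AEc: "AE x in Leb M. x \<in> carrier M"
  proof -
    have cs: "carrier M \<in> sets borel" by (rule borel_compact[OF compact_carrier])
    have "Q0 \<inter> E -` carrier M = Q0 \<inter> E -` UNIV" using E_Q0_carrier by auto
    then have "emeasure (Leb M) (carrier M) = emeasure (Leb M) UNIV"
      using emeasure_Leb_Q0[OF cs] emeasure_Leb_Q0[of UNIV] by simp
    then have "L.prob (carrier M) = 1" using L.emeasure_space_1 by (simp add: measure_def)
    then show ?thesis using L.AE_in_set_eq_1[of "carrier M"] cs by simp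
  qed
  have "(\<integral>x. \<bar>?B F x - c\<bar> \<partial>Leb M) \<le> (\<integral>x. \<epsilon> / 4 + \<bar>?B (f n) x - c\<bar> \<partial>Leb M)"
  proof (rule integral_mono_AE)
    show "AE x in Leb M. \<bar>?B F x - c\<bar> \<le> \<epsilon> / 4 + \<bar>?B (f n) x - c\<bar>"
      using AEc
    proof eventually_elim
      fix x assume "x \<in> carrier M"
      from Bdiff[OF this] show "\<bar>?B F x - c\<bar> \<le> \<epsilon> / 4 + \<bar>?B (f n) x - c\<bar>" by linarith
    qed
  qed (use Bi[OF FS] Bi[OF f_Symp0] in auto)
  also have "\<dots> = \<epsilon> / 4 + (\<integral>x. \<bar>?B (f n) x - c\<bar> \<partial>Leb M)"
    using Bi[OF f_Symp0, of n] by (subst Bochner_Integration.integral_add) (auto simp: L.prob_space[simplified])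
  also have "\<dots> \<le> \<epsilon> / 4 + (1 / real (q m) + sqrt (1 / real (q m)))"
    using average_close[OF n_def jq] by (simp add: c_def)
  also have "\<dots> < \<epsilon>"
  proof -
    have "sqrt (1 / real (q m)) < \<epsilon> / 4" using m3[of m] \<epsilon> by (intro real_less_lsqrt) (auto simp: m_def)
    moreover have "1 / real (q m) < \<epsilon> / 4" by (rule m2) (simp add: m_def)
    ultimately show ?thesis using \<epsilon> by linarith
  qed
  finally show "\<exists>N>0. (\<integral>x. \<bar>(1 / real N) * (\<Sum>k<N. \<phi> j ((F ^^ k) x)) - (\<integral>x. \<phi> j x \<partial>Leb M)\<bar> \<partial>Leb M) < \<epsilon>"
    using q_pos[of n] by (intro exI[of _ "q n"]) (simp add: c_def)
qed

end

lemma scheme: "C0_AbC_scheme M scheme_U scheme_\<nu>"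
  unfolding C0_AbC_scheme_def
proof (intro conjI ballI allI impI)
  fix h \<alpha> assume h: "h \<in> Symp0_rel M" and \<alpha>: "\<alpha> \<in> rational_angles"
  show "openin (T0_topology M) (scheme_U h \<alpha>)" by (rule scheme_U_open)
  show "0 < scheme_\<nu> h \<alpha>" using scheme_\<nu>[of h \<alpha>] h \<alpha> by (auto simp: Symp0_rel_def good_size_def)
  show "\<exists>h'\<in>scheme_U h \<alpha>. h' \<in> Symp0_rel M \<and> conj_rotation M h' \<alpha> = conj_rotation M h \<alpha>"
    by (rule scheme_U_nonempty[OF h \<alpha>])
next
  fix h \<alpha> assume "C0_AbC_sequence M scheme_U scheme_\<nu> h \<alpha>"
  then show "\<exists>f. C0_AbC_converges M h \<alpha> f" by (rule sequence_converges)
qed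

end

context circle_surface begin

lemma ergodic_conjugate:
  assumes f: "f \<in> Symp0 M" and h: "h \<in> Symp0 M" and e: "ergodic (Leb M) f"
  shows "ergodic (Leb M) (h \<circ> f \<circ> inv h)"
proof -
  have g: "h \<circ> f \<circ> inv h \<in> Symp0 M" by (intro Symp0_comp Symp0_inv f h)
  have m: "g \<in> measurable (Leb M) (Leb M)" if "g \<in> Symp0 M" for g
    using Symp0_measurable[OF that] by (simp cong: measurable_cong_sets)
  have "measure (Leb M) S = 0 \<or> measure (Leb M) S = 1"
    if S: "S \<in> sets (Leb M)" and i: "(h \<circ> f \<circ> inv h) -` S \<inter> space (Leb M) = S" for S
  proof -
    have hS: "h -` S \<in> sets (Leb M)" using measurable_sets[OF m[OF h] S] by simp
    have "x \<in> S \<longleftrightarrow> (h \<circ> f \<circ> inv h) x \<in> S" for x using i by auto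
    then have "h x \<in> S \<longleftrightarrow> h (f x) \<in> S" for x
      using Symp0_inverse(1)[OF h, of x] by (metis comp_apply)
    then have "f -` (h -` S) \<inter> space (Leb M) = h -` S" by auto
    then have "measure (Leb M) (h -` S) = 0 \<or> measure (Leb M) (h -` S) = 1"
      using e hS unfolding ergodic_def by blast
    moreover have "measure (Leb M) (h -` S) = measure (Leb M) S"
      using measure_distr[OF m[OF h] S] Symp0_distr[OF h] by simp
    ultimately show ?thesis by simp
  qed
  then show ?thesis using m[OF g] Symp0_distr[OF g] unfolding ergodic_def by blast
qed

theorem ergodic_realizable: "C0_AbC_realizable M (ergodic (Leb M))"
proof -
  obtain \<phi> :: "nat \<Rightarrow> 'a \<Rightarrow> real" where \<phi>: "\<And>j. continuous_on UNIV (\<phi> j)" "\<And>j x. 0 \<le> \<phi> j x" "\<And>j x. \<phi> j x \<le> 1"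
    "\<And>\<mu> S \<epsilon>. prob_space \<mu> \<Longrightarrow> sets \<mu> = sets borel \<Longrightarrow> S \<in> sets borel \<Longrightarrow> \<epsilon> > 0 \<Longrightarrow>
      \<exists>j. (\<integral>x. \<bar>indicator S x - \<phi> j x\<bar> \<partial>\<mu>) < \<epsilon>"
    using dense_test_functions by metis
  interpret circle_surface_tests M Z Y E E' \<kappa> proj curves \<phi>
    by unfold_locales (use \<phi> prob_Leb sets_Leb in auto)
  show ?thesis unfolding C0_AbC_realizable_def
    using ergodic_conjugate scheme limit_ergodic unfolding C0_constructed_def by blast
qed

end

section \<open>The three surfaces\<close>

lemma cis_vector_derivative:
  "((\<lambda>t. cis (2 * pi * t)) has_vector_derivative (2 * pi) *\<^sub>R (\<i> * cis (2 * pi * z))) (at z)"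
proof -
  have "((\<lambda>t. cos (2 * pi * t)) has_real_derivative - (2 * pi * sin (2 * pi * z))) (at z)"
    "((\<lambda>t. sin (2 * pi * t)) has_real_derivative 2 * pi * cos (2 * pi * z)) (at z)"
    by (auto intro!: derivative_eq_intros)
  then show ?thesis by (auto simp: has_vector_derivative_complex_iff)
qed

lemma cis_has_derivative:
  "((\<lambda>p :: real \<times> real. cis (2 * pi * fst p)) has_derivative (\<lambda>u. fst u *\<^sub>R ((2 * pi) *\<^sub>R (\<i> * cis (2 * pi * fst p))))) (at p)"
  by (rule has_derivative_compose[OF has_derivative_fst[OF has_derivative_ident] cis_vector_derivative[unfolded has_vector_derivative_def]])

lemma C1_at_cis: "C1_at (\<lambda>p :: real \<times> real. cis (2 * pi * fst p)) p"
  by (rule C1_at_real[OF open_UNIV UNIV_I cis_vector_derivative _ C1_at_fst]) (intro continuous_intros)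

lemma polar_angle:
  assumes "z \<noteq> 0"
  obtains t where "0 \<le> t" "t < 1" "z = of_real (cmod z) * cis (2 * pi * t)"
proof -
  let ?t = "Arg2pi z / (2 * pi)"
  have "z = of_real (cmod z) * exp (\<i> * of_real (Arg2pi z))" by (rule Arg2pi_eq)
  then have "z = of_real (cmod z) * cis (2 * pi * ?t)" by (simp add: cis_conv_exp)
  moreover have "0 \<le> ?t" "?t < 1" using Arg2pi_ge_0[of z] Arg2pi_lt_2pi[of z] by auto
  ultimately show ?thesis using that by blast
qed

text \<open>Used to show that a derivative of the constant \<open>0\<close> within the surface vanishes on the velocities of curves
in the surface.\<close>

lemma curve_tangent:
  fixes D :: "'b::euclidean_space \<Rightarrow> 'b"
  assumes D: "((\<lambda>_. 0 :: 'b) has_derivative D) (at x within S)"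
    and c: "(c has_vector_derivative u) (at 0 within {a..b})" "c 0 = x" "\<And>t. t \<in> {a..b} \<Longrightarrow> c t \<in> S"
    and ab: "a < b" "a \<le> 0" "0 \<le> b"
  shows "D u = 0"
proof -
  interpret D: bounded_linear D using D by (rule has_derivative_bounded_linear)
  have im: "c ` {a..b} \<subseteq> S" using c(3) by blast
  have "((\<lambda>t. 0 :: 'b) has_derivative (\<lambda>h. D (h *\<^sub>R u))) (at 0 within {a..b})"
    by (rule has_derivative_in_compose[OF c(1)[unfolded has_vector_derivative_def]])
      (use has_derivative_subset[OF D im] c(2) in simp)
  then have "((\<lambda>t. 0 :: 'b) has_vector_derivative D u) (at 0 within {a..b})"
    by (simp add: has_vector_derivative_def D.scaleR)
  moreover have "((\<lambda>t. 0 :: 'b) has_vector_derivative 0) (at 0 within {a..b})" by simp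
  ultimately show ?thesis
    using vector_derivative_unique_within_closed_interval[of a b 0 "\<lambda>_. 0 :: 'b" "D u" 0] ab by simp
qed

lemma great_circle_tangent:
  fixes z w :: "'b::euclidean_space"
  assumes "norm z = 1" "z \<bullet> w = 0"
  obtains c where "(c has_vector_derivative w) (at 0)" "c 0 = z" "\<And>t :: real. norm (c t) = 1"
proof (cases "w = 0")
  case True
  then show ?thesis by (intro that[of "\<lambda>_. z"]) (auto simp: assms)
next
  case False
  define k where "k = norm w"
  have k: "k > 0" using False by (simp add: k_def)
  define c where "c t = cos (k * t) *\<^sub>R z + (sin (k * t) / k) *\<^sub>R w" for t
  have "(c has_vector_derivative w) (at 0)" unfolding c_def
    using k by (auto intro!: derivative_eq_intros)
  moreover have "norm (c t) = 1" for t
  proof -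
    have "c t \<bullet> c t = (cos (k * t))\<^sup>2 * (z \<bullet> z) + (sin (k * t) / k)\<^sup>2 * (w \<bullet> w)"
      using assms(2) by (simp add: c_def inner_add inner_commute power2_eq_square)
    also have "z \<bullet> z = 1" using assms(1) by (simp add: norm_eq_1)
    also have "w \<bullet> w = k\<^sup>2" by (simp add: k_def power2_norm_eq_inner)
    finally show ?thesis using k by (simp add: norm_eq_1 power_divide)
  qed
  moreover have "c 0 = z" by (simp add: c_def)
  ultimately show ?thesis by (intro that[of c])
qed

text \<open>The normal component of \<open>y - z\<close> is of second order: it equals \<open>- (norm (y - z))\<^sup>2 / 2\<close>.\<close>

lemma sphere_proj_derivative:
  fixes z :: "'b::euclidean_space"
  assumes S: "\<And>y. y \<in> S \<Longrightarrow> norm y = 1" and z: "z \<in> S"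
  shows "((\<lambda>y. y) has_derivative (\<lambda>w. w - (z \<bullet> w) *\<^sub>R z)) (at z within S)"
proof -
  have "((\<lambda>y. (- ((y - z) \<bullet> (y - z)) / 2) *\<^sub>R z + (y - (z \<bullet> (y - z)) *\<^sub>R z)) has_derivative (\<lambda>w. w - (z \<bullet> w) *\<^sub>R z)) (at z within S)"
    by (auto intro!: derivative_eq_intros simp: inner_commute)
  then show ?thesis
  proof (rule has_derivative_transform_within[OF _ zero_less_one z])
    fix y assume "y \<in> S"
    then have "y \<bullet> y = 1" "z \<bullet> z = 1" using S z by (auto simp: norm_eq_1)
    then have "z \<bullet> (y - z) = - ((y - z) \<bullet> (y - z)) / 2"
      by (simp add: inner_diff inner_commute)
    then show "(- ((y - z) \<bullet> (y - z)) / 2) *\<^sub>R z + (y - (z \<bullet> (y - z)) *\<^sub>R z) = y" by simp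
  qed
qed

subsection \<open>The cylinder\<close>

definition cylinder_E :: "real \<times> real \<Rightarrow> complex \<times> real" where
  "cylinder_E p = (cis (2 * pi * fst p), snd p)"

definition cylinder_E' :: "real \<times> real \<Rightarrow> real \<times> real \<Rightarrow> complex \<times> real" where
  "cylinder_E' p u = (fst u *\<^sub>R ((2 * pi) *\<^sub>R (\<i> * cis (2 * pi * fst p))), snd u)"

definition cylinder_proj :: "complex \<times> real \<Rightarrow> complex \<times> real \<Rightarrow> complex \<times> real" where
  "cylinder_proj x w = (fst w - (fst x \<bullet> fst w) *\<^sub>R fst x, snd w)"

lemma unit_complex_orthogonal:
  assumes "cmod z = 1" "z \<bullet> w = 0"
  shows "w = (Im (cnj z * w)) *\<^sub>R (\<i> * z)"
proof -
  have z: "(Re z)\<^sup>2 + (Im z)\<^sup>2 = 1" using assms(1) by (simp add: cmod_def)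
  have o: "Re z * Re w + Im z * Im w = 0" using assms(2) by (simp add: inner_complex_def)
  have "Re w = ((Re z)\<^sup>2 + (Im z)\<^sup>2) * Re w - Re z * (Re z * Re w + Im z * Im w)" using z o by simp
  moreover have "Im w = ((Re z)\<^sup>2 + (Im z)\<^sup>2) * Im w - Im z * (Re z * Re w + Im z * Im w)" using z o by simp
  ultimately show ?thesis by (simp add: complex_eq_iff power2_eq_square algebra_simps)
qed

text \<open>The curve \<open>(1, sin s)\<close> runs along the seam, including its end points; the other two curves are the
boundary circles.\<close>

lemma circle_surface_cylinder:
  "circle_surface cylinder fst snd cylinder_E cylinder_E' 1 cylinder_proj
     {\<lambda>s. (1, sin s), \<lambda>s. (cis (2 * pi * s), 1), \<lambda>s. (cis (2 * pi * s), -1)}"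
proof (rule circle_surface.intro)
  show "cylinder_E (t, y) = chart cylinder (angle t, y)" for t y
    by (simp add: cylinder_E_def cylinder_def circle_cis_angle)
  show "compact (carrier cylinder)"
    unfolding cylinder_def by (simp add: compact_Times)
  show "core cylinder = {x \<in> carrier cylinder. fst x \<noteq> 0 \<and> \<bar>snd x\<bar> < 1}"
    by (auto simp: cylinder_def abs_less_iff)
  show "\<bar>y\<bar> \<le> 1 \<Longrightarrow> cylinder_E (t, y) \<in> carrier cylinder" for y t
    by (auto simp: cylinder_E_def cylinder_def)
  show "continuous_on UNIV cylinder_E" unfolding cylinder_E_def by (intro continuous_intros)
  show "C1_at cylinder_E p" for p unfolding cylinder_E_def[abs_def]
    by (intro C1_at_Pair C1_at_cis C1_at_snd)
  show "(cylinder_E has_derivative cylinder_E' p) (at p)" for p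
    unfolding cylinder_E_def[abs_def] cylinder_E'_def[abs_def]
    by (intro has_derivative_Pair cis_has_derivative has_derivative_snd has_derivative_ident)
  show "bounded_linear (fst :: complex \<times> real \<Rightarrow> complex)" by (rule bounded_linear_fst)
  show "\<exists>r>0. fst (cylinder_E (t, y)) = complex_of_real r * cis (2 * pi * t)" for y t
    by (rule exI[of _ 1]) (simp add: cylinder_E_def)
  show "\<bar>y\<bar> = 1 \<Longrightarrow> cylinder_E (t, y) \<notin> core cylinder" for y t
    by (auto simp: cylinder_E_def cylinder_def)
  show "C1_at snd (x :: complex \<times> real)" for x by (rule C1_at_linear) (rule bounded_linear_snd)
  show "snd (cylinder_E (t, y)) = y" for t y by (simp add: cylinder_E_def)
  show "cylinder_E (t, snd x) = x" if "x \<in> core cylinder" "r > 0" "fst x = of_real r * cis (2 * pi * t)" for x r t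
  proof -
    have "cmod (fst x) = 1" using that(1) by (auto simp: cylinder_def)
    then have "r = 1" using that(2,3) by (simp add: norm_mult)
    then show ?thesis using that(3) by (simp add: cylinder_E_def prod_eq_iff)
  qed
  show "tangent cylinder (cylinder_E p) = range (cylinder_E' p)" for p
  proof -
    let ?z = "cis (2 * pi * fst p)"
    have "(w, s) \<in> range (cylinder_E' p)" if "?z \<bullet> w = 0" for w s
    proof -
      have "w = (Im (cnj ?z * w)) *\<^sub>R (\<i> * ?z)" by (rule unit_complex_orthogonal[OF norm_cis that])
      then have "(w, s) = cylinder_E' p (Im (cnj ?z * w) / (2 * pi), s)" by (simp add: cylinder_E'_def)
      then show ?thesis by blast
    qed
    moreover have "?z \<bullet> (r *\<^sub>R (\<i> * ?z)) = 0" for r by (simp add: inner_complex_def)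
    ultimately show ?thesis
      by (auto simp: cylinder_def cylinder_E_def cylinder_E'_def simp del: cis.simps)
  qed
  show "omega cylinder (cylinder_E p) (cylinder_E' p u) (cylinder_E' p v) = 1 * det2 u v" for p u v
  proof -
    have im: "Im (cnj (cis x) * (r *\<^sub>R ((2 * pi) *\<^sub>R (\<i> * cis x)))) / (2 * pi) = r" for x r
    proof -
      have "Im (cnj (cis x) * (r *\<^sub>R ((2 * pi) *\<^sub>R (\<i> * cis x)))) = 2 * pi * r * ((cos x)\<^sup>2 + (sin x)\<^sup>2)"
        by (simp add: power2_eq_square algebra_simps del: sin_cos_squared_add sin_cos_squared_add2 sin_cos_squared_add3)
      then show ?thesis by simp
    qed
    show ?thesis
      by (simp only: cylinder_def cylinder_E_def cylinder_E'_def det2_def surface.simps prod.case im) simp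
  qed
  show "(1 :: real) \<noteq> 0" by simp
  show "((\<lambda>y. y) has_derivative cylinder_proj x) (at x within carrier cylinder)" if x: "x \<in> carrier cylinder" for x
  proof -
    have "((\<lambda>y. (\<lambda>y. y) (fst y)) has_derivative (\<lambda>w. fst w - (fst x \<bullet> fst w) *\<^sub>R fst x)) (at x within carrier cylinder)"
      by (rule has_derivative_in_compose[OF has_derivative_fst[OF has_derivative_ident] sphere_proj_derivative])
        (use x in \<open>auto simp: cylinder_def\<close>)
    from has_derivative_Pair[OF this has_derivative_snd[OF has_derivative_ident]]
    show ?thesis by (simp add: cylinder_proj_def[abs_def])
  qed
  show "cylinder_proj x w \<in> tangent cylinder x" if "x \<in> carrier cylinder" for x w
  proof -
    have "fst x \<bullet> fst x = 1" using that by (auto simp: cylinder_def norm_eq_1)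
    then show ?thesis by (cases x) (simp add: cylinder_def cylinder_proj_def inner_diff_right)
  qed
  show "omega cylinder x (cylinder_proj x w) (cylinder_proj x w') = omega cylinder x w w'" for x w w'
  proof -
    have "Im (cnj z * (w - r *\<^sub>R z)) = Im (cnj z * w)" for z w and r :: real by (simp add: algebra_simps)
    then show ?thesis
      by (cases x; cases w; cases w') (simp add: cylinder_def cylinder_proj_def del: complex_scaleR)
  qed
  show "D w = 0" if x: "x \<in> carrier cylinder" and D: "((\<lambda>_. 0 :: complex \<times> real) has_derivative D) (at x within carrier cylinder)"
    and w: "w \<in> tangent cylinder x" for x D w
  proof -
    interpret D: bounded_linear D using D by (rule has_derivative_bounded_linear)
    obtain z y where xz: "x = (z, y)" by (cases x)
    obtain v s where ws: "w = (v, s)" by (cases w)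
    have z: "cmod z = 1" "\<bar>y\<bar> \<le> 1" using x by (auto simp: cylinder_def xz)
    have v: "z \<bullet> v = 0" using w by (simp add: cylinder_def xz ws)
    obtain c where c: "(c has_vector_derivative v) (at 0)" "c 0 = z" "\<And>t. cmod (c t) = 1"
      using great_circle_tangent[OF z(1) v] by blast
    have "D (v, 0) = 0"
    proof (rule curve_tangent[OF D, where c="\<lambda>t. (c t, y)" and a="-1" and b=1])
      show "((\<lambda>t. (c t, y)) has_vector_derivative (v, 0)) (at 0 within {-1..1})"
        by (rule has_vector_derivative_at_within[OF has_vector_derivative_Pair[OF c(1) has_vector_derivative_const]])
    qed (use c z in \<open>auto simp: cylinder_def xz\<close>)
    moreover have "D (0, 1) = 0"
    proof (rule curve_tangent[OF D, where c="\<lambda>t. (z, y + t)" and a="-1 - y" and b="1 - y"])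
      show "((\<lambda>t. (z, y + t)) has_vector_derivative (0, 1)) (at 0 within {-1 - y..1 - y})"
        by (auto intro!: has_vector_derivative_Pair derivative_eq_intros)
    qed (use z in \<open>auto simp: cylinder_def xz abs_le_iff\<close>)
    moreover have "w = (v, 0) + s *\<^sub>R (0, 1)" by (simp add: ws)
    ultimately show ?thesis by (simp only: D.add D.scaleR) simp
  qed
  show "bounded_linear (action cylinder \<alpha>)" for \<alpha>
    unfolding cylinder_def by (auto simp: case_prod_unfold intro!: bounded_linear_intros)
  show "action cylinder 0 x = x" for x by (cases x) (simp add: cylinder_def)
  show "action cylinder (\<alpha> + \<beta>) x = action cylinder \<alpha> (action cylinder \<beta> x)" for \<alpha> \<beta> x
    by (cases x) (simp add: cylinder_def circle_cis_add mult.assoc)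
  show "x \<in> carrier cylinder \<Longrightarrow> action cylinder \<alpha> x \<in> carrier cylinder" for x \<alpha>
    by (auto simp: cylinder_def norm_mult)
  show "omega cylinder (action cylinder \<alpha> x) (action cylinder \<alpha> w) (action cylinder \<alpha> w') = omega cylinder x w w'" for \<alpha> x w w'
  proof -
    let ?c = "circle_cis \<alpha>"
    have eq: "cnj (?c * z) * (?c * w) = cnj z * w" for z w
    proof -
      have "cnj (?c * z) * (?c * w) = (?c * cnj ?c) * (cnj z * w)" by simp
      also have "?c * cnj ?c = 1" by (simp add: complex_norm_square[symmetric])
      finally show ?thesis by simp
    qed
    show ?thesis by (cases x; cases w; cases w') (simp only: cylinder_def surface.simps prod.case eq)
  qed
  show "action cylinder (angle s) (cylinder_E (t, y)) = cylinder_E (s + t, y)" for s t y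
    by (simp add: cylinder_def cylinder_E_def circle_cis_angle cis_mult distrib_left)
  show "dist (action cylinder \<alpha> x) x \<le> 2 * pi * circle_abs \<alpha>" if x: "x \<in> carrier cylinder" for x \<alpha>
  proof -
    obtain z y where xz: "x = (z, y)" by (cases x)
    have "cmod z = 1" using x by (auto simp: cylinder_def xz)
    moreover have "circle_cis \<alpha> * z - z = (circle_cis \<alpha> - 1) * z" by (simp add: algebra_simps)
    ultimately have "dist (action cylinder \<alpha> x) x = cmod (circle_cis \<alpha> - 1)"
      by (simp add: cylinder_def xz dist_Pair_Pair dist_norm norm_mult)
    then show ?thesis using norm_circle_cis_diff_le by simp
  qed
  let ?C = "{\<lambda>s. (1, sin s), \<lambda>s. (cis (2 * pi * s), 1), \<lambda>s. (cis (2 * pi * s), -1)} :: (real \<Rightarrow> complex \<times> real) set"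
  show "countable ?C" by simp
  show "b differentiable at s" if "b \<in> ?C" for b s
  proof -
    have "(\<lambda>s. (1 :: complex, sin s)) differentiable at s"
      by (rule differentiableI_vector[where y="(0, cos s)"])
        (auto intro!: has_vector_derivative_Pair simp: has_real_derivative_iff_has_vector_derivative[symmetric] intro!: derivative_eq_intros)
    moreover have "(\<lambda>s. (cis (2 * pi * s), k)) differentiable at s" for k :: real
      by (rule differentiableI_vector, rule has_vector_derivative_Pair[OF cis_vector_derivative has_vector_derivative_const])
    ultimately show ?thesis using that by auto
  qed
  show "b s \<in> carrier cylinder" if "b \<in> ?C" for b s using that by (auto simp: cylinder_def)
  show "\<exists>b\<in>?C. x \<in> range b" if x: "x \<in> carrier cylinder" "x \<notin> cylinder_E ` ({0<..<1} \<times> {-1<..<1})" for x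
  proof -
    obtain z y where xz: "x = (z, y)" by (cases x)
    have z: "cmod z = 1" "-1 \<le> y" "y \<le> 1" using x(1) by (auto simp: cylinder_def xz)
    then have "z \<noteq> 0" by auto
    then obtain t where t: "0 \<le> t" "t < 1" "z = cis (2 * pi * t)" using polar_angle[of z] z(1) by (metis mult_1 of_real_1)
    consider "y = 1" | "y = -1" | "-1 < y" "y < 1" using z(2,3) by linarith
    then show ?thesis
    proof cases
      case 3
      have "t = 0"
      proof (rule ccontr)
        assume "t \<noteq> 0"
        then have "(t, y) \<in> {0<..<1} \<times> {-1<..<1}" using t 3 by auto
        moreover have "x = cylinder_E (t, y)" by (simp add: cylinder_E_def xz t(3))
        ultimately show False using x(2) by blast
      qed
      then have "x = (\<lambda>s. (1, sin s)) (arcsin y)" using t(3) z by (simp add: xz)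
      then have "x \<in> range (\<lambda>s. (1, sin s))" by (rule range_eqI)
      then show ?thesis by (rule bexI[where x="\<lambda>s. (1, sin s)" and P="\<lambda>b. x \<in> range b"]) simp
    next
      case 1
      then have "x = (\<lambda>s. (cis (2 * pi * s), 1)) t" using t(3) by (simp add: xz)
      then have "x \<in> range (\<lambda>s. (cis (2 * pi * s), 1))" by (rule range_eqI)
      then show ?thesis by (rule bexI[where x="\<lambda>s. (cis (2 * pi * s), 1)" and P="\<lambda>b. x \<in> range b"]) simp
    next
      case 2
      then have "x = (\<lambda>s. (cis (2 * pi * s), -1)) t" using t(3) by (simp add: xz)
      then have "x \<in> range (\<lambda>s. (cis (2 * pi * s), -1))" by (rule range_eqI)
      then show ?thesis by (rule bexI[where x="\<lambda>s. (cis (2 * pi * s), -1)" and P="\<lambda>b. x \<in> range b"]) simp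
    qed
  qed
qed


subsection \<open>Surfaces of revolution\<close>

lemma bounded_linear_complex_of_components:
  fixes f g :: "'b::euclidean_space \<Rightarrow> real"
  assumes "bounded_linear f" "bounded_linear g"
  shows "bounded_linear (\<lambda>x. Complex (f x) (g x))"
  using assms unfolding linear_conv_bounded_linear[symmetric]
  by (auto simp: linear_iff complex_eq_iff)

lemma C1_at_cos_sin:
  assumes "C1_at (\<lambda>p. \<rho> (snd p)) (p :: real \<times> real)"
  shows "C1_at (\<lambda>p. \<rho> (snd p) * cos (2 * pi * fst p)) p" "C1_at (\<lambda>p. \<rho> (snd p) * sin (2 * pi * fst p)) p"
proof -
  have "C1_at (\<lambda>p. Re (cis (2 * pi * fst p))) p" "C1_at (\<lambda>p. Im (cis (2 * pi * fst p))) p"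
    by (rule C1_at_compose[OF C1_at_cis C1_at_linear[OF bounded_linear_Re]]
        C1_at_compose[OF C1_at_cis C1_at_linear[OF bounded_linear_Im]])+
  then show "C1_at (\<lambda>p. \<rho> (snd p) * cos (2 * pi * fst p)) p" "C1_at (\<lambda>p. \<rho> (snd p) * sin (2 * pi * fst p)) p"
    using C1_at_mult[OF assms] by simp_all
qed

text \<open>On the sphere and the disk the first two components of \<open>E\<close> are \<open>\<rho>(y) cos (2\<pi>\<theta>)\<close> and
\<open>\<rho>(y) sin (2\<pi>\<theta>)\<close> with a radius \<open>\<rho>\<close>.\<close>

lemma cos_sin_derivative:
  fixes p :: "real \<times> real"
  assumes "(\<rho> has_real_derivative r) (at (snd p))"
  shows "((\<lambda>p. \<rho> (snd p) * cos (2 * pi * fst p)) has_derivative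
      (\<lambda>u. r * snd u * cos (2 * pi * fst p) - 2 * pi * \<rho> (snd p) * fst u * sin (2 * pi * fst p))) (at p)"
    "((\<lambda>p. \<rho> (snd p) * sin (2 * pi * fst p)) has_derivative
      (\<lambda>u. r * snd u * sin (2 * pi * fst p) + 2 * pi * \<rho> (snd p) * fst u * cos (2 * pi * fst p))) (at p)"
proof -
  have \<rho>: "((\<lambda>p. \<rho> (snd p)) has_derivative (\<lambda>u. snd u * r)) (at p)"
    by (rule has_derivative_eq_rhs, rule DERIV_compose_FDERIV[OF assms has_derivative_snd[OF has_derivative_ident]]) (simp add: mult.commute)
  have c: "((\<lambda>p::real \<times> real. cos (2 * pi * fst p)) has_derivative (\<lambda>u. - (2 * pi * fst u) * sin (2 * pi * fst p))) (at p)"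
    "((\<lambda>p::real \<times> real. sin (2 * pi * fst p)) has_derivative (\<lambda>u. (2 * pi * fst u) * cos (2 * pi * fst p))) (at p)"
    by (auto intro!: derivative_eq_intros)
  show "((\<lambda>p. \<rho> (snd p) * cos (2 * pi * fst p)) has_derivative
      (\<lambda>u. r * snd u * cos (2 * pi * fst p) - 2 * pi * \<rho> (snd p) * fst u * sin (2 * pi * fst p))) (at p)"
    by (rule has_derivative_eq_rhs, rule has_derivative_mult[OF \<rho> c(1)]) (auto simp: fun_eq_iff)
  show "((\<lambda>p. \<rho> (snd p) * sin (2 * pi * fst p)) has_derivative
      (\<lambda>u. r * snd u * sin (2 * pi * fst p) + 2 * pi * \<rho> (snd p) * fst u * cos (2 * pi * fst p))) (at p)"
    by (rule has_derivative_eq_rhs, rule has_derivative_mult[OF \<rho> c(2)]) (auto simp: fun_eq_iff)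
qed

lemma rotated_frame:
  fixes c s :: real
  assumes "c\<^sup>2 + s\<^sup>2 = 1"
  shows "c * (c * a + s * b) - s * (c * b - s * a) = a" "s * (c * a + s * b) + c * (c * b - s * a) = b"
proof -
  have "c * (c * a + s * b) - s * (c * b - s * a) = (c\<^sup>2 + s\<^sup>2) * a" "s * (c * a + s * b) + c * (c * b - s * a) = (c\<^sup>2 + s\<^sup>2) * b"
    by (simp_all add: power2_eq_square algebra_simps)
  then show "c * (c * a + s * b) - s * (c * b - s * a) = a" "s * (c * a + s * b) + c * (c * b - s * a) = b"
    using assms by simp_all
qed

lemma circle_cis_norm_sq: "(Re (circle_cis \<alpha>))\<^sup>2 + (Im (circle_cis \<alpha>))\<^sup>2 = 1"
  using norm_circle_cis[of \<alpha>] by (simp add: cmod_def)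

subsection \<open>The sphere\<close>

lemma vector3_axis: "(vector [a, b, c] :: real^3) = a *\<^sub>R axis 1 1 + b *\<^sub>R axis 2 1 + c *\<^sub>R axis 3 1"
  by (simp add: vec_eq_iff forall_3 axis_def)

lemma C1_at_vector3: "C1_at a x \<Longrightarrow> C1_at b x \<Longrightarrow> C1_at c x \<Longrightarrow> C1_at (\<lambda>y. vector [a y, b y, c y] :: real^3) x"
  unfolding vector3_axis by (intro C1_at_add C1_at_scaleR C1_at_const)

lemma has_derivative_vector3:
  "(a has_derivative a') F \<Longrightarrow> (b has_derivative b') F \<Longrightarrow> (c has_derivative c') F \<Longrightarrow>
   ((\<lambda>y. vector [a y, b y, c y] :: real^3) has_derivative (\<lambda>u. vector [a' u, b' u, c' u])) F"
  unfolding vector3_axis by (intro has_derivative_add has_derivative_scaleR_left)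

lemma norm_vector3: "norm (v :: real^3) = sqrt ((v$1)\<^sup>2 + (v$2)\<^sup>2 + (v$3)\<^sup>2)"
  by (simp add: norm_vec_def L2_set_def sum_3)

lemma sphere2_carrier: "carrier sphere2 = sphere 0 1"
  by (auto simp: sphere2_def norm_vector3 dist_norm)

definition sphere_radius :: "real \<Rightarrow> real" where "sphere_radius y = sqrt (1 - y\<^sup>2)"

lemma sphere_radius:
  assumes "\<bar>y\<bar> < 1"
  shows "sphere_radius y > 0" "(sphere_radius y)\<^sup>2 = 1 - y\<^sup>2"
    "(sphere_radius has_real_derivative - y / sphere_radius y) (at y)"
proof -
  have y: "y\<^sup>2 < 1" using assms by (simp add: abs_square_less_1)
  then show "sphere_radius y > 0" "(sphere_radius y)\<^sup>2 = 1 - y\<^sup>2" by (simp_all add: sphere_radius_def)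
  show "(sphere_radius has_real_derivative - y / sphere_radius y) (at y)"
    unfolding sphere_radius_def[abs_def] using y by (auto intro!: derivative_eq_intros simp: field_simps)
qed

lemma C1_at_sphere_radius: "\<bar>snd p\<bar> < 1 \<Longrightarrow> C1_at (\<lambda>p :: real \<times> real. sphere_radius (snd p)) p"
proof (rule C1_at_real[of "{-1<..<1}" snd p sphere_radius "\<lambda>y. - y / sphere_radius y"])
  show "continuous_on {-1<..<1} (\<lambda>y. - y / sphere_radius y)"
  proof (intro continuous_intros)
    show "continuous_on {-1<..<1} sphere_radius" unfolding sphere_radius_def[abs_def] by (intro continuous_intros)
    show "\<forall>y\<in>{-1<..<1}. sphere_radius y \<noteq> 0"
    proof
      fix y :: real assume "y \<in> {-1<..<1}"
      then have "sphere_radius y > 0" by (intro sphere_radius(1)) (auto simp: abs_less_iff)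
      then show "sphere_radius y \<noteq> 0" by simp
    qed
  qed
  show "(sphere_radius has_vector_derivative - z / sphere_radius z) (at z)" if "z \<in> {-1<..<1}" for z
    using sphere_radius(3)[of z] that by (auto simp: has_real_derivative_iff_has_vector_derivative[symmetric])
qed (auto intro: C1_at_snd)

definition sphere_E :: "real \<times> real \<Rightarrow> real^3" where
  "sphere_E p = vector [sphere_radius (snd p) * cos (2 * pi * fst p), sphere_radius (snd p) * sin (2 * pi * fst p), snd p]"

definition sphere_E' :: "real \<times> real \<Rightarrow> real \<times> real \<Rightarrow> real^3" where
  "sphere_E' p u = (let r = sphere_radius (snd p); c = cos (2 * pi * fst p); s = sin (2 * pi * fst p) in
     vector [- snd p / r * snd u * c - 2 * pi * r * fst u * s, - snd p / r * snd u * s + 2 * pi * r * fst u * c, snd u])"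

text \<open>The single curve is the great circle through the poles that contains the seam.\<close>

lemma circle_surface_sphere:
  "circle_surface sphere2 (\<lambda>x. Complex (x$1) (x$2)) (\<lambda>x. x$3) sphere_E sphere_E' (2 * pi)
     (\<lambda>x w. w - (x \<bullet> w) *\<^sub>R x) {\<lambda>s. vector [cos s, 0, sin s]}"
proof (rule circle_surface.intro)
  have norm1: "(x$1)\<^sup>2 + (x$2)\<^sup>2 + (x$3)\<^sup>2 = 1" if "x \<in> carrier sphere2" for x
    using that by (simp add: sphere2_def)
  have core: "core sphere2 = {x \<in> carrier sphere2. Complex (x$1) (x$2) \<noteq> 0 \<and> \<bar>x$3\<bar> < 1}"
  proof -
    have "x = vector [0, 0, 1] \<or> x = vector [0, 0, -1] \<longleftrightarrow> \<not> (Complex (x$1) (x$2) \<noteq> 0 \<and> \<bar>x$3\<bar> < 1)"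
      if x: "x \<in> carrier sphere2" for x
    proof
      assume "\<not> (Complex (x$1) (x$2) \<noteq> 0 \<and> \<bar>x$3\<bar> < 1)"
      then have "Complex (x$1) (x$2) = 0 \<or> \<bar>x$3\<bar> \<ge> 1" by auto
      then have z: "x$1 = 0 \<and> x$2 = 0"
      proof
        assume "\<bar>x$3\<bar> \<ge> 1"
        then have "(x$3)\<^sup>2 \<ge> 1" by (simp add: abs_le_square_iff[of 1, simplified])
        then have "(x$1)\<^sup>2 + (x$2)\<^sup>2 \<le> 0" using norm1[OF x] by linarith
        then show ?thesis by (simp add: sum_power2_le_zero_iff)
      qed (simp add: complex_eq_iff)
      then have "(x$3)\<^sup>2 = 1" using norm1[OF x] by simp
      then have "x$3 = 1 \<or> x$3 = -1" by (simp add: power2_eq_1_iff)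
      then show "x = vector [0, 0, 1] \<or> x = vector [0, 0, -1]" using z by (auto simp: vec_eq_iff forall_3)
    qed (auto simp: complex_eq_iff)
    then show ?thesis by (auto simp: sphere2_def)
  qed
  show "sphere_E (t, y) = chart sphere2 (angle t, y)" for t y
    by (simp add: sphere_E_def sphere2_def circle_cis_angle sphere_radius_def)
  show "compact (carrier sphere2)" unfolding sphere2_carrier by simp
  show "core sphere2 = {x \<in> carrier sphere2. Complex (x$1) (x$2) \<noteq> 0 \<and> \<bar>x$3\<bar> < 1}" by (rule core)
  show "sphere_E (t, y) \<in> carrier sphere2" if "\<bar>y\<bar> \<le> 1" for y t
  proof -
    have "y\<^sup>2 \<le> 1" using that by (simp add: abs_square_le_1)
    then have "(sphere_radius y)\<^sup>2 * ((cos (2 * pi * t))\<^sup>2 + (sin (2 * pi * t))\<^sup>2) + y\<^sup>2 = 1"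
      by (simp add: sphere_radius_def)
    then have "(sphere_radius y)\<^sup>2 * (cos (2 * pi * t))\<^sup>2 + (sphere_radius y)\<^sup>2 * (sin (2 * pi * t))\<^sup>2 + y\<^sup>2 = 1"
      by (simp only: distrib_left)
    then show ?thesis by (simp add: sphere_E_def sphere2_def power_mult_distrib)
  qed
  show "continuous_on UNIV sphere_E"
    unfolding sphere_E_def[abs_def] vector3_axis sphere_radius_def by (intro continuous_intros)
  show "C1_at sphere_E p" if "\<bar>snd p\<bar> < 1" for p
    unfolding sphere_E_def[abs_def] by (intro C1_at_vector3 C1_at_cos_sin C1_at_sphere_radius C1_at_snd that)
  show "(sphere_E has_derivative sphere_E' p) (at p)" if "\<bar>snd p\<bar> < 1" for p
    unfolding sphere_E_def[abs_def] sphere_E'_def[abs_def] Let_def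
    by (intro has_derivative_vector3 cos_sin_derivative sphere_radius that has_derivative_snd has_derivative_ident)
  show "bounded_linear (\<lambda>x :: real^3. Complex (x$1) (x$2))"
    by (intro bounded_linear_complex_of_components bounded_linear_vec_nth)
  have Z: "Complex (sphere_E (t, y) $ 1) (sphere_E (t, y) $ 2) = of_real (sphere_radius y) * cis (2 * pi * t)" for t y
    by (simp add: sphere_E_def complex_eq_iff)
  show "\<exists>r>0. Complex (sphere_E (t, y) $ 1) (sphere_E (t, y) $ 2) = complex_of_real r * cis (2 * pi * t)" if "\<bar>y\<bar> < 1" for y t
    using sphere_radius(1)[OF that] Z by blast
  show "sphere_E (t, y) \<notin> core sphere2" if "\<bar>y\<bar> = 1" for t y
    unfolding core by (simp add: that sphere_E_def)
  show "C1_at (\<lambda>x. x$3) (x :: real^3)" for x by (rule C1_at_linear) (rule bounded_linear_vec_nth)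
  show "sphere_E (t, y) $ 3 = y" for t y by (simp add: sphere_E_def)
  show "sphere_E (t, x$3) = x" if x: "x \<in> core sphere2" "r > 0" "Complex (x$1) (x$2) = of_real r * cis (2 * pi * t)" for x r t
  proof -
    have x12: "x$1 = r * cos (2 * pi * t)" "x$2 = r * sin (2 * pi * t)" using x(3) by (simp_all add: complex_eq_iff)
    have "r\<^sup>2 * (cos (2 * pi * t))\<^sup>2 + r\<^sup>2 * (sin (2 * pi * t))\<^sup>2 + (x$3)\<^sup>2 = 1"
      using norm1[of x] x(1) unfolding core by (simp add: x12 power_mult_distrib)
    then have "r\<^sup>2 * ((cos (2 * pi * t))\<^sup>2 + (sin (2 * pi * t))\<^sup>2) + (x$3)\<^sup>2 = 1"
      by (simp only: distrib_left)
    then have "1 - (x$3)\<^sup>2 = r\<^sup>2" by simp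
    then have "sphere_radius (x$3) = r" using x(2) by (simp add: sphere_radius_def)
    then show ?thesis by (simp add: sphere_E_def vec_eq_iff forall_3 x12)
  qed
  show "tangent sphere2 (sphere_E p) = range (sphere_E' p)" if p: "\<bar>snd p\<bar> < 1" for p
  proof -
    define r y c s where "r = sphere_radius (snd p)" and "y = snd p" and "c = cos (2 * pi * fst p)" and "s = sin (2 * pi * fst p)"
    have r: "r > 0" using sphere_radius(1)[OF p] by (simp add: r_def)
    have cs: "c\<^sup>2 + s\<^sup>2 = 1" by (simp add: c_def s_def)
    have E': "sphere_E' p u = vector [- y / r * snd u * c - 2 * pi * r * fst u * s, - y / r * snd u * s + 2 * pi * r * fst u * c, snd u]" for u
      by (simp only: sphere_E'_def Let_def r_def y_def c_def s_def)
    have E: "sphere_E p = vector [r * c, r * s, y]" by (simp only: sphere_E_def r_def y_def c_def s_def)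
    have inner: "sphere_E p \<bullet> w = r * (c * w$1 + s * w$2) + y * w$3" for w
      by (simp add: E inner_vec_def sum_3 algebra_simps)
    have "w \<in> range (sphere_E' p)" if "sphere_E p \<bullet> w = 0" for w
    proof -
      have "c * w$1 + s * w$2 = - y / r * w$3" using that r unfolding inner by (simp add: field_simps)
      then have *: "- y / r * w$3 * k = k * (c * w$1 + s * w$2)" for k by simp
      have "w = sphere_E' p ((c * w$2 - s * w$1) / (2 * pi * r), w$3)"
        unfolding E' fst_conv snd_conv * using rotated_frame[OF cs, of "w$1" "w$2"] r
        by (simp add: vec_eq_iff forall_3 mult.commute)
      then show ?thesis by blast
    qed
    moreover have "sphere_E p \<bullet> sphere_E' p u = 0" for u
    proof -
      have "sphere_E p \<bullet> sphere_E' p u = r * (- y / r * snd u * (c\<^sup>2 + s\<^sup>2)) + y * snd u"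
        unfolding inner E' by (simp add: power2_eq_square algebra_simps)
      then show ?thesis using r by (simp add: cs)
    qed
    ultimately show ?thesis by (auto simp: sphere2_def)
  qed
  show "omega sphere2 (sphere_E p) (sphere_E' p u) (sphere_E' p v) = 2 * pi * det2 u v" if p: "\<bar>snd p\<bar> < 1" for p u v
  proof -
    define r y c s where "r = sphere_radius (snd p)" and "y = snd p" and "c = cos (2 * pi * fst p)" and "s = sin (2 * pi * fst p)"
    define k P where "k = - y / r" and "P = 2 * pi * r"
    have r: "r > 0" "r\<^sup>2 + y\<^sup>2 = 1" using sphere_radius(1,2)[OF p] by (simp_all add: r_def y_def)
    have cs: "c\<^sup>2 + s\<^sup>2 = 1" by (simp add: c_def s_def)
    have E': "sphere_E' p u = vector [k * snd u * c - P * fst u * s, k * snd u * s + P * fst u * c, snd u]" for u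
      by (simp only: sphere_E'_def Let_def r_def y_def c_def s_def k_def P_def)
    have E: "sphere_E p = vector [r * c, r * s, y]" by (simp only: sphere_E_def r_def y_def c_def s_def)
    have "omega sphere2 (sphere_E p) (sphere_E' p u) (sphere_E' p v) = (c\<^sup>2 + s\<^sup>2) * det2 u v * (P * (r - k * y))"
      unfolding E E' sphere2_def det2_def
      by (simp add: cross3_def inner_vec_def sum_3 power2_eq_square algebra_simps)
    also have "P * (r - k * y) = 2 * pi * (r\<^sup>2 + y\<^sup>2)"
      using r(1) by (simp add: P_def k_def power2_eq_square field_simps)
    finally show ?thesis by (simp add: cs r(2) mult.assoc)
  qed
  show "2 * pi \<noteq> 0" by simp
  show "((\<lambda>y. y) has_derivative (\<lambda>w. w - (x \<bullet> w) *\<^sub>R x)) (at x within carrier sphere2)" if "x \<in> carrier sphere2" for x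
    by (rule sphere_proj_derivative) (use that in \<open>auto simp: sphere2_carrier\<close>)
  show "w - (x \<bullet> w) *\<^sub>R x \<in> tangent sphere2 x" if "x \<in> carrier sphere2" for x w
  proof -
    have "x \<bullet> x = 1" using that by (simp add: sphere2_carrier norm_eq_1)
    then show ?thesis by (simp add: sphere2_def inner_diff_right)
  qed
  show "omega sphere2 x (w - (x \<bullet> w) *\<^sub>R x) (w' - (x \<bullet> w') *\<^sub>R x) = omega sphere2 x w w'" for x w w'
  proof -
    have "x \<bullet> cross3 (w - a *\<^sub>R x) (w' - b *\<^sub>R x) = x \<bullet> cross3 w w'" for a b
      by (simp add: cross3_def inner_vec_def sum_3 algebra_simps)
    then show ?thesis by (simp add: sphere2_def)
  qed
  show "D w = 0" if x: "x \<in> carrier sphere2" and D: "((\<lambda>_. 0 :: real^3) has_derivative D) (at x within carrier sphere2)"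
    and w: "w \<in> tangent sphere2 x" for x D w
  proof -
    obtain c where c: "(c has_vector_derivative w) (at 0)" "c 0 = x" "\<And>t :: real. norm (c t) = 1"
      using great_circle_tangent[of x w] x w unfolding sphere2_carrier by (auto simp: sphere2_def)
    show ?thesis
      by (rule curve_tangent[OF D has_vector_derivative_at_within[OF c(1)] c(2), of "-1" 1])
        (use c(3) in \<open>auto simp: sphere2_carrier\<close>)
  qed
  show "bounded_linear (action sphere2 \<alpha>)" for \<alpha>
    unfolding linear_conv_bounded_linear[symmetric]
    by (rule linearI) (simp_all add: sphere2_def vec_eq_iff forall_3 algebra_simps)
  show "action sphere2 0 x = x" for x by (simp add: sphere2_def vec_eq_iff forall_3)
  show "action sphere2 (\<alpha> + \<beta>) x = action sphere2 \<alpha> (action sphere2 \<beta> x)" for \<alpha> \<beta> x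
    by (simp add: sphere2_def vec_eq_iff forall_3 circle_cis_add algebra_simps)
  show "action sphere2 \<alpha> x \<in> carrier sphere2" if "x \<in> carrier sphere2" for x \<alpha>
  proof -
    have "(action sphere2 \<alpha> x $ 1)\<^sup>2 + (action sphere2 \<alpha> x $ 2)\<^sup>2 + (action sphere2 \<alpha> x $ 3)\<^sup>2 =
        ((Re (circle_cis \<alpha>))\<^sup>2 + (Im (circle_cis \<alpha>))\<^sup>2) * ((x$1)\<^sup>2 + (x$2)\<^sup>2) + (x$3)\<^sup>2"
      by (simp add: sphere2_def power2_eq_square algebra_simps)
    also have "\<dots> = 1" using norm1[OF that] by (simp add: circle_cis_norm_sq)
    finally show ?thesis by (simp add: sphere2_def)
  qed
  show "omega sphere2 (action sphere2 \<alpha> x) (action sphere2 \<alpha> w) (action sphere2 \<alpha> w') = omega sphere2 x w w'" for \<alpha> x w w'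
  proof -
    have "omega sphere2 (action sphere2 \<alpha> x) (action sphere2 \<alpha> w) (action sphere2 \<alpha> w') =
        ((Re (circle_cis \<alpha>))\<^sup>2 + (Im (circle_cis \<alpha>))\<^sup>2) * omega sphere2 x w w'"
      by (simp add: sphere2_def cross3_def inner_vec_def sum_3 power2_eq_square algebra_simps)
    then show ?thesis by (simp add: circle_cis_norm_sq)
  qed
  show "action sphere2 (angle s) (sphere_E (t, y)) = sphere_E (s + t, y)" for s t y
    by (simp add: sphere2_def sphere_E_def vec_eq_iff forall_3 circle_cis_angle distrib_left cos_add sin_add algebra_simps)
  show "dist (action sphere2 \<alpha> x) x \<le> 2 * pi * circle_abs \<alpha>" if x: "x \<in> carrier sphere2" for x \<alpha>
  proof -
    let ?z = "Complex (x$1) (x$2)"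
    have "dist (action sphere2 \<alpha> x) x = cmod ((circle_cis \<alpha> - 1) * ?z)"
      by (simp add: dist_norm norm_vector3 sphere2_def cmod_def algebra_simps)
    also have "\<dots> \<le> cmod (circle_cis \<alpha> - 1) * 1"
    proof -
      have "(x$1)\<^sup>2 + (x$2)\<^sup>2 \<le> 1" using norm1[OF x] zero_le_power2[of "x$3"] by linarith
      then have "cmod ?z \<le> 1" by (simp add: cmod_def)
      then show ?thesis unfolding norm_mult by (intro mult_left_mono) auto
    qed
    finally show ?thesis using norm_circle_cis_diff_le[of \<alpha>] by simp
  qed
  let ?C = "{\<lambda>s. vector [cos s, 0, sin s]} :: (real \<Rightarrow> real^3) set"
  show "countable ?C" by simp
  show "b differentiable at s" if "b \<in> ?C" for b s
  proof -
    have "(cos has_derivative (\<lambda>h. h * - sin s)) (at s)" "(sin has_derivative (\<lambda>h. h * cos s)) (at s)"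
      by (auto intro!: derivative_eq_intros)
    from has_derivative_vector3[OF this(1) has_derivative_const this(2)] that
    show ?thesis by (auto intro: differentiableI)
  qed
  show "b s \<in> carrier sphere2" if "b \<in> ?C" for b s using that by (auto simp: sphere2_def)
  show "\<exists>b\<in>?C. x \<in> range b" if x: "x \<in> carrier sphere2" "x \<notin> sphere_E ` ({0<..<1} \<times> {-1<..<1})" for x
  proof -
    let ?z = "Complex (x$1) (x$2)"
    have x3: "\<bar>x$3\<bar> \<le> 1"
    proof -
      have "(x$3)\<^sup>2 \<le> 1" using norm1[OF x(1)] zero_le_power2[of "x$1"] zero_le_power2[of "x$2"] by linarith
      then show ?thesis by (simp add: abs_square_le_1)
    qed
    have "x$2 = 0 \<and> x$1 \<ge> 0"
    proof (cases "?z = 0")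
      case True then show ?thesis by (simp add: complex_eq_iff)
    next
      case False
      obtain t where t: "0 \<le> t" "t < 1" "?z = of_real (cmod ?z) * cis (2 * pi * t)" using polar_angle[OF False] .
      have sq: "(cmod ?z)\<^sup>2 = 1 - (x$3)\<^sup>2" using norm1[OF x(1)] by (simp add: cmod_power2)
      then have "(x$3)\<^sup>2 < 1" using False zero_less_power2[of "cmod ?z"] by (simp only: norm_eq_zero simp_thms)
      then have y: "\<bar>x$3\<bar> < 1" by (simp add: abs_square_less_1)
      have "sphere_radius (x$3) = cmod ?z" by (simp add: sphere_radius_def sq[symmetric])
      then have "x = sphere_E (t, x$3)"
        using t(3) by (simp add: sphere_E_def vec_eq_iff forall_3 complex_eq_iff)
      then have "t = 0" using x(2) t y by (cases "t = 0") (auto simp: abs_less_iff)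
      then have "?z = of_real (cmod ?z)" using t(3) by simp
      then show ?thesis by (metis Im_complex_of_real Re_complex_of_real complex.sel norm_ge_zero)
    qed
    moreover from this have "x$1 = sqrt (1 - (x$3)\<^sup>2)"
      using norm1[OF x(1)] by (metis add.right_neutral add_diff_cancel_right' real_sqrt_unique zero_power2)
    ultimately have "x = (\<lambda>s. vector [cos s, 0, sin s]) (arcsin (x$3))"
      using x3 by (simp add: vec_eq_iff forall_3 cos_arcsin abs_le_iff)
    then have "x \<in> range (\<lambda>s. vector [cos s, 0, sin s])" by (rule range_eqI)
    then show ?thesis by (rule bexI[where x="\<lambda>s. vector [cos s, 0, sin s]" and P="\<lambda>b. x \<in> range b"]) simp
  qed
qed


subsection \<open>The disk\<close>

lemma vector2_axis: "(vector [a, b] :: real^2) = a *\<^sub>R axis 1 1 + b *\<^sub>R axis 2 1"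
  by (simp add: vec_eq_iff forall_2 axis_def)

lemma C1_at_vector2: "C1_at a x \<Longrightarrow> C1_at b x \<Longrightarrow> C1_at (\<lambda>y. vector [a y, b y] :: real^2) x"
  unfolding vector2_axis by (intro C1_at_add C1_at_scaleR C1_at_const)

lemma has_derivative_vector2:
  "(a has_derivative a') F \<Longrightarrow> (b has_derivative b') F \<Longrightarrow>
   ((\<lambda>y. vector [a y, b y] :: real^2) has_derivative (\<lambda>u. vector [a' u, b' u])) F"
  unfolding vector2_axis by (intro has_derivative_add has_derivative_scaleR_left)

lemma norm_vector2: "norm (v :: real^2) = sqrt ((v$1)\<^sup>2 + (v$2)\<^sup>2)"
  by (simp add: norm_vec_def L2_set_def sum_2)

lemma disk_carrier: "carrier disk = cball 0 1"
  by (auto simp: disk_def norm_vector2 dist_norm)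

definition disk_radius :: "real \<Rightarrow> real" where "disk_radius y = sqrt ((1 + y) / 2)"

lemma disk_radius:
  assumes "\<bar>y\<bar> < 1"
  shows "disk_radius y > 0" "(disk_radius y)\<^sup>2 = (1 + y) / 2"
    "(disk_radius has_real_derivative 1 / (4 * disk_radius y)) (at y)"
proof -
  have y: "(1 + y) / 2 > 0" using assms by (simp add: abs_less_iff)
  then show "disk_radius y > 0" "(disk_radius y)\<^sup>2 = (1 + y) / 2" by (simp_all add: disk_radius_def)
  show "(disk_radius has_real_derivative 1 / (4 * disk_radius y)) (at y)"
    unfolding disk_radius_def[abs_def] using y by (auto intro!: derivative_eq_intros simp: field_simps)
qed

lemma C1_at_disk_radius: "\<bar>snd p\<bar> < 1 \<Longrightarrow> C1_at (\<lambda>p :: real \<times> real. disk_radius (snd p)) p"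
proof (rule C1_at_real[of "{-1<..<1}" snd p disk_radius "\<lambda>y. 1 / (4 * disk_radius y)"])
  show "continuous_on {-1<..<1} (\<lambda>y. 1 / (4 * disk_radius y))"
  proof (intro continuous_intros)
    show "continuous_on {-1<..<1} disk_radius" unfolding disk_radius_def[abs_def] by (intro continuous_intros) auto
    show "\<forall>y\<in>{-1<..<1}. 4 * disk_radius y \<noteq> 0"
    proof
      fix y :: real assume "y \<in> {-1<..<1}"
      then have "disk_radius y > 0" by (intro disk_radius(1)) (auto simp: abs_less_iff)
      then show "4 * disk_radius y \<noteq> 0" by simp
    qed
  qed
  show "(disk_radius has_vector_derivative 1 / (4 * disk_radius z)) (at z)" if "z \<in> {-1<..<1}" for z
    using disk_radius(3)[of z] that by (auto simp: has_real_derivative_iff_has_vector_derivative[symmetric])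
qed (auto intro: C1_at_snd)

definition disk_E :: "real \<times> real \<Rightarrow> real^2" where
  "disk_E p = vector [disk_radius (snd p) * cos (2 * pi * fst p), disk_radius (snd p) * sin (2 * pi * fst p)]"

definition disk_E' :: "real \<times> real \<Rightarrow> real \<times> real \<Rightarrow> real^2" where
  "disk_E' p u = (let r = disk_radius (snd p); c = cos (2 * pi * fst p); s = sin (2 * pi * fst p) in
     vector [1 / (4 * r) * snd u * c - 2 * pi * r * fst u * s, 1 / (4 * r) * snd u * s + 2 * pi * r * fst u * c])"

text \<open>The first curve covers the seam and the centre, the second the boundary. The orientation of \<open>(\<theta>,
y)\<close> is opposite to that of the plane, hence the negative constant.\<close>

lemma circle_surface_disk:
  "circle_surface disk (\<lambda>x. Complex (x$1) (x$2)) (\<lambda>x. 2 * (x$1 * x$1 + x$2 * x$2) - 1) disk_E disk_E' (- pi / 2)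
     (\<lambda>x w. w) {\<lambda>s. vector [sin s, 0], \<lambda>s. vector [cos s, sin s]}"
proof (rule circle_surface.intro)
  have sq: "x * x = x\<^sup>2" for x :: real by (simp add: power2_eq_square)
  have norm1: "(x$1)\<^sup>2 + (x$2)\<^sup>2 \<le> 1" if "x \<in> carrier disk" for x
    using that by (simp add: disk_def)
  have core: "core disk = {x \<in> carrier disk. Complex (x$1) (x$2) \<noteq> 0 \<and> \<bar>2 * (x$1 * x$1 + x$2 * x$2) - 1\<bar> < 1}"
  proof (rule set_eqI)
    fix x :: "real^2"
    let ?S = "(x$1)\<^sup>2 + (x$2)\<^sup>2"
    have 1: "x \<in> core disk \<longleftrightarrow> 0 < ?S \<and> ?S < 1" and 2: "x \<in> carrier disk \<longleftrightarrow> ?S \<le> 1"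
      by (simp_all add: disk_def)
    have 3: "Complex (x$1) (x$2) \<noteq> 0 \<longleftrightarrow> 0 < ?S" by (simp add: complex_eq_iff sum_power2_gt_zero_iff)
    have 4: "\<bar>2 * S - 1\<bar> < 1 \<longleftrightarrow> 0 < S \<and> S < 1" for S :: real by (auto simp: abs_less_iff)
    show "x \<in> core disk \<longleftrightarrow>
        x \<in> {x \<in> carrier disk. Complex (x$1) (x$2) \<noteq> 0 \<and> \<bar>2 * (x$1 * x$1 + x$2 * x$2) - 1\<bar> < 1}"
      unfolding mem_Collect_eq sq 1 2 3 4 by auto
  qed
  show "core disk = {x \<in> carrier disk. Complex (x$1) (x$2) \<noteq> 0 \<and> \<bar>2 * (x$1 * x$1 + x$2 * x$2) - 1\<bar> < 1}" by (rule core)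
  show "disk_E (t, y) = chart disk (angle t, y)" for t y
    by (simp add: disk_E_def disk_def circle_cis_angle disk_radius_def vec_eq_iff forall_2)
  show "compact (carrier disk)" unfolding disk_carrier by simp
  have rad: "(disk_E (t, y) $ 1)\<^sup>2 + (disk_E (t, y) $ 2)\<^sup>2 = (1 + y) / 2" if "\<bar>y\<bar> \<le> 1" for t y
  proof -
    have "(disk_radius y)\<^sup>2 * ((cos (2 * pi * t))\<^sup>2 + (sin (2 * pi * t))\<^sup>2) = (1 + y) / 2"
      using that by (simp add: disk_radius_def abs_le_iff)
    then have "(disk_radius y)\<^sup>2 * (cos (2 * pi * t))\<^sup>2 + (disk_radius y)\<^sup>2 * (sin (2 * pi * t))\<^sup>2 = (1 + y) / 2"
      by (simp only: distrib_left)
    then show ?thesis by (simp add: disk_E_def power_mult_distrib)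
  qed
  show "disk_E (t, y) \<in> carrier disk" if "\<bar>y\<bar> \<le> 1" for y t
    using rad[OF that, of t] that by (simp add: disk_def abs_le_iff)
  show "continuous_on UNIV disk_E"
    unfolding disk_E_def[abs_def] vector2_axis disk_radius_def by (intro continuous_intros) auto
  show "C1_at disk_E p" if "\<bar>snd p\<bar> < 1" for p
    unfolding disk_E_def[abs_def] by (intro C1_at_vector2 C1_at_cos_sin C1_at_disk_radius that)
  show "(disk_E has_derivative disk_E' p) (at p)" if "\<bar>snd p\<bar> < 1" for p
    unfolding disk_E_def[abs_def] disk_E'_def[abs_def] Let_def
    by (intro has_derivative_vector2 cos_sin_derivative disk_radius that)
  show "bounded_linear (\<lambda>x :: real^2. Complex (x$1) (x$2))"
    by (intro bounded_linear_complex_of_components bounded_linear_vec_nth)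
  have Z: "Complex (disk_E (t, y) $ 1) (disk_E (t, y) $ 2) = of_real (disk_radius y) * cis (2 * pi * t)" for t y
    by (simp add: disk_E_def complex_eq_iff)
  show "\<exists>r>0. Complex (disk_E (t, y) $ 1) (disk_E (t, y) $ 2) = complex_of_real r * cis (2 * pi * t)" if "\<bar>y\<bar> < 1" for y t
    using disk_radius(1)[OF that] Z by blast
  have Y: "2 * (disk_E (t, y) $ 1 * disk_E (t, y) $ 1 + disk_E (t, y) $ 2 * disk_E (t, y) $ 2) - 1 = y" if "\<bar>y\<bar> \<le> 1" for t y
    unfolding sq rad[OF that] by (simp add: field_simps)
  show "2 * (disk_E (t, y) $ 1 * disk_E (t, y) $ 1 + disk_E (t, y) $ 2 * disk_E (t, y) $ 2) - 1 = y" if "\<bar>y\<bar> \<le> 1" for t y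
    by (rule Y[OF that])
  show "disk_E (t, y) \<notin> core disk" if y: "\<bar>y\<bar> = 1" for t y
    unfolding core using Y[of y t] y by simp
  show "C1_at (\<lambda>x. 2 * (x$1 * x$1 + x$2 * x$2) - 1) (x :: real^2)" for x
    by (rule C1_at_diff[OF C1_at_mult[OF C1_at_const C1_at_add[OF C1_at_mult C1_at_mult]] C1_at_const];
        rule C1_at_linear; rule bounded_linear_vec_nth)
  show "disk_E (t, 2 * (x$1 * x$1 + x$2 * x$2) - 1) = x"
    if x: "x \<in> core disk" "r > 0" "Complex (x$1) (x$2) = of_real r * cis (2 * pi * t)" for x r t
  proof -
    have x12: "x$1 = r * cos (2 * pi * t)" "x$2 = r * sin (2 * pi * t)" using x(3) by (simp_all add: complex_eq_iff)
    have "x$1 * x$1 + x$2 * x$2 = r\<^sup>2 * ((cos (2 * pi * t))\<^sup>2 + (sin (2 * pi * t))\<^sup>2)"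
      unfolding x12 by (simp only: power2_eq_square algebra_simps)
    then have "x$1 * x$1 + x$2 * x$2 = r\<^sup>2" by simp
    then have "disk_radius (2 * (x$1 * x$1 + x$2 * x$2) - 1) = r" using x(2) by (simp add: disk_radius_def)
    then show ?thesis by (simp add: disk_E_def vec_eq_iff forall_2 x12)
  qed
  show "tangent disk (disk_E p) = range (disk_E' p)" if p: "\<bar>snd p\<bar> < 1" for p
  proof -
    define r c s where "r = disk_radius (snd p)" and "c = cos (2 * pi * fst p)" and "s = sin (2 * pi * fst p)"
    have r: "r > 0" using disk_radius(1)[OF p] by (simp add: r_def)
    have cs: "c\<^sup>2 + s\<^sup>2 = 1" by (simp add: c_def s_def)
    have E': "disk_E' p u = vector [1 / (4 * r) * snd u * c - 2 * pi * r * fst u * s, 1 / (4 * r) * snd u * s + 2 * pi * r * fst u * c]" for u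
      by (simp only: disk_E'_def Let_def r_def c_def s_def)
    have "w = disk_E' p ((c * w$2 - s * w$1) / (2 * pi * r), 4 * r * (c * w$1 + s * w$2))" for w
      unfolding E' fst_conv snd_conv using rotated_frame[OF cs, of "w$1" "w$2"] r
      by (simp add: vec_eq_iff forall_2 mult.commute)
    then have "w \<in> range (disk_E' p)" for w by blast
    then show ?thesis by (auto simp: disk_def)
  qed
  show "omega disk (disk_E p) (disk_E' p u) (disk_E' p v) = - pi / 2 * det2 u v" if p: "\<bar>snd p\<bar> < 1" for p u v
  proof -
    define r c s where "r = disk_radius (snd p)" and "c = cos (2 * pi * fst p)" and "s = sin (2 * pi * fst p)"
    define k P where "k = 1 / (4 * r)" and "P = 2 * pi * r"
    have r: "r > 0" using disk_radius(1)[OF p] by (simp add: r_def)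
    have cs: "c\<^sup>2 + s\<^sup>2 = 1" by (simp add: c_def s_def)
    have E': "disk_E' p u = vector [k * snd u * c - P * fst u * s, k * snd u * s + P * fst u * c]" for u
      by (simp only: disk_E'_def Let_def r_def c_def s_def k_def P_def)
    have "omega disk (disk_E p) (disk_E' p u) (disk_E' p v) = (c\<^sup>2 + s\<^sup>2) * (- (k * P)) * det2 u v"
      unfolding E' disk_def det2_def by (simp add: power2_eq_square algebra_simps)
    also have "k * P = pi / 2" using r by (simp add: k_def P_def)
    finally show ?thesis by (simp add: cs)
  qed
  show "- pi / 2 \<noteq> 0" by simp
  show "((\<lambda>y. y) has_derivative (\<lambda>w. w)) (at x within carrier disk)" for x by (rule has_derivative_ident)
  show "w \<in> tangent disk x" for x w by (simp add: disk_def)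
  show "omega disk x w w' = omega disk x w w'" for x w w' ..
  show "D w = 0" if x: "x \<in> carrier disk" and D: "((\<lambda>_. 0 :: real^2) has_derivative D) (at x within carrier disk)" for x D w
  proof -
    interpret D: bounded_linear D using D by (rule has_derivative_bounded_linear)
    have *: "D (z - x) = 0" if z: "z \<in> carrier disk" for z
    proof (rule curve_tangent[OF D, where c="\<lambda>t. (1 - t) *\<^sub>R x + t *\<^sub>R z" and a=0 and b=1])
      show "((\<lambda>t. (1 - t) *\<^sub>R x + t *\<^sub>R z) has_vector_derivative (z - x)) (at 0 within {0..1})"
        by (auto intro!: derivative_eq_intros)
      show "(1 - t) *\<^sub>R x + t *\<^sub>R z \<in> carrier disk" if "t \<in> {0..1}" for t
        using convexD_alt[OF convex_cball, of x 0 1 z t] x z that by (simp add: disk_carrier)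
    qed auto
    have "D x = 0" using *[of 0] by (simp add: disk_carrier D.neg)
    then have **: "D z = 0" if "z \<in> carrier disk" for z using *[OF that] by (simp add: D.diff)
    show ?thesis
    proof (cases "w = 0")
      case True then show ?thesis by (simp add: D.zero)
    next
      case False
      have "D ((1 / norm w) *\<^sub>R w) = 0" by (rule **) (simp add: disk_carrier False)
      then show ?thesis using False by (simp add: D.scaleR)
    qed
  qed
  show "bounded_linear (action disk \<alpha>)" for \<alpha>
    unfolding linear_conv_bounded_linear[symmetric]
    by (rule linearI) (simp_all add: disk_def vec_eq_iff forall_2 algebra_simps)
  show "action disk 0 x = x" for x by (simp add: disk_def vec_eq_iff forall_2)
  show "action disk (\<alpha> + \<beta>) x = action disk \<alpha> (action disk \<beta> x)" for \<alpha> \<beta> x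
    by (simp add: disk_def vec_eq_iff forall_2 circle_cis_add algebra_simps)
  show "action disk \<alpha> x \<in> carrier disk" if "x \<in> carrier disk" for x \<alpha>
  proof -
    have "(action disk \<alpha> x $ 1)\<^sup>2 + (action disk \<alpha> x $ 2)\<^sup>2 =
        ((Re (circle_cis \<alpha>))\<^sup>2 + (Im (circle_cis \<alpha>))\<^sup>2) * ((x$1)\<^sup>2 + (x$2)\<^sup>2)"
      by (simp add: disk_def power2_eq_square algebra_simps)
    also have "\<dots> \<le> 1" using norm1[OF that] by (simp add: circle_cis_norm_sq)
    finally show ?thesis by (simp add: disk_def)
  qed
  show "omega disk (action disk \<alpha> x) (action disk \<alpha> w) (action disk \<alpha> w') = omega disk x w w'" for \<alpha> x w w'
  proof -
    have "omega disk (action disk \<alpha> x) (action disk \<alpha> w) (action disk \<alpha> w') =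
        ((Re (circle_cis \<alpha>))\<^sup>2 + (Im (circle_cis \<alpha>))\<^sup>2) * omega disk x w w'"
      by (simp add: disk_def power2_eq_square algebra_simps)
    then show ?thesis by (simp add: circle_cis_norm_sq)
  qed
  show "action disk (angle s) (disk_E (t, y)) = disk_E (s + t, y)" for s t y
    by (simp add: disk_def disk_E_def vec_eq_iff forall_2 circle_cis_angle distrib_left cos_add sin_add algebra_simps)
  show "dist (action disk \<alpha> x) x \<le> 2 * pi * circle_abs \<alpha>" if x: "x \<in> carrier disk" for x \<alpha>
  proof -
    let ?z = "Complex (x$1) (x$2)"
    have "dist (action disk \<alpha> x) x = cmod ((circle_cis \<alpha> - 1) * ?z)"
      by (simp add: dist_norm norm_vector2 disk_def cmod_def algebra_simps)
    also have "\<dots> \<le> cmod (circle_cis \<alpha> - 1) * 1"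
    proof -
      have "cmod ?z \<le> 1" using norm1[OF x] by (simp add: cmod_def)
      then show ?thesis unfolding norm_mult by (intro mult_left_mono) auto
    qed
    finally show ?thesis using norm_circle_cis_diff_le[of \<alpha>] by simp
  qed
  let ?C = "{\<lambda>s. vector [sin s, 0], \<lambda>s. vector [cos s, sin s]} :: (real \<Rightarrow> real^2) set"
  show "countable ?C" by simp
  show "b differentiable at s" if "b \<in> ?C" for b s
  proof -
    have d: "(cos has_derivative (\<lambda>h. h * - sin s)) (at s)" "(sin has_derivative (\<lambda>h. h * cos s)) (at s)"
      by (auto intro!: derivative_eq_intros)
    from has_derivative_vector2[OF d(2) has_derivative_const] has_derivative_vector2[OF d] that
    show ?thesis by (auto intro: differentiableI)
  qed
  show "b s \<in> carrier disk" if "b \<in> ?C" for b s using that by (auto simp: disk_def abs_square_le_1)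
  show "\<exists>b\<in>?C. x \<in> range b" if x: "x \<in> carrier disk" "x \<notin> disk_E ` ({0<..<1} \<times> {-1<..<1})" for x
  proof (cases "(x$1)\<^sup>2 + (x$2)\<^sup>2 = 1")
    case True
    then obtain s where "x$1 = cos s" "x$2 = sin s" using sincos_total_2pi by metis
    then have "x = (\<lambda>s. vector [cos s, sin s]) s" by (simp add: vec_eq_iff forall_2)
    then have "x \<in> range (\<lambda>s. vector [cos s, sin s])" by (rule range_eqI)
    then show ?thesis by (rule bexI[where x="\<lambda>s. vector [cos s, sin s]" and P="\<lambda>b. x \<in> range b"]) simp
  next
    case False
    let ?z = "Complex (x$1) (x$2)"
    have lt: "(x$1)\<^sup>2 + (x$2)\<^sup>2 < 1" using False norm1[OF x(1)] by simp
    have "x$2 = 0"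
    proof (cases "?z = 0")
      case True then show ?thesis by (simp add: complex_eq_iff)
    next
      case nz: False
      obtain t where t: "0 \<le> t" "t < 1" "?z = of_real (cmod ?z) * cis (2 * pi * t)" using polar_angle[OF nz] .
      define y where "y = 2 * (cmod ?z)\<^sup>2 - 1"
      have "(cmod ?z)\<^sup>2 < 1" using lt by (simp add: cmod_power2)
      moreover have "(cmod ?z)\<^sup>2 > 0" using nz by simp
      ultimately have y: "-1 < y" "y < 1" by (simp_all add: y_def)
      have "disk_radius y = cmod ?z" by (simp add: disk_radius_def y_def)
      then have "x = disk_E (t, y)"
        using t(3) by (simp add: disk_E_def vec_eq_iff forall_2 complex_eq_iff)
      then have "t = 0" using x(2) t y by (cases "t = 0") auto
      then have "?z = of_real (cmod ?z)" using t(3) by simp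
      then show ?thesis by (metis Im_complex_of_real complex.sel(2))
    qed
    moreover from this have "\<bar>x$1\<bar> \<le> 1" using lt by (simp add: abs_square_less_1 less_imp_le)
    ultimately have "x = (\<lambda>s. vector [sin s, 0]) (arcsin (x$1))"
      by (simp add: vec_eq_iff forall_2 abs_le_iff)
    then have "x \<in> range (\<lambda>s. vector [sin s, 0])" by (rule range_eqI)
    then show ?thesis by (rule bexI[where x="\<lambda>s. vector [sin s, 0]" and P="\<lambda>b. x \<in> range b"]) simp
  qed
qed

theorem proposition2p3:
  shows "C0_AbC_realizable cylinder (ergodic (Leb cylinder)) \<and>
         C0_AbC_realizable sphere2 (ergodic (Leb sphere2)) \<and>
         C0_AbC_realizable disk (ergodic (Leb disk))"
  using circle_surface.ergodic_realizable[OF circle_surface_cylinder]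
    circle_surface.ergodic_realizable[OF circle_surface_sphere]
    circle_surface.ergodic_realizable[OF circle_surface_disk] by blast

end
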